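(* Let $\mathcal I$ be an interval with closure $[0,1]$ that is closed on the right (so $\mathcal I=[0,1]$ or $(0,1]$). Let $R:\mathcal I\to\mathbb R^{2\times2}$ be a random matrix-valued function such that $R$ together with $\mathfrak u_0=[1,0]^t$ satisfies Assumptions 1 and 2 (stated in the context) on $\mathcal I$. For $r\in\mathbb R\cup\{\infty\}$ let $\mu_{R,r}$ denote the right spectral measure of the Dirac operator $\operatorname{Dir}(R,\infty,r)$ on $\mathcal I$, i.e. the operator $u\mapsto R^{-1}Ju'$ with left boundary condition $\infty$ and right boundary condition $r$. Let $q$ be a random variable on $\mathbb R\cup\{\infty\}$, independent of $R$, such that the law of the angle $2\operatorname{arccot}(q)\in\mathbb S$ has a bounded density which is continuous and positive at $0$, where $\mathbb S=[0,2\pi)$ carries the topology of the circle. Then $(\mu_{R,q},(R,q))$ biased by the weight of $0$ exists and has the law of $(\mu_{R,\infty},(R,\infty))$.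
   Context: Notation: $J=\begin{pmatrix}0&-1\\1&0\end{pmatrix}$. Assumption 1: $R(t)$ is (symmetric) positive definite for all $t\in\mathcal I$, $\|R\|$ and $\|R^{-1}\|$ are locally bounded on $\mathcal I$, and $\det R(t)=1/4$ for all $t$. Assumption 2 (for $\mathcal I$ closed on the right): if $\mathcal I$ is open on the left, then $$\int_{\mathcal I}\|\mathfrak u_0^tR\|\,ds<\infty,\qquad \iint_{s<t,\ s,t\in\mathcal I}\mathfrak u_0^tR(s)\mathfrak u_0\,(J\mathfrak u_0)^tR(t)J\mathfrak u_0\,ds\,dt<\infty;$$ if $\mathcal I$ is closed there is no condition. Dirac operator: a boundary condition is given by the direction of a nonzero vector of $\mathbb R^2$; the vector $[a,b]^t$ is identified with $a/b\in\mathbb R\cup\{\infty\}$, so $\infty$ corresponds to $[1,0]^t$ and $r\in\mathbb R$ to $[-r,-1]^t$. With $L^2_R$ the space of functions $f:\mathcal I\to\mathbb R^2$ with $\|f\|_R^2=\int_{\mathcal I}f^tRf\,ds<\infty$, the operator with boundary conditions $\mathfrak u_0,\mathfrak u_1$ acts as $v\mapsto R^{-1}Jv'$ on the (locally) absolutely continuous $v\in L^2_R$ with $R^{-1}Jv'\in L^2_R$, $\lim_{s\downarrow0}v(s)^tJ\mathfrak u_0=0$, $\lim_{s\uparrow1}v(s)^tJ\mathfrak u_1=0$. It is self-adjoint, with discrete real spectrum, and its eigenfunctions have limits at both endpoints. Right spectral measure: $\sum_\lambda \frac{f_\lambda(1)^tf_\lambda(1)}{\|f_\lambda\|_R^2}\,\delta_\lambda$,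 the sum being over the eigenvalues $\lambda$, with $f_\lambda$ an eigenfunction for $\lambda$. Biasing by the weight of $0$: let $\mu$ be a random measure on $\mathbb R$ and $\xi$ a random element (a "decoration") defined on the same probability space. Let $(\mu_\varepsilon,\xi_\varepsilon)$ have the law with Radon–Nikodym derivative $\mu((-\varepsilon,\varepsilon))/E\mu((-\varepsilon,\varepsilon))$ with respect to the law of $(\mu,\xi)$. The pair $(\mu,\xi)$ biased by the weight of $0$ is the limit in distribution of $(\mu_\varepsilon,\xi_\varepsilon)$ as $\varepsilon\to0$, if it exists. Measures carry the vague topology, $\mathbb R\cup\{\infty\}$ the topology of the circle, and $R$ is regarded as a random element of a Polish space of coefficient functions. *)

theory Defs
  imports "HOL-Probability.Probability"
begin

section \<open>The extended line \<open>\<real> \<union> {\<infinity>}\<close> of boundary conditions\<close>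

text \<open>Points of \<open>\<real> \<union> {\<infinity>}\<close> have type \<^typ>\<open>real option\<close>, with \<^term>\<open>None\<close> for \<open>\<infinity>\<close>. The angle of a
  point \<open>r\<close> is \<open>2 arccot r\<close>, where \<open>arccot\<close> takes values in \<open>(0,\<pi>)\<close> on the reals and is \<open>0\<close> at
  \<open>\<infinity>\<close>; so angles fill \<open>[0,2\<pi>)\<close>, which carries the topology of the circle.\<close>

definition bc_angle :: "real option \<Rightarrow> real" where
  "bc_angle r = (case r of None \<Rightarrow> 0 | Some x \<Rightarrow> 2 * (pi / 2 - arctan x))"

definition circle_topology :: "real topology" where
  "circle_topology = pullback_topology {0..<2 * pi} cis euclidean"

definition extended_line :: "real option topology" where
  "extended_line = pullback_topology UNIV bc_angle circle_topology"

definition bc_vec :: "real option \<Rightarrow> real ^ 2" where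
  "bc_vec r = (case r of None \<Rightarrow> vector [1, 0] | Some x \<Rightarrow> vector [- x, - 1])"

section \<open>Coefficient functions\<close>

definition J :: "real ^ 2 ^ 2" where
  "J = vector [vector [0, - 1], vector [1, 0]]"

definition locally_bounded_on :: "real set \<Rightarrow> (real \<Rightarrow> 'a::real_normed_vector) \<Rightarrow> bool" where
  "locally_bounded_on I f \<longleftrightarrow> (\<forall>t\<in>I. \<exists>U. open U \<and> t \<in> U \<and> bounded (f ` (U \<inter> I)))"

text \<open>The norm of \<^typ>\<open>real ^ 2 ^ 2\<close> is the Frobenius norm; it is equivalent to the operator norm.
  Measurability of the coefficient function is implicit in the usual formulation.\<close>

definition assumption1 :: "real set \<Rightarrow> (real \<Rightarrow> real ^ 2 ^ 2) \<Rightarrow> bool" where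
  "assumption1 I R \<longleftrightarrow>
     set_borel_measurable lebesgue I R \<and>
     (\<forall>t\<in>I. transpose (R t) = R t \<and> (\<forall>x. x \<noteq> 0 \<longrightarrow> x \<bullet> (R t *v x) > 0)) \<and>
     locally_bounded_on I R \<and> locally_bounded_on I (\<lambda>t. matrix_inv (R t)) \<and>
     (\<forall>t\<in>I. det (R t) = 1 / 4)"

definition assumption2 :: "real set \<Rightarrow> real ^ 2 \<Rightarrow> (real \<Rightarrow> real ^ 2 ^ 2) \<Rightarrow> bool" where
  "assumption2 I u R \<longleftrightarrow>
     (\<not> closed I \<longrightarrow>
       (\<integral>\<^sup>+s\<in>I. ennreal (norm (u v* R s)) \<partial>lebesgue) < \<infinity> \<and>
       (\<integral>\<^sup>+t\<in>I. (\<integral>\<^sup>+s\<in>I \<inter> {..<t}.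
          ennreal ((u \<bullet> (R s *v u)) * ((J *v u) \<bullet> (R t *v (J *v u)))) \<partial>lebesgue) \<partial>lebesgue) < \<infinity>)"

section \<open>The Dirac operator\<close>

definition abs_continuous_on :: "real \<Rightarrow> real \<Rightarrow> (real \<Rightarrow> 'a::metric_space) \<Rightarrow> bool" where
  "abs_continuous_on a b v \<longleftrightarrow>
     (\<forall>\<epsilon>>0. \<exists>\<delta>>0. \<forall>D. finite D \<and> (\<forall>(c, d)\<in>D. a \<le> c \<and> c \<le> d \<and> d \<le> b) \<and>
        disjoint_family_on (\<lambda>(c, d). {c<..<d}) D \<and> (\<Sum>(c, d)\<in>D. d - c) < \<delta> \<longrightarrow>
        (\<Sum>(c, d)\<in>D. dist (v c) (v d)) < \<epsilon>)"

definition in_L2 :: "real set \<Rightarrow> (real \<Rightarrow> real ^ 2 ^ 2) \<Rightarrow> (real \<Rightarrow> real ^ 2) \<Rightarrow> bool" where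
  "in_L2 I R f \<longleftrightarrow> set_borel_measurable lebesgue I f \<and>
     (\<integral>\<^sup>+s\<in>I. ennreal (f s \<bullet> (R s *v f s)) \<partial>lebesgue) < \<infinity>"

definition L2_norm_sq :: "real set \<Rightarrow> (real \<Rightarrow> real ^ 2 ^ 2) \<Rightarrow> (real \<Rightarrow> real ^ 2) \<Rightarrow> real" where
  "L2_norm_sq I R f = (LINT s:I|lebesgue. f s \<bullet> (R s *v f s))"

text \<open>The graph of the Dirac operator on an interval with closure \<open>[0,1]\<close>: \<open>v\<close> is in the domain
  and is mapped to (the class of) \<open>g = R\<^sup>-\<^sup>1 J v'\<close>.\<close>

definition dirac_graph ::
  "real set \<Rightarrow> (real \<Rightarrow> real ^ 2 ^ 2) \<Rightarrow> real option \<Rightarrow> real option \<Rightarrow>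
   (real \<Rightarrow> real ^ 2) \<Rightarrow> (real \<Rightarrow> real ^ 2) \<Rightarrow> bool" where
  "dirac_graph I R r0 r1 v g \<longleftrightarrow>
     (\<forall>a b. {a..b} \<subseteq> I \<longrightarrow> abs_continuous_on a b v) \<and>
     in_L2 I R v \<and> in_L2 I R g \<and>
     (AE t in lebesgue. t \<in> I \<longrightarrow>
        (\<exists>d. (v has_vector_derivative d) (at t within I) \<and> g t = matrix_inv (R t) *v (J *v d))) \<and>
     ((\<lambda>s. v s \<bullet> (J *v bc_vec r0)) \<longlongrightarrow> 0) (at_right 0) \<and>
     ((\<lambda>s. v s \<bullet> (J *v bc_vec r1)) \<longlongrightarrow> 0) (at_left 1)"

definition eigenfunction ::
  "real set \<Rightarrow> (real \<Rightarrow> real ^ 2 ^ 2) \<Rightarrow> real option \<Rightarrow> real option \<Rightarrow> real \<Rightarrow>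
   (real \<Rightarrow> real ^ 2) \<Rightarrow> bool" where
  "eigenfunction I R r0 r1 l f \<longleftrightarrow>
     dirac_graph I R r0 r1 f (\<lambda>t. l *\<^sub>R f t) \<and> (\<exists>t\<in>I. f t \<noteq> 0)"

definition eigenvalues ::
  "real set \<Rightarrow> (real \<Rightarrow> real ^ 2 ^ 2) \<Rightarrow> real option \<Rightarrow> real option \<Rightarrow> real set" where
  "eigenvalues I R r0 r1 = {l. \<exists>f. eigenfunction I R r0 r1 l f}"

text \<open>Eigenvalues are simple, so the weight does not depend on the chosen eigenfunction.\<close>

definition right_weight ::
  "real set \<Rightarrow> (real \<Rightarrow> real ^ 2 ^ 2) \<Rightarrow> real option \<Rightarrow> real option \<Rightarrow> real \<Rightarrow> real" where
  "right_weight I R r0 r1 l =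
     (let f = (SOME f. eigenfunction I R r0 r1 l f) in (f 1 \<bullet> f 1) / L2_norm_sq I R f)"

text \<open>The purely atomic Borel measure with atoms of the above weights at the eigenvalues.\<close>

definition right_spectral_measure ::
  "real set \<Rightarrow> (real \<Rightarrow> real ^ 2 ^ 2) \<Rightarrow> real option \<Rightarrow> real option \<Rightarrow> real measure" where
  "right_spectral_measure I R r0 r1 =
     distr (density (count_space (eigenvalues I R r0 r1)) (\<lambda>l. ennreal (right_weight I R r0 r1 l)))
       borel (\<lambda>l. l)"

section \<open>Random elements of topological spaces\<close>

definition borel_of :: "'a topology \<Rightarrow> 'a measure" where
  "borel_of T = sigma (topspace T) {U. openin T U}"

definition polish_space :: "'a topology \<Rightarrow> bool" where
  "polish_space T \<longleftrightarrow> completely_metrizable_space T \<and> second_countable T"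

text \<open>A Polish space of functions on \<open>I\<close> in which the functions can be observed measurably through
  their integrals over compact subintervals. This holds for instance for spaces of representatives of
  locally integrable functions with the topology of local \<open>L\<^sup>1\<close>-convergence.\<close>

definition coefficient_space :: "real set \<Rightarrow> (real \<Rightarrow> real ^ 2 ^ 2) topology \<Rightarrow> bool" where
  "coefficient_space I T \<longleftrightarrow> polish_space T \<and>
     (\<forall>a\<in>I. \<forall>b\<in>I. (\<lambda>S. LINT t:{a..b}|lebesgue. S t) \<in> borel_measurable (borel_of T))"

definition locally_finite_measures :: "real measure set" where
  "locally_finite_measures =
     {\<nu>. sets \<nu> = sets borel \<and> (\<forall>K. compact K \<longrightarrow> emeasure \<nu> K < \<infinity>)}"

definition compactly_supported :: "(real \<Rightarrow> real) set" where
  "compactly_supported = {\<phi>. continuous_on UNIV \<phi> \<and> (\<exists>K. compact K \<and> (\<forall>x. x \<notin> K \<longrightarrow> \<phi> x = 0))}"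

definition vague_topology :: "real measure topology" where
  "vague_topology =
     pullback_topology locally_finite_measures
       (\<lambda>\<nu>. \<lambda>\<phi>\<in>compactly_supported. integral\<^sup>L \<nu> \<phi>)
       (product_topology (\<lambda>_. euclideanreal) compactly_supported)"

definition converges_weakly ::
  "'a topology \<Rightarrow> ('i \<Rightarrow> 'a measure) \<Rightarrow> 'a measure \<Rightarrow> 'i filter \<Rightarrow> bool" where
  "converges_weakly T P Q F \<longleftrightarrow>
     (\<forall>\<^sub>F i in F. prob_space (P i) \<and> sets (P i) = sets (borel_of T)) \<and>
     prob_space Q \<and> sets Q = sets (borel_of T) \<and>
     (\<forall>f. continuous_map T euclideanreal f \<and> bounded (f ` topspace T) \<longrightarrow>
        ((\<lambda>i. integral\<^sup>L (P i) f) \<longlongrightarrow> integral\<^sup>L Q f) F)"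

section \<open>Biasing by the weight of \<open>0\<close>\<close>

definition decorated_law ::
  "'w measure \<Rightarrow> 'x topology \<Rightarrow> ('w \<Rightarrow> real measure) \<Rightarrow> ('w \<Rightarrow> 'x) \<Rightarrow> (real measure \<times> 'x) measure" where
  "decorated_law M X \<mu> \<xi> = distr M (borel_of (prod_topology vague_topology X)) (\<lambda>\<omega>. (\<mu> \<omega>, \<xi> \<omega>))"

definition mean_weight :: "'w measure \<Rightarrow> ('w \<Rightarrow> real measure) \<Rightarrow> real \<Rightarrow> ennreal" where
  "mean_weight M \<mu> \<epsilon> = (\<integral>\<^sup>+\<omega>. emeasure (\<mu> \<omega>) {-\<epsilon><..<\<epsilon>} \<partial>M)"

text \<open>\<open>biased_by_weight_of_0 M X \<mu> \<xi> Q\<close>: the pair \<open>(\<mu>, \<xi>)\<close>, with decoration in \<open>X\<close>, biased by the weight of \<open>0\<close>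
  exists, and its law is \<open>Q\<close>. The means have to be positive and finite for the biased laws with
  small \<open>\<epsilon>\<close> to be defined.\<close>

definition biased_by_weight_of_0 ::
  "'w measure \<Rightarrow> 'x topology \<Rightarrow> ('w \<Rightarrow> real measure) \<Rightarrow> ('w \<Rightarrow> 'x) \<Rightarrow> (real measure \<times> 'x) measure \<Rightarrow>
   bool" where
  "biased_by_weight_of_0 M X \<mu> \<xi> Q \<longleftrightarrow>
     (\<lambda>\<omega>. (\<mu> \<omega>, \<xi> \<omega>)) \<in> measurable M (borel_of (prod_topology vague_topology X)) \<and>
     (\<forall>\<^sub>F \<epsilon> in at_right 0. 0 < mean_weight M \<mu> \<epsilon> \<and> mean_weight M \<mu> \<epsilon> < \<infinity>) \<and>
     converges_weakly (prod_topology vague_topology X)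
       (\<lambda>\<epsilon>. density (decorated_law M X \<mu> \<xi>)
               (\<lambda>(\<nu>, x). emeasure \<nu> {-\<epsilon><..<\<epsilon>} / mean_weight M \<mu> \<epsilon>))
       Q (at_right 0)"

end

theory Submission
  imports Defs
begin

text \<open>Let \<open>u(l, t)\<close> solve \<open>R\<^sup>-\<^sup>1 J u' = l u\<close> with \<open>u(l, 0) = [1, 0]\<close>. The direction of \<open>u(l, 1)\<close> has a continuously
  differentiable, strictly increasing phase \<open>\<psi>\<close> with \<open>\<psi>(0) = 0\<close>; the Wronskian identity shows that
  \<open>\<psi>'(l) = 2 \<parallel>u(l)\<parallel>\<^sup>2 / |u(l, 1)|\<^sup>2\<close>. So the right spectral measure for the boundary angle \<open>\<theta>\<close> is the sum of
  \<open>2/\<psi>'(l) \<delta>\<close> over the points \<open>l\<close> with \<open>\<psi>(l) + \<theta> \<in> 2\<pi>\<int>\<close>. Every \<open>l\<close> is an atom for exactly one angle \<open>\<theta>(l)\<close>, and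
  a change of variables turns the average over \<open>\<theta>\<close> with density \<open>\<rho>\<close> into \<open>2 \<rho>(\<theta>(l)) dl\<close>. Hence the biased expectation
  of a test function \<open>f\<close> is the normalised average of \<open>\<rho>(\<theta>(l)) f(\<mu>\<^bsub>R,\<theta>(l)\<^esub>, R, \<theta>(l))\<close> over \<open>|l| < \<epsilon>\<close>, and
  dominated convergence applies because everything is continuous at \<open>l = 0\<close>, where \<open>\<theta>(0) = 0\<close>.\<close>

section \<open>Absolutely continuous functions\<close>

text \<open>The left endpoint shapes the analysis. On (0,1] the entry r of R may fail to be
  integrable at 0; Assumption 2 gives integrability of p, of b and of r times the primitive of p.
  The second component of the solution is therefore measured against that primitive, and the same
  comparison shows that the left boundary condition selects one solution up to a factor. The power
  series in l serves two purposes: it makes the value at 1 continuously differentiable in l, and it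
  builds this value by repeated limits from integrals of R over compact intervals, which are the
  data of R that a coefficient space makes measurable. As a number, the angle \<theta>(l) jumps
  between 0 and 2 \<pi> at l = 0, so continuity there is always read on the circle. The biasing
  densities have no bound uniform in \<epsilon>; integrating over the angle first replaces them by
  the bounded density \<rho>, and only then is a limit taken.\<close>

lemma integral_indefinite_diff:
  fixes f :: "real \<Rightarrow> real"
  assumes "f integrable_on {a..b}" "a \<le> s" "s \<le> t" "t \<le> b"
  shows "integral {a..t} f - integral {a..s} f = integral {s..t} f"
proof -
  have "f integrable_on {a..t}"
    by (rule integrable_on_subinterval[OF assms(1)]) (use assms in auto)
  from Henstock_Kurzweil_Integration.integral_combine[OF assms(2,3) this] show ?thesis by simp
qed

text \<open>A straddle argument for the gauge integral. Tags off N contribute little because f is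
  differentiable there; the intervals with tags in N lie in an open set of measure below the
  \<delta> of absolute continuity, so f varies little over them in total.\<close>

lemma abs_continuous_has_integral:
  fixes f :: "real \<Rightarrow> real"
  assumes ac: "abs_continuous_on a b f" and ab: "a \<le> b" and N: "negligible N"
    and deriv: "\<And>x. x \<in> {a..b} - N \<Longrightarrow> (f has_vector_derivative g x) (at x within {a..b})"
  shows "(g has_integral f b - f a) {a..b}"
proof -
  \<comment> \<open>The values of g on N are arbitrary. With 0 in their place, tags in N leave only
    increments of f; the set N is spiked out at the end.\<close>
  define h where "h x = (if x \<in> N then 0 else g x)" for x
  have "(h has_integral f b - f a) (cbox a b)"
    unfolding has_integral
  proof (intro allI impI)
    fix e :: real assume e: "e > 0"
    \<comment> \<open>Tags off N contribute at most e1 times the total length b - a; the 1 added in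
      the denominator covers a = b.\<close>
    define e1 where "e1 = e / (2 * (b - a + 1))"
    have e1: "e1 > 0" "e1 * (b - a) < e / 2"
      using e ab by (auto simp: e1_def field_simps)
    obtain \<delta> where \<delta>: "\<delta> > 0" and ac': "\<And>D. finite D \<Longrightarrow> (\<forall>(c, d)\<in>D. a \<le> c \<and> c \<le> d \<and> d \<le> b) \<Longrightarrow>
        disjoint_family_on (\<lambda>(c, d). {c<..<d}) D \<Longrightarrow> (\<Sum>(c, d)\<in>D. d - c) < \<delta> \<Longrightarrow>
        (\<Sum>(c, d)\<in>D. dist (f c) (f d)) < e / 2"
    proof -
      have "e / 2 > 0" using e by simp
      with ac obtain \<delta> where "\<delta> > 0" and *: "\<forall>D. finite D \<and> (\<forall>(c, d)\<in>D. a \<le> c \<and> c \<le> d \<and> d \<le> b) \<and>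
        disjoint_family_on (\<lambda>(c, d). {c<..<d}) D \<and> (\<Sum>(c, d)\<in>D. d - c) < \<delta> \<longrightarrow>
        (\<Sum>(c, d)\<in>D. dist (f c) (f d)) < e / 2"
        unfolding abs_continuous_on_def by blast
      show ?thesis by (rule that[OF \<open>\<delta> > 0\<close>]) (intro *[rule_format] conjI)
    qed
    have Nn: "N \<in> null_sets lebesgue" using N negligible_iff_null_sets by blast
    obtain T where T: "open T" "N \<subseteq> T" "T - N \<in> lmeasurable" "emeasure lebesgue (T - N) < ennreal \<delta>"
      using sets_lebesgue_outer_open[of N \<delta>] Nn \<delta> by blast
    have Teq: "emeasure lebesgue T = emeasure lebesgue (T - N)"
      using emeasure_Diff_null_set[OF Nn, of T] T(1) by simp
    have Tl: "T \<in> lmeasurable" 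
    proof (rule fmeasurableI)
      show "T \<in> sets lebesgue" using T(1) by simp
      show "emeasure lebesgue T < \<infinity>" using T(4) Teq by (metis ennreal_less_top infinity_ennreal_def less_trans)
    qed
    have Tm: "measure lebesgue T < \<delta>"
      using T(4) Teq \<delta> Tl by (metis emeasure_eq_measure2 ennreal_less_iff measure_nonneg)
    have "\<forall>x. \<exists>d>0. x \<in> {a..b} - N \<longrightarrow>
         (\<forall>y\<in>{a..b}. norm (y-x) < d \<longrightarrow> norm (f y - f x - (y-x) *\<^sub>R g x) \<le> e1 * norm (y-x))"
      using deriv[unfolded has_vector_derivative_def has_derivative_within_alt] e1(1) zero_less_one by blast
    then obtain d where d: "\<And>x. 0 < d x"
       "\<And>x y. \<lbrakk>x \<in> {a..b} - N; y \<in> {a..b}; norm (y-x) < d x\<rbrakk>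
                        \<Longrightarrow> norm (f y - f x - (y-x) *\<^sub>R g x) \<le> e1 * norm (y-x)"
      by metis
    have "\<forall>x. \<exists>r>0. x \<in> N \<longrightarrow> ball x r \<subseteq> T"
      using T(1,2) openE zero_less_one by (metis subsetD)
    then obtain r where r: "\<And>x. r x > 0" "\<And>x. x \<in> N \<Longrightarrow> ball x (r x) \<subseteq> T" by metis
    define \<gamma> where "\<gamma> x = (if x \<in> N then ball x (r x) else ball x (d x))" for x
    show "\<exists>\<gamma>. gauge \<gamma> \<and> (\<forall>\<D>. \<D> tagged_division_of cbox a b \<and> \<gamma> fine \<D> \<longrightarrow>
        norm ((\<Sum>(x, k)\<in>\<D>. measure lborel k *\<^sub>R h x) - (f b - f a)) < e)"
    proof (intro exI conjI allI impI)
      show "gauge \<gamma>" using d r unfolding \<gamma>_def gauge_def by auto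
      fix p assume p': "p tagged_division_of cbox a b \<and> \<gamma> fine p"
      then have p: "p tagged_division_of {a..b}" and fine: "\<gamma> fine p" by auto
      have fin: "finite p" using p by blast
      have iv: "\<exists>u v. K = {u..v} \<and> u \<le> x \<and> x \<le> v \<and> a \<le> u \<and> v \<le> b" if xK: "(x,K) \<in> p" for x K
      proof -
        obtain u v where K: "K = cbox u v" using tagged_division_ofD(4)[OF p xK] by blast
        moreover have "x \<in> K" "K \<subseteq> {a..b}" using tagged_division_ofD(2,3)[OF p xK] by auto
        ultimately show ?thesis by (auto simp: cbox_interval)
      qed
      have disj: "interior K1 \<inter> interior K2 = {}" if "(x1,K1) \<in> p" "(x2,K2) \<in> p" "(x1,K1) \<noteq> (x2,K2)" for x1 K1 x2 K2
        using p that by (meson tagged_division_ofD(5))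
      have fsum: "f b - f a = (\<Sum>(x,K)\<in>p. f(Sup K) - f(Inf K))"
        using additive_tagged_division_1[OF ab p, of f] by simp
      have bsum: "b - a = (\<Sum>(x,K)\<in>p. Sup K - Inf K)"
        using additive_tagged_division_1[OF ab p, of "\<lambda>x. x"] by simp
      define P1 where "P1 = {(x,K) \<in> p. x \<in> N}"
      define P2 where "P2 = {(x,K) \<in> p. x \<notin> N}"
      have P12: "p = P1 \<union> P2" "P1 \<inter> P2 = {}" "finite P1" "finite P2" "P1 \<subseteq> p" "P2 \<subseteq> p"
        using fin by (auto simp: P1_def P2_def intro: finite_subset)
      have S2: "\<bar>\<Sum>(x,K)\<in>P2. measure lborel K *\<^sub>R h x - (f(Sup K) - f(Inf K))\<bar> \<le> (\<Sum>(x,K)\<in>P2. e1 * (Sup K - Inf K))"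
      proof (rule order_trans[OF sum_abs], rule sum_mono, safe)
        fix x K assume xK: "(x,K) \<in> P2"
        then have xp: "(x,K) \<in> p" and xN: "x \<notin> N" by (auto simp: P2_def)
        obtain u v where K: "K = {u..v}" "u \<le> x" "x \<le> v" "a \<le> u" "v \<le> b" using iv[OF xp] by blast
        have ball: "K \<subseteq> ball x (d x)" using fine xp xN unfolding fine_def \<gamma>_def by fastforce
        have "u \<in> K" "v \<in> K" using K by auto
        then have nu: "norm (u - x) < d x" "norm (v - x) < d x"
          using ball by (auto simp: dist_norm norm_minus_commute)
        have "\<bar>f u - f x - (u-x) * g x\<bar> \<le> e1 * \<bar>u-x\<bar>" "\<bar>f v - f x - (v-x) * g x\<bar> \<le> e1 * \<bar>v-x\<bar>"
          using d(2)[of x u] d(2)[of x v] nu K xN by auto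
        moreover have "e1 * \<bar>u-x\<bar> + e1 * \<bar>v-x\<bar> = e1 * (v - u)" using K by (simp add: algebra_simps)
        moreover have "(v - u) * g x - (f v - f u) = (f u - f x - (u-x) * g x) - (f v - f x - (v-x) * g x)"
          by (simp add: algebra_simps)
        ultimately have "\<bar>(v - u) * g x - (f v - f u)\<bar> \<le> e1 * (v - u)" by linarith
        then show "\<bar>measure lborel K *\<^sub>R h x - (f (Sup K) - f (Inf K))\<bar> \<le> e1 * (Sup K - Inf K)"
          using K xN by (simp add: h_def)
      qed
      also have "\<dots> \<le> (\<Sum>(x,K)\<in>p. e1 * (Sup K - Inf K))"
      proof (rule sum_mono2[OF fin P12(6)])
        fix z assume z: "z \<in> p - P2"
        obtain x K where xK: "z = (x,K)" by (cases z)
        with z iv[of x K] obtain u v where "K = {u..v}" "u \<le> x" "x \<le> v" by auto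
        then show "0 \<le> (case z of (x,K) \<Rightarrow> e1 * (Sup K - Inf K))" using e1 xK by auto
      qed
      also have "\<dots> = e1 * (b - a)" unfolding bsum by (simp add: sum_distrib_left case_prod_unfold)
      finally have S2': "\<bar>\<Sum>(x,K)\<in>P2. measure lborel K *\<^sub>R h x - (f(Sup K) - f(Inf K))\<bar> < e / 2" using e1 by linarith
      define ends where "ends = (\<lambda>(x::real,K::real set). (Inf K, Sup K))"
      define D where "D = ends ` P1"
      \<comment> \<open>Absolute continuity speaks of a set of pairs, the partition is a set of
        tagged intervals. Only degenerate intervals can share their endpoints, and these contribute
        0, so the sum can be reindexed.\<close>
      have deg: "Inf K = Sup K" if dg: "(x,K) \<in> P1" "(y,L) \<in> P1" "(x,K) \<noteq> (y,L)" "ends (x,K) = ends (y,L)" for x K y L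
      proof -
        have xyp: "(x,K) \<in> p" "(y,L) \<in> p" using dg(1,2) P12(5) by auto
        obtain u v where K: "K = {u..v}" "u \<le> x" "x \<le> v" using iv[OF xyp(1)] by blast
        obtain u' v' where L: "L = {u'..v'}" "u' \<le> y" "y \<le> v'" using iv[OF xyp(2)] by blast
        have "K = L" using dg(4) K L by (auto simp: ends_def)
        then have "interior K = {}" using disj[OF xyp dg(3)] by blast
        then show ?thesis using K by (auto simp: interior_atLeastAtMost_real)
      qed
      have reidx: "sum G D = sum (G \<circ> ends) P1" if G: "\<And>c. G (c,c) = (0::real)" for G
        unfolding D_def
      proof (rule sum.reindex_nontrivial[OF P12(3)])
        fix z w assume zw: "z \<in> P1" "w \<in> P1" "z \<noteq> w" "ends z = ends w"
        obtain x K y L where "z = (x,K)" "w = (y,L)" by (cases z, cases w) auto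
        with zw deg have "ends z = (Inf K, Inf K)" by (simp add: ends_def) metis
        then show "G (ends z) = 0" using G by metis
      qed
      have Dprop: "\<exists>x K. (x,K) \<in> P1 \<and> K = {c..d} \<and> c \<le> x \<and> x \<le> d \<and> a \<le> c \<and> d \<le> b" if "(c,d) \<in> D" for c d
      proof -
        obtain x K where xK: "(x,K) \<in> P1" "c = Inf K" "d = Sup K" using \<open>(c,d) \<in> D\<close> by (auto simp: D_def ends_def)
        then have "(x,K) \<in> p" using P12(5) by blast
        from iv[OF this] obtain u v where "K = {u..v}" "u \<le> x" "x \<le> v" "a \<le> u" "v \<le> b" by blast
        then show ?thesis using xK by (intro exI[of _ x] exI[of _ K]) auto
      qed
      have Dsub: "{c<..<d} \<subseteq> T" if cd: "(c,d) \<in> D" for c d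
      proof -
        obtain x K where xK: "(x,K) \<in> P1" "K = {c..d}" using Dprop[OF cd] by blast
        then have "x \<in> N" "(x,K) \<in> p" by (auto simp: P1_def)
        then have "K \<subseteq> ball x (r x)" using fine unfolding fine_def \<gamma>_def by fastforce
        then have "K \<subseteq> T" using r \<open>x \<in> N\<close> by blast
        then show ?thesis using xK by (meson greaterThanLessThan_subseteq_atLeastAtMost_iff order_refl subset_trans)
      qed
      have Ddisj: "disjoint_family_on (\<lambda>(c, d). {c<..<d}) D"
        unfolding disjoint_family_on_def
      proof (intro ballI impI)
        fix z w assume zw: "z \<in> D" "w \<in> D" "z \<noteq> w"
        obtain c d c' d' where cd: "z = (c,d)" "w = (c',d')" by (cases z, cases w) auto
        obtain x K where xK: "(x,K) \<in> P1" "K = {c..d}" "c \<le> x" "x \<le> d" using Dprop[of c d] zw cd by blast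
        obtain y L where yL: "(y,L) \<in> P1" "L = {c'..d'}" "c' \<le> y" "y \<le> d'" using Dprop[of c' d'] zw cd by blast
        have "K \<noteq> L" using xK yL zw cd by (auto simp: Icc_eq_Icc)
        moreover have "(x,K) \<in> p" "(y,L) \<in> p" using xK(1) yL(1) P12(5) by auto
        ultimately have "interior K \<inter> interior L = {}" using disj[of x K y L] by blast
        then show "(case z of (c, d) \<Rightarrow> {c<..<d}) \<inter> (case w of (c, d) \<Rightarrow> {c<..<d}) = {}"
          using xK yL cd by (simp add: interior_atLeastAtMost_real)
      qed
      have finD: "finite D" using P12 by (simp add: D_def)
      have cdle: "c \<le> d" if "(c,d) \<in> D" for c d using Dprop[OF that] by auto
      have "(\<Sum>(c, d)\<in>D. d - c) = (\<Sum>z\<in>D. measure lebesgue (case z of (c,d) \<Rightarrow> {c<..<d}))"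
        by (rule sum.cong) (use cdle in auto)
      also have "\<dots> = measure lebesgue (\<Union>z\<in>D. case z of (c,d) \<Rightarrow> {c<..<d})"
        by (rule measure_finite_Union[symmetric]) (use finD Ddisj cdle in \<open>auto simp: emeasure_lborel_Ioo\<close>)
      also have "\<dots> \<le> measure lebesgue T"
        by (rule measure_mono_fmeasurable) (use Dsub Tl finD in \<open>auto intro!: sets.finite_UN\<close>)
      finally have Dlen: "(\<Sum>(c, d)\<in>D. d - c) < \<delta>" using Tm by linarith
      have "(\<Sum>(c, d)\<in>D. dist (f c) (f d)) < e / 2"
      proof (rule ac'[OF finD _ Ddisj Dlen], safe)
        fix c d assume "(c,d) \<in> D"
        from Dprop[OF this] show "a \<le> c" "c \<le> d" "d \<le> b" by auto
      qed
      moreover have "(\<Sum>(c, d)\<in>D. dist (f c) (f d)) = (\<Sum>(x,K)\<in>P1. dist (f (Inf K)) (f (Sup K)))"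
        by (subst reidx) (auto simp: ends_def comp_def case_prod_unfold)
      moreover have "\<bar>\<Sum>(x,K)\<in>P1. measure lborel K *\<^sub>R h x - (f(Sup K) - f(Inf K))\<bar> \<le> (\<Sum>(x,K)\<in>P1. dist (f (Inf K)) (f (Sup K)))"
        by (rule order_trans[OF sum_abs], rule sum_mono) (auto simp: h_def P1_def dist_real_def)
      ultimately have S1': "\<bar>\<Sum>(x,K)\<in>P1. measure lborel K *\<^sub>R h x - (f(Sup K) - f(Inf K))\<bar> < e / 2" by linarith
      have "(\<Sum>(x, k)\<in>p. measure lborel k *\<^sub>R h x) - (f b - f a)
            = (\<Sum>(x,K)\<in>p. measure lborel K *\<^sub>R h x - (f(Sup K) - f(Inf K)))"
        unfolding fsum by (simp add: sum_subtractf case_prod_unfold)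
      also have "\<dots> = (\<Sum>(x,K)\<in>P1. measure lborel K *\<^sub>R h x - (f(Sup K) - f(Inf K)))
               + (\<Sum>(x,K)\<in>P2. measure lborel K *\<^sub>R h x - (f(Sup K) - f(Inf K)))"
        unfolding P12(1) by (rule sum.union_disjoint) (use P12 in auto)
      finally show "norm ((\<Sum>(x, k)\<in>p. measure lborel k *\<^sub>R h x) - (f b - f a)) < e"
        using S1' S2' by simp
    qed
  qed
  then show ?thesis unfolding box_real
    by (rule has_integral_spike[OF N, rotated]) (auto simp: h_def)
qed

text \<open>For a tolerance e the exceptional points are Vitali covered by balls with a half, tagged
  by the centre, on which the integral misses f times the length by more than e times the length.
  Disjoint balls yield a fine partial division, and the Henstock lemma makes their total length
  small.\<close>

lemma lebesgue_differentiation: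
  fixes f :: "real \<Rightarrow> real"
  assumes f: "f integrable_on {a..b}"
  obtains N where "negligible N"
    "\<And>x. x \<in> {a..b} - N \<Longrightarrow> ((\<lambda>t. integral {a..t} f) has_vector_derivative f x) (at x)"
proof -
  define F where "F x = integral {a..x} f" for x
  define bad where "bad e x h \<longleftrightarrow> \<bar>F (x+h) - F x - h * f x\<bar> > e * h \<or> \<bar>F x - F (x-h) - h * f x\<bar> > e * h" for e x h
  define S where "S e = {x \<in> {a<..<b}. \<forall>d>0. \<exists>h. 0 < h \<and> h < d \<and> bad e x h}" for e
  have neg: "negligible (S e)" if e: "e > 0" for e
    unfolding negligible_outer_le
  proof (intro allI impI)
    fix \<epsilon> :: real assume \<epsilon>: "\<epsilon> > 0"
    \<comment> \<open>A ball is twice as long as its tagged half, so the total length of the balls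
      is at most \<open>2 / e\<close> times the Henstock error; the bound is chosen to make this
      \<epsilon>.\<close>
    obtain \<gamma> where g: "gauge \<gamma>"
      and \<gamma>: "\<And>p. \<lbrakk>p tagged_partial_division_of (cbox a b); \<gamma> fine p\<rbrakk> \<Longrightarrow>
             sum (\<lambda>(x,k). norm(measure lborel k *\<^sub>R f x - integral k f)) p < \<epsilon> * e / 2"
      using Henstock_lemma[of f a b "\<epsilon> * e / 2"] f e \<epsilon> by auto
    define K where "K = {(x,h). x \<in> S e \<and> 0 < h \<and> bad e x h \<and> cball x h \<subseteq> \<gamma> x \<and> cball x h \<subseteq> {a..b}}"
    obtain C where C: "countable C" "C \<subseteq> K"
        "pairwise (\<lambda>i j. disjnt (ball (fst i) (snd i)) (ball (fst j) (snd j))) C"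
        "negligible(S e - (\<Union>i \<in> C. ball (fst i) (snd i)))"
    proof (rule Vitali_covering_theorem_balls [of "S e" K fst snd])
      fix x and d :: real assume x: "x \<in> S e" and d: "d > 0"
      obtain r where r: "r > 0" "ball x r \<subseteq> \<gamma> x" using g unfolding gauge_def by (meson openE)
      define d' where "d' = min (min d r) (min (x - a) (b - x))"
      have "d' > 0" using x r d by (auto simp: d'_def S_def)
      then obtain h where h: "0 < h" "h < d'" "bad e x h" using x by (auto simp: S_def)
      then have "cball x h \<subseteq> \<gamma> x" using r by (auto simp: d'_def dist_real_def subset_iff)
      moreover have "cball x h \<subseteq> {a..b}" using h by (auto simp: d'_def dist_real_def)
      ultimately have "(x,h) \<in> K \<and> x \<in> ball (fst (x,h)) (snd (x,h)) \<and> snd (x,h) < d"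
        using h x by (auto simp: K_def d'_def)
      then show "\<exists>i. i \<in> K \<and> x \<in> ball (fst i) (snd i) \<and> snd i < d" by blast
    qed auto
    have fin_bound: "measure lebesgue (\<Union>i\<in>A. ball (fst i) (snd i)) \<le> \<epsilon>" if A: "A \<subseteq> C" "finite A" for A
    proof -
      \<comment> \<open>Of the two halves of the ball, one on which the estimate fails is taken; the
        centre is an endpoint of it and serves as its tag.\<close>
      define iv where "iv = (\<lambda>(x,h). if \<bar>F (x+h) - F x - h * f x\<bar> > e * h then {x..x+h} else {x-h..x})"
      define tag where "tag = (\<lambda>i. (fst i :: real, iv i))"
      have inC: "fst i \<in> S e \<and> 0 < snd i \<and> bad e (fst i) (snd i) \<and> cball (fst i) (snd i) \<subseteq> \<gamma> (fst i) \<and> cball (fst i) (snd i) \<subseteq> {a..b}" if "i \<in> A" for i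
        using that A C(2) by (force simp: K_def)
      have dj: "disjnt (ball (fst i) (snd i)) (ball (fst j) (snd j))" if "i \<in> A" "j \<in> A" "i \<noteq> j" for i j
        using C(3) A that unfolding pairwise_def by blast
      have inj: "i = j" if "i \<in> A" "j \<in> A" "fst i = fst j" for i j
      proof (rule ccontr)
        assume "i \<noteq> j"
        from dj[OF that(1,2) this] have "disjnt (ball (fst i) (snd i)) (ball (fst j) (snd j))" .
        moreover have "fst i \<in> ball (fst i) (snd i)" "fst i \<in> ball (fst j) (snd j)"
          using inC[OF that(1)] inC[OF that(2)] that(3) by auto
        ultimately show False by (auto simp: disjnt_iff)
      qed
      have ivsub: "iv i \<subseteq> cball (fst i) (snd i)" if "i \<in> A" for i
        using inC[OF that] by (cases i) (auto simp: iv_def dist_real_def split: if_splits)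
      have ivint: "interior (iv i) \<subseteq> ball (fst i) (snd i)" if "i \<in> A" for i
        using interior_mono[OF ivsub[OF that]] by (simp add: interior_cball)
      have part: "(tag ` A) tagged_partial_division_of (cbox a b)"
        unfolding tagged_partial_division_of_def
      proof (intro conjI allI impI)
        show "finite (tag ` A)" using A by simp
      next
        fix x L assume "(x,L) \<in> tag ` A"
        then obtain i where i: "i \<in> A" "x = fst i" "L = iv i" by (auto simp: tag_def)
        have "0 < snd i" using inC i by auto
        then show "x \<in> L" unfolding i by (cases i) (auto simp: iv_def)
        show "L \<subseteq> cbox a b" using ivsub[OF i(1)] inC[OF i(1)] i by auto
        show "\<exists>a b. L = cbox a b" unfolding i by (cases i) (auto simp: iv_def cbox_interval split: if_splits)
      next
        fix x1 K1 x2 K2 assume *: "(x1,K1) \<in> tag ` A \<and> (x2,K2) \<in> tag ` A \<and> (x1,K1) \<noteq> (x2,K2)"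
        then obtain i j where ij: "i \<in> A" "j \<in> A" "(x1,K1) = tag i" "(x2,K2) = tag j" by auto
        then have "i \<noteq> j" using * by auto
        then show "interior K1 \<inter> interior K2 = {}"
          using dj[OF ij(1,2)] ivint[OF ij(1)] ivint[OF ij(2)] ij(3,4) by (auto simp: tag_def disjnt_def)
      qed
      have fine: "\<gamma> fine (tag ` A)" unfolding fine_def
        using ivsub inC by (fastforce simp: tag_def)
      have big: "e * snd i \<le> norm (measure lborel (iv i) *\<^sub>R f (fst i) - integral (iv i) f)" if i: "i \<in> A" for i
      proof -
        obtain x h where xh: "i = (x,h)" by (cases i)
        have h: "0 < h" "bad e x h" "cball x h \<subseteq> {a..b}" using inC[OF i] xh by auto
        have "x - h \<in> cball x h" "x + h \<in> cball x h" using h by (auto simp: dist_real_def)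
        then have "x - h \<in> {a..b}" "x + h \<in> {a..b}" using h(3) by blast+
        then have ab: "a \<le> x - h" "x + h \<le> b" by auto
        have "integral {x..x+h} f = F (x+h) - F x"
          using integral_indefinite_diff[OF f, of x "x+h"] ab h by (simp add: F_def)
        moreover have "integral {x-h..x} f = F x - F (x-h)"
          using integral_indefinite_diff[OF f, of "x-h" x] ab h by (simp add: F_def)
        ultimately show ?thesis using h(1,2) unfolding xh bad_def iv_def
          by (auto simp: abs_minus_commute)
      qed
      have "measure lebesgue (\<Union>i\<in>A. ball (fst i) (snd i)) \<le> (\<Sum>i\<in>A. measure lebesgue (ball (fst i) (snd i)))"
        by (rule measure_UNION_le) (use A in auto)
      also have "\<dots> = (\<Sum>i\<in>A. 2 * snd i)"
        by (rule sum.cong) (use inC in \<open>auto simp: ball_eq_greaterThanLessThan less_imp_le\<close>)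
      also have "\<dots> = (2 / e) * (\<Sum>i\<in>A. e * snd i)" using e by (simp add: sum_distrib_left)
      also have "\<dots> \<le> (2 / e) * (\<Sum>i\<in>A. norm (measure lborel (iv i) *\<^sub>R f (fst i) - integral (iv i) f))"
        using big e by (intro mult_left_mono sum_mono) auto
      also have "(\<Sum>i\<in>A. norm (measure lborel (iv i) *\<^sub>R f (fst i) - integral (iv i) f))
          = (\<Sum>(x,k)\<in>tag ` A. norm(measure lborel k *\<^sub>R f x - integral k f))"
        by (subst sum.reindex) (use inj in \<open>auto simp: tag_def inj_on_def comp_def\<close>)
      also have "(2 / e) * \<dots> \<le> (2 / e) * (\<epsilon> * e / 2)"
        using \<gamma>[OF part fine] e by (intro mult_left_mono) auto
      also have "\<dots> = \<epsilon>" using e by simp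
      finally show ?thesis .
    qed
    have "(\<Union>i\<in>C. ball (fst i) (snd i)) \<in> lmeasurable" 
      by (rule fmeasurable_UN_bound [OF C(1) _ fin_bound]) auto
    moreover have "measure lebesgue (\<Union>i\<in>C. ball (fst i) (snd i)) \<le> \<epsilon>"
      by (rule measure_UN_bound [OF C(1) _ fin_bound]) auto
    moreover have "S e \<subseteq> (\<Union>i\<in>C. ball (fst i) (snd i)) \<union> (S e - (\<Union>i \<in> C. ball (fst i) (snd i)))" by blast
    moreover have "(\<Union>i\<in>C. ball (fst i) (snd i)) \<union> (S e - (\<Union>i \<in> C. ball (fst i) (snd i))) \<in> lmeasurable"
      by (rule fmeasurable.Un[OF calculation(1) negligible_imp_measurable[OF C(4)]])
    moreover have "measure lebesgue ((\<Union>i\<in>C. ball (fst i) (snd i)) \<union> (S e - (\<Union>i \<in> C. ball (fst i) (snd i)))) \<le> \<epsilon>"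
      using calculation(1,2) C(4) 
      by (metis measure_Un_null_set fmeasurableD negligible_iff_null_sets)
    ultimately show "\<exists>T. S e \<subseteq> T \<and> T \<in> lmeasurable \<and> measure lebesgue T \<le> \<epsilon>" by blast
  qed
  define N where "N = {a,b} \<union> (\<Union>n::nat. S (inverse (Suc n)))"
  have "negligible N" unfolding N_def
    by (intro negligible_Un negligible_finite negligible_Union_nat neg) auto
  moreover have "(F has_vector_derivative f x) (at x)" if x: "x \<in> {a..b} - N" for x
    unfolding has_vector_derivative_def has_derivative_at_alt
  proof (intro conjI allI impI)
    show "bounded_linear (\<lambda>h. h *\<^sub>R f x)" by (rule bounded_linear_scaleR_left)
    fix e :: real assume "e > 0"
    then obtain n where n: "inverse (Suc n) < e" using reals_Archimedean by blast
    have "x \<notin> S (inverse (Suc n))" "x \<in> {a<..<b}" using x by (auto simp: N_def)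
    then obtain d where d: "d > 0" "\<And>h. 0 < h \<Longrightarrow> h < d \<Longrightarrow> \<not> bad (inverse (Suc n)) x h" by (auto simp: S_def)
    show "\<exists>d>0. \<forall>y. norm (y - x) < d \<longrightarrow> norm (F y - F x - (y - x) *\<^sub>R f x) \<le> e * norm (y - x)"
    proof (intro exI conjI allI impI)
      show "d > 0" by fact
      fix y assume y: "norm (y - x) < d"
      have *: "inverse (Suc n) * \<bar>y - x\<bar> \<le> e * \<bar>y - x\<bar>" using n by (intro mult_right_mono) auto
      consider "y = x" | "y > x" | "y < x" by linarith
      then show "norm (F y - F x - (y - x) *\<^sub>R f x) \<le> e * norm (y - x)"
      proof cases
        case 2
        then have "\<bar>F y - F x - (y - x) * f x\<bar> \<le> inverse (Suc n) * \<bar>y - x\<bar>"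
          using d(2)[of "y - x"] y by (auto simp: bad_def)
        then show ?thesis using * by auto
      next
        case 3
        then have "\<bar>F x - F y - (x - y) * f x\<bar> \<le> inverse (Suc n) * \<bar>y - x\<bar>" using d(2)[of "x - y"] y by (auto simp: bad_def)
        moreover have "F y - F x - (y - x) * f x = - (F x - F y - (x - y) * f x)" by (simp add: algebra_simps)
        ultimately show ?thesis using * by auto
      qed auto
    qed
  qed
  ultimately show ?thesis using that unfolding F_def by blast
qed

lemma lipschitz_abs_continuous:
  fixes f :: "real \<Rightarrow> 'a::metric_space"
  assumes L: "0 \<le> L" "\<And>s t. a \<le> s \<Longrightarrow> s \<le> t \<Longrightarrow> t \<le> b \<Longrightarrow> dist (f s) (f t) \<le> L * (t - s)"
  shows "abs_continuous_on a b f"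
  unfolding abs_continuous_on_def
proof (intro allI impI)
  fix e :: real assume e: "e > 0"
  show "\<exists>\<delta>>0. \<forall>D. finite D \<and> (\<forall>(c, d)\<in>D. a \<le> c \<and> c \<le> d \<and> d \<le> b) \<and>
        disjoint_family_on (\<lambda>(c, d). {c<..<d}) D \<and> (\<Sum>(c, d)\<in>D. d - c) < \<delta> \<longrightarrow>
        (\<Sum>(c, d)\<in>D. dist (f c) (f d)) < e"
  proof (intro exI conjI allI impI)
    show "e / (L + 1) > 0" using e L by simp
    fix D assume D: "finite D \<and> (\<forall>(c, d)\<in>D. a \<le> c \<and> c \<le> d \<and> d \<le> b) \<and>
        disjoint_family_on (\<lambda>(c, d). {c<..<d}) D \<and> (\<Sum>(c, d)\<in>D. d - c) < e / (L + 1)"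
    have "(\<Sum>(c, d)\<in>D. dist (f c) (f d)) \<le> (\<Sum>(c, d)\<in>D. L * (d - c))"
      by (rule sum_mono) (use D L in force)
    also have "\<dots> = L * (\<Sum>(c, d)\<in>D. d - c)" by (simp add: sum_distrib_left case_prod_unfold)
    also have "\<dots> \<le> L * (e / (L + 1))" using D L by (intro mult_left_mono) auto
    also have "\<dots> < e" using e L by (simp add: field_simps)
    finally show "(\<Sum>(c, d)\<in>D. dist (f c) (f d)) < e" .
  qed
qed

text \<open>The integral form makes sums and multiples immediate, and it fixes f' at every point, so
  the derivative can be rewritten pointwise. Boundedness of f' is what a locally bounded R provides
  on compact intervals, and it makes f Lipschitz.\<close>

definition primitive_on :: "real \<Rightarrow> real \<Rightarrow> (real \<Rightarrow> real) \<Rightarrow> (real \<Rightarrow> real) \<Rightarrow> bool" where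
  "primitive_on a b f f' \<longleftrightarrow>
     (\<forall>s t. a \<le> s \<and> s \<le> t \<and> t \<le> b \<longrightarrow> (f' has_integral f t - f s) {s..t}) \<and> bounded (f' ` {a..b})"

lemma primitive_onD:
  assumes "primitive_on a b f f'" "a \<le> s" "s \<le> t" "t \<le> b"
  shows "(f' has_integral f t - f s) {s..t}"
  using assms by (auto simp: primitive_on_def)

lemma bounded_realE:
  fixes f :: "'a \<Rightarrow> real"
  assumes "bounded (f ` S)"
  obtains B where "0 \<le> B" "\<And>x. x \<in> S \<Longrightarrow> \<bar>f x\<bar> \<le> B"
proof -
  obtain B where "\<forall>y\<in>f ` S. norm y \<le> B" using assms unfolding bounded_iff by blast
  then have "\<bar>f x\<bar> \<le> \<bar>B\<bar>" if "x \<in> S" for x using that by fastforce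
  then show ?thesis using that[of "\<bar>B\<bar>"] by simp
qed

lemma primitive_on_bounded:
  assumes "primitive_on a b f f'"
  shows "bounded (f' ` {a..b})"
  using assms by (simp add: primitive_on_def)

lemma primitive_on_lipschitz:
  assumes "primitive_on a b f f'"
  obtains L where "0 \<le> L" "\<And>s t. s \<in> {a..b} \<Longrightarrow> t \<in> {a..b} \<Longrightarrow> dist (f s) (f t) \<le> L * \<bar>t - s\<bar>"
proof -
  obtain L where L: "\<And>x. x \<in> {a..b} \<Longrightarrow> \<bar>f' x\<bar> \<le> L"
    using bounded_realE[OF primitive_on_bounded[OF assms]] by metis
  have *: "dist (f s) (f t) \<le> \<bar>L\<bar> * \<bar>t - s\<bar>" if "a \<le> s" "s \<le> t" "t \<le> b" for s t
  proof -
    have "norm (f t - f s) \<le> \<bar>L\<bar> * measure lborel {s..t}"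
      by (rule has_integral_bound_real[OF _ finite.emptyI primitive_onD[OF assms]])
         (use that in \<open>auto intro: order_trans[OF L]\<close>)
    then show ?thesis using that by (simp add: dist_norm norm_minus_commute)
  qed
  show ?thesis
  proof (rule that[of "\<bar>L\<bar>"])
    fix s t assume "s \<in> {a..b}" "t \<in> {a..b}"
    then show "dist (f s) (f t) \<le> \<bar>L\<bar> * \<bar>t - s\<bar>"
      using *[of s t] *[of t s] by (cases "s \<le> t") (auto simp: dist_commute abs_minus_commute)
  qed simp
qed

lemma primitive_on_continuous:
  assumes "primitive_on a b f f'"
  shows "continuous_on {a..b} f"
proof -
  obtain L where "0 \<le> L" "\<And>s t. s \<in> {a..b} \<Longrightarrow> t \<in> {a..b} \<Longrightarrow> dist (f s) (f t) \<le> L * \<bar>t - s\<bar>"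
    using primitive_on_lipschitz[OF assms] by metis
  then have "L-lipschitz_on {a..b} f" by (auto intro!: lipschitz_onI simp: dist_real_def abs_minus_commute)
  then show ?thesis by (rule lipschitz_on_continuous_on)
qed

lemma primitive_on_derivative:
  assumes "primitive_on a b f f'"
  obtains N where "negligible N"
    "\<And>x. x \<in> {a..b} - N \<Longrightarrow> (f has_vector_derivative f' x) (at x within {a..b})"
proof (cases "a \<le> b")
  case True
  have int: "f' integrable_on {a..b}" using primitive_onD[OF assms, of a b] True by blast
  obtain N where N: "negligible N"
    "\<And>x. x \<in> {a..b} - N \<Longrightarrow> ((\<lambda>t. integral {a..t} f') has_vector_derivative f' x) (at x)"
    using lebesgue_differentiation[OF int] by metis
  have "(f has_vector_derivative f' x) (at x within {a..b})" if x: "x \<in> {a..b} - N" for x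
  proof -
    have "((\<lambda>t. f a + integral {a..t} f') has_vector_derivative 0 + f' x) (at x within {a..b})"
      by (intro has_vector_derivative_add has_vector_derivative_const
            has_vector_derivative_at_within[OF N(2)[OF x]])
    then have "((\<lambda>t. f a + integral {a..t} f') has_vector_derivative f' x) (at x within {a..b})" by simp
    then show ?thesis
    proof (rule has_vector_derivative_transform[rotated 2])
      fix t assume "t \<in> {a..b}"
      then have "integral {a..t} f' = f t - f a"
        using primitive_onD[OF assms, of a t] True by (intro integral_unique) auto
      then show "f t = f a + integral {a..t} f'" by simp
    qed (use x in auto)
  qed
  with N that show ?thesis by blast
qed (use that[of "{}"] in auto)

lemma primitive_onI:
  assumes ac: "abs_continuous_on a b f" and N: "negligible N"
    and deriv: "\<And>x. x \<in> {a..b} - N \<Longrightarrow> (f has_vector_derivative g x) (at x within {a..b})"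
    and bdd: "bounded (g ` {a..b})"
  shows "primitive_on a b f g"
  unfolding primitive_on_def
proof (intro conjI allI impI)
  fix s t assume st: "a \<le> s \<and> s \<le> t \<and> t \<le> b"
  show "(g has_integral f t - f s) {s..t}"
  proof (rule abs_continuous_has_integral[OF _ _ N])
    show "abs_continuous_on s t f" unfolding abs_continuous_on_def
    proof (intro allI impI)
      fix e :: real assume "e > 0"
      then obtain d where d: "d > 0" "\<And>D. finite D \<and> (\<forall>(c, d)\<in>D. a \<le> c \<and> c \<le> d \<and> d \<le> b) \<and>
        disjoint_family_on (\<lambda>(c, d). {c<..<d}) D \<and> (\<Sum>(c, d)\<in>D. d - c) < d \<Longrightarrow>
        (\<Sum>(c, d)\<in>D. dist (f c) (f d)) < e" using ac unfolding abs_continuous_on_def by blast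
      have "(\<Sum>(c, d)\<in>D. dist (f c) (f d)) < e" if D: "finite D \<and> (\<forall>(c, d)\<in>D. s \<le> c \<and> c \<le> d \<and> d \<le> t) \<and>
        disjoint_family_on (\<lambda>(c, d). {c<..<d}) D \<and> (\<Sum>(c, d)\<in>D. d - c) < d" for D
      proof -
        have "\<forall>(c, d)\<in>D. a \<le> c \<and> c \<le> d \<and> d \<le> b" using D st by fastforce
        then show ?thesis using D d(2)[of D] by blast
      qed
      with d(1) show "\<exists>\<delta>>0. \<forall>D. finite D \<and> (\<forall>(c, d)\<in>D. s \<le> c \<and> c \<le> d \<and> d \<le> t) \<and>
        disjoint_family_on (\<lambda>(c, d). {c<..<d}) D \<and> (\<Sum>(c, d)\<in>D. d - c) < \<delta> \<longrightarrow>
        (\<Sum>(c, d)\<in>D. dist (f c) (f d)) < e" by blast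
    qed
    show "s \<le> t" using st by simp
    fix x assume "x \<in> {s..t} - N"
    then show "(f has_vector_derivative g x) (at x within {s..t})"
      by (intro has_vector_derivative_within_subset[OF deriv]) (use st in auto)
  qed
qed (rule bdd)

text \<open>The ordinary product rule holds off a null set, and the Lipschitz bound for the product
  allows it to be integrated back.\<close>

lemma primitive_on_mult:
  assumes f: "primitive_on a b f f'" and g: "primitive_on a b g g'"
  shows "primitive_on a b (\<lambda>t. f t * g t) (\<lambda>t. f t * g' t + f' t * g t)"
proof -
  obtain N where N: "negligible N" "\<And>x. x \<in> {a..b} - N \<Longrightarrow> (f has_vector_derivative f' x) (at x within {a..b})"
    using primitive_on_derivative[OF f] by metis
  obtain M where M: "negligible M" "\<And>x. x \<in> {a..b} - M \<Longrightarrow> (g has_vector_derivative g' x) (at x within {a..b})"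
    using primitive_on_derivative[OF g] by metis
  obtain L where L: "0 \<le> L" "\<And>s t. s \<in> {a..b} \<Longrightarrow> t \<in> {a..b} \<Longrightarrow> dist (f s) (f t) \<le> L * \<bar>t - s\<bar>"
    using primitive_on_lipschitz[OF f] by metis
  obtain K where K: "0 \<le> K" "\<And>s t. s \<in> {a..b} \<Longrightarrow> t \<in> {a..b} \<Longrightarrow> dist (g s) (g t) \<le> K * \<bar>t - s\<bar>"
    using primitive_on_lipschitz[OF g] by metis
  have bf: "bounded (f ` {a..b})" "bounded (g ` {a..b})"
    using primitive_on_continuous f g by (auto intro!: compact_imp_bounded compact_continuous_image)
  obtain F where F: "F \<ge> 0" "\<And>x. x \<in> {a..b} \<Longrightarrow> \<bar>f x\<bar> \<le> F"
    using bounded_realE[OF bf(1)] by metis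
  obtain G where G: "G \<ge> 0" "\<And>x. x \<in> {a..b} \<Longrightarrow> \<bar>g x\<bar> \<le> G"
    using bounded_realE[OF bf(2)] by metis
  obtain F' where F': "\<And>x. x \<in> {a..b} \<Longrightarrow> \<bar>f' x\<bar> \<le> F'"
    using bounded_realE[OF primitive_on_bounded[OF f]] by metis
  obtain G' where G': "\<And>x. x \<in> {a..b} \<Longrightarrow> \<bar>g' x\<bar> \<le> G'"
    using bounded_realE[OF primitive_on_bounded[OF g]] by metis
  show ?thesis
  proof (rule primitive_onI[OF lipschitz_abs_continuous negligible_Un[OF N(1) M(1)]])
    show "0 \<le> F * K + L * G" using F G L K by simp
    fix s t assume st: "a \<le> s" "s \<le> t" "t \<le> b"
    have "f s * g s - f t * g t = f s * (g s - g t) + (f s - f t) * g t" by (simp add: algebra_simps)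
    then have "\<bar>f s * g s - f t * g t\<bar> \<le> \<bar>f s\<bar> * \<bar>g s - g t\<bar> + \<bar>f s - f t\<bar> * \<bar>g t\<bar>"
      by (metis abs_mult abs_triangle_ineq)
    also have "\<dots> \<le> F * (K * (t - s)) + (L * (t - s)) * G"
      using F(2)[of s] G(2)[of t] L(2)[of s t] K(2)[of s t] st F G L K
      by (intro add_mono mult_mono) (auto simp: dist_real_def)
    finally show "dist (f s * g s) (f t * g t) \<le> (F * K + L * G) * (t - s)"
      by (simp add: dist_real_def algebra_simps)
  next
    fix x assume x: "x \<in> {a..b} - (N \<union> M)"
    show "((\<lambda>t. f t * g t) has_vector_derivative f x * g' x + f' x * g x) (at x within {a..b})"
      using has_vector_derivative_mult[OF N(2) M(2), of x] x by simp
  next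
    show "bounded ((\<lambda>t. f t * g' t + f' t * g t) ` {a..b})"
      unfolding bounded_iff
    proof (intro exI ballI)
      fix y assume "y \<in> (\<lambda>t. f t * g' t + f' t * g t) ` {a..b}"
      then obtain t where t: "t \<in> {a..b}" "y = f t * g' t + f' t * g t" by blast
      have "\<bar>y\<bar> \<le> \<bar>f t\<bar> * \<bar>g' t\<bar> + \<bar>f' t\<bar> * \<bar>g t\<bar>" unfolding t by (metis abs_mult abs_triangle_ineq)
      also have "\<dots> \<le> F * G' + F' * G"
        using F G F'[OF t(1)] G'[OF t(1)] F(2)[OF t(1)] G(2)[OF t(1)] by (intro add_mono mult_mono) auto
      finally show "norm y \<le> F * G' + F' * G" by simp
    qed
  qed
qed

text \<open>This supplies the integrating factors: the weight \<open>exp (K * g t)\<close> of the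
  iteration bounds and the factor \<open>exp (c * t)\<close> of the Gronwall argument.\<close>

lemma primitive_on_exp:
  assumes f: "primitive_on a b f f'"
  shows "primitive_on a b (\<lambda>t. exp (f t)) (\<lambda>t. f' t * exp (f t))"
proof -
  obtain N where N: "negligible N" "\<And>x. x \<in> {a..b} - N \<Longrightarrow> (f has_vector_derivative f' x) (at x within {a..b})"
    using primitive_on_derivative[OF f] by metis
  obtain L where L: "0 \<le> L" "\<And>s t. s \<in> {a..b} \<Longrightarrow> t \<in> {a..b} \<Longrightarrow> dist (f s) (f t) \<le> L * \<bar>t - s\<bar>"
    using primitive_on_lipschitz[OF f] by metis
  have bf: "bounded (f ` {a..b})"
    using primitive_on_continuous f by (auto intro!: compact_imp_bounded compact_continuous_image)
  obtain F where F: "\<And>x. x \<in> {a..b} \<Longrightarrow> \<bar>f x\<bar> \<le> F"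
    using bounded_realE[OF bf] by metis
  obtain F' where F': "\<And>x. x \<in> {a..b} \<Longrightarrow> \<bar>f' x\<bar> \<le> F'"
    using bounded_realE[OF primitive_on_bounded[OF f]] by metis
  have expL: "exp v - exp u \<le> exp F * (v - u)" if "u \<le> v" "v \<le> F" for u v :: real
  proof -
    have "exp v - exp u = exp v * (1 - exp (u - v))" by (simp add: algebra_simps flip: exp_add)
    also have "\<dots> \<le> exp v * (v - u)" 
    proof (rule mult_left_mono)
      show "1 - exp (u - v) \<le> v - u" using exp_ge_add_one_self[of "u - v"] by linarith
    qed simp
    also have "\<dots> \<le> exp F * (v - u)" using that by (intro mult_right_mono) auto
    finally show ?thesis .
  qed
  show ?thesis
  proof (rule primitive_onI[OF lipschitz_abs_continuous N(1)])
    show "0 \<le> exp F * L" using L by simp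
    fix s t assume st: "a \<le> s" "s \<le> t" "t \<le> b"
    have "\<bar>exp (f s) - exp (f t)\<bar> \<le> exp F * \<bar>f s - f t\<bar>"
      using expL[of "f s" "f t"] expL[of "f t" "f s"] F[of s] F[of t] st by (cases "f s \<le> f t") auto
    also have "\<dots> \<le> exp F * (L * (t - s))" using L(2)[of s t] st by (intro mult_left_mono) (auto simp: dist_real_def)
    finally show "dist (exp (f s)) (exp (f t)) \<le> exp F * L * (t - s)" by (simp add: dist_real_def)
  next
    fix x assume x: "x \<in> {a..b} - N"
    have "(f has_real_derivative f' x) (at x within {a..b})"
      using N(2)[OF x] by (simp add: has_real_derivative_iff_has_vector_derivative)
    then have "((\<lambda>t. exp (f t)) has_real_derivative f' x * exp (f x)) (at x within {a..b})"
      by (auto intro!: derivative_eq_intros)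
    then show "((\<lambda>t. exp (f t)) has_vector_derivative f' x * exp (f x)) (at x within {a..b})"
      by (simp add: has_real_derivative_iff_has_vector_derivative)
  next
    show "bounded ((\<lambda>t. f' t * exp (f t)) ` {a..b})"
      unfolding bounded_iff
    proof (intro exI ballI)
      fix y assume "y \<in> (\<lambda>t. f' t * exp (f t)) ` {a..b}"
      then obtain t where t: "t \<in> {a..b}" "y = f' t * exp (f t)" by blast
      have "\<bar>y\<bar> \<le> F' * exp F" unfolding t abs_mult
        using F'[OF t(1)] F[OF t(1)] by (intro mult_mono) auto
      then show "norm y \<le> F' * exp F" by simp
    qed
  qed
qed

lemma primitive_on_add:
  assumes "primitive_on a b f f'" "primitive_on a b g g'"
  shows "primitive_on a b (\<lambda>t. f t + g t) (\<lambda>t. f' t + g' t)"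
  unfolding primitive_on_def
proof (intro conjI allI impI)
  fix s t assume "a \<le> s \<and> s \<le> t \<and> t \<le> b"
  then have "(f' has_integral f t - f s) {s..t}" "(g' has_integral g t - g s) {s..t}"
    using primitive_onD[OF assms(1)] primitive_onD[OF assms(2)] by blast+
  from has_integral_add[OF this]
  show "((\<lambda>t. f' t + g' t) has_integral f t + g t - (f s + g s)) {s..t}" by (simp add: algebra_simps)
next
  show "bounded ((\<lambda>t. f' t + g' t) ` {a..b})"
    using assms by (auto simp: primitive_on_def intro!: bounded_plus_comp)
qed

lemma primitive_on_cmult:
  assumes "primitive_on a b f f'"
  shows "primitive_on a b (\<lambda>t. c * f t) (\<lambda>t. c * f' t)"
  unfolding primitive_on_def
proof (intro conjI allI impI)
  fix s t assume "a \<le> s \<and> s \<le> t \<and> t \<le> b"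
  then have "(f' has_integral f t - f s) {s..t}" using primitive_onD[OF assms] by blast
  from has_integral_mult_right[OF this, of c]
  show "((\<lambda>t. c * f' t) has_integral c * f t - c * f s) {s..t}" by (simp add: algebra_simps)
next
  have "bounded ((\<lambda>y. c *\<^sub>R y) ` (f' ` {a..b}))" using assms unfolding primitive_on_def by (intro bounded_scaling) auto
  then show "bounded ((\<lambda>t. c * f' t) ` {a..b})" by (simp add: image_image)
qed

lemma primitive_on_diff:
  assumes "primitive_on a b f f'" "primitive_on a b g g'"
  shows "primitive_on a b (\<lambda>t. f t - g t) (\<lambda>t. f' t - g' t)"
  using primitive_on_add[OF assms(1) primitive_on_cmult[OF assms(2), of "-1"]] by simp

lemma primitive_on_ident: "primitive_on a b (\<lambda>t. t) (\<lambda>t. 1)"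
proof -
  have "((\<lambda>t. 1::real) has_integral t - s) {s..t}" if "s \<le> t" for s t :: real
    using has_integral_const_real[of "1::real" s t] that by simp
  then show ?thesis by (auto simp: primitive_on_def image_constant_conv)
qed

lemma primitive_on_cong:
  assumes "primitive_on a b f f'" "\<And>t. t \<in> {a..b} \<Longrightarrow> f t = g t" "\<And>t. t \<in> {a..b} \<Longrightarrow> f' t = g' t"
  shows "primitive_on a b g g'"
  unfolding primitive_on_def
proof (intro conjI allI impI)
  fix s t assume st: "a \<le> s \<and> s \<le> t \<and> t \<le> b"
  then have "(f' has_integral f t - f s) {s..t}" using primitive_onD[OF assms(1)] by blast
  then have "(g' has_integral f t - f s) {s..t}" by (rule has_integral_eq[rotated]) (use st assms in auto)
  then show "(g' has_integral g t - g s) {s..t}" using assms(2)[of s] assms(2)[of t] st by auto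
next
  have "f' ` {a..b} = g' ` {a..b}" using assms(3) by (rule image_cong[OF refl])
  then show "bounded (g' ` {a..b})" using assms(1) by (simp add: primitive_on_def)
qed

lemma primitive_on_mono:
  assumes "primitive_on a b f f'" "\<And>t. t \<in> {a..b} \<Longrightarrow> 0 \<le> f' t" "a \<le> s" "s \<le> t" "t \<le> b"
  shows "f s \<le> f t"
  using has_integral_nonneg[OF primitive_onD[OF assms(1,3,4,5)]] assms by auto

lemma primitive_on_of_integrable:
  assumes "f integrable_on {c..b}" "bounded (f ` {a..b})" "c \<le> a"
  shows "primitive_on a b (\<lambda>t. integral {c..t} f) f"
  unfolding primitive_on_def
proof (intro conjI allI impI)
  fix s t assume st: "a \<le> s \<and> s \<le> t \<and> t \<le> b"
  have "f integrable_on {s..t}" by (rule integrable_on_subinterval[OF assms(1)]) (use st assms in auto)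
  moreover have "integral {c..t} f - integral {c..s} f = integral {s..t} f"
    by (rule integral_indefinite_diff[OF assms(1)]) (use st assms in auto)
  ultimately show "(f has_integral integral {c..t} f - integral {c..s} f) {s..t}"
    by (simp add: integrable_integral)
qed (rule assms)

section \<open>The Dirac system as a power series in the eigenvalue\<close>

text \<open>For \<open>R = [[p, b], [b, r]]\<close> the equation \<open>R\<^sup>-\<^sup>1 J (x, y)' = l (x, y)\<close> reads \<open>x' = l (b x + r y)\<close> and
  \<open>y' = - l (p x + b y)\<close>. The pairs below are the coefficients of \<open>l\<^sup>n\<close> in its solution with initial value
  \<open>(1, 0)\<close>.\<close>

primrec dirac_iter :: "(real \<Rightarrow> real) \<Rightarrow> (real \<Rightarrow> real) \<Rightarrow> (real \<Rightarrow> real) \<Rightarrow> nat \<Rightarrow> (real \<Rightarrow> real) \<times> (real \<Rightarrow> real)" where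
  "dirac_iter p b r 0 = (\<lambda>_. 1, \<lambda>_. 0)"
| "dirac_iter p b r (Suc n) =
     (\<lambda>t. integral {0..t} (\<lambda>s. b s * fst (dirac_iter p b r n) s + r s * snd (dirac_iter p b r n) s),
      \<lambda>t. - integral {0..t} (\<lambda>s. p s * fst (dirac_iter p b r n) s + b s * snd (dirac_iter p b r n) s))"

lemma integrable_on_bounded_by:
  fixes f g :: "real \<Rightarrow> real"
  assumes "f \<in> borel_measurable (lebesgue_on {0..1})" "g integrable_on {0..1}" "\<And>x. x \<in> {0..1} \<Longrightarrow> \<bar>f x\<bar> \<le> g x"
  shows "f absolutely_integrable_on {0..1}"
  by (rule measurable_bounded_by_integrable_imp_absolutely_integrable[OF assms(1) _ assms(2)]) (use assms(3) in auto)

lemma integrable_sub: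
  fixes f :: "real \<Rightarrow> real"
  assumes "f integrable_on {0..1}" "0 \<le> s" "t \<le> 1"
  shows "f integrable_on {s..t}"
  by (rule integrable_on_subinterval[OF assms(1)]) (use assms in auto)

lemma integral_tendsto_0:
  fixes f :: "real \<Rightarrow> real"
  assumes "f integrable_on {0..1}"
  shows "((\<lambda>t. integral {0..t} f) \<longlongrightarrow> 0) (at_right 0)"
proof -
  have "continuous_on {0..1} (\<lambda>t. integral {0..t} f)" by (rule indefinite_integral_continuous_1[OF assms])
  then have "((\<lambda>t. integral {0..t} f) \<longlongrightarrow> integral {0..0} f) (at 0 within {0..1})"
    unfolding continuous_on by (rule bspec) simp
  then show ?thesis by (simp add: at_within_Icc_at_right)
qed

text \<open>The entries may be unbounded at 0, so primitives with bounded derivative are available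
  on [\<eta>,t] with \<eta> > 0; estimates proved there pass to [0,t].\<close>

lemma integral_le_from_right:
  fixes f :: "real \<Rightarrow> real"
  assumes f: "f integrable_on {0..1}" and t: "t \<in> {0<..1}"
    and le: "\<And>\<eta>. 0 < \<eta> \<Longrightarrow> \<eta> < t \<Longrightarrow> integral {\<eta>..t} f \<le> B"
  shows "integral {0..t} f \<le> B"
proof -
  have "((\<lambda>\<eta>. integral {0..t} f - integral {0..\<eta>} f) \<longlongrightarrow> integral {0..t} f - 0) (at_right 0)"
    by (intro tendsto_intros integral_tendsto_0 f)
  moreover have "\<forall>\<^sub>F \<eta> in at_right 0. integral {0..t} f - integral {0..\<eta>} f \<le> B"
  proof -
    have "\<forall>\<^sub>F \<eta> in at_right 0. \<eta> \<in> {0<..<t}" using t by (intro eventually_at_right_real) auto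
    then show ?thesis
    proof eventually_elim
      case (elim \<eta>)
      then show ?case using integral_indefinite_diff[OF f, of \<eta> t] le[of \<eta>] t by auto
    qed
  qed
  ultimately have "integral {0..t} f - 0 \<le> B" by (rule tendsto_upperbound) simp
  then show ?thesis by simp
qed

text \<open>The consequences of Assumptions 1 and 2 for the entries of R. Integrability of the first
  row is the first condition of Assumption 2, and integrability of r times the primitive of p is the
  second one after its inner integration. The entry r alone may have a non-integrable singularity at
  0.\<close>

locale dirac_entries =
  fixes p b r :: "real \<Rightarrow> real"
  assumes p_meas: "p \<in> borel_measurable lebesgue" and b_meas: "b \<in> borel_measurable lebesgue"
    and r_meas: "r \<in> borel_measurable lebesgue"
    and p_int: "p integrable_on {0..1}" and b_int: "(\<lambda>t. \<bar>b t\<bar>) integrable_on {0..1}"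
    and ra_int: "(\<lambda>t. r t * integral {0..t} p) integrable_on {0..1}"
    and p_nonneg: "\<And>t. 0 \<le> p t" and r_nonneg: "\<And>t. 0 \<le> r t"
    and det: "\<And>t. t \<in> {0<..1} \<Longrightarrow> p t * r t - (b t)\<^sup>2 = 1 / 4"
    and bdd: "\<And>\<eta>. \<eta> \<in> {0<..1} \<Longrightarrow> \<exists>K. \<forall>t\<in>{\<eta>..1}. \<bar>p t\<bar> \<le> K \<and> \<bar>b t\<bar> \<le> K \<and> \<bar>r t\<bar> \<le> K"
begin

lemma bddE:
  assumes "\<eta> \<in> {0<..1}"
  obtains K where "K > 0" "\<And>t. t \<in> {\<eta>..1} \<Longrightarrow> \<bar>p t\<bar> \<le> K" "\<And>t. t \<in> {\<eta>..1} \<Longrightarrow> \<bar>b t\<bar> \<le> K" "\<And>t. t \<in> {\<eta>..1} \<Longrightarrow> \<bar>r t\<bar> \<le> K"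
proof -
  obtain K where K: "\<forall>t\<in>{\<eta>..1}. \<bar>p t\<bar> \<le> K \<and> \<bar>b t\<bar> \<le> K \<and> \<bar>r t\<bar> \<le> K" using bdd[OF assms] by blast
  show ?thesis by (rule that[of "\<bar>K\<bar> + 1"]) (use K in fastforce)+
qed

definition a :: "real \<Rightarrow> real" where "a t = integral {0..t} p"
text \<open>This dominates the right-hand side of the equation for x when |x| is at most 1 and |y|
  at most \<open>a\<close>.\<close>

definition g' :: "real \<Rightarrow> real" where "g' t = \<bar>b t\<bar> + r t * a t"
definition g :: "real \<Rightarrow> real" where "g t = integral {0..t} g'"

lemma ra_int': "(\<lambda>t. r t * a t) integrable_on {0..1}" using ra_int by (simp add: a_def)

lemma g'_int: "g' integrable_on {0..1}" unfolding g'_def by (intro integrable_add b_int ra_int')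

lemma a_nonneg: "0 \<le> t \<Longrightarrow> t \<le> 1 \<Longrightarrow> 0 \<le> a t"
  unfolding a_def by (rule integral_nonneg[OF integrable_sub[OF p_int]]) (auto simp: p_nonneg)

lemma a_mono: "0 \<le> s \<Longrightarrow> s \<le> t \<Longrightarrow> t \<le> 1 \<Longrightarrow> a s \<le> a t"
  unfolding a_def by (rule integral_subset_le) (auto simp: p_nonneg intro: integrable_sub[OF p_int])

lemma g'_nonneg: "0 \<le> t \<Longrightarrow> t \<le> 1 \<Longrightarrow> 0 \<le> g' t"
  unfolding g'_def using a_nonneg r_nonneg by auto

lemma g_mono: "0 \<le> s \<Longrightarrow> s \<le> t \<Longrightarrow> t \<le> 1 \<Longrightarrow> g s \<le> g t"
  unfolding g_def by (rule integral_subset_le) (auto simp: g'_nonneg intro: integrable_sub[OF g'_int])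

lemma g_nonneg: "0 \<le> t \<Longrightarrow> t \<le> 1 \<Longrightarrow> 0 \<le> g t"
  using g_mono[of 0 t] by (simp add: g_def)

lemma a_cont: "continuous_on {0..1} a"
  unfolding a_def by (rule indefinite_integral_continuous_1[OF p_int])

lemma g_cont: "continuous_on {0..1} g"
  unfolding g_def by (rule indefinite_integral_continuous_1[OF g'_int])

text \<open>The determinant gives p r \<ge> 1/4, hence p \<ge> 1/(4 K) wherever r \<le> K.
  Positivity allows \<open>a\<close> to be cancelled in the uniqueness proof.\<close>

lemma a_pos: assumes "t \<in> {0<..1}" shows "0 < a t"
proof -
  have "t/2 \<in> {0<..1}" using assms by auto
  from bddE[OF this] obtain K where K: "K > 0" "\<And>s. s \<in> {t/2..1} \<Longrightarrow> \<bar>r s\<bar> \<le> K" by metis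
  have pl: "1 / (4 * K) \<le> p s" if s: "s \<in> {t/2..t}" for s
  proof -
    have "1 / 4 \<le> p s * r s" using det[of s] s assms by (auto simp: algebra_simps)
    also have "\<dots> \<le> p s * K" using K(2)[of s] s assms p_nonneg by (intro mult_left_mono) auto
    finally show ?thesis using K(1) by (simp add: field_simps)
  qed
  have "0 < 1 / (4 * K) * (t / 2)" using K assms by simp
  also have "\<dots> = integral {t/2..t} (\<lambda>_. 1 / (4 * K))" using assms by simp
  also have "\<dots> \<le> integral {t/2..t} p"
    by (rule integral_le) (use assms pl in \<open>auto intro!: integrable_sub[OF p_int]\<close>)
  also have "\<dots> \<le> integral {0..t} p"
    by (rule integral_subset_le) (use assms in \<open>auto simp: p_nonneg intro: integrable_sub[OF p_int]\<close>)
  finally show ?thesis by (simp add: a_def)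
qed

lemma meas_on:
  "p \<in> borel_measurable (lebesgue_on {0..1})" "b \<in> borel_measurable (lebesgue_on {0..1})"
  "r \<in> borel_measurable (lebesgue_on {0..1})" "a \<in> borel_measurable (lebesgue_on {0..1})"
  "g \<in> borel_measurable (lebesgue_on {0..1})"
  using p_meas b_meas r_meas a_cont g_cont
  by (auto intro: measurable_restrict_space1 continuous_imp_measurable_on_sets_lebesgue)

text \<open>The factor \<open>a\<close> in the bound on \<open>y\<close> compensates the singularity of \<open>r\<close> at \<open>0\<close>, because
  \<open>r a\<close> is integrable by Assumption 2.\<close>

definition admissible :: "real \<Rightarrow> (real \<Rightarrow> real) \<Rightarrow> (real \<Rightarrow> real) \<Rightarrow> bool" where
  "admissible C x y \<longleftrightarrow> continuous_on {0..1} x \<and> continuous_on {0..1} y \<and>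
     (\<forall>t\<in>{0..1}. \<bar>x t\<bar> \<le> C \<and> \<bar>y t\<bar> \<le> C * a t)"

lemma row_bounds:
  assumes "\<bar>x\<bar> \<le> C" "\<bar>y\<bar> \<le> C * a t"
  shows "\<bar>b t * x + r t * y\<bar> \<le> C * g' t" "\<bar>p t * x + b t * y\<bar> \<le> C * (p t + \<bar>b t\<bar> * a t)"
proof -
  have "\<bar>b t * x + r t * y\<bar> \<le> \<bar>b t\<bar> * \<bar>x\<bar> + r t * \<bar>y\<bar>"
    using abs_triangle_ineq[of "b t * x" "r t * y"] r_nonneg[of t] by (simp add: abs_mult)
  also have "\<dots> \<le> \<bar>b t\<bar> * C + r t * (C * a t)" using assms r_nonneg[of t] by (intro add_mono mult_left_mono) auto
  finally show "\<bar>b t * x + r t * y\<bar> \<le> C * g' t" by (simp add: g'_def algebra_simps)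
  have "\<bar>p t * x + b t * y\<bar> \<le> p t * \<bar>x\<bar> + \<bar>b t\<bar> * \<bar>y\<bar>"
    using abs_triangle_ineq[of "p t * x" "b t * y"] p_nonneg[of t] by (simp add: abs_mult)
  also have "\<dots> \<le> p t * C + \<bar>b t\<bar> * (C * a t)" using assms p_nonneg[of t] by (intro add_mono mult_left_mono) auto
  finally show "\<bar>p t * x + b t * y\<bar> \<le> C * (p t + \<bar>b t\<bar> * a t)" by (simp add: algebra_simps)
qed

lemma admissible_int:
  assumes adm: "admissible C x y"
  shows "(\<lambda>t. b t * x t + r t * y t) absolutely_integrable_on {0..1}"
    and "(\<lambda>t. p t * x t + b t * y t) absolutely_integrable_on {0..1}"
proof -
  have cont: "continuous_on {0..1} x" "continuous_on {0..1} y" using adm by (auto simp: admissible_def)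
  have bd: "\<bar>x t\<bar> \<le> C" "\<bar>y t\<bar> \<le> C * a t" if "t \<in> {0..1}" for t using adm that by (auto simp: admissible_def)
  have C: "0 \<le> C" using bd(1)[of 0] by auto
  have [measurable]: "x \<in> borel_measurable (lebesgue_on {0..1})" "y \<in> borel_measurable (lebesgue_on {0..1})"
    using cont by (auto intro: continuous_imp_measurable_on_sets_lebesgue)
  note [measurable] = meas_on
  have m1: "(\<lambda>t. b t * x t + r t * y t) \<in> borel_measurable (lebesgue_on {0..1})"
    and m2: "(\<lambda>t. p t * x t + b t * y t) \<in> borel_measurable (lebesgue_on {0..1})" by measurable
  show "(\<lambda>t. b t * x t + r t * y t) absolutely_integrable_on {0..1}"
    by (rule integrable_on_bounded_by[OF m1 integrable_on_mult_right[OF g'_int, of C] row_bounds(1)[OF bd]])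
  have int: "(\<lambda>t. C * (p t + a 1 * \<bar>b t\<bar>)) integrable_on {0..1}"
    by (intro integrable_on_mult_right integrable_add p_int b_int)
  show "(\<lambda>t. p t * x t + b t * y t) absolutely_integrable_on {0..1}"
  proof (rule integrable_on_bounded_by[OF m2 int])
    fix t :: real assume t: "t \<in> {0..1}"
    have "\<bar>b t\<bar> * a t \<le> \<bar>b t\<bar> * a 1" using a_mono[of t 1] t by (intro mult_left_mono) auto
    then have "C * (p t + \<bar>b t\<bar> * a t) \<le> C * (p t + a 1 * \<bar>b t\<bar>)" using C by (intro mult_left_mono) (auto simp: algebra_simps)
    then show "\<bar>p t * x t + b t * y t\<bar> \<le> C * (p t + a 1 * \<bar>b t\<bar>)" using row_bounds(2)[OF bd[OF t]] by linarith
  qed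
qed

lemmas admissible_int' = admissible_int(1,2)[THEN set_lebesgue_integral_eq_integral(1)]

text \<open>Away from 0 the integrand has the primitive \<open>exp (K * g s) / K\<close>.
  Integration against \<open>g'\<close> thus gains a factor 1/K, which drives the iteration
  bounds.\<close>

lemma exp_int:
  assumes "0 < K" "t \<in> {0..1}"
  shows "(\<lambda>s. g' s * exp (K * g s)) integrable_on {0..1}"
    and "integral {0..t} (\<lambda>s. g' s * exp (K * g s)) \<le> exp (K * g t) / K"
proof -
  note [measurable] = meas_on
  have "(\<lambda>s. g' s * exp (K * g s)) absolutely_integrable_on {0..1}"
  proof (rule integrable_on_bounded_by)
    show "(\<lambda>s. g' s * exp (K * g s)) \<in> borel_measurable (lebesgue_on {0..1})" unfolding g'_def by measurable
    show "(\<lambda>s. g' s * exp (K * g 1)) integrable_on {0..1}" by (intro integrable_on_mult_left g'_int)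
    fix x :: real assume "x \<in> {0..1}"
    then show "\<bar>g' x * exp (K * g x)\<bar> \<le> g' x * exp (K * g 1)"
      using g'_nonneg[of x] g_mono[of x 1] assms by (auto simp: abs_mult intro!: mult_left_mono)
  qed
  then show int: "(\<lambda>s. g' s * exp (K * g s)) integrable_on {0..1}" by (rule set_lebesgue_integral_eq_integral(1))
  show "integral {0..t} (\<lambda>s. g' s * exp (K * g s)) \<le> exp (K * g t) / K"
  proof (cases "t = 0")
    case False
    then have t: "t \<in> {0<..1}" using assms by auto
    show ?thesis
    proof (rule integral_le_from_right[OF int t])
      fix \<eta> assume \<eta>: "0 < \<eta>" "\<eta> < t"
      then have "\<eta> \<in> {0<..1}" using t by auto
      from bddE[OF this] obtain B where B: "\<And>t. t \<in> {\<eta>..1} \<Longrightarrow> \<bar>p t\<bar> \<le> B" "\<And>t. t \<in> {\<eta>..1} \<Longrightarrow> \<bar>b t\<bar> \<le> B" "\<And>t. t \<in> {\<eta>..1} \<Longrightarrow> \<bar>r t\<bar> \<le> B" "B > 0" by metis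
      have "bounded (g' ` {\<eta>..1})" unfolding bounded_iff
      proof (intro exI ballI)
        fix y assume "y \<in> g' ` {\<eta>..1}"
        then obtain s where s: "s \<in> {\<eta>..1}" "y = g' s" by blast
        have "\<bar>g' s\<bar> = \<bar>b s\<bar> + r s * a s" using g'_nonneg[of s] s \<eta> by (simp add: g'_def)
        also have "\<dots> \<le> B + B * a 1" using B(2,3)[OF s(1)] B(4) a_mono[of s 1] a_nonneg[of s] s \<eta> r_nonneg[of s]
          by (intro add_mono mult_mono) auto
        finally show "norm y \<le> B + B * a 1" using s by simp
      qed
      then have "primitive_on \<eta> 1 g g'" unfolding g_def
        by (intro primitive_on_of_integrable[OF g'_int]) (use \<eta> in auto)
      then have "primitive_on \<eta> 1 (\<lambda>s. 1/K * exp (K * g s)) (\<lambda>s. 1/K * ((K * g' s) * exp (K * g s)))"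
        by (intro primitive_on_cmult primitive_on_exp)
      then have "primitive_on \<eta> 1 (\<lambda>s. exp (K * g s) / K) (\<lambda>s. g' s * exp (K * g s))"
        by (rule primitive_on_cong) (use assms in auto)
      from primitive_onD[OF this, of \<eta> t] have
        "integral {\<eta>..t} (\<lambda>s. g' s * exp (K * g s)) = exp (K * g t) / K - exp (K * g \<eta>) / K"
        using \<eta> t by (intro integral_unique) auto
      also have "\<dots> \<le> exp (K * g t) / K" using assms by simp
      finally show "integral {\<eta>..t} (\<lambda>s. g' s * exp (K * g s)) \<le> exp (K * g t) / K" .
    qed
  qed (use assms in auto)
qed

abbreviation "xs n \<equiv> fst (dirac_iter p b r n)"
abbreviation "ys n \<equiv> snd (dirac_iter p b r n)"

lemma integral_abs_le:
  fixes f h :: "real \<Rightarrow> real"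
  assumes "f integrable_on {0..1}" "h integrable_on {0..1}" "\<And>s. s \<in> {0..t} \<Longrightarrow> \<bar>f s\<bar> \<le> h s" "t \<in> {0..1}"
  shows "\<bar>integral {0..t} f\<bar> \<le> integral {0..t} h"
  using integral_norm_bound_integral[of f "{0..t}" h] assms integrable_sub[of f 0 t] integrable_sub[of h 0 t] by auto

text \<open>The weight \<open>exp (K * g t)\<close> plays the role of the factorials in a Picard
  iteration. A step for x costs c and gains 1/K, and c/K = \<kappa>. In a step for y the term with p
  gains nothing from the weight, so y is allowed to be larger by the factor c: the requirement is 1
  + c/K \<le> c \<kappa>, which holds because c \<kappa> = 2 and c/K \<le> 1. With \<kappa> = 1/(2
  L) the series is geometric of ratio 1/2 for |l| \<le> L.\<close>

lemma iter_bound_aux: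
  assumes L: "1 \<le> L" "c = 4 * L" "K = 8 * L\<^sup>2" "\<kappa> = 1 / (2 * L)"
  shows "continuous_on {0..1} (xs n) \<and> continuous_on {0..1} (ys n) \<and>
    (\<forall>t\<in>{0..1}. \<bar>xs n t\<bar> \<le> \<kappa>^n * exp (K * g t) \<and> \<bar>ys n t\<bar> \<le> c * a t * \<kappa>^n * exp (K * g t))"
proof (induction n)
  case 0
  have "1 \<le> exp (K * g t)" if "t \<in> {0..1}" for t using g_nonneg[of t] that L by simp
  then show ?case using a_nonneg L by auto
next
  case (Suc n)
  have pos: "K > 0" "c > 0" "\<kappa> > 0" "1 \<le> c" using L by auto
  have bd: "\<bar>xs n t\<bar> \<le> \<kappa>^n * exp (K * g t)" "\<bar>ys n t\<bar> \<le> c * a t * \<kappa>^n * exp (K * g t)" if "t \<in> {0..1}" for t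
    using Suc that by auto
  define C where "C = c * \<kappa>^n * exp (K * g 1)"
  have "admissible C (xs n) (ys n)" unfolding admissible_def
  proof (intro conjI ballI)
    fix t :: real assume t: "t \<in> {0..1}"
    have e: "exp (K * g t) \<le> exp (K * g 1)" using g_mono[of t 1] t pos by simp
    have "\<kappa>^n * exp (K * g t) \<le> c * (\<kappa>^n * exp (K * g 1))"
      using pos e by (intro order_trans[OF mult_left_mono[OF e]] mult_right_mono[of 1 c, simplified]) auto
    then show "\<bar>xs n t\<bar> \<le> C" using bd(1)[OF t] by (simp add: C_def)
    have "c * a t * \<kappa>^n * exp (K * g t) \<le> c * a t * \<kappa>^n * exp (K * g 1)"
      using pos e a_nonneg[of t] t by (intro mult_left_mono) auto
    then show "\<bar>ys n t\<bar> \<le> C * a t" using bd(2)[OF t] by (simp add: C_def mult_ac)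
  qed (use Suc in auto)
  note int = admissible_int'[OF this]
  have x_bd: "\<bar>xs (Suc n) t\<bar> \<le> \<kappa>^Suc n * exp (K * g t)" if t: "t \<in> {0..1}" for t
  proof -
    have "\<bar>xs (Suc n) t\<bar> \<le> integral {0..t} (\<lambda>s. c * \<kappa>^n * (g' s * exp (K * g s)))"
      unfolding dirac_iter.simps fst_conv
    proof (rule integral_abs_le[OF int(1) _ _ t])
      show "(\<lambda>s. c * \<kappa>^n * (g' s * exp (K * g s))) integrable_on {0..1}"
        by (intro integrable_on_mult_right exp_int[OF pos(1) t])
      fix s assume s: "s \<in> {0..t}"
      then have s1: "s \<in> {0..1}" using t by auto
      have "\<bar>b s * xs n s + r s * ys n s\<bar> \<le> \<bar>b s\<bar> * \<bar>xs n s\<bar> + r s * \<bar>ys n s\<bar>"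
        using abs_triangle_ineq[of "b s * xs n s" "r s * ys n s"] r_nonneg[of s] by (simp add: abs_mult)
      also have "\<dots> \<le> \<bar>b s\<bar> * (c * (\<kappa>^n * exp (K * g s))) + r s * (c * a s * \<kappa>^n * exp (K * g s))"
      proof (intro add_mono mult_left_mono)
        have "\<kappa>^n * exp (K * g s) \<le> c * (\<kappa>^n * exp (K * g s))"
          using pos by (intro mult_right_mono[of 1 c, simplified]) auto
        then show "\<bar>xs n s\<bar> \<le> c * (\<kappa>^n * exp (K * g s))" using bd(1)[OF s1] by linarith
      qed (use bd(2)[OF s1] r_nonneg in auto)
      also have "\<dots> = c * \<kappa>^n * (g' s * exp (K * g s))" by (simp add: g'_def algebra_simps)
      finally show "\<bar>b s * xs n s + r s * ys n s\<bar> \<le> c * \<kappa>^n * (g' s * exp (K * g s))" .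
    qed
    also have "\<dots> = c * \<kappa>^n * integral {0..t} (\<lambda>s. g' s * exp (K * g s))" by simp
    also have "\<dots> \<le> c * \<kappa>^n * (exp (K * g t) / K)" using exp_int(2)[OF pos(1) t] pos by (intro mult_left_mono) auto
    also have "\<dots> = \<kappa>^Suc n * exp (K * g t)" using L by (simp add: power2_eq_square)
    finally show ?thesis .
  qed
  have y_bd: "\<bar>ys (Suc n) t\<bar> \<le> c * a t * \<kappa>^Suc n * exp (K * g t)" if t: "t \<in> {0..1}" for t
  proof -
    let ?h = "\<lambda>s. \<kappa>^n * exp (K * g t) * p s + c * a t * \<kappa>^n * (g' s * exp (K * g s))"
    have "\<bar>ys (Suc n) t\<bar> \<le> integral {0..t} ?h"
      unfolding dirac_iter.simps snd_conv abs_minus_cancel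
    proof (rule integral_abs_le[OF int(2) _ _ t])
      show "?h integrable_on {0..1}"
        by (intro integrable_add integrable_on_mult_right exp_int[OF pos(1) t] p_int)
      fix s assume s: "s \<in> {0..t}"
      then have s1: "s \<in> {0..1}" using t by auto
      have "\<bar>p s * xs n s + b s * ys n s\<bar> \<le> p s * \<bar>xs n s\<bar> + \<bar>b s\<bar> * \<bar>ys n s\<bar>"
        using abs_triangle_ineq[of "p s * xs n s" "b s * ys n s"] p_nonneg[of s] by (simp add: abs_mult)
      also have "\<dots> \<le> p s * (\<kappa>^n * exp (K * g t)) + g' s * (c * a t * \<kappa>^n * exp (K * g s))"
      proof (intro add_mono mult_mono)
        have "exp (K * g s) \<le> exp (K * g t)" using g_mono[of s t] s t pos by simp
        then have "\<kappa>^n * exp (K * g s) \<le> \<kappa>^n * exp (K * g t)" using pos by simp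
        then show "\<bar>xs n s\<bar> \<le> \<kappa>^n * exp (K * g t)" using bd(1)[OF s1] by linarith
        have "c * a s * \<kappa>^n * exp (K * g s) \<le> c * a t * \<kappa>^n * exp (K * g s)"
          using a_mono[of s t] s t pos by (intro mult_right_mono mult_left_mono) auto
        then show "\<bar>ys n s\<bar> \<le> c * a t * \<kappa>^n * exp (K * g s)" using bd(2)[OF s1] by linarith
        show "\<bar>b s\<bar> \<le> g' s" using r_nonneg[of s] a_nonneg[of s] s1 by (auto simp: g'_def)
      qed (use p_nonneg g'_nonneg s1 in auto)
      also have "\<dots> = ?h s" by (simp add: algebra_simps)
      finally show "\<bar>p s * xs n s + b s * ys n s\<bar> \<le> ?h s" .
    qed
    also have "\<dots> = \<kappa>^n * exp (K * g t) * a t + c * a t * \<kappa>^n * integral {0..t} (\<lambda>s. g' s * exp (K * g s))"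
      unfolding a_def
      by (subst Henstock_Kurzweil_Integration.integral_add)
         (use t in \<open>auto intro!: integrable_on_mult_right integrable_sub[OF exp_int(1)[OF pos(1) t]] integrable_sub[OF p_int]\<close>)
    also have "\<dots> \<le> \<kappa>^n * exp (K * g t) * a t + c * a t * \<kappa>^n * (exp (K * g t) / K)"
      using exp_int(2)[OF pos(1) t] pos a_nonneg[of t] t by (intro add_left_mono mult_left_mono) auto
    also have "\<dots> = (1 + c / K) * (a t * \<kappa>^n * exp (K * g t))" by (simp add: algebra_simps)
    also have "\<dots> \<le> (c * \<kappa>) * (a t * \<kappa>^n * exp (K * g t))"
    proof (rule mult_right_mono)
      have "c / K \<le> 1" using L by (simp add: power2_eq_square field_simps)
      moreover have "c * \<kappa> = 2" using L by simp
      ultimately show "1 + c / K \<le> c * \<kappa>" by simp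
    qed (use pos a_nonneg[of t] t in auto)
    finally show ?thesis by (simp add: algebra_simps)
  qed
  have "continuous_on {0..1} (xs (Suc n))" "continuous_on {0..1} (ys (Suc n))"
    using indefinite_integral_continuous_1[OF int(1)] indefinite_integral_continuous_1[OF int(2)]
    by (auto intro!: continuous_on_minus)
  then show ?case using x_bd y_bd by blast
qed

lemma iter_cont: "continuous_on {0..1} (xs n)" "continuous_on {0..1} (ys n)"
  using iter_bound_aux[OF order_refl refl refl refl, of n] by auto

lemma iter_boundE:
  assumes "1 \<le> L"
  obtains C where "C > 0" "\<And>n t. t \<in> {0..1} \<Longrightarrow> \<bar>xs n t\<bar> \<le> C * (1 / (2 * L))^n"
    "\<And>n t. t \<in> {0..1} \<Longrightarrow> \<bar>ys n t\<bar> \<le> C * a t * (1 / (2 * L))^n"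
proof -
  define C where "C = 4 * L * exp (8 * L\<^sup>2 * g 1)"
  have e: "exp (8 * L\<^sup>2 * g t) \<le> exp (8 * L\<^sup>2 * g 1)" if "t \<in> {0..1}" for t using g_mono[of t 1] that assms by simp
  have "\<bar>xs n t\<bar> \<le> C * (1 / (2 * L))^n" "\<bar>ys n t\<bar> \<le> C * a t * (1 / (2 * L))^n" if t: "t \<in> {0..1}" for n t
  proof -
    have *: "\<bar>xs n t\<bar> \<le> (1 / (2 * L))^n * exp (8 * L\<^sup>2 * g t)"
      "\<bar>ys n t\<bar> \<le> 4 * L * a t * (1 / (2 * L))^n * exp (8 * L\<^sup>2 * g t)"
      using iter_bound_aux[OF assms refl refl refl, of n] t by auto
    have "(1 / (2 * L))^n * exp (8 * L\<^sup>2 * g t) \<le> (1 / (2 * L))^n * (4 * L * exp (8 * L\<^sup>2 * g 1))"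
      using assms e[OF t] mult_mono[of 1 "4 * L" "exp (8 * L\<^sup>2 * g t)" "exp (8 * L\<^sup>2 * g 1)"]
      by (intro mult_left_mono) auto
    then show "\<bar>xs n t\<bar> \<le> C * (1 / (2 * L))^n" using *(1) by (simp add: C_def mult_ac)
    have "4 * L * a t * (1 / (2 * L))^n * exp (8 * L\<^sup>2 * g t) \<le> 4 * L * a t * (1 / (2 * L))^n * exp (8 * L\<^sup>2 * g 1)"
      using assms e[OF t] a_nonneg[of t] t by (intro mult_left_mono) auto
    then show "\<bar>ys n t\<bar> \<le> C * a t * (1 / (2 * L))^n" using *(2) by (simp add: C_def mult_ac)
  qed
  moreover have "C > 0" using assms by (simp add: C_def)
  ultimately show ?thesis using that by blast
qed

end

lemma geometric_half_bounds:
  fixes f :: "nat \<Rightarrow> real"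
  assumes f: "\<And>n. \<bar>f n\<bar> \<le> C * (1/2)^n"
  shows "summable f" "\<bar>suminf f\<bar> \<le> 2 * C" "\<bar>sum f {..<N}\<bar> \<le> 2 * C"
proof -
  have g: "(\<lambda>n. C * (1/2::real)^n) sums (2 * C)" using sums_mult[OF power_half_series, of "2*C"]
    by simp
  then have gs: "summable (\<lambda>n. C * (1/2::real)^n)" "(\<Sum>n. C * (1/2::real)^n) = 2 * C"
    by (auto simp: sums_iff)
  have sa: "summable (\<lambda>n. \<bar>f n\<bar>)" by (rule summable_comparison_test'[OF gs(1)]) (use f in auto)
  then show "summable f" by (rule summable_rabs_cancel)
  have "\<bar>suminf f\<bar> \<le> (\<Sum>n. \<bar>f n\<bar>)" by (rule summable_rabs[OF sa])
  also have s2: "\<dots> \<le> 2 * C" unfolding gs(2)[symmetric] by (rule suminf_le[OF f sa gs(1)])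
  finally show "\<bar>suminf f\<bar> \<le> 2 * C" .
  have "\<bar>sum f {..<N}\<bar> \<le> (\<Sum>n<N. \<bar>f n\<bar>)" by (rule sum_abs)
  also have "\<dots> \<le> (\<Sum>n. \<bar>f n\<bar>)" by (rule sum_le_suminf[OF sa]) auto
  finally show "\<bar>sum f {..<N}\<bar> \<le> 2 * C" using s2 by linarith
qed

lemma primitive_on_const: "primitive_on a b (\<lambda>_. c) (\<lambda>_. 0)"
  by (auto simp: primitive_on_def image_constant_conv)

section \<open>The sum of the series: fundamental solution, uniqueness and Wronskian\<close>

context dirac_entries
begin

definition solX :: "real \<Rightarrow> real \<Rightarrow> real" where "solX l t = (\<Sum>n. xs n t * l ^ n)"
definition solY :: "real \<Rightarrow> real \<Rightarrow> real" where "solY l t = (\<Sum>n. ys n t * l ^ n)"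

lemma iter_admissible: obtains C where "C > 0" "\<And>n. admissible C (xs n) (ys n)"
proof -
  obtain C where C: "C > 0" "\<And>n t. t \<in> {0..1} \<Longrightarrow> \<bar>xs n t\<bar> \<le> C * (1 / (2 * 1))^n"
    "\<And>n t. t \<in> {0..1} \<Longrightarrow> \<bar>ys n t\<bar> \<le> C * a t * (1 / (2 * 1))^n"
    using iter_boundE[of 1] by auto
  have le1: "(1 / (2 * 1))^n \<le> (1::real)" for n :: nat by (rule power_le_one) auto
  have "admissible C (xs n) (ys n)" for n unfolding admissible_def
  proof (intro conjI ballI iter_cont)
    fix t :: real assume t: "t \<in> {0..1}"
    have "C * (1 / (2 * 1))^n \<le> C * 1" using C(1) by (intro mult_left_mono le1) auto
    then show "\<bar>xs n t\<bar> \<le> C" using C(2)[OF t, of n] by linarith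
    have "C * a t * (1 / (2 * 1))^n \<le> C * a t * 1" using C(1) a_nonneg[of t] t by (intro mult_left_mono le1) auto
    then show "\<bar>ys n t\<bar> \<le> C * a t" using C(3)[OF t, of n] by linarith
  qed
  with C(1) that show ?thesis by blast
qed

lemma series_bounds:
  assumes "1 \<le> L"
  obtains C where "C > 0"
    "\<And>l n t. \<bar>l\<bar> \<le> L \<Longrightarrow> t \<in> {0..1} \<Longrightarrow> \<bar>xs n t * l ^ n\<bar> \<le> C * (1/2)^n"
    "\<And>l n t. \<bar>l\<bar> \<le> L \<Longrightarrow> t \<in> {0..1} \<Longrightarrow> \<bar>ys n t * l ^ n\<bar> \<le> C * a t * (1/2)^n"
proof -
  obtain C where C: "C > 0" "\<And>n t. t \<in> {0..1} \<Longrightarrow> \<bar>xs n t\<bar> \<le> C * (1 / (2 * L))^n"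
    "\<And>n t. t \<in> {0..1} \<Longrightarrow> \<bar>ys n t\<bar> \<le> C * a t * (1 / (2 * L))^n"
    using iter_boundE[OF assms] by metis
  have eq: "(1 / (2 * L))^n * L ^ n = (1/2)^n" for n
    using assms by (simp flip: power_mult_distrib)
  have ll: "\<bar>l ^ n\<bar> \<le> L ^ n" if "\<bar>l\<bar> \<le> L" for l n using power_mono[OF that, of n] by (simp add: power_abs)
  show ?thesis
  proof (rule that[OF C(1)])
    fix l t :: real and n assume l: "\<bar>l\<bar> \<le> L" and t: "t \<in> {0..1}"
    have "\<bar>xs n t * l ^ n\<bar> \<le> (C * (1 / (2 * L))^n) * L ^ n" unfolding abs_mult
      using C(1) C(2)[OF t] ll[OF l] assms by (intro mult_mono) auto
    then show "\<bar>xs n t * l ^ n\<bar> \<le> C * (1/2)^n" using eq[of n] by (simp add: mult.assoc)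
    have "\<bar>ys n t * l ^ n\<bar> \<le> (C * a t * (1 / (2 * L))^n) * L ^ n" unfolding abs_mult
      using C(1) C(3)[OF t] ll[OF l] assms a_nonneg[of t] t by (intro mult_mono) auto
    then show "\<bar>ys n t * l ^ n\<bar> \<le> C * a t * (1/2)^n" using eq[of n] by (simp add: mult.assoc)
  qed
qed

lemma series_summable:
  assumes "t \<in> {0..1}"
  shows "summable (\<lambda>n. xs n t * l ^ n)" "summable (\<lambda>n. ys n t * l ^ n)"
proof -
  have L: "1 \<le> max 1 \<bar>l\<bar>" "\<bar>l\<bar> \<le> max 1 \<bar>l\<bar>" by auto
  obtain C where C:
    "\<And>n t. t \<in> {0..1} \<Longrightarrow> \<bar>xs n t * l ^ n\<bar> \<le> C * (1/2)^n"
    "\<And>n t. t \<in> {0..1} \<Longrightarrow> \<bar>ys n t * l ^ n\<bar> \<le> C * a t * (1/2)^n"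
    using series_bounds[OF L(1)] L(2) by metis
  show "summable (\<lambda>n. xs n t * l ^ n)" "summable (\<lambda>n. ys n t * l ^ n)"
    using geometric_half_bounds(1)[OF C(1)[OF assms]] geometric_half_bounds(1)[OF C(2)[OF assms]] by blast+
qed

text \<open>Partial sums satisfy the integral equations up to an index shift, and their bounds,
  uniform in the number of terms, give the majorants for passing to the limit.\<close>

lemma sol_eq:
  assumes t: "t \<in> {0..1}"
  shows "solX l t = 1 + l * integral {0..t} (\<lambda>s. b s * solX l s + r s * solY l s)"
    and "solY l t = - l * integral {0..t} (\<lambda>s. p s * solX l s + b s * solY l s)"
proof -
  have L: "1 \<le> max 1 \<bar>l\<bar>" "\<bar>l\<bar> \<le> max 1 \<bar>l\<bar>" by auto
  obtain C where C: "C > 0"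
    "\<And>n t. t \<in> {0..1} \<Longrightarrow> \<bar>xs n t * l ^ n\<bar> \<le> C * (1/2)^n"
    "\<And>n t. t \<in> {0..1} \<Longrightarrow> \<bar>ys n t * l ^ n\<bar> \<le> C * a t * (1/2)^n"
    using series_bounds[OF L(1)] L(2) by metis
  obtain C' where adm: "\<And>n. admissible C' (xs n) (ys n)" using iter_admissible by metis
  define P where "P N s = (\<Sum>n<N. xs n s * l ^ n)" for N s
  define Q where "Q N s = (\<Sum>n<N. ys n s * l ^ n)" for N s
  have PQ: "\<bar>P N s\<bar> \<le> 2 * C" "\<bar>Q N s\<bar> \<le> (2 * C) * a s" if "s \<in> {0..t}" for N s
  proof -
    have s1: "s \<in> {0..1}" using that t by auto
    show "\<bar>P N s\<bar> \<le> 2 * C" unfolding P_def by (rule geometric_half_bounds(3)[OF C(2)[OF s1]])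
    show "\<bar>Q N s\<bar> \<le> (2 * C) * a s" unfolding Q_def
      using geometric_half_bounds(3)[OF C(3)[OF s1]] by (simp add: mult.assoc)
  qed
  have PQl: "(\<lambda>N. P N s) \<longlonglongrightarrow> solX l s" "(\<lambda>N. Q N s) \<longlonglongrightarrow> solY l s" if "s \<in> {0..t}" for s
    unfolding P_def Q_def solX_def solY_def
    by (rule summable_LIMSEQ, rule series_summable, use that t in auto)+
  have t': "0 \<le> (0::real)" "t \<le> 1" using t by auto
  note int1 = integrable_sub[OF admissible_int'(1)[OF adm]]
  note int2 = integrable_sub[OF admissible_int'(2)[OF adm]]
  have row1: "b s * P N s + r s * Q N s = (\<Sum>n<N. l ^ n * (b s * xs n s + r s * ys n s))" for N s
    unfolding P_def Q_def sum_distrib_left sum.distrib[symmetric] by (rule sum.cong) (auto simp: algebra_simps)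
  have row2: "p s * P N s + b s * Q N s = (\<Sum>n<N. l ^ n * (p s * xs n s + b s * ys n s))" for N s
    unfolding P_def Q_def sum_distrib_left sum.distrib[symmetric] by (rule sum.cong) (auto simp: algebra_simps)
  have I1: "(\<lambda>s. b s * P N s + r s * Q N s) integrable_on {0..t}"
    "integral {0..t} (\<lambda>s. b s * P N s + r s * Q N s) = (\<Sum>n<N. l ^ n * xs (Suc n) t)" for N
    unfolding row1
    by (auto intro!: integrable_sum integrable_on_mult_right int1 t'
        simp: Henstock_Kurzweil_Integration.integral_sum[OF _ integrable_on_mult_right[OF int1[OF t']]] sum_negf)
  have I2: "(\<lambda>s. p s * P N s + b s * Q N s) integrable_on {0..t}"
    "integral {0..t} (\<lambda>s. p s * P N s + b s * Q N s) = - (\<Sum>n<N. l ^ n * ys (Suc n) t)" for N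
    unfolding row2
    by (auto intro!: integrable_sum integrable_on_mult_right int2 t'
        simp: Henstock_Kurzweil_Integration.integral_sum[OF _ integrable_on_mult_right[OF int2[OF t']]] sum_negf)
  have "(\<lambda>N. integral {0..t} (\<lambda>s. b s * P N s + r s * Q N s)) \<longlonglongrightarrow> integral {0..t} (\<lambda>s. b s * solX l s + r s * solY l s)"
  proof (rule dominated_convergence(2)[where h="\<lambda>s. (2 * C) * g' s"])
    show "(\<lambda>s. (2 * C) * g' s) integrable_on {0..t}"
      using t by (intro integrable_on_mult_right integrable_sub[OF g'_int]) auto
  qed (use I1 row_bounds(1)[OF PQ] PQl in \<open>auto intro!: tendsto_intros\<close>)
  then have "(\<lambda>N. 1 + l * (\<Sum>n<N. l ^ n * xs (Suc n) t)) \<longlonglongrightarrow> 1 + l * integral {0..t} (\<lambda>s. b s * solX l s + r s * solY l s)"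
    unfolding I1 by (intro tendsto_intros)
  \<comment> \<open>Integrating N terms yields the partial sum with N + 1 terms; the added 1 is the
    term of index 0.\<close>
  moreover have "1 + l * (\<Sum>n<N. l ^ n * xs (Suc n) t) = P (Suc N) t" for N
    unfolding P_def sum.lessThan_Suc_shift by (simp add: sum_distrib_left mult_ac)
  moreover have "(\<lambda>N. P (Suc N) t) \<longlonglongrightarrow> solX l t" using PQl(1)[of t] t by (intro LIMSEQ_Suc) auto
  ultimately show "solX l t = 1 + l * integral {0..t} (\<lambda>s. b s * solX l s + r s * solY l s)"
    using LIMSEQ_unique by simp
  have "(\<lambda>N. integral {0..t} (\<lambda>s. p s * P N s + b s * Q N s)) \<longlonglongrightarrow> integral {0..t} (\<lambda>s. p s * solX l s + b s * solY l s)"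
  proof (rule dominated_convergence(2)[where h="\<lambda>s. (2 * C) * (p s + a 1 * \<bar>b s\<bar>)"])
    show "(\<lambda>s. (2 * C) * (p s + a 1 * \<bar>b s\<bar>)) integrable_on {0..t}"
      by (rule integrable_sub) (use t in \<open>auto intro!: integrable_on_mult_right integrable_add p_int b_int\<close>)
    fix N s assume s: "s \<in> {0..t}"
    have "\<bar>b s\<bar> * a s \<le> \<bar>b s\<bar> * a 1" using a_mono[of s 1] s t by (intro mult_left_mono) auto
    then have "(2 * C) * (p s + \<bar>b s\<bar> * a s) \<le> (2 * C) * (p s + a 1 * \<bar>b s\<bar>)" using C(1) by (simp add: mult.commute)
    then show "norm (p s * P N s + b s * Q N s) \<le> (2 * C) * (p s + a 1 * \<bar>b s\<bar>)"
      using row_bounds(2)[OF PQ[OF s, of N]] by simp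
  qed (use I2 PQl in \<open>auto intro!: tendsto_intros\<close>)
  then have "(\<lambda>N. - l * (- (\<Sum>n<N. l ^ n * ys (Suc n) t))) \<longlonglongrightarrow> - l * integral {0..t} (\<lambda>s. p s * solX l s + b s * solY l s)"
    unfolding I2 by (rule tendsto_mult_left)
  moreover have "- l * (- (\<Sum>n<N. l ^ n * ys (Suc n) t)) = Q (Suc N) t" for N
    unfolding Q_def sum.lessThan_Suc_shift by (simp add: sum_distrib_left sum_negf mult_ac)
  moreover have "(\<lambda>N. Q (Suc N) t) \<longlonglongrightarrow> solY l t" using PQl(2)[of t] t by (intro LIMSEQ_Suc) auto
  ultimately show "solY l t = - l * integral {0..t} (\<lambda>s. p s * solX l s + b s * solY l s)"
    using LIMSEQ_unique by simp
qed

lemma sol_cont: "continuous_on {0..1} (solX l)" "continuous_on {0..1} (solY l)"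
proof -
  have L: "1 \<le> max 1 \<bar>l\<bar>" "\<bar>l\<bar> \<le> max 1 \<bar>l\<bar>" by auto
  obtain C where C: "C > 0"
    "\<And>n t. t \<in> {0..1} \<Longrightarrow> \<bar>xs n t * l ^ n\<bar> \<le> C * (1/2)^n"
    "\<And>n t. t \<in> {0..1} \<Longrightarrow> \<bar>ys n t * l ^ n\<bar> \<le> C * a t * (1/2)^n"
    using series_bounds[OF L(1)] L(2) by metis
  have sm: "summable (\<lambda>n. K * (1/2::real)^n)" for K by (intro summable_mult summable_geometric) auto
  have "uniform_limit {0..1} (\<lambda>N t. \<Sum>n<N. xs n t * l ^ n) (solX l) sequentially"
    unfolding solX_def[abs_def] by (rule Weierstrass_m_test[OF _ sm[of C]]) (use C in auto)
  then show "continuous_on {0..1} (solX l)"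
    by (rule uniform_limit_theorem[rotated]) (auto intro!: always_eventually continuous_intros iter_cont)
  have "uniform_limit {0..1} (\<lambda>N t. \<Sum>n<N. ys n t * l ^ n) (solY l) sequentially"
    unfolding solY_def[abs_def]
  proof (rule Weierstrass_m_test[OF _ sm[of "C * a 1"]])
    fix n t assume t: "t \<in> {0..1::real}"
    have "C * a t * (1/2)^n \<le> C * a 1 * (1/2)^n" using a_mono[of t 1] C(1) t by simp
    then show "norm (ys n t * l ^ n) \<le> C * a 1 * (1/2)^n" using C(3)[OF t, of n] by simp
  qed
  then show "continuous_on {0..1} (solY l)"
    by (rule uniform_limit_theorem[rotated]) (auto intro!: always_eventually continuous_intros iter_cont)
qed

lemma sol_admissible:
  assumes "1 \<le> L"
  obtains C where "C > 0" "\<And>l. \<bar>l\<bar> \<le> L \<Longrightarrow> admissible C (solX l) (solY l)"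
proof -
  obtain C where C: "C > 0"
    "\<And>l n t. \<bar>l\<bar> \<le> L \<Longrightarrow> t \<in> {0..1} \<Longrightarrow> \<bar>xs n t * l ^ n\<bar> \<le> C * (1/2)^n"
    "\<And>l n t. \<bar>l\<bar> \<le> L \<Longrightarrow> t \<in> {0..1} \<Longrightarrow> \<bar>ys n t * l ^ n\<bar> \<le> C * a t * (1/2)^n"
    using series_bounds[OF assms] by metis
  have "admissible (2 * C) (solX l) (solY l)" if l: "\<bar>l\<bar> \<le> L" for l
    unfolding admissible_def
  proof (intro conjI ballI sol_cont)
    fix t :: real assume t: "t \<in> {0..1}"
    show "\<bar>solX l t\<bar> \<le> 2 * C" unfolding solX_def by (rule geometric_half_bounds(2)[OF C(2)[OF l t]])
    show "\<bar>solY l t\<bar> \<le> 2 * C * a t" unfolding solY_def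
      using geometric_half_bounds(2)[OF C(3)[OF l t]] by (simp add: mult.assoc)
  qed
  with C(1) that[of "2 * C"] show ?thesis by simp
qed

lemma sol_admissible1: obtains C where "C > 0" "admissible C (solX l) (solY l)"
proof -
  have L: "1 \<le> max 1 \<bar>l\<bar>" "\<bar>l\<bar> \<le> max 1 \<bar>l\<bar>" by auto
  from sol_admissible[OF L(1)] L(2) that show ?thesis by metis
qed

text \<open>The equation is posed on every [\<eta>,1] with \<eta> > 0, where R is bounded. This
  covers eigenfunctions on (0,1]; the behaviour at 0 is imposed separately as a limit.\<close>

definition solution :: "real \<Rightarrow> (real \<Rightarrow> real) \<Rightarrow> (real \<Rightarrow> real) \<Rightarrow> bool" where
  "solution l x y \<longleftrightarrow> (\<forall>\<eta>\<in>{0<..1}.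
     primitive_on \<eta> 1 x (\<lambda>t. l * (b t * x t + r t * y t)) \<and>
     primitive_on \<eta> 1 y (\<lambda>t. - l * (p t * x t + b t * y t)))"

lemma bounded_rows:
  assumes bd: "\<exists>K. \<forall>t\<in>{\<eta>..1}. \<bar>p t\<bar> \<le> K \<and> \<bar>b t\<bar> \<le> K \<and> \<bar>r t\<bar> \<le> K" and x: "bounded (x ` {\<eta>..1})" and y: "bounded (y ` {\<eta>..1})"
  shows "bounded ((\<lambda>t. b t * x t + r t * y t) ` {\<eta>..1})" "bounded ((\<lambda>t. p t * x t + b t * y t) ` {\<eta>..1})"
proof -
  obtain K' where "\<forall>t\<in>{\<eta>..1}. \<bar>p t\<bar> \<le> K' \<and> \<bar>b t\<bar> \<le> K' \<and> \<bar>r t\<bar> \<le> K'" using bd by blast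
  then obtain K where K: "K > 0" "\<And>t. t \<in> {\<eta>..1} \<Longrightarrow> \<bar>p t\<bar> \<le> K" "\<And>t. t \<in> {\<eta>..1} \<Longrightarrow> \<bar>b t\<bar> \<le> K" "\<And>t. t \<in> {\<eta>..1} \<Longrightarrow> \<bar>r t\<bar> \<le> K"
    using that[of "\<bar>K'\<bar> + 1"] by fastforce
  obtain X where X: "\<And>t. t \<in> {\<eta>..1} \<Longrightarrow> \<bar>x t\<bar> \<le> X" using bounded_realE[OF x] by metis
  obtain Y where Y: "\<And>t. t \<in> {\<eta>..1} \<Longrightarrow> \<bar>y t\<bar> \<le> Y" using bounded_realE[OF y] by metis
  have *: "\<bar>u * x t + v * y t\<bar> \<le> K * X + K * Y" if "t \<in> {\<eta>..1}" "\<bar>u\<bar> \<le> K" "\<bar>v\<bar> \<le> K" for u v t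
  proof -
    have "\<bar>u * x t + v * y t\<bar> \<le> \<bar>u\<bar> * \<bar>x t\<bar> + \<bar>v\<bar> * \<bar>y t\<bar>" by (metis abs_mult abs_triangle_ineq)
    also have "\<dots> \<le> K * X + K * Y" using that X[OF that(1)] Y[OF that(1)] K(1) by (intro add_mono mult_mono) auto
    finally show ?thesis .
  qed
  show "bounded ((\<lambda>t. b t * x t + r t * y t) ` {\<eta>..1})" "bounded ((\<lambda>t. p t * x t + b t * y t) ` {\<eta>..1})"
    unfolding bounded_iff using * K by (intro exI[of _ "K * X + K * Y"]; auto)+
qed

lemma cont_bounded: "continuous_on {0..1} (f::real\<Rightarrow>real) \<Longrightarrow> 0 \<le> \<eta> \<Longrightarrow> bounded (f ` {\<eta>..1})"
  by (rule compact_imp_bounded[OF compact_continuous_image[OF continuous_on_subset[of "{0..1}" f]]]) auto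

text \<open>The bound on the entries is a hypothesis in place of \<eta> > 0, so that \<eta> = 0 is
  available for I = [0,1], where absolute continuity up to 0 belongs to the domain of the
  operator.\<close>

lemma sol_primitive:
  assumes \<eta>: "0 \<le> \<eta>" and bd: "\<exists>K. \<forall>t\<in>{\<eta>..1}. \<bar>p t\<bar> \<le> K \<and> \<bar>b t\<bar> \<le> K \<and> \<bar>r t\<bar> \<le> K"
  shows "primitive_on \<eta> 1 (solX l) (\<lambda>t. l * (b t * solX l t + r t * solY l t))"
    and "primitive_on \<eta> 1 (solY l) (\<lambda>t. - l * (p t * solX l t + b t * solY l t))"
proof -
  obtain C where C: "admissible C (solX l) (solY l)" using sol_admissible1 by metis
  note int = admissible_int'[OF C]
  have bX: "bounded (solX l ` {\<eta>..1})" "bounded (solY l ` {\<eta>..1})" using sol_cont cont_bounded \<eta> by auto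
  have "primitive_on \<eta> 1 (\<lambda>t. 1 + l * integral {0..t} (\<lambda>s. b s * solX l s + r s * solY l s))
      (\<lambda>t. 0 + l * (b t * solX l t + r t * solY l t))"
    by (intro primitive_on_add primitive_on_const primitive_on_cmult primitive_on_of_integrable int(1) bounded_rows bd bX)
      (use \<eta> in auto)
  then show "primitive_on \<eta> 1 (solX l) (\<lambda>t. l * (b t * solX l t + r t * solY l t))"
    by (rule primitive_on_cong) (use sol_eq(1)[symmetric] \<eta> in auto)
  have "primitive_on \<eta> 1 (\<lambda>t. - l * integral {0..t} (\<lambda>s. p s * solX l s + b s * solY l s))
      (\<lambda>t. - l * (p t * solX l t + b t * solY l t))"
    by (intro primitive_on_cmult primitive_on_of_integrable int(2) bounded_rows bd bX) (use \<eta> in auto)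
  then show "primitive_on \<eta> 1 (solY l) (\<lambda>t. - l * (p t * solX l t + b t * solY l t))"
    by (rule primitive_on_cong) (use sol_eq(2)[symmetric] \<eta> in auto)
qed

lemma sol_solution: "solution l (solX l) (solY l)"
  unfolding solution_def by (intro ballI conjI sol_primitive bdd) auto

lemma sol_0: "solX l 0 = 1" "solY l 0 = 0"
  using sol_eq[of 0 l] by auto

lemma tendsto_at_right_0:
  assumes "continuous_on {0..1} (f::real\<Rightarrow>real)" shows "(f \<longlongrightarrow> f 0) (at_right 0)"
proof -
  have "(f \<longlongrightarrow> f 0) (at 0 within {0..1})" using assms unfolding continuous_on by (rule bspec) simp
  then show ?thesis by (simp add: at_within_Icc_at_right)
qed

lemma sol_lim: "(solX l \<longlongrightarrow> 1) (at_right 0)" "(solY l \<longlongrightarrow> 0) (at_right 0)"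
  using tendsto_at_right_0[OF sol_cont(1)] tendsto_at_right_0[OF sol_cont(2)] by (simp_all add: sol_0)

text \<open>Lagrange's identity: the Wronskian of solutions for l and k has as derivative l - k
  times the bilinear form of R. For l = k it is constant.\<close>

lemma solution_cross:
  assumes "solution l x y" "solution k u v" "\<eta> \<in> {0<..1}"
  shows "primitive_on \<eta> 1 (\<lambda>t. x t * v t - y t * u t)
    (\<lambda>t. (l - k) * (p t * x t * u t + b t * (x t * v t + y t * u t) + r t * y t * v t))"
proof -
  have "primitive_on \<eta> 1 x (\<lambda>t. l * (b t * x t + r t * y t))" "primitive_on \<eta> 1 y (\<lambda>t. - l * (p t * x t + b t * y t))"
    "primitive_on \<eta> 1 u (\<lambda>t. k * (b t * u t + r t * v t))" "primitive_on \<eta> 1 v (\<lambda>t. - k * (p t * u t + b t * v t))"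
    using assms by (auto simp: solution_def)
  from primitive_on_diff[OF primitive_on_mult[OF this(1,4)] primitive_on_mult[OF this(2,3)]]
  show ?thesis by (rule primitive_on_cong) (auto simp: algebra_simps)
qed

lemma solution_lincomb:
  assumes "solution l x y" "solution l u v"
  shows "solution l (\<lambda>t. x t - c * u t) (\<lambda>t. y t - c * v t)"
  unfolding solution_def
proof (intro ballI conjI)
  fix \<eta> :: real assume \<eta>: "\<eta> \<in> {0<..1}"
  have *: "primitive_on \<eta> 1 x (\<lambda>t. l * (b t * x t + r t * y t))" "primitive_on \<eta> 1 y (\<lambda>t. - l * (p t * x t + b t * y t))"
    "primitive_on \<eta> 1 u (\<lambda>t. l * (b t * u t + r t * v t))" "primitive_on \<eta> 1 v (\<lambda>t. - l * (p t * u t + b t * v t))"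
    using assms \<eta> by (auto simp: solution_def)
  show "primitive_on \<eta> 1 (\<lambda>t. x t - c * u t) (\<lambda>t. l * (b t * (x t - c * u t) + r t * (y t - c * v t)))"
    by (rule primitive_on_cong[OF primitive_on_diff[OF *(1) primitive_on_cmult[OF *(3), of c]]]) (auto simp: algebra_simps)
  show "primitive_on \<eta> 1 (\<lambda>t. y t - c * v t) (\<lambda>t. - l * (p t * (x t - c * u t) + b t * (y t - c * v t)))"
    by (rule primitive_on_cong[OF primitive_on_diff[OF *(2) primitive_on_cmult[OF *(4), of c]]]) (auto simp: algebra_simps)
qed

text \<open>A backward Gronwall argument: E = x^2 + y^2 satisfies |E'| \<le> c E almost everywhere,
  so exp(c t) E(t) increases and a zero at t forces zeros before it.\<close>

lemma solution_zero_backward: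
  assumes sol: "solution l x y" and t: "t \<in> {0<..1}" "x t = 0" "y t = 0" and s: "0 < s" "s \<le> t"
  shows "x s = 0 \<and> y s = 0"
proof -
  have s1: "s \<in> {0<..1}" using s t by auto
  obtain K where K: "K > 0" "\<And>t. t \<in> {s..1} \<Longrightarrow> \<bar>p t\<bar> \<le> K" "\<And>t. t \<in> {s..1} \<Longrightarrow> \<bar>b t\<bar> \<le> K" "\<And>t. t \<in> {s..1} \<Longrightarrow> \<bar>r t\<bar> \<le> K"
    using bddE[OF s1] by metis
  \<comment> \<open>Bounding the entries by K and 2 |x y| by x^2 + y^2 gives |E'| \<le> 2 |l| K (x^2
    + 2 |x y| + y^2) \<le> 4 |l| K E.\<close>
  define c where "c = 4 * \<bar>l\<bar> * K"
  have *: "primitive_on s 1 x (\<lambda>t. l * (b t * x t + r t * y t))" "primitive_on s 1 y (\<lambda>t. - l * (p t * x t + b t * y t))"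
    using sol s1 by (auto simp: solution_def)
  let ?E = "\<lambda>t. x t * x t + y t * y t"
  let ?E' = "\<lambda>t. 2 * l * (x t * (b t * x t + r t * y t) - y t * (p t * x t + b t * y t))"
  have "primitive_on s 1 ?E (\<lambda>t. (x t * (l * (b t * x t + r t * y t)) + l * (b t * x t + r t * y t) * x t)
     + (y t * (- l * (p t * x t + b t * y t)) + - l * (p t * x t + b t * y t) * y t))"
    by (intro primitive_on_add primitive_on_mult *)
  then have E: "primitive_on s 1 ?E ?E'" by (rule primitive_on_cong) (auto simp: algebra_simps)
  have ex: "primitive_on s 1 (\<lambda>t. exp (c * t)) (\<lambda>t. c * 1 * exp (c * t))"
    by (intro primitive_on_exp primitive_on_cmult primitive_on_ident)
  have "exp (c * s) * ?E s \<le> exp (c * t) * ?E t"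
  proof (rule primitive_on_mono[OF primitive_on_mult[OF ex E]])
    fix \<tau> assume \<tau>: "\<tau> \<in> {s..1}"
    have xy: "\<bar>x \<tau>\<bar> * \<bar>y \<tau>\<bar> * 2 \<le> x \<tau> * x \<tau> + y \<tau> * y \<tau>"
      using zero_le_power2[of "\<bar>x \<tau>\<bar> - \<bar>y \<tau>\<bar>"] by (simp add: power2_eq_square algebra_simps abs_mult_self_eq)
    have "\<bar>x \<tau> * (b \<tau> * x \<tau> + r \<tau> * y \<tau>) - y \<tau> * (p \<tau> * x \<tau> + b \<tau> * y \<tau>)\<bar>
       \<le> \<bar>b \<tau> * (x \<tau> * x \<tau>)\<bar> + \<bar>r \<tau> * (x \<tau> * y \<tau>)\<bar> + \<bar>p \<tau> * (x \<tau> * y \<tau>)\<bar> + \<bar>b \<tau> * (y \<tau> * y \<tau>)\<bar>"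
      by (simp add: algebra_simps)
    also have "\<dots> \<le> K * (x \<tau> * x \<tau>) + K * (\<bar>x \<tau>\<bar> * \<bar>y \<tau>\<bar>) + K * (\<bar>x \<tau>\<bar> * \<bar>y \<tau>\<bar>) + K * (y \<tau> * y \<tau>)"
    proof -
      have m: "\<bar>u * v\<bar> \<le> K * \<bar>v\<bar>" if "\<bar>u\<bar> \<le> K" for u v by (simp add: abs_mult mult_right_mono that)
      show ?thesis
        using m[OF K(3)[OF \<tau>], of "x \<tau> * x \<tau>"] m[OF K(4)[OF \<tau>], of "x \<tau> * y \<tau>"]
          m[OF K(2)[OF \<tau>], of "x \<tau> * y \<tau>"] m[OF K(3)[OF \<tau>], of "y \<tau> * y \<tau>"]
        by (simp add: abs_mult)
    qed
    also have "\<dots> = K * (x \<tau> * x \<tau> + \<bar>x \<tau>\<bar> * \<bar>y \<tau>\<bar> * 2 + y \<tau> * y \<tau>)" by (simp add: algebra_simps)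
    also have "\<dots> \<le> K * (2 * ?E \<tau>)" using xy K(1) by (intro mult_left_mono) auto
    finally have "\<bar>?E' \<tau>\<bar> \<le> 2 * \<bar>l\<bar> * (K * (2 * ?E \<tau>))" by (simp add: abs_mult mult_left_mono)
    moreover have "2 * \<bar>l\<bar> * (K * (2 * ?E \<tau>)) = c * ?E \<tau>" by (simp add: c_def)
    ultimately have "- ?E' \<tau> \<le> c * ?E \<tau>" using abs_ge_minus_self[of "?E' \<tau>"] by linarith
    then have "0 \<le> exp (c * \<tau>) * (?E' \<tau> + c * ?E \<tau>)" by (intro mult_nonneg_nonneg) auto
    then show "0 \<le> exp (c * \<tau>) * ?E' \<tau> + c * 1 * exp (c * \<tau>) * ?E \<tau>" by (simp add: algebra_simps)
  qed (use s t in auto)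
  then have "?E s \<le> 0" using t by (simp add: mult_le_0_iff)
  then show ?thesis by (simp add: sum_squares_le_zero_iff)
qed

text \<open>A zero would propagate back towards 0, where \<open>solX\<close> tends to 1.\<close>

lemma sol_nonzero:
  assumes "t \<in> {0<..1}"
  shows "solX l t \<noteq> 0 \<or> solY l t \<noteq> 0"
proof (rule ccontr)
  assume "\<not> ?thesis"
  then have z: "solX l s = 0" if "0 < s" "s \<le> t" for s
    using solution_zero_backward[OF sol_solution assms _ _ that] by auto
  have "\<forall>\<^sub>F s in at_right 0. s \<in> {0<..<t}" using assms by (intro eventually_at_right_real) auto
  then have "\<forall>\<^sub>F s in at_right 0. solX l s = 0" by eventually_elim (use z in auto)
  then have "(solX l \<longlongrightarrow> 0) (at_right 0)" by (rule tendsto_eventually)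
  with sol_lim(1) have "(1::real) = 0" using tendsto_unique trivial_limit_at_right_real by blast
  then show False by simp
qed

text \<open>The Wronskian w with the fundamental solution is constant, and w = 0 has to be shown
  although x may be unbounded near 0. Differentiating the product of \<open>solY\<close> and y and
  eliminating x through x solY = w + y solX leaves -l w p and terms bounded by sup |y| times p + a
  |b|. Integration from 0 to t gives |l w| a(t) \<le> const sup |y| a(t); here a(t) > 0 cancels and
  sup |y| tends to 0 with t.\<close>

lemma solution_unique:
  assumes sol: "solution l x y" and lim: "(y \<longlongrightarrow> 0) (at_right 0)"
  obtains c where "\<And>t. t \<in> {0<..1} \<Longrightarrow> x t = c * solX l t \<and> y t = c * solY l t"
proof -
  define w where "w = x 1 * solY l 1 - y 1 * solX l 1"
  have W: "x t * solY l t - y t * solX l t = w" if t: "t \<in> {0<..1}" for t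
  proof -
    have "primitive_on t 1 (\<lambda>t. x t * solY l t - y t * solX l t) (\<lambda>t. 0)"
      using solution_cross[OF sol sol_solution[of l] t] by simp
    from primitive_onD[OF this, of t 1] t
    have "((\<lambda>t. 0) has_integral w - (x t * solY l t - y t * solX l t)) {t..1}" by (simp add: w_def)
    then show ?thesis using has_integral_unique has_integral_0 by fastforce
  qed
  obtain C where C: "C > 0" "admissible C (solX l) (solY l)" using sol_admissible1 by metis
  have "w = 0"
  proof (cases "l = 0")
    \<comment> \<open>The elimination of x controls only l w. For l = 0 the fundamental solution is
      (1,0), so w = -y, which tends to 0.\<close>
    case True
    have "\<forall>\<^sub>F t in at_right 0. t \<in> {0<..<(1::real)}" by (intro eventually_at_right_real) auto
    then have "\<forall>\<^sub>F t in at_right 0. - y t = w"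
      by eventually_elim (use W sol_eq True in force)
    then have "((\<lambda>t. - y t) \<longlongrightarrow> w) (at_right 0)" by (rule tendsto_eventually)
    moreover have "((\<lambda>t. - y t) \<longlongrightarrow> - 0) (at_right 0)" by (intro tendsto_intros lim)
    ultimately show ?thesis using tendsto_unique trivial_limit_at_right_real by fastforce
  next
    case False
    define \<beta> where "\<beta> = integral {0..1} (\<lambda>t. \<bar>b t\<bar>)"
    have \<beta>: "\<beta> \<ge> 0" unfolding \<beta>_def by (rule integral_nonneg[OF b_int]) auto
    \<comment> \<open>S bounds |y| on some interval (0,t] and can be taken arbitrarily
      small.\<close>
    have key: "\<bar>l * w\<bar> \<le> S * (C + 2 * \<bar>l\<bar> * C * (1 + \<beta>))" if S: "S > 0" for S
    proof -
      have "\<forall>\<^sub>F t in at_right 0. \<bar>y t\<bar> < S"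
        using order_tendstoD(2)[OF tendsto_rabs_zero[OF lim] S] .
      then obtain d where d: "d > 0" "\<And>t. 0 < t \<Longrightarrow> t < d \<Longrightarrow> \<bar>y t\<bar> < S"
        by (auto simp: eventually_at_right_field)
      define t where "t = min 1 (d / 2)"
      have t: "t \<in> {0<..1}" "t < d" using d by (auto simp: t_def)
      have yS: "\<bar>y s\<bar> \<le> S" if "s \<in> {0<..t}" for s using d(2)[of s] that t by auto
      have aux: "\<bar>solY l t * y t - solY l \<eta> * y \<eta> + l * w * (a t - a \<eta>)\<bar> \<le> 2 * \<bar>l\<bar> * S * C * (1 + \<beta>) * a t"
        if \<eta>: "0 < \<eta>" "\<eta> < t" for \<eta>
      proof -
        have \<eta>1: "\<eta> \<in> {0<..1}" using \<eta> t by auto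
        have "primitive_on \<eta> 1 (solY l) (\<lambda>t. - l * (p t * solX l t + b t * solY l t))"
          "primitive_on \<eta> 1 y (\<lambda>t. - l * (p t * x t + b t * y t))"
          using sol sol_solution[of l] \<eta>1 by (auto simp: solution_def)
        from primitive_onD[OF primitive_on_mult[OF this], of \<eta> t]
        have 1: "((\<lambda>s. solY l s * (- l * (p s * x s + b s * y s)) + - l * (p s * solX l s + b s * solY l s) * y s)
            has_integral solY l t * y t - solY l \<eta> * y \<eta>) {\<eta>..t}" using \<eta> t by auto
        have pint: "p integrable_on {\<eta>..t}" using \<eta> t by (intro integrable_sub[OF p_int]) auto
        have "(p has_integral a t - a \<eta>) {\<eta>..t}"
          using integrable_integral[OF pint] integral_indefinite_diff[OF p_int, of \<eta> t] \<eta> t by (simp add: a_def)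
        from has_integral_add[OF 1 has_integral_mult_right[OF this, of "l * w"]]
        have 2: "((\<lambda>s. - 2 * l * y s * (p s * solX l s + b s * solY l s))
            has_integral solY l t * y t - solY l \<eta> * y \<eta> + l * w * (a t - a \<eta>)) {\<eta>..t}"
        proof (rule has_integral_eq[rotated])
          fix s assume s: "s \<in> {\<eta>..t}"
          then have "x s * solY l s = w + y s * solX l s" using W[of s] \<eta> t by auto
          then have "solY l s * x s * p s = (w + y s * solX l s) * p s" by (simp add: mult.commute)
          then show "solY l s * (- l * (p s * x s + b s * y s)) + - l * (p s * solX l s + b s * solY l s) * y s
            + l * w * p s = - 2 * l * y s * (p s * solX l s + b s * solY l s)"
            by (simp add: algebra_simps)
        qed
        have bint: "(\<lambda>t. \<bar>b t\<bar>) integrable_on {\<eta>..t}" using \<eta> t by (intro integrable_sub[OF b_int]) auto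
        have "norm (integral {\<eta>..t} (\<lambda>s. - 2 * l * y s * (p s * solX l s + b s * solY l s)))
          \<le> integral {\<eta>..t} (\<lambda>s. 2 * \<bar>l\<bar> * S * C * (p s + a t * \<bar>b s\<bar>))"
        proof (rule integral_norm_bound_integral)
          show "(\<lambda>s. 2 * \<bar>l\<bar> * S * C * (p s + a t * \<bar>b s\<bar>)) integrable_on {\<eta>..t}"
            by (intro integrable_on_mult_right integrable_add pint bint)
          show "(\<lambda>s. - 2 * l * y s * (p s * solX l s + b s * solY l s)) integrable_on {\<eta>..t}" using 2 by blast
          fix s assume s: "s \<in> {\<eta>..t}"
          then have s1: "s \<in> {0..1}" "s \<in> {0<..t}" using \<eta> t by auto
          have "\<bar>p s * solX l s + b s * solY l s\<bar> \<le> C * (p s + \<bar>b s\<bar> * a s)" using C(2) s1(1) by (intro row_bounds) (auto simp: admissible_def)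
          also have "\<dots> \<le> C * (p s + a t * \<bar>b s\<bar>)"
          proof -
            have "\<bar>b s\<bar> * a s \<le> \<bar>b s\<bar> * a t" using a_mono[of s t] s1 t by (intro mult_left_mono) auto
            then show ?thesis using C(1) by (simp add: mult.commute)
          qed
          finally have *: "\<bar>p s * solX l s + b s * solY l s\<bar> \<le> C * (p s + a t * \<bar>b s\<bar>)" .
          have "\<bar>- 2 * l * y s * (p s * solX l s + b s * solY l s)\<bar> = 2 * \<bar>l\<bar> * (\<bar>y s\<bar> * \<bar>p s * solX l s + b s * solY l s\<bar>)"
            by (simp add: abs_mult)
          also have "\<dots> \<le> 2 * \<bar>l\<bar> * (S * (C * (p s + a t * \<bar>b s\<bar>)))"
            using * yS[OF s1(2)] S by (intro mult_left_mono mult_mono) auto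
          finally show "norm (- 2 * l * y s * (p s * solX l s + b s * solY l s)) \<le> 2 * \<bar>l\<bar> * S * C * (p s + a t * \<bar>b s\<bar>)"
            by (simp add: mult.assoc)
        qed
        also have "\<dots> = 2 * \<bar>l\<bar> * S * C * (integral {\<eta>..t} p + a t * integral {\<eta>..t} (\<lambda>s. \<bar>b s\<bar>))"
          using pint bint by (simp add: Henstock_Kurzweil_Integration.integral_add integrable_on_mult_right)
        also have "\<dots> \<le> 2 * \<bar>l\<bar> * S * C * (a t + a t * \<beta>)"
        proof (intro mult_left_mono add_mono)
          show "integral {\<eta>..t} p \<le> a t" unfolding a_def
            by (rule integral_subset_le) (use \<eta> t in \<open>auto simp: p_nonneg intro: integrable_sub[OF p_int]\<close>)
          show "integral {\<eta>..t} (\<lambda>s. \<bar>b s\<bar>) \<le> \<beta>" unfolding \<beta>_def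
            by (rule integral_subset_le) (use \<eta> t in \<open>auto intro: integrable_sub[OF b_int]\<close>)
        qed (use a_nonneg[of t] t S C in auto)
        finally show ?thesis using integral_unique[OF 2] by (simp add: algebra_simps)
      qed
      have "((\<lambda>\<eta>. \<bar>solY l t * y t - solY l \<eta> * y \<eta> + l * w * (a t - a \<eta>)\<bar>) \<longlongrightarrow>
          \<bar>solY l t * y t - 0 * 0 + l * w * (a t - 0)\<bar>) (at_right 0)"
        using integral_tendsto_0[OF p_int] by (intro tendsto_intros sol_lim lim) (simp add: a_def[abs_def])
      moreover have "\<forall>\<^sub>F \<eta> in at_right 0. \<bar>solY l t * y t - solY l \<eta> * y \<eta> + l * w * (a t - a \<eta>)\<bar> \<le> 2 * \<bar>l\<bar> * S * C * (1 + \<beta>) * a t"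
      proof -
        have "\<forall>\<^sub>F s in at_right 0. s \<in> {0<..<t}" using t by (intro eventually_at_right_real) auto
        then show ?thesis by eventually_elim (use aux in auto)
      qed
      ultimately have "\<bar>solY l t * y t - 0 * 0 + l * w * (a t - 0)\<bar> \<le> 2 * \<bar>l\<bar> * S * C * (1 + \<beta>) * a t"
        by (rule tendsto_upperbound) simp
      then have 3: "\<bar>solY l t * y t + l * w * a t\<bar> \<le> 2 * \<bar>l\<bar> * S * C * (1 + \<beta>) * a t" by simp
      have "\<bar>solY l t * y t\<bar> \<le> (C * a t) * S"
        unfolding abs_mult using C(2) t yS[of t] S a_nonneg[of t] C(1) by (intro mult_mono) (auto simp: admissible_def)
      with 3 have "\<bar>l * w * a t\<bar> \<le> (C * a t) * S + 2 * \<bar>l\<bar> * S * C * (1 + \<beta>) * a t" by linarith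
      then have "\<bar>l * w\<bar> * a t \<le> (S * (C + 2 * \<bar>l\<bar> * C * (1 + \<beta>))) * a t"
        using a_nonneg[of t] t by (simp add: abs_mult algebra_simps)
      then show ?thesis using a_pos[OF t(1)] by simp
    qed
    have "\<bar>l * w\<bar> \<le> e" if e: "e > 0" for e
    proof -
      define D where "D = C + 2 * \<bar>l\<bar> * C * (1 + \<beta>)"
      have "D > 0" unfolding D_def using C(1) \<beta> by (intro add_pos_nonneg) auto
      then show ?thesis using key[of "e / D"] e by (simp add: D_def[symmetric])
    qed
    then have "\<bar>l * w\<bar> \<le> 0" by (rule field_le_epsilon) simp
    then show "w = 0" using False by simp
  qed
  \<comment> \<open>Since w = 0 the vectors at 1 are parallel, and c is the projection coefficient.
    Equality at 1 then propagates backwards.\<close>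
  define c where "c = (x 1 * solX l 1 + y 1 * solY l 1) / (solX l 1 * solX l 1 + solY l 1 * solY l 1)"
  have n0: "solX l 1 * solX l 1 + solY l 1 * solY l 1 \<noteq> 0"
    using sol_nonzero[of 1 l] by (auto simp: sum_squares_eq_zero_iff)
  have eq: "x 1 * solY l 1 = y 1 * solX l 1" using \<open>w = 0\<close> by (simp add: w_def)
  have "c * solX l 1 = (x 1 * (solX l 1 * solX l 1) + (y 1 * solX l 1) * solY l 1) / (solX l 1 * solX l 1 + solY l 1 * solY l 1)"
    by (simp add: c_def algebra_simps)
  also have "\<dots> = x 1" unfolding eq[symmetric] using n0 by (simp add: field_simps)
  finally have x1: "x 1 = c * solX l 1" by simp
  have "c * solY l 1 = ((x 1 * solY l 1) * solX l 1 + y 1 * (solY l 1 * solY l 1)) / (solX l 1 * solX l 1 + solY l 1 * solY l 1)"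
    by (simp add: c_def algebra_simps)
  also have "\<dots> = y 1" unfolding eq using n0 by (simp add: field_simps)
  finally have y1: "y 1 = c * solY l 1" by simp
  show ?thesis
  proof (rule that[of c])
    fix t :: real assume t: "t \<in> {0<..1}"
    have "x t - c * solX l t = 0 \<and> y t - c * solY l t = 0"
      by (rule solution_zero_backward[OF solution_lincomb[OF sol sol_solution], of 1]) (use t x1 y1 in auto)
    then show "x t = c * solX l t \<and> y t = c * solY l t" by simp
  qed
qed

text \<open>The integrand of the inner product of the solutions for l and k in the space with norm
  given by R.\<close>

definition q :: "real \<Rightarrow> real \<Rightarrow> real \<Rightarrow> real" where
  "q l k t = p t * solX l t * solX k t + b t * (solX l t * solY k t + solY l t * solX k t) + r t * solY l t * solY k t"

text \<open>The majorant comes from |solX| \<le> C and |solY| \<le> C a(t) \<le> C a(1). In the term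
  with r one factor a(t) is kept, because r a is the integrable quantity.\<close>

definition qdom :: "real \<Rightarrow> real" where
  "qdom t = p t + 2 * a 1 * \<bar>b t\<bar> + a 1 * (r t * a t)"

lemma qdom_int: "qdom integrable_on {0..1}"
  unfolding qdom_def by (intro integrable_add integrable_on_mult_right p_int b_int ra_int')

lemma q_bound:
  assumes "1 \<le> L"
  obtains C where "C > 0" "\<And>l k t. \<bar>l\<bar> \<le> L \<Longrightarrow> \<bar>k\<bar> \<le> L \<Longrightarrow> t \<in> {0..1} \<Longrightarrow> \<bar>q l k t\<bar> \<le> C * qdom t"
proof -
  obtain C where C: "C > 0" "\<And>l. \<bar>l\<bar> \<le> L \<Longrightarrow> admissible C (solX l) (solY l)"
    using sol_admissible[OF assms] by metis
  show ?thesis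
  proof (rule that[of "C * C"])
    fix l k t :: real assume lk: "\<bar>l\<bar> \<le> L" "\<bar>k\<bar> \<le> L" and t: "t \<in> {0..1}"
    have X: "\<bar>solX l t\<bar> \<le> C" "\<bar>solX k t\<bar> \<le> C" and Y: "\<bar>solY l t\<bar> \<le> C * a t" "\<bar>solY k t\<bar> \<le> C * a t"
      using C(2)[OF lk(1)] C(2)[OF lk(2)] t by (auto simp: admissible_def)
    have a: "0 \<le> a t" "a t \<le> a 1" using a_nonneg[of t] a_mono[of t 1] t by auto
    have Y1: "\<bar>solY l t\<bar> \<le> C * a 1" "\<bar>solY k t\<bar> \<le> C * a 1"
      using Y mult_left_mono[OF a(2) less_imp_le[OF C(1)]] by auto
    have pp: "\<bar>p t * solX l t * solX k t\<bar> \<le> p t * (C * C)"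
      using X p_nonneg[of t] C(1) by (simp add: abs_mult mult.assoc) (intro mult_left_mono mult_mono; auto)
    have "\<bar>solX l t * solY k t + solY l t * solX k t\<bar> \<le> \<bar>solX l t\<bar> * \<bar>solY k t\<bar> + \<bar>solY l t\<bar> * \<bar>solX k t\<bar>"
      by (metis abs_mult abs_triangle_ineq)
    also have "\<dots> \<le> C * (C * a 1) + (C * a 1) * C" using X Y1 C(1) a by (intro add_mono mult_mono) auto
    finally have "\<bar>b t * (solX l t * solY k t + solY l t * solX k t)\<bar> \<le> \<bar>b t\<bar> * (C * (C * a 1) + (C * a 1) * C)"
      unfolding abs_mult by (intro mult_left_mono) auto
    moreover have "\<bar>r t * solY l t * solY k t\<bar> \<le> r t * ((C * a 1) * (C * a t))"
      using Y Y1 r_nonneg[of t] C(1) a by (simp add: abs_mult mult.assoc[of "r t"]) (intro mult_left_mono mult_mono; auto)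
    ultimately have "\<bar>q l k t\<bar> \<le> p t * (C * C) + \<bar>b t\<bar> * (C * (C * a 1) + (C * a 1) * C) + r t * ((C * a 1) * (C * a t))"
      using pp unfolding q_def by linarith
    then show "\<bar>q l k t\<bar> \<le> C * C * qdom t" by (simp add: qdom_def algebra_simps)
  qed (use C in auto)
qed

lemma q_abs_int: "q l k absolutely_integrable_on {0..1}"
proof -
  have L: "1 \<le> max 1 (max \<bar>l\<bar> \<bar>k\<bar>)" by auto
  obtain C where C: "\<And>t. t \<in> {0..1} \<Longrightarrow> \<bar>q l k t\<bar> \<le> C * qdom t"
    using q_bound[OF L] by (metis max.cobounded1 max.cobounded2 order_trans)
  have [measurable]: "solX l \<in> borel_measurable (lebesgue_on {0..1})" "solY l \<in> borel_measurable (lebesgue_on {0..1})" for l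
    using sol_cont by (auto intro: continuous_imp_measurable_on_sets_lebesgue)
  note [measurable] = meas_on
  have "q l k \<in> borel_measurable (lebesgue_on {0..1})" unfolding q_def by measurable
  then show ?thesis by (rule integrable_on_bounded_by[OF _ integrable_on_mult_right[OF qdom_int] C])
qed

lemma q_int: "q l k integrable_on {0..1}"
  using q_abs_int by (rule set_lebesgue_integral_eq_integral(1))

text \<open>Lagrange's identity is integrated over [\<eta>,1] and \<eta> tends to 0; the Wronskian
  vanishes there because both solutions start at (1,0).\<close>

lemma sol_cross: "solX l 1 * solY k 1 - solY l 1 * solX k 1 = (l - k) * integral {0..1} (q l k)"
proof -
  let ?W = "\<lambda>t. solX l t * solY k t - solY l t * solX k t"
  have eq: "?W 1 - ?W \<eta> = (l - k) * (integral {0..1} (q l k) - integral {0..\<eta>} (q l k))" if \<eta>: "\<eta> \<in> {0<..<1}" for \<eta>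
  proof -
    have "((\<lambda>t. (l - k) * q l k t) has_integral ?W 1 - ?W \<eta>) {\<eta>..1}"
      using primitive_onD[OF solution_cross[OF sol_solution[of l] sol_solution[of k], of \<eta>], of \<eta> 1] \<eta>
      by (simp add: q_def[abs_def])
    from integral_unique[OF this] have "?W 1 - ?W \<eta> = (l - k) * integral {\<eta>..1} (q l k)"
      by simp
    then show ?thesis using integral_indefinite_diff[OF q_int, of \<eta> 1 l k] \<eta> by simp
  qed
  have ev: "\<forall>\<^sub>F \<eta> in at_right 0. ?W 1 - ?W \<eta> = (l - k) * (integral {0..1} (q l k) - integral {0..\<eta>} (q l k))"
  proof -
    have "\<forall>\<^sub>F s in at_right 0. s \<in> {0<..<(1::real)}" by (intro eventually_at_right_real) auto
    then show ?thesis by eventually_elim (rule eq)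
  qed
  have 1: "((\<lambda>\<eta>. ?W 1 - ?W \<eta>) \<longlongrightarrow> ?W 1 - (1 * 0 - 0 * 1)) (at_right 0)"
    by (intro tendsto_intros sol_lim)
  have 2: "((\<lambda>\<eta>. (l - k) * (integral {0..1} (q l k) - integral {0..\<eta>} (q l k))) \<longlongrightarrow> (l - k) * (integral {0..1} (q l k) - 0)) (at_right 0)"
    by (intro tendsto_intros integral_tendsto_0 q_int)
  have "((\<lambda>\<eta>. ?W 1 - ?W \<eta>) \<longlongrightarrow> (l - k) * (integral {0..1} (q l k) - 0)) (at_right 0)"
    using 2 by (rule Lim_transform_eventually) (use ev in eventually_elim, simp)
  from tendsto_unique[OF _ 1 this] show ?thesis by simp
qed

definition sq_norm :: "real \<Rightarrow> real" where "sq_norm l = integral {0..1} (q l l)"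
definition dX :: "real \<Rightarrow> real" where "dX l = (\<Sum>n. diffs (\<lambda>n. xs n 1) n * l ^ n)"
definition dY :: "real \<Rightarrow> real" where "dY l = (\<Sum>n. diffs (\<lambda>n. ys n 1) n * l ^ n)"

lemma sol_param_cont: "t \<in> {0..1} \<Longrightarrow> isCont (\<lambda>l. solX l t) l" "t \<in> {0..1} \<Longrightarrow> isCont (\<lambda>l. solY l t) l"
  unfolding solX_def solY_def by (rule isCont_powser_converges_everywhere, rule series_summable, assumption)+

lemma dX: "((\<lambda>l. solX l 1) has_real_derivative dX l) (at l)" and dY: "((\<lambda>l. solY l 1) has_real_derivative dY l) (at l)"
  unfolding solX_def solY_def dX_def dY_def
  by (rule termdiffs_strong_converges_everywhere, rule series_summable, simp)+

lemma dX_cont: "isCont dX l" and dY_cont: "isCont dY l"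
  unfolding dX_def[abs_def] dY_def[abs_def]
  by (rule isCont_powser_converges_everywhere, rule termdiff_converges_all, rule series_summable, simp)+

text \<open>A convergent sequence of parameters is bounded, so one multiple of \<open>qdom\<close>
  dominates all integrands.\<close>

lemma q_param_tendsto: "((\<lambda>k. integral {0..1} (q l k)) \<longlongrightarrow> sq_norm l) (at l)"
  unfolding tendsto_at_iff_sequentially
proof (intro allI impI)
  fix k :: "nat \<Rightarrow> real" assume k: "\<forall>i. k i \<in> UNIV - {l}" "k \<longlonglongrightarrow> l"
  obtain B where B: "\<And>i. \<bar>k i\<bar> \<le> B"
    using convergent_imp_Bseq[of k] k(2) unfolding convergent_def Bseq_def by auto
  have L: "1 \<le> max 1 (max \<bar>l\<bar> B)" "\<bar>l\<bar> \<le> max 1 (max \<bar>l\<bar> B)" "\<And>i. \<bar>k i\<bar> \<le> max 1 (max \<bar>l\<bar> B)"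
    using B by (auto simp: le_max_iff_disj)
  obtain C where C: "\<And>i t. t \<in> {0..1} \<Longrightarrow> \<bar>q l (k i) t\<bar> \<le> C * qdom t"
    using q_bound[OF L(1)] L(2,3) by metis
  have lim: "(\<lambda>i. solX (k i) t) \<longlonglongrightarrow> solX l t" "(\<lambda>i. solY (k i) t) \<longlonglongrightarrow> solY l t" if "t \<in> {0..1}" for t
    using isCont_tendsto_compose[OF sol_param_cont(1)[OF that] k(2)] isCont_tendsto_compose[OF sol_param_cont(2)[OF that] k(2)] by auto
  show "((\<lambda>k. integral {0..1} (q l k)) \<circ> k) \<longlonglongrightarrow> sq_norm l"
    unfolding comp_def sq_norm_def
  proof (rule dominated_convergence(2)[OF q_int integrable_on_mult_right[OF qdom_int]])
    show "norm (q l (k i) t) \<le> C * qdom t" if "t \<in> {0..1}" for i t using C[OF that] by simp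
    show "(\<lambda>i. q l (k i) t) \<longlonglongrightarrow> q l l t" if "t \<in> {0..1}" for t
      unfolding q_def by (intro tendsto_intros lim that)
  qed
qed

text \<open>Dividing \<open>sol_cross\<close> by k - l and letting k tend to l produces the
  Wronskian of the solution with its derivative in l on one side and the squared norm on the
  other.\<close>

lemma wronskian: "solY l 1 * dX l - solX l 1 * dY l = sq_norm l"
proof -
  let ?F = "\<lambda>k. solX l 1 * solY k 1 - solY l 1 * solX k 1"
  have "(?F has_real_derivative solX l 1 * dY l - solY l 1 * dX l) (at l)"
    by (auto intro!: derivative_eq_intros dX dY)
  then have 1: "((\<lambda>k. (?F k - ?F l) / (k - l)) \<longlongrightarrow> solX l 1 * dY l - solY l 1 * dX l) (at l)"
    by (simp add: has_field_derivative_iff)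
  have "((\<lambda>k. - integral {0..1} (q l k)) \<longlongrightarrow> - sq_norm l) (at l)"
    by (intro tendsto_intros q_param_tendsto)
  moreover have "\<forall>\<^sub>F k in at l. - integral {0..1} (q l k) = (?F k - ?F l) / (k - l)"
    unfolding eventually_at_filter
  proof (intro always_eventually allI impI)
    fix k assume "k \<noteq> l"
    then show "- integral {0..1} (q l k) = (?F k - ?F l) / (k - l)"
      unfolding sol_cross[of l k] by (simp add: field_simps)
  qed
  ultimately have "((\<lambda>k. (?F k - ?F l) / (k - l)) \<longlongrightarrow> - sq_norm l) (at l)"
    by (rule Lim_transform_eventually)
  from tendsto_unique[OF _ 1 this] show ?thesis by simp
qed

text \<open>By Cayley-Hamilton, the trace of R times the form of R at u equals det R |u|^2 + |R
  u|^2. The last term is dropped and det R = 1/4 inserted.\<close>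

lemma q_lower:
  assumes t: "t \<in> {0<..1}"
  shows "(solX l t)\<^sup>2 + (solY l t)\<^sup>2 \<le> 4 * (p t + r t) * q l l t"
proof -
  let ?x = "solX l t" and ?y = "solY l t"
  have "(p t + r t) * q l l t = (p t * r t - (b t)\<^sup>2) * (?x\<^sup>2 + ?y\<^sup>2) + (p t * ?x + b t * ?y)\<^sup>2 + (b t * ?x + r t * ?y)\<^sup>2"
    by (simp add: q_def power2_eq_square algebra_simps)
  moreover have "S \<le> 4 * Z" if "Z = 1 / 4 * S + u\<^sup>2 + v\<^sup>2" for Z S u v :: real
    using that by simp
  ultimately have "?x\<^sup>2 + ?y\<^sup>2 \<le> 4 * ((p t + r t) * q l l t)" unfolding det[OF t] by blast
  then show ?thesis by (simp only: mult.assoc)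
qed

lemma q_nonneg: "t \<in> {0<..1} \<Longrightarrow> 0 \<le> q l l t"
proof -
  assume t: "t \<in> {0<..1}"
  have "0 < p t * r t" using det[OF t] by (metis add.commute add_pos_nonneg diff_eq_eq zero_le_power2 zero_less_divide_1_iff zero_less_numeral)
  then have pr: "0 < p t + r t" using p_nonneg[of t] r_nonneg[of t] by (metis add_pos_nonneg less_eq_real_def mult_zero_left)
  have "0 \<le> 4 * (p t + r t) * q l l t" using q_lower[OF t, of l] by (smt (verit) zero_le_power2)
  then show ?thesis using pr by (simp add: zero_le_mult_iff)
qed

text \<open>On [1/2,1] the entries are bounded and the solution has no zero, so by compactness the
  form has a positive lower bound there; on the rest of (0,1] it is nonnegative.\<close>

lemma sq_norm_pos: "0 < sq_norm l"
proof -
  have h: "1/2 \<in> {0<..(1::real)}" by auto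
  from bddE[OF h] obtain K where K: "K > 0" "\<And>t. t \<in> {1/2..1} \<Longrightarrow> \<bar>p t\<bar> \<le> K" "\<And>t. t \<in> {1/2..1} \<Longrightarrow> \<bar>r t\<bar> \<le> K" by metis
  have "continuous_on {1/2..1} (\<lambda>t. (solX l t)\<^sup>2 + (solY l t)\<^sup>2)"
    by (intro continuous_intros continuous_on_subset[OF sol_cont(1)] continuous_on_subset[OF sol_cont(2)]) auto
  then obtain t0 where t0: "t0 \<in> {1/2..1}" "\<And>t. t \<in> {1/2..1} \<Longrightarrow> (solX l t0)\<^sup>2 + (solY l t0)\<^sup>2 \<le> (solX l t)\<^sup>2 + (solY l t)\<^sup>2"
    using continuous_attains_inf[of "{1/2..1::real}" "\<lambda>t. (solX l t)\<^sup>2 + (solY l t)\<^sup>2"] by auto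
  define m where "m = (solX l t0)\<^sup>2 + (solY l t0)\<^sup>2"
  have m: "m > 0" using sol_nonzero[of t0 l] t0(1) by (auto simp: m_def sum_power2_gt_zero_iff)
  have low: "m / (8 * K) \<le> q l l t" if t: "t \<in> {1/2..1}" for t
  proof -
    have t1: "t \<in> {0<..1}" using t by auto
    have "m \<le> 4 * (p t + r t) * q l l t" using q_lower[OF t1, of l] t0(2)[OF t] by (simp add: m_def)
    also have "\<dots> \<le> 4 * (K + K) * q l l t"
      using K(2)[OF t] K(3)[OF t] q_nonneg[OF t1, of l] by (intro mult_right_mono mult_left_mono add_mono) auto
    finally show ?thesis using K(1) by (simp add: field_simps)
  qed
  have "0 < m / (8 * K) * (1 / 2)" using m K(1) by simp
  also have "\<dots> = integral {1/2..1::real} (\<lambda>_. m / (8 * K))" by simp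
  also have "\<dots> \<le> integral {1/2..1} (q l l)"
    by (rule integral_le) (use low in \<open>auto intro!: integrable_sub[OF q_int]\<close>)
  also have "\<dots> \<le> integral {0..1} (q l l)"
  proof -
    have "0 \<le> integral {0..1/2} (q l l)"
    \<comment> \<open>Nonnegativity of the form is known on (0,1], so the value at 0 is spiked to
      0.\<close>
    proof (rule has_integral_nonneg[OF has_integral_spike[of "{0}" "{0..1/2}" _ "q l l"]])
      show "(q l l has_integral integral {0..1/2} (q l l)) {0..1/2}"
        by (rule integrable_integral[OF integrable_sub[OF q_int]]) auto
      show "(if t = 0 then 0 else q l l t) = q l l t" if "t \<in> {0..1/2} - {0}" for t using that by auto
      show "0 \<le> (if t = 0 then 0 else q l l t)" if "t \<in> {0..1/2}" for t using q_nonneg[of t l] that by auto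
    qed auto
    then show ?thesis using integral_indefinite_diff[OF q_int, of "1/2" 1 l l] by simp
  qed
  finally show ?thesis by (simp add: sq_norm_def)
qed

end

section \<open>Eigenvalues and weights of the Dirac operator\<close>

lemma locally_bounded_on_compact:
  assumes f: "locally_bounded_on I f" and K: "compact K" "K \<subseteq> I"
  shows "bounded (f ` K)"
proof -
  have "\<forall>t\<in>K. \<exists>U. open U \<and> t \<in> U \<and> bounded (f ` (U \<inter> I))"
    using f K(2) unfolding locally_bounded_on_def by blast
  then obtain U where U: "\<And>t. t \<in> K \<Longrightarrow> open (U t) \<and> t \<in> U t \<and> bounded (f ` (U t \<inter> I))" by metis
  obtain D where D: "D \<subseteq> K" "finite D" "K \<subseteq> (\<Union>t\<in>D. U t)"
    by (rule compactE_image[OF K(1), of K U]) (use U in blast)+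
  have "bounded (\<Union>t\<in>D. f ` (U t \<inter> I))" using D U by (intro bounded_UN) auto
  moreover have "f ` K \<subseteq> (\<Union>t\<in>D. f ` (U t \<inter> I))" using D(3) K(2) by blast
  ultimately show ?thesis by (rule bounded_subset)
qed

lemma abs_continuous_imp_continuous:
  assumes "abs_continuous_on a b f"
  shows "continuous_on {a..b} f"
  unfolding continuous_on_iff
proof (intro ballI allI impI)
  fix x and e :: real assume x: "x \<in> {a..b}" and e: "0 < e"
  then obtain d where d: "d > 0" "\<And>D. finite D \<and> (\<forall>(c, d)\<in>D. a \<le> c \<and> c \<le> d \<and> d \<le> b) \<and>
        disjoint_family_on (\<lambda>(c, d). {c<..<d}) D \<and> (\<Sum>(c, d)\<in>D. d - c) < d \<Longrightarrow>
        (\<Sum>(c, d)\<in>D. dist (f c) (f d)) < e" using assms unfolding abs_continuous_on_def by blast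
  show "\<exists>d>0. \<forall>x'\<in>{a..b}. dist x' x < d \<longrightarrow> dist (f x') (f x) < e"
  proof (intro exI conjI ballI impI)
    fix y assume y: "y \<in> {a..b}" "dist y x < d"
    have "dist (f (min x y)) (f (max x y)) < e"
    proof -
      have "max x y - min x y < d" using y by (auto simp: dist_real_def max_def min_def)
      then show ?thesis using d(2)[of "{(min x y, max x y)}"] x y by (simp add: disjoint_family_on_def)
    qed
    then show "dist (f y) (f x) < e" by (auto simp: min_def max_def dist_commute split: if_splits)
  qed (rule d(1))
qed

lemma abs_continuous_component:
  fixes f :: "real \<Rightarrow> real ^ 2"
  assumes "abs_continuous_on a b f"
  shows "abs_continuous_on a b (\<lambda>t. f t $ i)"
  unfolding abs_continuous_on_def
proof (intro allI impI)
  fix e :: real assume "0 < e"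
  then obtain d where d: "d > 0" "\<And>D. finite D \<and> (\<forall>(c, d)\<in>D. a \<le> c \<and> c \<le> d \<and> d \<le> b) \<and>
        disjoint_family_on (\<lambda>(c, d). {c<..<d}) D \<and> (\<Sum>(c, d)\<in>D. d - c) < d \<Longrightarrow>
        (\<Sum>(c, d)\<in>D. dist (f c) (f d)) < e" using assms unfolding abs_continuous_on_def by blast
  show "\<exists>\<delta>>0. \<forall>D. finite D \<and> (\<forall>(c, d)\<in>D. a \<le> c \<and> c \<le> d \<and> d \<le> b) \<and>
        disjoint_family_on (\<lambda>(c, d). {c<..<d}) D \<and> (\<Sum>(c, d)\<in>D. d - c) < \<delta> \<longrightarrow>
        (\<Sum>(c, d)\<in>D. dist (f c $ i) (f d $ i)) < e"
  proof (intro exI conjI allI impI)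
    fix D assume D: "finite D \<and> (\<forall>(c, d)\<in>D. a \<le> c \<and> c \<le> d \<and> d \<le> b) \<and>
        disjoint_family_on (\<lambda>(c, d). {c<..<d}) D \<and> (\<Sum>(c, d)\<in>D. d - c) < d"
    have "(\<Sum>(c, d)\<in>D. dist (f c $ i) (f d $ i)) \<le> (\<Sum>(c, d)\<in>D. dist (f c) (f d))"
      by (rule sum_mono) (auto intro: dist_vec_nth_le)
    with d(2)[OF D] show "(\<Sum>(c, d)\<in>D. dist (f c $ i) (f d $ i)) < e" by linarith
  qed (rule d(1))
qed

lemma J_mult: "(J *v d) $ 1 = - d $ 2" "(J *v d) $ 2 = d $ 1"
  by (simp_all add: J_def matrix_vector_mult_def sum_2)

lemma dot_2: "(x :: real ^ 2) \<bullet> y = x $ 1 * y $ 1 + x $ 2 * y $ 2"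
  by (simp add: inner_vec_def sum_2)

lemma mult_2: "((A :: real ^ 2 ^ 2) *v x) $ i = A $ i $ 1 * x $ 1 + A $ i $ 2 * x $ 2"
  by (simp add: matrix_vector_mult_def sum_2)

lemma not_closed_Ioc: "\<not> closed {0<..(1::real)}"
proof
  assume "closed {0<..(1::real)}"
  then have "closure {0<..(1::real)} = {0<..1}" by simp
  then have "{0..(1::real)} = {0<..1}" by simp
  then have "(0::real) \<in> {0<..1}" by (metis atLeastAtMost_iff order_refl zero_le_one)
  then show False by simp
qed

text \<open>The entry functions are set to \<open>0\<close> off \<open>(0,1]\<close>, so that \<open>I = [0,1]\<close> and \<open>I = (0,1]\<close> lead to
  the same functions.\<close>

definition entry :: "(real \<Rightarrow> real ^ 2 ^ 2) \<Rightarrow> 2 \<Rightarrow> 2 \<Rightarrow> real \<Rightarrow> real" where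
  "entry R i j t = (if t \<in> {0<..1} then R t $ i $ j else 0)"

locale dirac_coefficient =
  fixes I :: "real set" and R :: "real \<Rightarrow> real ^ 2 ^ 2"
  assumes I: "I = {0..1} \<or> I = {0<..1}"
    and A1: "assumption1 I R" and A2: "assumption2 I (bc_vec None) R"
begin

abbreviation "p \<equiv> entry R 1 1"
abbreviation "b \<equiv> entry R 1 2"
abbreviation "r \<equiv> entry R 2 2"

lemma sub_I: "{0<..1} \<subseteq> I" "I \<subseteq> {0..1}" using I by auto

lemma R_sym: "t \<in> I \<Longrightarrow> R t $ 2 $ 1 = R t $ 1 $ 2"
proof -
  assume "t \<in> I"
  then have "transpose (R t) $ 1 $ 2 = R t $ 1 $ 2" using A1 by (simp add: assumption1_def)
  then show ?thesis by (simp add: transpose_def)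
qed

lemma R_pos: "t \<in> I \<Longrightarrow> x \<noteq> 0 \<Longrightarrow> 0 < x \<bullet> (R t *v x)"
  using A1 by (auto simp: assumption1_def)

lemma R_det: "t \<in> I \<Longrightarrow> R t $ 1 $ 1 * R t $ 2 $ 2 - (R t $ 1 $ 2)\<^sup>2 = 1 / 4"
  using A1 R_sym by (auto simp: assumption1_def det_2 power2_eq_square)

lemma R_diag: "t \<in> I \<Longrightarrow> 0 < R t $ i $ i"
proof -
  assume t: "t \<in> I"
  have "axis i 1 \<noteq> (0 :: real ^ 2)" by (simp add: axis_eq_0_iff)
  from R_pos[OF t this] have "0 < (R t *v axis i 1) $ i" by (simp add: inner_axis')
  then show ?thesis by (simp add: matrix_vector_mult_basis column_def)
qed

lemma R_inv: "t \<in> I \<Longrightarrow> matrix_inv (R t) ** R t = mat 1" "t \<in> I \<Longrightarrow> R t ** matrix_inv (R t) = mat 1"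
proof -
  assume t: "t \<in> I"
  have "invertible (R t)" using A1 t by (auto simp: assumption1_def invertible_det_nz)
  then show "matrix_inv (R t) ** R t = mat 1" "R t ** matrix_inv (R t) = mat 1"
    unfolding invertible_def matrix_inv_def by (rule someI2_ex; simp)+
qed

lemma entry_eq: "t \<in> {0<..1} \<Longrightarrow> entry R i j t = R t $ i $ j" by (simp add: entry_def)

lemma entry_meas: "entry R i j \<in> borel_measurable lebesgue"
proof -
  have "(\<lambda>t. indicator I t *\<^sub>R R t) \<in> borel_measurable lebesgue"
    using A1 by (simp add: assumption1_def set_borel_measurable_def)
  moreover have "(\<lambda>A :: real ^ 2 ^ 2. A $ i $ j) \<in> borel_measurable borel"
    by (intro borel_measurable_continuous_onI continuous_intros)
  ultimately have "(\<lambda>t. (indicator I t *\<^sub>R R t) $ i $ j) \<in> borel_measurable lebesgue"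
    by (rule measurable_compose)
  then have "(\<lambda>t. indicator {0<..1} t * (indicator I t *\<^sub>R R t) $ i $ j) \<in> borel_measurable lebesgue"
    by (intro borel_measurable_times borel_measurable_indicator) auto
  moreover have "indicator {0<..1} t * (indicator I t *\<^sub>R R t) $ i $ j = entry R i j t" for t
    using sub_I by (auto simp: entry_def indicator_def)
  ultimately show ?thesis by simp
qed

lemma R_bounded: 
  assumes "compact K" "K \<subseteq> I" obtains B where "B \<ge> 0" "\<And>t i j. t \<in> K \<Longrightarrow> \<bar>R t $ i $ j\<bar> \<le> B" "\<And>t i j. t \<in> K \<Longrightarrow> \<bar>entry R i j t\<bar> \<le> B"
proof -
  have "bounded (R ` K)" using A1 assms by (intro locally_bounded_on_compact) (auto simp: assumption1_def)
  then obtain B where B: "\<And>t. t \<in> K \<Longrightarrow> norm (R t) \<le> B" unfolding bounded_iff by auto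
  have "\<bar>R t $ i $ j\<bar> \<le> \<bar>B\<bar>" if "t \<in> K" for t i j
    using component_le_norm_cart[of "R t $ i" j] Finite_Cartesian_Product.norm_nth_le[of "R t" i] B[OF that] by linarith
  then show ?thesis using that[of "\<bar>B\<bar>"] by (auto simp: entry_def)
qed

lemma entry_bounded:
  assumes "\<eta> \<in> I"
  shows "\<exists>K. \<forall>t\<in>{\<eta>..1}. \<bar>p t\<bar> \<le> K \<and> \<bar>b t\<bar> \<le> K \<and> \<bar>r t\<bar> \<le> K"
proof -
  have "{\<eta>..1} \<subseteq> I" using assms I by auto
  then obtain B where "\<And>t i j. t \<in> {\<eta>..1} \<Longrightarrow> \<bar>entry R i j t\<bar> \<le> B" using R_bounded[of "{\<eta>..1}"] by (metis compact_Icc)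
  then show ?thesis by blast
qed

lemma entry_diag_nonneg: "0 \<le> entry R i i t"
  using R_diag[of t i] sub_I(1) by (auto simp: entry_def)

lemmas p_nn = entry_diag_nonneg[of 1] and r_nn = entry_diag_nonneg[of 2]

lemma integrable_on_of_lebesgue:
  fixes f :: "real \<Rightarrow> real"
  assumes "f \<in> borel_measurable lebesgue" "(\<integral>\<^sup>+t\<in>I. ennreal \<bar>f t\<bar> \<partial>lebesgue) < \<infinity>" "\<And>t. t \<notin> {0<..1} \<Longrightarrow> f t = 0"
  shows "f absolutely_integrable_on {0..1}"
  unfolding set_integrable_def
proof (rule integrableI_bounded)
  show "(\<lambda>x. indicator {0..1} x *\<^sub>R f x) \<in> borel_measurable lebesgue" 
    using assms(1) by (intro borel_measurable_scaleR borel_measurable_indicator) auto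
  have "(\<integral>\<^sup>+x. ennreal (norm (indicator {0..1} x *\<^sub>R f x)) \<partial>lebesgue) = (\<integral>\<^sup>+t\<in>I. ennreal \<bar>f t\<bar> \<partial>lebesgue)"
  proof (rule nn_integral_cong)
    fix x
    show "ennreal (norm (indicator {0..1} x *\<^sub>R f x)) = ennreal \<bar>f x\<bar> * indicator I x"
      using assms(3)[of x] sub_I by (cases "x \<in> {0<..1}") (auto simp: indicator_def)
  qed
  then show "(\<integral>\<^sup>+x. ennreal (norm (indicator {0..1} x *\<^sub>R f x)) \<partial>lebesgue) < \<infinity>" using assms(2) by simp
qed

lemma bounded_case:
  fixes f :: "real \<Rightarrow> real"
  assumes "f \<in> borel_measurable lebesgue" "\<And>t. t \<in> {0..1} \<Longrightarrow> \<bar>f t\<bar> \<le> B"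
  shows "f absolutely_integrable_on {0..1}"
  by (rule integrable_on_bounded_by[OF measurable_restrict_space1[OF assms(1)], of "\<lambda>_. B"]) (use assms in auto)

text \<open>For the left vector [1,0] the row in the first condition of Assumption 2 is (p,b). On
  the closed interval the entries are bounded.\<close>

lemma pb_int: "p absolutely_integrable_on {0..1}" "b absolutely_integrable_on {0..1}"
proof -
  consider (closed) "I = {0..1}" | (op) "I = {0<..1}" using I by blast
  then have "p absolutely_integrable_on {0..1} \<and> b absolutely_integrable_on {0..1}"
  proof cases
    case closed
    then obtain B where B: "\<And>t i j. t \<in> {0..1} \<Longrightarrow> \<bar>entry R i j t\<bar> \<le> B" using R_bounded[of "{0..1}"] by (metis compact_Icc order_refl)
    show ?thesis using bounded_case[OF entry_meas B] by blast
  next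
    case op
    have "\<not> closed I" unfolding op by (rule not_closed_Ioc)
    then have fin: "(\<integral>\<^sup>+s\<in>I. ennreal (norm (bc_vec None v* R s)) \<partial>lebesgue) < \<infinity>" using A2 by (simp add: assumption2_def)
    have row: "\<bar>entry R 1 j s\<bar> \<le> norm (bc_vec None v* R s)" for j s
    proof -
      have "(bc_vec None v* R s) $ j = R s $ 1 $ j" by (simp add: bc_vec_def vector_matrix_mult_def sum_2)
      then show ?thesis using component_le_norm_cart[of "bc_vec None v* R s" j] by (auto simp: entry_def)
    qed
    have "entry R 1 j absolutely_integrable_on {0..1}" for j
    proof (rule integrable_on_of_lebesgue[OF entry_meas])
      have "(\<integral>\<^sup>+t\<in>I. ennreal \<bar>entry R 1 j t\<bar> \<partial>lebesgue) \<le> (\<integral>\<^sup>+s\<in>I. ennreal (norm (bc_vec None v* R s)) \<partial>lebesgue)"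
        by (intro nn_integral_mono mult_right_mono ennreal_leI row) auto
      then show "(\<integral>\<^sup>+t\<in>I. ennreal \<bar>entry R 1 j t\<bar> \<partial>lebesgue) < \<infinity>" using fin by (rule le_less_trans)
    qed (simp add: entry_def del: greaterThanAtMost_iff)
    then show ?thesis by blast
  qed
  then show "p absolutely_integrable_on {0..1}" "b absolutely_integrable_on {0..1}" by auto
qed

lemma p_int': "p integrable_on {0..1}" using pb_int(1) by (rule set_lebesgue_integral_eq_integral(1))

text \<open>On (0,1] the two quadratic forms in Assumption 2 are p(s) and r(t), so the inner
  integral over s < t is r(t) times the primitive of p at t.\<close>

lemma ra_abs_int: "(\<lambda>t. r t * integral {0..t} p) absolutely_integrable_on {0..1}"
proof -
  define a where "a t = integral {0..t} p" for t
  have a_cont: "continuous_on {0..1} a" unfolding a_def by (rule indefinite_integral_continuous_1[OF p_int'])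
  have a_meas: "(\<lambda>t. indicator {0..1} t * a t) \<in> borel_measurable lebesgue"
    using borel_measurable_continuous_on_indicator[OF _ a_cont]
    by (simp add: measurable_completion)
  have ra_meas: "(\<lambda>t. r t * a t) \<in> borel_measurable lebesgue"
  proof -
    have "(\<lambda>t. r t * (indicator {0..1} t * a t)) \<in> borel_measurable lebesgue"
      by (intro borel_measurable_times entry_meas a_meas)
    moreover have "r t * (indicator {0..1} t * a t) = r t * a t" for t by (auto simp: entry_def indicator_def)
    ultimately show ?thesis by simp
  qed
  consider (closed) "I = {0..1}" | (op) "I = {0<..1}" using I by blast
  then have "(\<lambda>t. r t * a t) absolutely_integrable_on {0..1}"
  proof cases
    case closed
    then obtain B where B: "\<And>t i j. t \<in> {0..1} \<Longrightarrow> \<bar>entry R i j t\<bar> \<le> B" using R_bounded[of "{0..1}"] by (metis compact_Icc order_refl)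
    have "bounded (a ` {0..1})" by (intro compact_imp_bounded compact_continuous_image a_cont) auto
    then obtain C where C: "0 \<le> C" "\<And>t. t \<in> {0..1} \<Longrightarrow> \<bar>a t\<bar> \<le> C" by (rule bounded_realE) blast
    show ?thesis
    proof (rule bounded_case[OF ra_meas])
      fix t :: real assume t: "t \<in> {0..1}"
      show "\<bar>r t * a t\<bar> \<le> B * C" unfolding abs_mult using B[OF t, of 2 2] C(2)[OF t] by (intro mult_mono) auto
    qed
  next
    case op
    have "\<not> closed I" unfolding op by (rule not_closed_Ioc)
    then have fin: "(\<integral>\<^sup>+t\<in>I. (\<integral>\<^sup>+s\<in>I \<inter> {..<t}.
          ennreal ((bc_vec None \<bullet> (R s *v bc_vec None)) * ((J *v bc_vec None) \<bullet> (R t *v (J *v bc_vec None)))) \<partial>lebesgue) \<partial>lebesgue) < \<infinity>"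
      using A2 by (simp add: assumption2_def)
    have quad: "bc_vec None \<bullet> (R s *v bc_vec None) = R s $ 1 $ 1" "(J *v bc_vec None) \<bullet> (R s *v (J *v bc_vec None)) = R s $ 2 $ 2" for s
      unfolding dot_2 mult_2[of "R s"] J_mult by (simp_all add: bc_vec_def)
    have inner: "(\<integral>\<^sup>+s\<in>I \<inter> {..<t}.
          ennreal ((bc_vec None \<bullet> (R s *v bc_vec None)) * ((J *v bc_vec None) \<bullet> (R t *v (J *v bc_vec None)))) \<partial>lebesgue)
        = ennreal \<bar>r t * a t\<bar>" if t: "t \<in> I" for t
    proof -
      have t1: "t \<in> {0<..1}" using t op by simp
      have ph: "(p has_integral a t) {0..t}" unfolding a_def
        by (rule integrable_integral[OF integrable_sub[OF p_int']]) (use t1 in auto)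
      have a0: "0 \<le> a t" by (rule has_integral_nonneg[OF ph]) (rule p_nn)
      have "(\<integral>\<^sup>+s\<in>I \<inter> {..<t}.
          ennreal ((bc_vec None \<bullet> (R s *v bc_vec None)) * ((J *v bc_vec None) \<bullet> (R t *v (J *v bc_vec None)))) \<partial>lebesgue)
        = (\<integral>\<^sup>+s. ennreal (r t) * (indicator {0..t} s * ennreal (p s)) \<partial>lebesgue)"
      proof (rule nn_integral_cong_AE)
        \<comment> \<open>The domain s < t in I and the interval [0,t] differ at s = t, a null set,
          and at s = 0, where \<open>entry\<close> vanishes.\<close>
        have "AE s in lebesgue. s \<notin> {t}" by (rule AE_not_in) simp
        then show "AE s in lebesgue. ennreal ((bc_vec None \<bullet> (R s *v bc_vec None)) * ((J *v bc_vec None) \<bullet> (R t *v (J *v bc_vec None)))) * indicator (I \<inter> {..<t}) s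
          = ennreal (r t) * (indicator {0..t} s * ennreal (p s))"
        proof eventually_elim
          case (elim s)
          show ?case unfolding quad using elim t1 op R_diag[of t 2] t
            by (cases "s \<in> I \<inter> {..<t}") (auto simp: entry_def indicator_def ennreal_mult'' mult.commute)
        qed
      qed
      also have "\<dots> = ennreal (r t) * (\<integral>\<^sup>+s. indicator {0..t} s * ennreal (p s) \<partial>lebesgue)"
        by (intro nn_integral_cmult borel_measurable_times_ennreal borel_measurable_indicator
            measurable_compose[OF entry_meas] measurable_ennreal) auto
      also have "(\<integral>\<^sup>+s. indicator {0..t} s * ennreal (p s) \<partial>lebesgue) = ennreal (a t)"
        using nn_integral_has_integral_lebesgue'[OF _ ph] p_nn by (simp add: mult.commute nn_integral_completion)
      finally show ?thesis using r_nn[of t] a0 by (simp add: ennreal_mult')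
    qed
    have "(\<integral>\<^sup>+t\<in>I. ennreal \<bar>r t * a t\<bar> \<partial>lebesgue) < \<infinity>"
    proof -
      have "(\<integral>\<^sup>+t\<in>I. ennreal \<bar>r t * a t\<bar> \<partial>lebesgue) = (\<integral>\<^sup>+t\<in>I. (\<integral>\<^sup>+s\<in>I \<inter> {..<t}.
          ennreal ((bc_vec None \<bullet> (R s *v bc_vec None)) * ((J *v bc_vec None) \<bullet> (R t *v (J *v bc_vec None)))) \<partial>lebesgue) \<partial>lebesgue)"
      proof (rule nn_integral_cong)
        fix t
        show "ennreal \<bar>r t * a t\<bar> * indicator I t = (\<integral>\<^sup>+s\<in>I \<inter> {..<t}.
          ennreal ((bc_vec None \<bullet> (R s *v bc_vec None)) * ((J *v bc_vec None) \<bullet> (R t *v (J *v bc_vec None)))) \<partial>lebesgue) * indicator I t"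
          by (cases "t \<in> I") (simp only: inner, simp)
      qed
      then show ?thesis using fin by simp
    qed
    then show ?thesis by (rule integrable_on_of_lebesgue[OF ra_meas]) (simp add: entry_def del: greaterThanAtMost_iff)
  qed
  then show ?thesis by (simp add: a_def)
qed

sublocale dirac_entries p b r
proof
  show "p integrable_on {0..1}" by (rule p_int')
  show "(\<lambda>t. \<bar>b t\<bar>) integrable_on {0..1}"
    using pb_int(2) by (simp add: absolutely_integrable_on_def)
  show "(\<lambda>t. r t * integral {0..t} p) integrable_on {0..1}"
    using ra_abs_int by (rule set_lebesgue_integral_eq_integral(1))
  show "p t * r t - (b t)\<^sup>2 = 1 / 4" if "t \<in> {0<..1}" for t
    using R_det[of t] sub_I that by (auto simp: entry_def)
  show "\<exists>K. \<forall>t\<in>{\<eta>..1}. \<bar>p t\<bar> \<le> K \<and> \<bar>b t\<bar> \<le> K \<and> \<bar>r t\<bar> \<le> K" if "\<eta> \<in> {0<..1}" for \<eta>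
    by (rule entry_bounded) (use sub_I that in auto)
qed (use entry_meas p_nn r_nn in auto)

end

lemma tendsto_at_left_1:
  fixes v :: "real \<Rightarrow> 'a::t2_space"
  assumes "continuous_on {\<eta>..1} v" "\<eta> < 1"
  shows "(v \<longlongrightarrow> v 1) (at_left 1)"
proof -
  have "(v \<longlongrightarrow> v 1) (at 1 within {\<eta>..1})"
    using assms(1) unfolding continuous_on by (rule bspec) (use assms(2) in simp)
  then show ?thesis using assms(2) by (simp add: at_within_Icc_at_left)
qed

section \<open>Eigenfunctions as multiples of the fundamental solution\<close>

context dirac_coefficient
begin

definition fund :: "real \<Rightarrow> real \<Rightarrow> real ^ 2" where
  "fund l t = vector [solX l t, solY l t]"

lemma fund_nth: "fund l t $ 1 = solX l t" "fund l t $ 2 = solY l t"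
  by (simp_all add: fund_def)

text \<open>Multiplication by R removes the inverse, and J d = (-d_2, d_1) then reads off the
  first-order system.\<close>

lemma derivative_iff:
  assumes t: "t \<in> {0<..1}"
  shows "l *\<^sub>R x = matrix_inv (R t) *v (J *v d) \<longleftrightarrow>
    d $ 1 = l * (b t * x $ 1 + r t * x $ 2) \<and> d $ 2 = - l * (p t * x $ 1 + b t * x $ 2)"
proof -
  have tI: "t \<in> I" using t sub_I by auto
  have "l *\<^sub>R x = matrix_inv (R t) *v (J *v d) \<longleftrightarrow> R t *v (l *\<^sub>R x) = J *v d"
    using R_inv[OF tI] by (metis matrix_vector_mul_assoc matrix_vector_mul_lid)
  also have "\<dots> \<longleftrightarrow> (R t *v (l *\<^sub>R x)) $ 1 = (J *v d) $ 1 \<and> (R t *v (l *\<^sub>R x)) $ 2 = (J *v d) $ 2"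
    by (simp add: vec_eq_iff forall_2)
  also have "\<dots> \<longleftrightarrow> d $ 1 = l * (b t * x $ 1 + r t * x $ 2) \<and> d $ 2 = - l * (p t * x $ 1 + b t * x $ 2)"
    unfolding J_mult mult_2[of "R t"] entry_eq[OF t] R_sym[OF tI] by (auto simp: algebra_simps)
  finally show ?thesis .
qed

lemma eigenfunction_solution:
  assumes eig: "eigenfunction I R None r1 l f"
  shows "solution l (\<lambda>t. f t $ 1) (\<lambda>t. f t $ 2)" "((\<lambda>t. f t $ 2) \<longlongrightarrow> 0) (at_right 0)"
proof -
  have ac: "\<And>a b. {a..b} \<subseteq> I \<Longrightarrow> abs_continuous_on a b f"
    and de: "AE t in lebesgue. t \<in> I \<longrightarrow> (\<exists>d. (f has_vector_derivative d) (at t within I) \<and> l *\<^sub>R f t = matrix_inv (R t) *v (J *v d))"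
    and lim: "((\<lambda>s. f s \<bullet> (J *v bc_vec None)) \<longlongrightarrow> 0) (at_right 0)"
    using eig by (auto simp: eigenfunction_def dirac_graph_def)
  show "((\<lambda>t. f t $ 2) \<longlongrightarrow> 0) (at_right 0)"
    using lim by (simp add: dot_2 J_mult bc_vec_def)
  obtain N where N: "N \<in> null_sets lebesgue" 
    "{t \<in> space lebesgue. \<not> (t \<in> I \<longrightarrow> (\<exists>d. (f has_vector_derivative d) (at t within I) \<and> l *\<^sub>R f t = matrix_inv (R t) *v (J *v d)))} \<subseteq> N"
    using de unfolding eventually_ae_filter by blast
  have Nn: "negligible N" using N(1) by (simp add: negligible_iff_null_sets)
  show "solution l (\<lambda>t. f t $ 1) (\<lambda>t. f t $ 2)"
    unfolding solution_def
  proof (intro ballI)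
    fix \<eta> :: real assume \<eta>: "\<eta> \<in> {0<..1}"
    have sub: "{\<eta>..1} \<subseteq> I" using \<eta> sub_I by auto
    have "continuous_on {\<eta>..1} f" by (rule abs_continuous_imp_continuous[OF ac[OF sub]])
    then have "bounded ((\<lambda>t. f t $ i) ` {\<eta>..1})" for i
      by (intro compact_imp_bounded compact_continuous_image continuous_intros) auto
    note rows = bounded_rows[OF bdd[OF \<eta>] this this]
    have d: "((\<lambda>t. f t $ 1) has_vector_derivative l * (b x * f x $ 1 + r x * f x $ 2)) (at x within {\<eta>..1}) \<and>
        ((\<lambda>t. f t $ 2) has_vector_derivative - l * (p x * f x $ 1 + b x * f x $ 2)) (at x within {\<eta>..1})"
      if x: "x \<in> {\<eta>..1} - N" for x
    proof -
      have xI: "x \<in> I" "x \<in> {0<..1}" using x \<eta> sub by auto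
      then obtain d where d: "(f has_vector_derivative d) (at x within I)" "l *\<^sub>R f x = matrix_inv (R x) *v (J *v d)"
        using N(2) x by auto
      have "(f has_vector_derivative d) (at x within {\<eta>..1})"
        by (rule has_vector_derivative_within_subset[OF d(1) sub])
      then have "((\<lambda>t. f t $ i) has_vector_derivative d $ i) (at x within {\<eta>..1})" for i
        by (rule bounded_linear.has_vector_derivative[OF bounded_linear_vec_nth])
      then show ?thesis using d(2)[unfolded derivative_iff[OF xI(2)]] by metis
    qed
    have "bounded ((\<lambda>t. c * h t) ` S)" if "bounded (h ` S)" for c and h :: "real \<Rightarrow> real" and S
      using bounded_scaling[OF that, of c] by (simp add: image_image)
    note rows = this[OF rows(1), of l] this[OF rows(2), of "- l"]
    show "primitive_on \<eta> 1 (\<lambda>t. f t $ 1) (\<lambda>t. l * (b t * f t $ 1 + r t * f t $ 2)) \<and>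
         primitive_on \<eta> 1 (\<lambda>t. f t $ 2) (\<lambda>t. - l * (p t * f t $ 1 + b t * f t $ 2))"
      using rows by (intro conjI primitive_onI[OF abs_continuous_component[OF ac[OF sub]] Nn]) (use d in auto)
  qed
qed

text \<open>Uniqueness under the left boundary condition leaves only multiples of
  \<open>fund\<close>; the right condition passes to the value at 1 because f is continuous
  there.\<close>

lemma eigenfunction_cases:
  assumes eig: "eigenfunction I R None r1 l f"
  obtains c where "c \<noteq> 0" "\<And>t. t \<in> {0<..1} \<Longrightarrow> f t = c *\<^sub>R fund l t" "fund l 1 \<bullet> (J *v bc_vec r1) = 0"
proof -
  have ac: "\<And>a b. {a..b} \<subseteq> I \<Longrightarrow> abs_continuous_on a b f"
    and lim: "((\<lambda>s. f s \<bullet> (J *v bc_vec r1)) \<longlongrightarrow> 0) (at_left 1)"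
    and nz: "\<exists>t\<in>I. f t \<noteq> 0"
    using eig by (auto simp: eigenfunction_def dirac_graph_def)
  obtain c where c: "\<And>t. t \<in> {0<..1} \<Longrightarrow> f t $ 1 = c * solX l t \<and> f t $ 2 = c * solY l t"
    using solution_unique[OF eigenfunction_solution[OF eig]] by metis
  have f: "f t = c *\<^sub>R fund l t" if "t \<in> {0<..1}" for t
    using c[OF that] by (simp add: vec_eq_iff forall_2 fund_nth)
  have "c \<noteq> 0"
  proof
    \<comment> \<open>For I = [0,1] the nonzero value might sit at 0 alone; continuity at 0 excludes
      this.\<close>
    assume "c = 0"
    then have z: "f t = 0" if "t \<in> {0<..1}" for t using f[OF that] by simp
    obtain t where t: "t \<in> I" "f t \<noteq> 0" using nz by blast
    then have "t \<notin> {0<..1}" using z by blast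
    then have t0: "t = 0" "I = {0..1}" using t(1) I by auto
    have "continuous_on {0..1} f" by (rule abs_continuous_imp_continuous[OF ac]) (use t0 in simp)
    then have "(f \<longlongrightarrow> f 0) (at 0 within {0..1})" unfolding continuous_on by (rule bspec) simp
    then have "(f \<longlongrightarrow> f 0) (at_right 0)" by (simp add: at_within_Icc_at_right)
    moreover have "(f \<longlongrightarrow> 0) (at_right 0)"
    proof (rule tendsto_eventually)
      have "\<forall>\<^sub>F s in at_right 0. s \<in> {0<..<(1::real)}" by (intro eventually_at_right_real) auto
      then show "\<forall>\<^sub>F s in at_right 0. f s = 0" by eventually_elim (use z in auto)
    qed
    ultimately have "f 0 = 0" using tendsto_unique trivial_limit_at_right_real by blast
    then show False using t t0 by simp
  qed
  moreover have "fund l 1 \<bullet> (J *v bc_vec r1) = 0"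
  proof -
    have "continuous_on {1/2..1} f" by (rule abs_continuous_imp_continuous[OF ac]) (use sub_I in auto)
    then have "((\<lambda>s. f s \<bullet> (J *v bc_vec r1)) \<longlongrightarrow> f 1 \<bullet> (J *v bc_vec r1)) (at_left 1)"
      by (intro tendsto_intros tendsto_at_left_1[of "1/2"]) auto
    then have "f 1 \<bullet> (J *v bc_vec r1) = 0" using tendsto_unique[OF _ _ lim] trivial_limit_at_left_real by blast
    then show ?thesis using f[of 1] \<open>c \<noteq> 0\<close> by simp
  qed
  ultimately show ?thesis using that f by blast
qed

lemma form_fund:
  assumes t: "t \<in> {0<..1}"
  shows "(c *\<^sub>R fund l t) \<bullet> (R t *v (c *\<^sub>R fund l t)) = c\<^sup>2 * q l l t"
proof -
  have tI: "t \<in> I" using t sub_I by auto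
  show ?thesis unfolding dot_2 mult_2 q_def entry_eq[OF t] R_sym[OF tI]
    by (simp add: fund_nth power2_eq_square algebra_simps)
qed

lemma sq_norm_lebesgue:
  "integrable lebesgue (\<lambda>s. indicator {0..1} s * q l l s)" "(\<integral>s. indicator {0..1} s * q l l s \<partial>lebesgue) = sq_norm l"
  using q_abs_int[of l l] set_lebesgue_integral_eq_integral(2)[OF q_abs_int[of l l]]
  by (simp_all add: set_integrable_def set_lebesgue_integral_def sq_norm_def)

lemma L2_norm_fund:
  assumes f: "\<And>t. t \<in> {0<..1} \<Longrightarrow> f t = c *\<^sub>R fund l t"
  shows "L2_norm_sq I R f = c\<^sup>2 * sq_norm l"
proof -
  \<comment> \<open>The formula for f is given on (0,1]; k is the discrepancy at the single point 0,
    which has measure 0.\<close>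
  define k where "k = indicator I 0 * (f 0 \<bullet> (R 0 *v f 0)) - c\<^sup>2 * q l l 0"
  have eq: "indicator I s *\<^sub>R (f s \<bullet> (R s *v f s)) = indicator {0} s * k + c\<^sup>2 * (indicator {0..1} s * q l l s)" for s
  proof (cases "s \<in> {0<..1}")
    case True
    then show ?thesis using f[OF True] form_fund[OF True, of c l] sub_I by (auto simp: indicator_def)
  next
    case False
    then show ?thesis using sub_I by (cases "s = 0") (auto simp: indicator_def k_def)
  qed
  have i0: "integrable lebesgue (\<lambda>s. indicator {0::real} s * k)" by simp
  have "L2_norm_sq I R f = (\<integral>s. indicator {0} s * k + c\<^sup>2 * (indicator {0..1} s * q l l s) \<partial>lebesgue)"
    unfolding L2_norm_sq_def set_lebesgue_integral_def eq ..
  also have "\<dots> = (\<integral>s. indicator {0} s * k \<partial>lebesgue) + c\<^sup>2 * sq_norm l"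
    using i0 sq_norm_lebesgue[of l] by (subst Bochner_Integration.integral_add) auto
  finally show ?thesis by simp
qed

text \<open>If u lies in I, the entries are bounded on [u,1], so \<open>fund\<close> is even
  Lipschitz there; for I = [0,1] this includes u = 0.\<close>

lemma fund_abs_continuous:
  assumes "{u..v} \<subseteq> I"
  shows "abs_continuous_on u v (fund l)"
proof (cases "u \<le> v")
  case True
  then have "u \<in> I" "v \<in> I" using assms by auto
  then have uI: "u \<in> I" "v \<le> 1" "0 \<le> u" using sub_I by auto
  note pr = sol_primitive[OF uI(3) entry_bounded[OF uI(1)], of l]
  obtain K where K: "0 \<le> K" "\<And>s t. s \<in> {u..1} \<Longrightarrow> t \<in> {u..1} \<Longrightarrow> dist (solX l s) (solX l t) \<le> K * \<bar>t - s\<bar>"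
    using primitive_on_lipschitz[OF pr(1)] by metis
  obtain L where L: "0 \<le> L" "\<And>s t. s \<in> {u..1} \<Longrightarrow> t \<in> {u..1} \<Longrightarrow> dist (solY l s) (solY l t) \<le> L * \<bar>t - s\<bar>"
    using primitive_on_lipschitz[OF pr(2)] by metis
  show ?thesis
  proof (rule lipschitz_abs_continuous)
    show "0 \<le> K + L" using K L by simp
    fix s t assume st: "u \<le> s" "s \<le> t" "t \<le> v"
    have "dist (fund l s) (fund l t) \<le> (\<Sum>i\<in>UNIV. \<bar>(fund l s - fund l t) $ i\<bar>)"
      unfolding dist_norm by (rule norm_le_l1_cart)
    also have "\<dots> = dist (solX l s) (solX l t) + dist (solY l s) (solY l t)"
      by (simp add: sum_2 fund_nth dist_real_def)
    also have "\<dots> \<le> K * \<bar>t - s\<bar> + L * \<bar>t - s\<bar>" using st uI by (intro add_mono K(2) L(2)) auto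
    finally show "dist (fund l s) (fund l t) \<le> (K + L) * (t - s)" using st by (simp add: algebra_simps)
  qed
next
  case False
  show ?thesis by (rule lipschitz_abs_continuous[of 0]) (use False in auto)
qed

lemma fund_continuous: "continuous_on {0..1} (fund l)"
proof -
  have "fund l = (\<lambda>t. \<chi> i. if i = 1 then solX l t else solY l t)"
    by (auto simp: fun_eq_iff vec_eq_iff forall_2 fund_nth)
  moreover have "continuous_on {0..1} (\<lambda>t. if i = 1 then solX l t else solY l t)" for i :: 2
    by (cases "i = 1") (simp_all add: sol_cont)
  ultimately show ?thesis by (simp add: continuous_on_vec_lambda)
qed

lemma fund_L2: "in_L2 I R (\<lambda>t. k *\<^sub>R fund l t)"
  unfolding in_L2_def
proof
  have "(\<lambda>t. indicator {0..1} t *\<^sub>R (k *\<^sub>R fund l t)) \<in> borel_measurable borel"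
    by (intro borel_measurable_continuous_on_indicator continuous_intros fund_continuous) auto
  then have m: "(\<lambda>t. indicator {0..1} t *\<^sub>R (k *\<^sub>R fund l t)) \<in> borel_measurable lebesgue"
    by (simp add: measurable_completion)
  have IL: "I \<in> sets lebesgue" using I by auto
  have m2: "(\<lambda>t. indicator I t *\<^sub>R (indicator {0..1} t *\<^sub>R (k *\<^sub>R fund l t))) \<in> borel_measurable lebesgue"
    by (rule borel_measurable_scaleR[OF borel_measurable_indicator[OF IL] m])
  have "(\<lambda>t. indicat_real I t *\<^sub>R (indicat_real {0..1} t *\<^sub>R (k *\<^sub>R fund l t))) = (\<lambda>t. indicat_real I t *\<^sub>R (k *\<^sub>R fund l t))"
    using sub_I by (auto simp: fun_eq_iff indicator_def)
  then show "set_borel_measurable lebesgue I (\<lambda>t. k *\<^sub>R fund l t)"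
    using m2 unfolding set_borel_measurable_def by (simp only:)
  have "(\<integral>\<^sup>+s\<in>I. ennreal ((k *\<^sub>R fund l s) \<bullet> (R s *v (k *\<^sub>R fund l s))) \<partial>lebesgue)
      = (\<integral>\<^sup>+s. ennreal (k\<^sup>2 * norm (indicator {0..1} s * q l l s)) \<partial>lebesgue)"
  proof (rule nn_integral_cong_AE)
    have "AE s in lebesgue. s \<notin> {0::real}" by (rule AE_not_in) simp
    then show "AE s in lebesgue. ennreal ((k *\<^sub>R fund l s) \<bullet> (R s *v (k *\<^sub>R fund l s))) * indicator I s
      = ennreal (k\<^sup>2 * norm (indicator {0..1} s * q l l s))"
    proof eventually_elim
      case (elim s)
      show ?case
      proof (cases "s \<in> {0<..1}")
        case True
        then show ?thesis using form_fund[OF True, of k l] q_nonneg[OF True, of l] sub_I by (auto simp: indicator_def)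
      next
        case False
        then show ?thesis using sub_I elim by (auto simp: indicator_def)
      qed
    qed
  qed
  also have "\<dots> = k\<^sup>2 * (\<integral>\<^sup>+s. ennreal (norm (indicator {0..1} s * q l l s)) \<partial>lebesgue)"
    using sq_norm_lebesgue(1)[of l, THEN borel_measurable_integrable]
    by (simp add: ennreal_mult' nn_integral_cmult)
  also have "\<dots> < \<infinity>"
    using sq_norm_lebesgue(1)[of l] unfolding integrable_iff_bounded by (simp add: ennreal_mult_less_top)
  finally show "(\<integral>\<^sup>+s\<in>I. ennreal ((k *\<^sub>R fund l s) \<bullet> (R s *v (k *\<^sub>R fund l s))) \<partial>lebesgue) < \<infinity>" .
qed

text \<open>The exceptional null sets for the intervals [1/(n+1),1] are united. Removing 0 and 1 as
  well places every remaining point in the interior of one of these intervals, so the derivative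
  within it is two-sided.\<close>

lemma fund_derivative:
  "AE t in lebesgue. t \<in> I \<longrightarrow> (\<exists>d. (fund l has_vector_derivative d) (at t within I) \<and>
     l *\<^sub>R fund l t = matrix_inv (R t) *v (J *v d))"
proof -
  have "\<exists>N. negligible N \<and> (\<forall>x\<in>{1 / Suc n..1} - N.
      (solX l has_vector_derivative l * (b x * solX l x + r x * solY l x)) (at x within {1 / Suc n..1}) \<and>
      (solY l has_vector_derivative - l * (p x * solX l x + b x * solY l x)) (at x within {1 / Suc n..1}))" for n
  proof -
    have n: "1 / Suc n \<in> {0<..(1::real)}" by auto
    have "primitive_on (1 / Suc n) 1 (solX l) (\<lambda>t. l * (b t * solX l t + r t * solY l t))"
      "primitive_on (1 / Suc n) 1 (solY l) (\<lambda>t. - l * (p t * solX l t + b t * solY l t))"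
      using sol_solution[of l] n unfolding solution_def by blast+
    from primitive_on_derivative[OF this(1)] primitive_on_derivative[OF this(2)]
    obtain N M where "negligible N" "negligible M"
      "\<And>x. x \<in> {1 / Suc n..1} - N \<Longrightarrow> (solX l has_vector_derivative l * (b x * solX l x + r x * solY l x)) (at x within {1 / Suc n..1})"
      "\<And>x. x \<in> {1 / Suc n..1} - M \<Longrightarrow> (solY l has_vector_derivative - l * (p x * solX l x + b x * solY l x)) (at x within {1 / Suc n..1})"
      by metis
    then show ?thesis by (intro exI[of _ "N \<union> M"]) auto
  qed
  then obtain N where N: "\<And>n. negligible (N n)"
    "\<And>n x. x \<in> {1 / Suc n..1} - N n \<Longrightarrow>
      (solX l has_vector_derivative l * (b x * solX l x + r x * solY l x)) (at x within {1 / Suc n..1}) \<and>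
      (solY l has_vector_derivative - l * (p x * solX l x + b x * solY l x)) (at x within {1 / Suc n..1})"
    by metis
  have "negligible ({0,1} \<union> (\<Union>n. N n))"
    by (intro negligible_Un negligible_Union_nat N negligible_finite) auto
  then have "AE t in lebesgue. t \<notin> {0,1} \<union> (\<Union>n. N n)"
    by (intro AE_not_in) (simp add: negligible_iff_null_sets)
  then show ?thesis
  proof eventually_elim
    case (elim t)
    show ?case
    proof
      assume "t \<in> I"
      then have t: "0 < t" "t < 1" using elim sub_I by (force simp: less_le)+
      obtain n where n: "1 / Suc n < t" using reals_Archimedean[OF t(1)] by (auto simp: inverse_eq_divide)
      have int: "t \<in> interior {1 / Suc n..1}" using n t by (simp add: interior_atLeastAtMost_real)
      have "t \<in> {1 / Suc n..1} - N n" using n t elim by auto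
      from N(2)[OF this]
      have d: "(solX l has_vector_derivative l * (b t * solX l t + r t * solY l t)) (at t)"
        "(solY l has_vector_derivative - l * (p t * solX l t + b t * solY l t)) (at t)"
        unfolding at_within_interior[OF int] by auto
      let ?d = "vector [l * (b t * solX l t + r t * solY l t), - l * (p t * solX l t + b t * solY l t)] :: real ^ 2"
      have "((\<lambda>t. solX l t *\<^sub>R axis 1 1 + solY l t *\<^sub>R axis 2 1 :: real ^ 2) has_vector_derivative
         (l * (b t * solX l t + r t * solY l t)) *\<^sub>R axis 1 1 + (- l * (p t * solX l t + b t * solY l t)) *\<^sub>R axis 2 1) (at t)"
        by (intro has_vector_derivative_add bounded_linear.has_vector_derivative[OF bounded_linear_scaleR_left] d)
      moreover have "(\<lambda>t. solX l t *\<^sub>R axis 1 1 + solY l t *\<^sub>R axis 2 1) = fund l"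
        by (auto simp: fun_eq_iff vec_eq_iff forall_2 fund_nth axis_def)
      moreover have "(l * (b t * solX l t + r t * solY l t)) *\<^sub>R axis 1 1 + (- l * (p t * solX l t + b t * solY l t)) *\<^sub>R axis 2 1 = ?d"
        by (auto simp: vec_eq_iff forall_2 axis_def)
      ultimately have "(fund l has_vector_derivative ?d) (at t)" by simp
      then have "(fund l has_vector_derivative ?d) (at t within I)" by (rule has_vector_derivative_at_within)
      moreover have "t \<in> {0<..1}" using t by auto
      ultimately show "\<exists>d. (fund l has_vector_derivative d) (at t within I) \<and> l *\<^sub>R fund l t = matrix_inv (R t) *v (J *v d)"
        using derivative_iff[of t l "fund l t" ?d] by (intro exI[of _ ?d]) (simp add: fund_nth)
    qed
  qed
qed

lemma fund_eigenfunction: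
  assumes "fund l 1 \<bullet> (J *v bc_vec r1) = 0"
  shows "eigenfunction I R None r1 l (fund l)"
  unfolding eigenfunction_def dirac_graph_def
proof (intro conjI allI impI)
  show "in_L2 I R (fund l)" using fund_L2[of 1 l] by simp
  show "((\<lambda>s. fund l s \<bullet> (J *v bc_vec None)) \<longlongrightarrow> 0) (at_right 0)"
    using sol_lim(2)[of l] by (simp add: dot_2 J_mult bc_vec_def fund_nth)
  have "((\<lambda>s. fund l s \<bullet> (J *v bc_vec r1)) \<longlongrightarrow> fund l 1 \<bullet> (J *v bc_vec r1)) (at_left 1)"
    by (intro tendsto_intros tendsto_at_left_1[OF fund_continuous]) auto
  then show "((\<lambda>s. fund l s \<bullet> (J *v bc_vec r1)) \<longlongrightarrow> 0) (at_left 1)" using assms by simp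
  have "fund l 1 \<noteq> 0" using sol_nonzero[of 1 l] by (auto simp: vec_eq_iff forall_2 fund_nth)
  then show "\<exists>t\<in>I. fund l t \<noteq> 0" using sub_I by force
qed (use fund_abs_continuous fund_L2 fund_derivative in auto)

lemma eigenvalues_eq: "eigenvalues I R None r1 = {l. fund l 1 \<bullet> (J *v bc_vec r1) = 0}"
proof (intro equalityI subsetI)
  fix l assume "l \<in> eigenvalues I R None r1"
  then obtain f where "eigenfunction I R None r1 l f" by (auto simp: eigenvalues_def)
  then show "l \<in> {l. fund l 1 \<bullet> (J *v bc_vec r1) = 0}" by (rule eigenfunction_cases) simp
next
  fix l assume "l \<in> {l. fund l 1 \<bullet> (J *v bc_vec r1) = 0}"
  then have "eigenfunction I R None r1 l (fund l)" by (intro fund_eigenfunction) simp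
  then show "l \<in> eigenvalues I R None r1" by (auto simp: eigenvalues_def)
qed

text \<open>Whatever eigenfunction is chosen, it is a nonzero multiple of \<open>fund\<close>, and
  the square of the factor cancels in the quotient.\<close>

lemma right_weight_eq:
  assumes "l \<in> eigenvalues I R None r1"
  shows "right_weight I R None r1 l = ((solX l 1)\<^sup>2 + (solY l 1)\<^sup>2) / sq_norm l"
proof -
  define f where "f = (SOME f. eigenfunction I R None r1 l f)"
  have "\<exists>f. eigenfunction I R None r1 l f" using assms by (simp add: eigenvalues_def)
  then have eig: "eigenfunction I R None r1 l f" unfolding f_def by (rule someI_ex)
  obtain c where c: "c \<noteq> 0" "\<And>t. t \<in> {0<..1} \<Longrightarrow> f t = c *\<^sub>R fund l t"
    using eigenfunction_cases[OF eig] by metis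
  have "f 1 \<bullet> f 1 = c\<^sup>2 * ((solX l 1)\<^sup>2 + (solY l 1)\<^sup>2)"
    using c(2)[of 1] by (simp add: dot_2 fund_nth power2_eq_square algebra_simps)
  then show ?thesis using c(1) L2_norm_fund[OF c(2)]
    by (simp add: right_weight_def f_def[symmetric] Let_def)
qed

end

section \<open>Phase functions and their point measures\<close>

text \<open>The inverse of \<open>bc_angle\<close> on [0, 2 \<pi>).\<close>

definition bc_of :: "real \<Rightarrow> real option" where
  "bc_of \<theta> = (if \<theta> = 0 then None else Some (cot (\<theta> / 2)))"

text \<open>The representative of x modulo 2 \<pi> in [0, 2 \<pi>).\<close>

definition circle_residue :: "real \<Rightarrow> real" where
  "circle_residue x = x - 2 * pi * of_int \<lfloor>x / (2 * pi)\<rfloor>"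

lemma two_pi_pos: "0 < 2 * pi" by simp

lemma circle_residue_range: "circle_residue x \<in> {0..<2 * pi}"
proof -
  define k where "k = real_of_int \<lfloor>x / (2 * pi)\<rfloor>"
  have "k \<le> x / (2 * pi)" "x / (2 * pi) < k + 1" unfolding k_def by linarith+
  then have "k * (2 * pi) \<le> x" "x < (k + 1) * (2 * pi)" by (simp_all only: pos_le_divide_eq pos_divide_less_eq two_pi_pos)
  then show ?thesis unfolding circle_residue_def k_def[symmetric] by (simp add: algebra_simps)
qed

lemma circle_residue_unique:
  assumes "\<theta> \<in> {0..<2 * pi}" "x = \<theta> + 2 * pi * of_int k"
  shows "circle_residue x = \<theta>"
proof -
  have "x / (2 * pi) = \<theta> / (2 * pi) + of_int k" using assms(2) by (simp add: field_simps)
  moreover have "0 \<le> \<theta> / (2 * pi)" "\<theta> / (2 * pi) < 1" using assms(1) by (auto simp: field_simps)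
  ultimately have "\<lfloor>x / (2 * pi)\<rfloor> = k" by linarith
  then show ?thesis using assms(2) by (simp add: circle_residue_def)
qed

lemma cis_circle_residue: "cis (circle_residue x) = cis x"
proof -
  have "cis (circle_residue x) = cis (x + 2 * pi * of_int (- \<lfloor>x / (2 * pi)\<rfloor>))"
    by (simp add: circle_residue_def)
  also have "\<dots> = cis x * cis (2 * pi * of_int (- \<lfloor>x / (2 * pi)\<rfloor>))" by (simp add: cis_mult)
  also have "cis (2 * pi * of_int (- \<lfloor>x / (2 * pi)\<rfloor>)) = 1" by (intro cis_multiple_2pi) auto
  finally show ?thesis by simp
qed

lemma circle_residue_measurable [measurable]: "circle_residue \<in> borel_measurable borel"
  unfolding circle_residue_def by measurable

lemma bc_angle_range: "bc_angle r \<in> {0..<2 * pi}"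
proof (cases r)
  case (Some x)
  then show ?thesis using arctan_lbound[of x] arctan_ubound[of x] by (auto simp: bc_angle_def algebra_simps)
qed (simp add: bc_angle_def)

lemma bc_of_angle: "bc_of (bc_angle r) = r"
proof (cases r)
  case (Some x)
  have "arctan x < pi / 2" by (rule arctan_ubound)
  moreover have "cot (pi / 2 - arctan x) = x"
    using tan_arctan[of x] by (simp add: cot_def tan_def cos_diff sin_diff)
  moreover have "2 * (pi / 2 - arctan x) / 2 = pi / 2 - arctan x" by simp
  ultimately show ?thesis using Some by (simp only: bc_angle_def bc_of_def option.case) simp
qed (simp add: bc_angle_def bc_of_def)

lemma bc_angle_of:
  assumes "\<theta> \<in> {0..<2 * pi}"
  shows "bc_angle (bc_of \<theta>) = \<theta>"
proof (cases "\<theta> = 0")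
  case False
  have "arctan (cot (\<theta> / 2)) = arctan (tan (pi / 2 - \<theta> / 2))"
    by (simp add: tan_def cot_def cos_diff sin_diff)
  also have "\<dots> = pi / 2 - \<theta> / 2" by (rule arctan_tan) (use assms False in auto)
  finally show ?thesis using False by (simp add: bc_angle_def bc_of_def)
qed (simp add: bc_angle_def bc_of_def)

text \<open>In the application \<open>atoms \<theta>\<close> are the eigenvalues for the right boundary condition of angle \<open>\<theta>\<close>, and \<open>\<mu> \<theta>\<close>
  is the right spectral measure. The function \<open>push f\<close> is \<open>f \<circ> \<psi>\<^sup>-\<^sup>1\<close>, extended by \<open>0\<close> off the range of \<open>\<psi>\<close>.\<close>

locale phase =
  fixes \<psi> \<psi>' :: "real \<Rightarrow> real"
  assumes deriv: "\<And>l. (\<psi> has_real_derivative \<psi>' l) (at l)"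
    and deriv_cont: "\<And>l. isCont \<psi>' l" and deriv_pos: "\<And>l. 0 < \<psi>' l"
    and zero: "\<psi> 0 = 0"
begin

definition atoms :: "real \<Rightarrow> real set" where
  "atoms \<theta> = {l. \<exists>k::int. \<psi> l + \<theta> = 2 * pi * of_int k}"

definition weight :: "real \<Rightarrow> real" where "weight l = 2 / \<psi>' l"

definition \<mu> :: "real \<Rightarrow> real measure" where
  "\<mu> \<theta> = distr (density (count_space (atoms \<theta>)) (\<lambda>l. ennreal (weight l))) borel (\<lambda>l. l)"

definition push :: "(real \<Rightarrow> 'a::zero) \<Rightarrow> real \<Rightarrow> 'a" where
  "push f s = (if s \<in> range \<psi> then f (inv \<psi> s) else 0)"

lemma weight_pos: "0 < weight l" using deriv_pos[of l] by (simp add: weight_def)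

lemma strict_mono: "strict_mono \<psi>"
proof (rule strict_monoI)
  fix x y :: real assume "x < y"
  then show "\<psi> x < \<psi> y" by (rule DERIV_pos_imp_increasing) (use deriv deriv_pos in blast)
qed

lemma inj: "inj \<psi>" using strict_mono by (rule strict_mono_imp_inj_on)

lemma cont: "isCont \<psi> l" using deriv DERIV_isCont by blast

lemma inv_eq [simp]: "inv \<psi> (\<psi> l) = l" using inj by simp

lemma push_eq [simp]: "push f (\<psi> l) = f l" by (simp add: push_def)

lemma cont_on: "continuous_on S \<psi>" using cont by (simp add: continuous_at_imp_continuous_on)

lemma open_range: "open (range \<psi>)"
  by (rule invariance_of_domain[OF cont_on open_UNIV inj])

lemma cont_inv: "continuous_on (range \<psi>) (inv \<psi>)"
proof -
  obtain g where g: "homeomorphism UNIV (range \<psi>) \<psi> g"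
    using invariance_of_domain_homeomorphism[OF open_UNIV cont_on _ inj] by auto
  then have "g s = inv \<psi> s" if "s \<in> range \<psi>" for s
    using that inv_eq unfolding homeomorphism_def by auto
  then show ?thesis using g unfolding homeomorphism_def by (metis continuous_on_cong)
qed

lemma cont_measurable [measurable]: "\<psi> \<in> borel_measurable borel" "\<psi>' \<in> borel_measurable borel" "weight \<in> borel_measurable borel"
proof -
  show "\<psi> \<in> borel_measurable borel" by (rule borel_measurable_continuous_onI[OF cont_on])
  show *: "\<psi>' \<in> borel_measurable borel"
    by (rule borel_measurable_continuous_onI) (use deriv_cont in \<open>simp add: continuous_at_imp_continuous_on\<close>)
  show "weight \<in> borel_measurable borel" unfolding weight_def using * by measurable
qed

lemma range_measurable [measurable]: "range \<psi> \<in> sets borel" using open_range by simp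

lemma push_measurable:
  assumes [measurable]: "f \<in> borel_measurable borel"
  shows "push f \<in> borel_measurable borel"
proof -
  have [measurable]: "(\<lambda>s. indicator (range \<psi>) s *\<^sub>R inv \<psi> s) \<in> borel_measurable borel"
    by (rule borel_measurable_continuous_on_indicator[OF range_measurable cont_inv])
  have "push f = (\<lambda>s. if s \<in> range \<psi> then f (indicator (range \<psi>) s *\<^sub>R inv \<psi> s) else 0)"
    by (auto simp: push_def fun_eq_iff)
  also have "\<dots> \<in> borel_measurable borel" by measurable
  finally show ?thesis .
qed

text \<open>The change of variables s = \<psi>(l) is made on [-n,n] and extended by monotone limits.
  The image is Lebesgue measure restricted to the range, since \<psi> may be bounded.\<close>

lemma distr_deriv: "distr (density lborel (\<lambda>l. ennreal (\<psi>' l))) borel \<psi> = density lborel (indicator (range \<psi>))"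
proof (rule measure_eqI)
  fix A assume "A \<in> sets (distr (density lborel (\<lambda>l. ennreal (\<psi>' l))) borel \<psi>)"
  then have A [measurable]: "A \<in> sets borel" by simp
  let ?D = "density lborel (\<lambda>l. ennreal (\<psi>' l))"
  have vm: "\<psi> -` A \<inter> {- real n..real n} \<in> sets borel" for n
    by (intro sets.Int measurable_sets_borel[OF cont_measurable(1) A]) simp
  have fin: "emeasure ?D (\<psi> -` A \<inter> {- real n..real n}) = emeasure lborel (A \<inter> {\<psi> (- real n)..\<psi> (real n)})" for n
  proof -
    have "emeasure ?D (\<psi> -` A \<inter> {- real n..real n})
       = (\<integral>\<^sup>+l. ennreal (\<psi>' l) * indicator (\<psi> -` A \<inter> {- real n..real n}) l \<partial>lborel)"
    proof (rule emeasure_density)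
      show "\<psi> -` A \<inter> {- real n..real n} \<in> sets lborel" using vm by (simp only: sets_lborel)
    qed measurable
    also have "\<dots> = (\<integral>\<^sup>+l. ennreal (indicator A (\<psi> l) * \<psi>' l * indicator {- real n..real n} l) \<partial>lborel)"
      by (intro nn_integral_cong) (auto simp: indicator_def)
    also have "\<dots> = (\<integral>\<^sup>+s. ennreal (indicator A s * indicator {\<psi> (- real n)..\<psi> (real n)} s) \<partial>lborel)"
    proof (rule nn_integral_substitution[symmetric])
      show "set_borel_measurable borel {\<psi> (- real n)..\<psi> (real n)} (indicat_real A)"
        unfolding set_borel_measurable_def by measurable
      show "continuous_on {- real n..real n} \<psi>'" using deriv_cont by (simp add: continuous_at_imp_continuous_on)
    qed (use deriv deriv_pos in \<open>auto intro: less_imp_le\<close>)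
    also have "\<dots> = (\<integral>\<^sup>+s. indicator (A \<inter> {\<psi> (- real n)..\<psi> (real n)}) s \<partial>lborel)"
      by (intro nn_integral_cong) (auto simp: indicator_def)
    finally show ?thesis by simp
  qed
  have mono: "\<psi> x \<le> \<psi> y" if "x \<le> y" for x y using strict_mono that by (simp add: strict_mono_less_eq)
  have u1: "(\<Union>n. \<psi> -` A \<inter> {- real n..real n}) = \<psi> -` A"
  proof (intro equalityI subsetI)
    fix x assume "x \<in> \<psi> -` A"
    obtain n where "\<bar>x\<bar> \<le> real n" using real_arch_simple by blast
    then show "x \<in> (\<Union>n. \<psi> -` A \<inter> {- real n..real n})" using \<open>x \<in> \<psi> -` A\<close> by (intro UN_I[of n]) auto
  qed auto
  have u2: "(\<Union>n. A \<inter> {\<psi> (- real n)..\<psi> (real n)}) = A \<inter> range \<psi>"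
  proof (intro equalityI subsetI)
    fix s assume s: "s \<in> A \<inter> range \<psi>"
    then obtain x where x: "s = \<psi> x" by blast
    obtain n where "\<bar>x\<bar> \<le> real n" using real_arch_simple by blast
    then show "s \<in> (\<Union>n. A \<inter> {\<psi> (- real n)..\<psi> (real n)})" using s x by (intro UN_I[of n]) (auto intro!: mono)
  next
    fix s assume "s \<in> (\<Union>n. A \<inter> {\<psi> (- real n)..\<psi> (real n)})"
    then obtain n where n: "s \<in> A" "\<psi> (- real n) \<le> s" "s \<le> \<psi> (real n)" by auto
    then obtain x where "\<psi> x = s" using IVT'[of \<psi> "- real n" s "real n"] cont_on by auto
    then show "s \<in> A \<inter> range \<psi>" using n by auto
  qed
  have inc2: "{\<psi> (- real n)..\<psi> (real n)} \<subseteq> {\<psi> (- real m)..\<psi> (real m)}" if "n \<le> m" for n m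
    using mono[of "- real m" "- real n"] mono[of "real n" "real m"] that by auto
  have "(SUP n. emeasure ?D (\<psi> -` A \<inter> {- real n..real n})) = emeasure ?D (\<Union>n. \<psi> -` A \<inter> {- real n..real n})"
    by (rule SUP_emeasure_incseq) (use vm in \<open>auto simp: incseq_def\<close>)
  then have "emeasure ?D (\<psi> -` A) = (SUP n. emeasure ?D (\<psi> -` A \<inter> {- real n..real n}))" unfolding u1 by simp
  also have "\<dots> = (SUP n. emeasure lborel (A \<inter> {\<psi> (- real n)..\<psi> (real n)}))" using fin by simp
  also have "\<dots> = emeasure lborel (\<Union>n. A \<inter> {\<psi> (- real n)..\<psi> (real n)})"
  proof (rule SUP_emeasure_incseq)
    show "incseq (\<lambda>n. A \<inter> {\<psi> (- real n)..\<psi> (real n)})" unfolding incseq_def using inc2 by blast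
  qed auto
  also have "\<dots> = emeasure lborel (A \<inter> range \<psi>)" unfolding u2 ..
  also have "\<dots> = (\<integral>\<^sup>+s. indicator (A \<inter> range \<psi>) s \<partial>lborel)" by simp
  also have "\<dots> = (\<integral>\<^sup>+s. indicator (range \<psi>) s * indicator A s \<partial>lborel)"
    by (intro nn_integral_cong) (auto simp: indicator_def)
  also have "\<dots> = emeasure (density lborel (indicator (range \<psi>))) A"
    by (rule emeasure_density[symmetric]) (use A in auto)
  finally show "emeasure (distr ?D borel \<psi>) A = emeasure (density lborel (indicator (range \<psi>))) A"
    by (simp add: emeasure_distr)
qed simp

lemma nn_integral_push:
  fixes F :: "real \<Rightarrow> ennreal"
  assumes [measurable]: "F \<in> borel_measurable borel"
  shows "(\<integral>\<^sup>+l. \<psi>' l * F (\<psi> l) \<partial>lborel) = (\<integral>\<^sup>+s. indicator (range \<psi>) s * F s \<partial>lborel)"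
proof -
  have "(\<integral>\<^sup>+l. \<psi>' l * F (\<psi> l) \<partial>lborel) = (\<integral>\<^sup>+s. F s \<partial>distr (density lborel (\<lambda>l. ennreal (\<psi>' l))) borel \<psi>)"
    by (simp add: nn_integral_distr nn_integral_density)
  also have "\<dots> = (\<integral>\<^sup>+s. indicator (range \<psi>) s * F s \<partial>lborel)"
    unfolding distr_deriv by (simp add: nn_integral_density)
  finally show ?thesis .
qed

lemma atoms_bij: "bij_betw (\<lambda>k::int. inv \<psi> (2 * pi * of_int k - \<theta>)) {k. 2 * pi * of_int k - \<theta> \<in> range \<psi>} (atoms \<theta>)"
proof (rule bij_betwI')
  fix x y :: int assume xy: "x \<in> {k. 2 * pi * of_int k - \<theta> \<in> range \<psi>}" "y \<in> {k. 2 * pi * of_int k - \<theta> \<in> range \<psi>}"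
  then obtain u v where uv: "2 * pi * of_int x - \<theta> = \<psi> u" "2 * pi * of_int y - \<theta> = \<psi> v" by auto
  show "(inv \<psi> (2 * pi * of_int x - \<theta>) = inv \<psi> (2 * pi * of_int y - \<theta>)) = (x = y)"
    using uv by (metis inv_eq add_diff_cancel mult_cancel_left of_int_eq_iff pi_neq_zero diff_add_cancel zero_neq_numeral mult_eq_0_iff)
next
  fix k :: int assume "k \<in> {k. 2 * pi * of_int k - \<theta> \<in> range \<psi>}"
  then obtain u where u: "2 * pi * of_int k - \<theta> = \<psi> u" by auto
  then show "inv \<psi> (2 * pi * of_int k - \<theta>) \<in> atoms \<theta>"
    by (auto simp: atoms_def intro!: exI[of _ k])
next
  fix l assume "l \<in> atoms \<theta>"
  then obtain k :: int where k: "\<psi> l + \<theta> = 2 * pi * of_int k" by (auto simp: atoms_def)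
  then have "2 * pi * of_int k - \<theta> = \<psi> l" by simp
  then show "\<exists>k\<in>{k. 2 * pi * of_int k - \<theta> \<in> range \<psi>}. l = inv \<psi> (2 * pi * of_int k - \<theta>)"
    by (intro bexI[of _ k]) auto
qed

lemma sets_\<mu> [simp, measurable_cong]: "sets (\<mu> \<theta>) = sets borel" by (simp add: \<mu>_def)
text \<open>The atoms are the preimages of those numbers 2 \<pi> k - \<theta> that lie in the range
  of \<psi>. Since \<open>push\<close> is 0 off the range, the sum may run over all integers k, a
  form that can be integrated over \<theta> term by term.\<close>

lemma nn_integral_\<mu>:
  fixes f :: "real \<Rightarrow> ennreal"
  assumes [measurable]: "f \<in> borel_measurable borel"
  shows "(\<integral>\<^sup>+l. f l \<partial>\<mu> \<theta>) = (\<integral>\<^sup>+k. push (\<lambda>l. f l * ennreal (weight l)) (2 * pi * of_int k - \<theta>) \<partial>count_space (UNIV :: int set))"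
proof -
  have "(\<integral>\<^sup>+l. f l \<partial>\<mu> \<theta>) = (\<integral>\<^sup>+l. f l * weight l \<partial>count_space (atoms \<theta>))"
    by (simp add: \<mu>_def nn_integral_distr nn_integral_density mult.commute)
  also have "\<dots> = (\<integral>\<^sup>+k. f (inv \<psi> (2 * pi * of_int k - \<theta>)) * weight (inv \<psi> (2 * pi * of_int k - \<theta>))
      \<partial>count_space {k::int. 2 * pi * of_int k - \<theta> \<in> range \<psi>})"
    by (rule nn_integral_bij_count_space[OF atoms_bij, symmetric])
  also have "\<dots> = (\<integral>\<^sup>+k. push (\<lambda>l. f l * ennreal (weight l)) (2 * pi * of_int k - \<theta>) \<partial>count_space {k::int. 2 * pi * of_int k - \<theta> \<in> range \<psi>})"
    by (intro nn_integral_cong) (auto simp: push_def)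
  also have "\<dots> = (\<integral>\<^sup>+k. push (\<lambda>l. f l * ennreal (weight l)) (2 * pi * of_int k - \<theta>) \<partial>count_space (UNIV :: int set))"
    by (rule nn_integral_count_space_eq) (auto simp: push_def)
  finally show ?thesis .
qed

lemma count_space_int: "(\<integral>\<^sup>+k. f k \<partial>count_space (UNIV :: int set)) = (\<Sum>n. f (int_decode n))"
  using nn_integral_bij_count_space[OF bij_int_decode, of f] by (simp add: nn_integral_count_space_nat)

text \<open>Averaging \<open>\<mu> \<theta>\<close> over the circle gives Lebesgue measure, since every \<open>l\<close> is an atom of exactly
  one \<open>\<mu> \<theta>\<close> and the weights are the inverse derivatives of \<open>\<psi>/2\<close>.\<close>

lemma nn_integral_\<mu>_circle:
  fixes f G :: "real \<Rightarrow> ennreal"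
  assumes [measurable]: "f \<in> borel_measurable borel" "G \<in> borel_measurable borel"
  shows "(\<integral>\<^sup>+\<theta>. indicator {0..<2 * pi} \<theta> * G \<theta> * (\<integral>\<^sup>+l. f l \<partial>\<mu> \<theta>) \<partial>lborel)
     = 2 * (\<integral>\<^sup>+l. f l * G (circle_residue (- \<psi> l)) \<partial>lborel)"
proof -
  define h where "h = push (\<lambda>l. f l * ennreal (weight l))"
  have [measurable]: "h \<in> borel_measurable borel" unfolding h_def by (rule push_measurable) measurable
  define IG where "IG \<theta> = indicator {0..<2 * pi} \<theta> * G \<theta>" for \<theta>
  have [measurable]: "IG \<in> borel_measurable borel" unfolding IG_def by measurable
  have "(\<integral>\<^sup>+\<theta>. indicator {0..<2 * pi} \<theta> * G \<theta> * (\<integral>\<^sup>+l. f l \<partial>\<mu> \<theta>) \<partial>lborel)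
    = (\<integral>\<^sup>+\<theta>. (\<Sum>n. IG \<theta> * h (2 * pi * of_int (int_decode n) - \<theta>)) \<partial>lborel)"
    by (simp add: nn_integral_\<mu> count_space_int h_def[symmetric] IG_def)
  also have "\<dots> = (\<Sum>n. \<integral>\<^sup>+\<theta>. IG \<theta> * h (2 * pi * of_int (int_decode n) - \<theta>) \<partial>lborel)"
    by (rule nn_integral_suminf) measurable
  also have "\<dots> = (\<Sum>n. \<integral>\<^sup>+s. IG (2 * pi * of_int (int_decode n) - s) * h s \<partial>lborel)"
  proof (rule suminf_cong)
    fix n
    show "(\<integral>\<^sup>+\<theta>. IG \<theta> * h (2 * pi * of_int (int_decode n) - \<theta>) \<partial>lborel) = (\<integral>\<^sup>+s. IG (2 * pi * of_int (int_decode n) - s) * h s \<partial>lborel)"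
      by (subst nn_integral_real_affine[where c="-1" and t="2 * pi * of_int (int_decode n)"]) simp_all
  qed
  also have "\<dots> = (\<integral>\<^sup>+s. (\<Sum>n. IG (2 * pi * of_int (int_decode n) - s) * h s) \<partial>lborel)"
    by (rule nn_integral_suminf[symmetric]) measurable
  also have "\<dots> = (\<integral>\<^sup>+s. G (circle_residue (- s)) * h s \<partial>lborel)"
  proof (rule nn_integral_cong)
    fix s
    \<comment> \<open>Exactly one translate 2 \<pi> k - s lies in [0, 2 \<pi>), namely the residue
      of -s, so a single term of the sum over k survives.\<close>
    define k0 where "k0 = - \<lfloor>(- s) / (2 * pi)\<rfloor>"
    have r0: "circle_residue (- s) = 2 * pi * of_int k0 - s" by (simp add: circle_residue_def k0_def)
    have other: "IG (2 * pi * of_int k - s) = 0" if "k \<noteq> k0" for k :: int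
    proof (rule ccontr)
      assume "IG (2 * pi * of_int k - s) \<noteq> 0"
      then have "2 * pi * of_int k - s \<in> {0..<2 * pi}" by (auto simp: IG_def indicator_def split: if_splits)
      then have "circle_residue (- s) = 2 * pi * of_int k - s" by (rule circle_residue_unique[of _ _ "- k"]) simp
      then show False using r0 that by simp
    qed
    have "(\<Sum>n. IG (2 * pi * of_int (int_decode n) - s) * h s) = (\<integral>\<^sup>+k. IG (2 * pi * of_int k - s) * h s \<partial>count_space (UNIV :: int set))"
      by (simp add: count_space_int)
    also have "\<dots> = (\<Sum>k\<in>{k0}. IG (2 * pi * of_int k - s) * h s)"
      by (rule nn_integral_count_space') (use other in auto)
    also have "\<dots> = G (circle_residue (- s)) * h s"
      using circle_residue_range[of "- s"] by (simp add: r0 IG_def)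
    finally show "(\<Sum>n. IG (2 * pi * of_int (int_decode n) - s) * h s) = G (circle_residue (- s)) * h s" .
  qed
  also have "\<dots> = (\<integral>\<^sup>+s. indicator (range \<psi>) s * (G (circle_residue (- s)) * h s) \<partial>lborel)"
    by (intro nn_integral_cong) (auto simp: h_def push_def)
  also have "\<dots> = (\<integral>\<^sup>+l. \<psi>' l * (G (circle_residue (- \<psi> l)) * h (\<psi> l)) \<partial>lborel)"
    by (rule nn_integral_push[symmetric]) measurable
  also have "\<dots> = (\<integral>\<^sup>+l. 2 * (f l * G (circle_residue (- \<psi> l))) \<partial>lborel)"
  proof (rule nn_integral_cong)
    fix l
    have "ennreal (\<psi>' l) * ennreal (weight l) = 2"
      using deriv_pos[of l] by (simp add: weight_def flip: ennreal_mult' ennreal_numeral)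
    then show "\<psi>' l * (G (circle_residue (- \<psi> l)) * h (\<psi> l)) = 2 * (f l * G (circle_residue (- \<psi> l)))"
      by (simp add: h_def mult_ac) (metis mult.assoc mult.commute)
  qed
  also have "\<dots> = 2 * (\<integral>\<^sup>+l. f l * G (circle_residue (- \<psi> l)) \<partial>lborel)"
    by (rule nn_integral_cmult) measurable
  finally show ?thesis .
qed

lemma finite_window: "finite {k::int. \<bar>2 * pi * of_int k - \<theta>\<bar> \<le> C}"
proof (rule finite_subset)
  show "{k::int. \<bar>2 * pi * of_int k - \<theta>\<bar> \<le> C} \<subseteq> {\<lfloor>(\<theta> - C) / (2 * pi)\<rfloor>..\<lceil>(\<theta> + C) / (2 * pi)\<rceil>}"
  proof
    fix k :: int assume "k \<in> {k::int. \<bar>2 * pi * of_int k - \<theta>\<bar> \<le> C}"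
    then have "\<theta> - C \<le> of_int k * (2 * pi)" "of_int k * (2 * pi) \<le> \<theta> + C" by (auto simp: abs_le_iff algebra_simps)
    then have "(\<theta> - C) / (2 * pi) \<le> of_int k" "of_int k \<le> (\<theta> + C) / (2 * pi)"
      by (simp_all only: pos_divide_le_eq pos_le_divide_eq two_pi_pos)
    then show "k \<in> {\<lfloor>(\<theta> - C) / (2 * pi)\<rfloor>..\<lceil>(\<theta> + C) / (2 * pi)\<rceil>}" by (simp; linarith)
  qed
qed simp

lemma push_support:
  fixes f :: "real \<Rightarrow> 'a::zero"
  assumes "\<And>x. \<bar>x\<bar> > B \<Longrightarrow> f x = 0" "push f s \<noteq> 0"
  shows "\<bar>s\<bar> \<le> max \<bar>\<psi> B\<bar> \<bar>\<psi> (- B)\<bar>"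
proof -
  obtain x where x: "s = \<psi> x" "f x \<noteq> 0" using assms(2) by (auto simp: push_def split: if_splits)
  then have "- B \<le> x" "x \<le> B" using assms(1)[of x] by force+
  then have "\<psi> (- B) \<le> \<psi> x" "\<psi> x \<le> \<psi> B" using strict_mono by (simp_all add: strict_mono_less_eq)
  then show ?thesis using x by (auto simp: max_def abs_le_iff)
qed

text \<open>Atoms in [-B,B] have \<psi>-values in a bounded set, which contains only finitely many
  of the points 2 \<pi> k - \<theta>.\<close>

lemma emeasure_\<mu>_bounded: "emeasure (\<mu> \<theta>) {- B..B} < \<infinity>"
proof -
  define h where "h = push (\<lambda>l. indicator {- B..B} l * ennreal (weight l))"
  define C where "C = max \<bar>\<psi> B\<bar> \<bar>\<psi> (- B)\<bar>"
  have "emeasure (\<mu> \<theta>) {- B..B} = (\<integral>\<^sup>+l. indicator {- B..B} l \<partial>\<mu> \<theta>)" by simp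
  also have "\<dots> = (\<integral>\<^sup>+k. h (2 * pi * of_int k - \<theta>) \<partial>count_space (UNIV :: int set))"
    unfolding h_def by (rule nn_integral_\<mu>) measurable
  also have "\<dots> = (\<Sum>k | \<bar>2 * pi * of_int k - \<theta>\<bar> \<le> C. h (2 * pi * of_int k - \<theta>))"
  proof (rule nn_integral_count_space'[OF finite_window])
    fix k :: int assume k: "k \<notin> {k. \<bar>2 * pi * of_int k - \<theta>\<bar> \<le> C}"
    show "h (2 * pi * of_int k - \<theta>) = 0"
    proof (rule ccontr)
      assume nz: "h (2 * pi * of_int k - \<theta>) \<noteq> 0"
      have "\<bar>2 * pi * of_int k - \<theta>\<bar> \<le> C" unfolding C_def
        by (rule push_support[OF _ nz[unfolded h_def]]) (auto simp: indicator_def)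
      with k show False by simp
    qed
  qed auto
  also have "\<dots> < \<infinity>"
    using finite_window by (simp add: less_top[symmetric] h_def push_def ennreal_mult_eq_top_iff indicator_def)
  finally show ?thesis .
qed

lemma \<mu>_locally_finite: "\<mu> \<theta> \<in> locally_finite_measures"
  unfolding locally_finite_measures_def
proof (intro CollectI conjI allI impI)
  fix K :: "real set" assume "compact K"
  then obtain B where "\<forall>x\<in>K. \<bar>x\<bar> \<le> B" using compact_imp_bounded[of K] unfolding bounded_iff by auto
  then have "K \<subseteq> {- B..B}" by (auto simp: abs_le_iff minus_le_iff)
  then have "emeasure (\<mu> \<theta>) K \<le> emeasure (\<mu> \<theta>) {- B..B}" by (intro emeasure_mono) auto
  then show "emeasure (\<mu> \<theta>) K < \<infinity>" using emeasure_\<mu>_bounded by (rule le_less_trans)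
qed simp

lemma \<mu>_periodic: "\<mu> (\<theta> + 2 * pi * of_int m) = \<mu> \<theta>"
proof -
  have "atoms (\<theta> + 2 * pi * of_int m) = atoms \<theta>"
  proof -
    have "(\<exists>k::int. \<psi> l + (\<theta> + 2 * pi * of_int m) = 2 * pi * of_int k) \<longleftrightarrow> (\<exists>k::int. \<psi> l + \<theta> = 2 * pi * of_int k)" for l
    proof
      assume "\<exists>k::int. \<psi> l + (\<theta> + 2 * pi * of_int m) = 2 * pi * of_int k"
      then obtain k :: int where "\<psi> l + (\<theta> + 2 * pi * of_int m) = 2 * pi * of_int k" ..
      then have "\<psi> l + \<theta> = 2 * pi * of_int (k - m)" by (simp add: algebra_simps)
      then show "\<exists>k::int. \<psi> l + \<theta> = 2 * pi * of_int k" ..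
    next
      assume "\<exists>k::int. \<psi> l + \<theta> = 2 * pi * of_int k"
      then obtain k :: int where "\<psi> l + \<theta> = 2 * pi * of_int k" ..
      then have "\<psi> l + (\<theta> + 2 * pi * of_int m) = 2 * pi * of_int (k + m)" by (simp add: algebra_simps)
      then show "\<exists>k::int. \<psi> l + (\<theta> + 2 * pi * of_int m) = 2 * pi * of_int k" ..
    qed
    then show ?thesis by (simp add: atoms_def)
  qed
  then show ?thesis by (simp add: \<mu>_def)
qed

lemma \<mu>_circle_residue: "\<mu> (circle_residue x) = \<mu> x"
  using \<mu>_periodic[of x "- \<lfloor>x / (2 * pi)\<rfloor>"] by (simp add: circle_residue_def)

text \<open>The extension by 0 has no jump at the ends of the range: the range and the complement of
  the compact image of [-B,B] are open and cover the line; the function is f composed with the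
  inverse of \<psi> on the first set and 0 on the second.\<close>

lemma push_cont:
  fixes f :: "real \<Rightarrow> real"
  assumes f: "continuous_on UNIV f" "\<And>x. \<bar>x\<bar> > B \<Longrightarrow> f x = 0"
  shows "continuous_on UNIV (push f)"
proof -
  have "compact (\<psi> ` {- B..B})" by (intro compact_continuous_image cont_on) auto
  then have op: "open (- \<psi> ` {- B..B})" by (simp add: compact_imp_closed open_Compl)
  have 1: "continuous_on (range \<psi>) (push f)"
  proof (rule continuous_on_eq)
    show "continuous_on (range \<psi>) (\<lambda>s. f (inv \<psi> s))"
      by (rule continuous_on_compose2[OF f(1) cont_inv]) auto
  qed (auto simp: push_def)
  have "push f s = 0" if "s \<in> - \<psi> ` {- B..B}" for s
  proof (rule ccontr)
    assume "push f s \<noteq> 0"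
    then obtain x where x: "s = \<psi> x" "f x \<noteq> 0" by (auto simp: push_def split: if_splits)
    then have "x \<in> {- B..B}" using f(2)[of x] by force
    then show False using that x by auto
  qed
  then have 2: "continuous_on (- \<psi> ` {- B..B}) (push f)"
    by (intro continuous_on_eq[OF continuous_on_const, of _ 0]) auto
  have "range \<psi> \<union> - \<psi> ` {- B..B} = UNIV" by auto
  then show ?thesis using continuous_on_open_Un[OF open_range op 1 2] by simp
qed

text \<open>K may be any finite set containing the indices that contribute, so it can be chosen
  independently of \<theta>.\<close>

lemma integral_\<mu>:
  fixes f :: "real \<Rightarrow> real"
  assumes f: "continuous_on UNIV f" and K: "finite K"
    "\<And>k. k \<notin> K \<Longrightarrow> push (\<lambda>l. f l * weight l) (2 * pi * of_int k - \<theta>) = 0"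
  shows "integral\<^sup>L (\<mu> \<theta>) f = (\<Sum>k\<in>K. push (\<lambda>l. f l * weight l) (2 * pi * of_int k - \<theta>))"
proof -
  let ?h = "push (\<lambda>l. f l * weight l)"
  let ?K = "{k::int. 2 * pi * of_int k - \<theta> \<in> range \<psi>}"
  have fm: "f \<in> borel_measurable borel" by (rule borel_measurable_continuous_onI[OF f])
  have "integral\<^sup>L (\<mu> \<theta>) f = (\<integral>l. f l * weight l \<partial>count_space (atoms \<theta>))"
    unfolding \<mu>_def using fm weight_pos
    by (subst integral_distr) (auto simp: integral_density less_imp_le mult.commute)
  also have "\<dots> = (\<integral>k. f (inv \<psi> (2 * pi * of_int k - \<theta>)) * weight (inv \<psi> (2 * pi * of_int k - \<theta>)) \<partial>count_space ?K)"
    by (rule integral_bij_count_space[OF atoms_bij, symmetric])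
  also have "\<dots> = (\<integral>k. ?h (2 * pi * of_int k - \<theta>) \<partial>count_space ?K)"
    by (intro Bochner_Integration.integral_cong) (auto simp: push_def)
  also have "\<dots> = (\<Sum>k | k \<in> ?K \<and> ?h (2 * pi * of_int k - \<theta>) \<noteq> 0. ?h (2 * pi * of_int k - \<theta>))"
    by (rule lebesgue_integral_count_space_finite_support) (rule finite_subset[OF _ K(1)], use K(2) in auto)
  also have "\<dots> = (\<Sum>k\<in>K. ?h (2 * pi * of_int k - \<theta>))"
  proof (rule sum.mono_neutral_left[OF K(1)])
    show "{k \<in> ?K. ?h (2 * pi * of_int k - \<theta>) \<noteq> 0} \<subseteq> K" using K(2) by auto
    show "\<forall>i\<in>K - {k \<in> ?K. ?h (2 * pi * of_int k - \<theta>) \<noteq> 0}. ?h (2 * pi * of_int i - \<theta>) = 0"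
      by (auto simp: push_def)
  qed
  finally show ?thesis .
qed

text \<open>Vague continuity in the angle: near \<theta>0 the integral is a sum of continuous
  functions over one fixed finite set of integers.\<close>

lemma integral_\<mu>_cont:
  assumes "f \<in> compactly_supported"
  shows "isCont (\<lambda>\<theta>. integral\<^sup>L (\<mu> \<theta>) f) \<theta>0"
proof -
  obtain S where f: "continuous_on UNIV f" and S: "compact S" "\<And>x. x \<notin> S \<Longrightarrow> f x = 0"
    using assms by (auto simp: compactly_supported_def)
  obtain B where B: "\<And>x. x \<in> S \<Longrightarrow> \<bar>x\<bar> \<le> B" using compact_imp_bounded[OF S(1)] unfolding bounded_iff by auto
  have supp: "f x * weight x = 0" if "\<bar>x\<bar> > B" for x using B[of x] S(2)[of x] that by force
  have "continuous_on UNIV weight"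
    unfolding weight_def using deriv_cont deriv_pos
    by (intro continuous_intros) (auto simp: continuous_at_imp_continuous_on less_imp_neq[symmetric])
  then have "continuous_on UNIV (push (\<lambda>l. f l * weight l))"
    by (intro push_cont[of _ B] continuous_intros f supp)
  then have hc: "isCont (push (\<lambda>l. f l * weight l)) x" for x
    by (simp add: continuous_on_eq_continuous_at)
  define C where "C = max \<bar>\<psi> B\<bar> \<bar>\<psi> (- B)\<bar>"
  \<comment> \<open>The 1 added to C makes the same K work for all \<theta> within distance 1 of
    \<theta>0.\<close>
  define K where "K = {k::int. \<bar>2 * pi * of_int k - \<theta>0\<bar> \<le> C + 1}"
  have eq: "integral\<^sup>L (\<mu> \<theta>) f = (\<Sum>k\<in>K. push (\<lambda>l. f l * weight l) (2 * pi * of_int k - \<theta>))" if "\<bar>\<theta> - \<theta>0\<bar> < 1" for \<theta>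
  proof (rule integral_\<mu>[OF f])
    show "finite K" unfolding K_def by (rule finite_window)
    fix k :: int assume k: "k \<notin> K"
    show "push (\<lambda>l. f l * weight l) (2 * pi * of_int k - \<theta>) = 0"
    proof (rule ccontr)
      assume "push (\<lambda>l. f l * weight l) (2 * pi * of_int k - \<theta>) \<noteq> 0"
      from push_support[OF supp this] have "\<bar>2 * pi * of_int k - \<theta>\<bar> \<le> C" by (simp add: C_def)
      with k that show False by (auto simp: K_def)
    qed
  qed
  have "isCont (\<lambda>\<theta>. \<Sum>k\<in>K. push (\<lambda>l. f l * weight l) (2 * pi * of_int k - \<theta>)) \<theta>0"
    by (intro continuous_intros isCont_o2[OF _ hc])
  moreover have "\<forall>\<^sub>F \<theta> in nhds \<theta>0. integral\<^sup>L (\<mu> \<theta>) f = (\<Sum>k\<in>K. push (\<lambda>l. f l * weight l) (2 * pi * of_int k - \<theta>))"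
    unfolding eventually_nhds_metric by (intro exI[of _ 1]) (auto simp: dist_real_def eq)
  ultimately show ?thesis by (simp add: isCont_cong)
qed

end

section \<open>The Pruefer phase at the right endpoint\<close>

context dirac_coefficient
begin

definition radius_sq :: "real \<Rightarrow> real" where
  "radius_sq l = (solX l 1)\<^sup>2 + (solY l 1)\<^sup>2"

definition phase_deriv :: "real \<Rightarrow> real" where
  "phase_deriv l = 2 * sq_norm l / radius_sq l"

text \<open>Integrating the derivative avoids choosing branches of an angle; that the result is an
  angle is the content of \<open>polar\<close>. The half phase there matches the boundary angle 2
  arccot: a direction returns to itself after half a turn.\<close>

definition phase_fun :: "real \<Rightarrow> real" where
  "phase_fun l = (LBINT y=0..l. phase_deriv y)"

lemma radius_sq_pos: "0 < radius_sq l"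
  using sol_nonzero[of 1 l] by (auto simp: radius_sq_def sum_power2_gt_zero_iff)

lemma phase_deriv_pos: "0 < phase_deriv l"
  using radius_sq_pos[of l] sq_norm_pos[of l] by (simp add: phase_deriv_def)

lemma phase_deriv_cont: "isCont phase_deriv l"
proof -
  have "isCont (\<lambda>l. solX l 1) l" "isCont (\<lambda>l. solY l 1) l" using dX dY by (blast intro: DERIV_isCont)+
  moreover have "phase_deriv = (\<lambda>l. 2 * (solY l 1 * dX l - solX l 1 * dY l) / radius_sq l)"
    by (simp add: phase_deriv_def wronskian fun_eq_iff)
  ultimately show ?thesis
    using dX_cont dY_cont radius_sq_pos[of l] unfolding radius_sq_def by (auto intro!: continuous_intros)
qed

lemma phase_fun_deriv: "(phase_fun has_real_derivative phase_deriv l) (at l)"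
proof -
  have int: "l \<in> interior {- \<bar>l\<bar> - 1..\<bar>l\<bar> + 1}" by (auto simp: interior_atLeastAtMost_real)
  have "((\<lambda>u. LBINT y=ereal 0..u. phase_deriv y) has_vector_derivative phase_deriv l) (at l within {- \<bar>l\<bar> - 1..\<bar>l\<bar> + 1})"
    by (rule interval_integral_FTC2) (auto intro!: continuous_at_imp_continuous_on phase_deriv_cont)
  then show ?thesis
    unfolding at_within_interior[OF int] phase_fun_def
    by (simp add: has_real_derivative_iff_has_vector_derivative zero_ereal_def)
qed

lemma phase_fun_0: "phase_fun 0 = 0"
  by (simp add: phase_fun_def zero_ereal_def[symmetric])

sublocale phase: phase phase_fun phase_deriv
  by standard (rule phase_fun_deriv phase_deriv_cont phase_deriv_pos phase_fun_0)+

text \<open>U and V are the components of the vector at 1 rotated by the half phase. Both of them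
  and the radius solve W' = \<alpha> W in l, so U and V divided by the radius are constant; at l = 0
  the vector is (1,0).\<close>

lemma polar: "solX l 1 = sqrt (radius_sq l) * cos (phase_fun l / 2)" "solY l 1 = - sqrt (radius_sq l) * sin (phase_fun l / 2)"
proof -
  define U where "U l = solX l 1 * cos (phase_fun l / 2) - solY l 1 * sin (phase_fun l / 2)" for l
  define V where "V l = solX l 1 * sin (phase_fun l / 2) + solY l 1 * cos (phase_fun l / 2)" for l
  define \<alpha> where "\<alpha> l = (solX l 1 * dX l + solY l 1 * dY l) / radius_sq l" for l
  note [derivative_intros] = dX[THEN DERIV_chain2] dY[THEN DERIV_chain2] phase_fun_deriv[THEN DERIV_chain2]
  have half: "phase_deriv l / 2 = (solY l 1 * dX l - solX l 1 * dY l) / radius_sq l" for l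
    by (simp add: phase_deriv_def wronskian)
  have frac: "E - (w / S) * F = (S * E - w * F) / S" "E + (w / S) * F = (S * E + w * F) / S"
    if "S \<noteq> 0" for E w F S :: real
    using that by (simp_all add: diff_divide_distrib add_divide_distrib)
  have dU: "(U has_real_derivative \<alpha> l * U l) (at l)" for l
  proof -
    let ?c = "cos (phase_fun l / 2)" and ?s = "sin (phase_fun l / 2)" and ?x = "solX l 1" and ?y = "solY l 1"
    have "(U has_real_derivative (dX l * ?c - dY l * ?s) - (phase_deriv l / 2) * (?x * ?s + ?y * ?c)) (at l)"
      unfolding U_def by (auto intro!: derivative_eq_intros simp: algebra_simps)
    moreover have "(dX l * ?c - dY l * ?s) - (phase_deriv l / 2) * (?x * ?s + ?y * ?c)
      = (radius_sq l * (dX l * ?c - dY l * ?s) - (?y * dX l - ?x * dY l) * (?x * ?s + ?y * ?c)) / radius_sq l"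
      unfolding half by (rule frac(1)) (use radius_sq_pos[of l] in simp)
    moreover have "radius_sq l * (dX l * ?c - dY l * ?s) - (?y * dX l - ?x * dY l) * (?x * ?s + ?y * ?c)
      = (?x * dX l + ?y * dY l) * U l"
      by (simp add: radius_sq_def U_def power2_eq_square algebra_simps)
    ultimately show ?thesis by (simp add: \<alpha>_def)
  qed
  have dV: "(V has_real_derivative \<alpha> l * V l) (at l)" for l
  proof -
    let ?c = "cos (phase_fun l / 2)" and ?s = "sin (phase_fun l / 2)" and ?x = "solX l 1" and ?y = "solY l 1"
    have "(V has_real_derivative (dX l * ?s + dY l * ?c) + (phase_deriv l / 2) * (?x * ?c - ?y * ?s)) (at l)"
      unfolding V_def by (auto intro!: derivative_eq_intros simp: algebra_simps)
    moreover have "(dX l * ?s + dY l * ?c) + (phase_deriv l / 2) * (?x * ?c - ?y * ?s)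
      = (radius_sq l * (dX l * ?s + dY l * ?c) + (?y * dX l - ?x * dY l) * (?x * ?c - ?y * ?s)) / radius_sq l"
      unfolding half by (rule frac(2)) (use radius_sq_pos[of l] in simp)
    moreover have "radius_sq l * (dX l * ?s + dY l * ?c) + (?y * dX l - ?x * dY l) * (?x * ?c - ?y * ?s)
      = (?x * dX l + ?y * dY l) * V l"
      by (simp add: radius_sq_def V_def power2_eq_square algebra_simps)
    ultimately show ?thesis by (simp add: \<alpha>_def)
  qed
  have dS: "((\<lambda>l. sqrt (radius_sq l)) has_real_derivative \<alpha> l * sqrt (radius_sq l)) (at l)" for l
  proof -
    have "(radius_sq has_real_derivative 2 * (solX l 1 * dX l + solY l 1 * dY l)) (at l)"
      unfolding radius_sq_def by (auto intro!: derivative_eq_intros simp: algebra_simps)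
    then have "((\<lambda>l. sqrt (radius_sq l)) has_real_derivative inverse (sqrt (radius_sq l)) / 2 * (2 * (solX l 1 * dX l + solY l 1 * dY l))) (at l)"
      by (rule DERIV_chain2[where f=sqrt and g=radius_sq, OF DERIV_real_sqrt[OF radius_sq_pos]])
    moreover have "inverse (sqrt (radius_sq l)) / 2 * (2 * (solX l 1 * dX l + solY l 1 * dY l)) = \<alpha> l * sqrt (radius_sq l)"
    proof -
      define Q where "Q = sqrt (radius_sq l)"
      define E where "E = solX l 1 * dX l + solY l 1 * dY l"
      have S: "radius_sq l = Q * Q" "Q \<noteq> 0" using radius_sq_pos[of l] by (auto simp: Q_def)
      have "\<alpha> l = E / (Q * Q)" by (simp only: \<alpha>_def E_def S(1)[symmetric])
      then have "inverse Q / 2 * (2 * E) = \<alpha> l * Q" using S(2) by (simp add: field_simps)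
      then show ?thesis by (simp only: Q_def E_def)
    qed
    ultimately show ?thesis by simp
  qed
  have quot: "W l / sqrt (radius_sq l) = W 0 / sqrt (radius_sq 0)"
    if dW: "\<And>l. (W has_real_derivative \<alpha> l * W l) (at l)" for W l
  proof -
    have "((\<lambda>l. W l / sqrt (radius_sq l)) has_real_derivative 0) (at x)" for x
    proof -
      have "((\<lambda>l. W l / sqrt (radius_sq l)) has_real_derivative
         ((\<alpha> x * W x) * sqrt (radius_sq x) - W x * (\<alpha> x * sqrt (radius_sq x))) / (sqrt (radius_sq x) * sqrt (radius_sq x))) (at x)"
        by (rule DERIV_divide[OF dW dS]) (use radius_sq_pos[of x] in simp)
      then show ?thesis by simp
    qed
    then show ?thesis using DERIV_isconst_all[of "\<lambda>l. W l / sqrt (radius_sq l)" l 0] by blast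
  qed
  have s0: "solX 0 1 = 1" "solY 0 1 = 0" using sol_eq[of 1 0] by auto
  have "sqrt (radius_sq l) > 0" using radius_sq_pos by simp
  then have UV: "U l = sqrt (radius_sq l)" "V l = 0"
    using quot[OF dU, of l] quot[OF dV, of l] by (auto simp: U_def V_def radius_sq_def s0 phase_fun_0)
  let ?c = "cos (phase_fun l / 2)" and ?s = "sin (phase_fun l / 2)"
  have "x * (c\<^sup>2 + s\<^sup>2) = (x * c - y * s) * c + (x * s + y * c) * s"
    "y * (c\<^sup>2 + s\<^sup>2) = (x * s + y * c) * c - (x * c - y * s) * s" for x y c s :: real
    by (simp_all add: power2_eq_square algebra_simps)
  from this(1)[of "solX l 1" ?c ?s "solY l 1"] this(2)[of "solY l 1" ?c ?s "solX l 1"]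
  have "solX l 1 = U l * ?c + V l * ?s" "solY l 1 = V l * ?c - U l * ?s"
    unfolding U_def V_def by simp_all
  then show "solX l 1 = sqrt (radius_sq l) * ?c" "solY l 1 = - sqrt (radius_sq l) * ?s" using UV by simp_all
qed

lemma fund_bc:
  "fund l 1 \<bullet> (J *v bc_vec None) = solY l 1" "fund l 1 \<bullet> (J *v bc_vec (Some x)) = solX l 1 - x * solY l 1"
  by (simp_all add: dot_2 J_mult bc_vec_def fund_nth)

text \<open>By \<open>polar\<close> and the addition formulas the boundary form is a nonzero
  multiple of the sine of half the sum of phase and boundary angle.\<close>

lemma fund_bc_angle:
  "fund l 1 \<bullet> (J *v bc_vec r1) = 0 \<longleftrightarrow> (\<exists>k::int. phase_fun l + bc_angle r1 = 2 * pi * of_int k)"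
proof -
  have "fund l 1 \<bullet> (J *v bc_vec r1) = 0 \<longleftrightarrow> sin ((phase_fun l + bc_angle r1) / 2) = 0"
  proof (cases r1)
    case None
    then show ?thesis using polar(2)[of l] radius_sq_pos[of l] by (simp add: fund_bc bc_angle_def)
  next
    case (Some x)
    have cp: "cos (arctan x) > 0" by (intro cos_gt_zero_pi arctan_lbound arctan_ubound)
    have sx: "sin (arctan x) = x * cos (arctan x)" using tan_arctan[of x] cp by (simp add: tan_def field_simps)
    have "(phase_fun l + bc_angle r1) / 2 = phase_fun l / 2 + (pi / 2 - arctan x)"
      by (simp add: Some bc_angle_def add_divide_distrib)
    moreover have "sin (u + (pi / 2 - v)) = cos u * cos v + sin u * sin v" for u v :: real
      by (simp add: sin_add sin_diff cos_diff)
    ultimately have "sin ((phase_fun l + bc_angle r1) / 2)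
      = cos (phase_fun l / 2) * cos (arctan x) + sin (phase_fun l / 2) * (x * cos (arctan x))" by (simp only: sx)
    then have "sqrt (radius_sq l) * sin ((phase_fun l + bc_angle r1) / 2) = cos (arctan x) * (solX l 1 - x * solY l 1)"
      unfolding polar[of l] by (simp only: algebra_simps mult_minus_left minus_minus)
    then have "sin ((phase_fun l + bc_angle r1) / 2) = 0 \<longleftrightarrow> solX l 1 - x * solY l 1 = 0"
      using radius_sq_pos[of l] cp by (metis mult_eq_0_iff less_irrefl real_sqrt_gt_0_iff)
    then show ?thesis by (simp add: Some fund_bc)
  qed
  also have "\<dots> \<longleftrightarrow> (\<exists>k::int. (phase_fun l + bc_angle r1) / 2 = of_int k * pi)" by (rule sin_zero_iff_int2)
  also have "\<dots> \<longleftrightarrow> (\<exists>k::int. phase_fun l + bc_angle r1 = 2 * pi * of_int k)"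
    by (intro ex_cong1) (auto simp: field_simps)
  finally show ?thesis .
qed

lemma right_spectral_measure_eq: "right_spectral_measure I R None r1 = phase.\<mu> (bc_angle r1)"
proof -
  have E: "eigenvalues I R None r1 = phase.atoms (bc_angle r1)"
    unfolding eigenvalues_eq phase.atoms_def fund_bc_angle ..
  have w: "right_weight I R None r1 l = phase.weight l" if "l \<in> phase.atoms (bc_angle r1)" for l
  proof -
    have "phase.weight l = radius_sq l / sq_norm l" by (simp add: phase.weight_def phase_deriv_def)
    then show ?thesis using right_weight_eq[of l r1] that by (simp add: E radius_sq_def)
  qed
  have "density (count_space (phase.atoms (bc_angle r1))) (\<lambda>l. ennreal (right_weight I R None r1 l))
    = density (count_space (phase.atoms (bc_angle r1))) (\<lambda>l. ennreal (phase.weight l))"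
    by (rule density_cong) (auto simp: AE_count_space w)
  then show ?thesis unfolding right_spectral_measure_def phase.\<mu>_def E by simp
qed

text \<open>The boundary condition for which l is an eigenvalue can be read off the vector at 1.
  This expresses \<theta>(l) without the phase, in a form that is visibly measurable in the
  coefficient.\<close>

lemma circle_residue_phase:
  "circle_residue (- phase_fun l) = bc_angle (if solY l 1 = 0 then None else Some (solX l 1 / solY l 1))" (is "_ = bc_angle ?r")
proof -
  have "fund l 1 \<bullet> (J *v bc_vec ?r) = 0" by (simp add: fund_bc)
  then obtain k :: int where "phase_fun l + bc_angle ?r = 2 * pi * of_int k" unfolding fund_bc_angle by blast
  then have "- phase_fun l = bc_angle ?r + 2 * pi * of_int (- k)" by simp
  then show ?thesis by (rule circle_residue_unique[OF bc_angle_range])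
qed

end

section \<open>The vague topology\<close>

lemma space_borel_of [simp]: "space (borel_of X) = topspace X"
  unfolding borel_of_def by (rule space_measure_of) (auto dest: openin_subset)

lemma openin_borel_of: "openin X U \<Longrightarrow> U \<in> sets (borel_of X)"
  unfolding borel_of_def by (subst sets_measure_of) (auto dest: openin_subset)

lemma measurable_borel_ofI:
  assumes "f \<in> space M \<rightarrow> topspace X" "\<And>U. openin X U \<Longrightarrow> f -` U \<inter> space M \<in> sets M"
  shows "f \<in> measurable M (borel_of X)"
  unfolding borel_of_def by (rule measurable_measure_of) (use assms in \<open>auto dest: openin_subset\<close>)

lemma measurable_borel_of_open: "f \<in> measurable M (borel_of X) \<Longrightarrow> openin X U \<Longrightarrow> f -` U \<inter> space M \<in> sets M"
  by (rule measurable_sets[OF _ openin_borel_of])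

lemma continuous_map_borel_of:
  assumes "continuous_map X Y f"
  shows "f \<in> measurable (borel_of X) (borel_of Y)"
proof (rule measurable_borel_ofI)
  show "f \<in> space (borel_of X) \<rightarrow> topspace Y" using assms by (auto simp: continuous_map_def)
  fix U assume "openin Y U"
  then have "openin X {x \<in> topspace X. f x \<in> U}" by (rule openin_continuous_map_preimage[OF assms])
  moreover have "f -` U \<inter> space (borel_of X) = {x \<in> topspace X. f x \<in> U}" by auto
  ultimately show "f -` U \<inter> space (borel_of X) \<in> sets (borel_of X)" by (simp add: openin_borel_of)
qed

lemma sets_borel_of_euclidean: "sets (borel_of euclidean) = sets borel"
  unfolding borel_of_def borel_def by simp

lemma continuous_map_borel_measurable:
  fixes f :: "'a \<Rightarrow> 'b::topological_space"
  assumes "continuous_map X euclidean f"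
  shows "f \<in> borel_measurable (borel_of X)"
  using continuous_map_borel_of[OF assms] measurable_cong_sets[OF refl sets_borel_of_euclidean] by blast

lemma measurable_pullback:
  fixes f :: "'a \<Rightarrow> 'b::topological_space"
  assumes "g \<in> space M \<rightarrow> A" "(\<lambda>x. f (g x)) \<in> borel_measurable M"
  shows "g \<in> measurable M (borel_of (pullback_topology A f euclidean))"
proof (rule measurable_borel_ofI)
  show "g \<in> space M \<rightarrow> topspace (pullback_topology A f euclidean)"
    using assms(1) by (simp add: topspace_pullback_topology)
  fix U assume "openin (pullback_topology A f euclidean) U"
  then obtain V where V: "open V" "U = f -` V \<inter> A" by (auto simp: openin_pullback_topology)
  have "g -` U \<inter> space M = (\<lambda>x. f (g x)) -` V \<inter> space M" using V assms(1) by auto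
  also have "\<dots> \<in> sets M" using assms(2) V(1) by (simp add: measurable_sets)
  finally show "g -` U \<inter> space M \<in> sets M" .
qed

lemma second_countable_pullback:
  fixes f :: "'a \<Rightarrow> 'b::second_countable_topology"
  shows "second_countable (pullback_topology A f euclidean)"
proof -
  obtain B :: "'b set set" where B: "countable B" "topological_basis B" using ex_countable_basis by blast
  show ?thesis unfolding second_countable_def
  proof (intro exI[of _ "(\<lambda>U. f -` U \<inter> A) ` B"] conjI allI impI ballI)
    fix V assume "V \<in> (\<lambda>U. f -` U \<inter> A) ` B"
    then show "openin (pullback_topology A f euclidean) V"
      using topological_basis_open[OF B(2)] by (auto simp: openin_pullback_topology)
  next
    fix U x assume U: "openin (pullback_topology A f euclidean) U \<and> x \<in> U"
    then obtain W where W: "open W" "U = f -` W \<inter> A" by (auto simp: openin_pullback_topology)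
    then have "f x \<in> W" "x \<in> A" using U by auto
    then obtain V where "V \<in> B" "f x \<in> V" "V \<subseteq> W" using topological_basisE[OF B(2) W(1)] by metis
    then show "\<exists>V\<in>(\<lambda>U. f -` U \<inter> A) ` B. x \<in> V \<and> V \<subseteq> U" using W \<open>x \<in> A\<close> by auto
  qed (use B in simp)
qed

lemma second_countable_rectangles:
  assumes "second_countable X" "second_countable Y"
  obtains B where "countable B" "\<And>U. U \<in> B \<Longrightarrow> \<exists>V W. U = V \<times> W \<and> openin X V \<and> openin Y W"
    "\<And>U z. openin (prod_topology X Y) U \<Longrightarrow> z \<in> U \<Longrightarrow> \<exists>V\<in>B. z \<in> V \<and> V \<subseteq> U"
proof -
  obtain B1 where B1: "countable B1" "\<forall>V\<in>B1. openin X V" "\<forall>U x. openin X U \<and> x \<in> U \<longrightarrow> (\<exists>V\<in>B1. x \<in> V \<and> V \<subseteq> U)"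
    using assms(1) unfolding second_countable_def by auto
  obtain B2 where B2: "countable B2" "\<forall>V\<in>B2. openin Y V" "\<forall>U x. openin Y U \<and> x \<in> U \<longrightarrow> (\<exists>V\<in>B2. x \<in> V \<and> V \<subseteq> U)"
    using assms(2) unfolding second_countable_def by auto
  show ?thesis
  proof (rule that[of "(\<lambda>(V,W). V \<times> W) ` (B1 \<times> B2)"])
    show "countable ((\<lambda>(V,W). V \<times> W) ` (B1 \<times> B2))" using B1 B2 by simp
    show "\<exists>V W. U = V \<times> W \<and> openin X V \<and> openin Y W" if "U \<in> (\<lambda>(V,W). V \<times> W) ` (B1 \<times> B2)" for U
    proof -
      obtain V W where "U = V \<times> W" "V \<in> B1" "W \<in> B2" using \<open>U \<in> (\<lambda>(V,W). V \<times> W) ` (B1 \<times> B2)\<close> by auto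
      then show ?thesis using B1(2) B2(2) by blast
    qed
    fix U z assume U: "openin (prod_topology X Y) U" "z \<in> U"
    obtain x y where z: "z = (x,y)" by (cases z)
    obtain V W where VW: "openin X V" "openin Y W" "x \<in> V" "y \<in> W" "V \<times> W \<subseteq> U"
    proof -
      have "(x,y) \<in> U" using U(2) z by simp
      from U(1)[unfolded openin_prod_topology_alt, rule_format, OF this] show ?thesis using that by blast
    qed
    obtain V' where V': "V' \<in> B1" "x \<in> V'" "V' \<subseteq> V" using B1(3) VW by blast
    obtain W' where W': "W' \<in> B2" "y \<in> W'" "W' \<subseteq> W" using B2(3) VW by blast
    have "V' \<times> W' \<in> (\<lambda>(V,W). V \<times> W) ` (B1 \<times> B2)" using V' W' by auto
    moreover have "z \<in> V' \<times> W'" "V' \<times> W' \<subseteq> U" using V' W' VW z by auto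
    ultimately show "\<exists>V\<in>(\<lambda>(V,W). V \<times> W) ` (B1 \<times> B2). z \<in> V \<and> V \<subseteq> U" by blast
  qed
qed

lemma second_countable_prod:
  assumes "second_countable X" "second_countable Y"
  shows "second_countable (prod_topology X Y)"
proof -
  obtain B where B: "countable B" "\<And>U. U \<in> B \<Longrightarrow> \<exists>V W. U = V \<times> W \<and> openin X V \<and> openin Y W"
    "\<And>U z. openin (prod_topology X Y) U \<Longrightarrow> z \<in> U \<Longrightarrow> \<exists>V\<in>B. z \<in> V \<and> V \<subseteq> U"
    using second_countable_rectangles[OF assms] by metis
  have "openin (prod_topology X Y) U" if "U \<in> B" for U using B(2)[OF that] by (auto simp: openin_prod_Times_iff)
  then show ?thesis unfolding second_countable_def using B(1,3) by blast
qed

text \<open>Second countability writes every open set of the product as a countable union of open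
  rectangles, so measurable components suffice.\<close>

lemma measurable_prod_borel_of:
  assumes sc: "second_countable X" "second_countable Y"
    and f: "f \<in> measurable M (borel_of X)" and g: "g \<in> measurable M (borel_of Y)"
  shows "(\<lambda>x. (f x, g x)) \<in> measurable M (borel_of (prod_topology X Y))"
proof (rule measurable_borel_ofI)
  show "(\<lambda>x. (f x, g x)) \<in> space M \<rightarrow> topspace (prod_topology X Y)"
    using measurable_space[OF f] measurable_space[OF g] by auto
  fix U assume U: "openin (prod_topology X Y) U"
  obtain B where B: "countable B" "\<And>U. U \<in> B \<Longrightarrow> \<exists>V W. U = V \<times> W \<and> openin X V \<and> openin Y W"
    "\<And>U z. openin (prod_topology X Y) U \<Longrightarrow> z \<in> U \<Longrightarrow> \<exists>V\<in>B. z \<in> V \<and> V \<subseteq> U"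
    using second_countable_rectangles[OF sc] by metis
  have "U = \<Union> {V \<in> B. V \<subseteq> U}" using B(3)[OF U] by blast
  then have "(\<lambda>x. (f x, g x)) -` U \<inter> space M = (\<Union>V\<in>{V \<in> B. V \<subseteq> U}. (\<lambda>x. (f x, g x)) -` V \<inter> space M)"
    by blast
  also have "\<dots> \<in> sets M"
  proof (rule sets.countable_UN'')
    show "countable {V \<in> B. V \<subseteq> U}" using B(1) by simp
    fix V assume "V \<in> {V \<in> B. V \<subseteq> U}"
    then obtain V1 V2 where V: "V = V1 \<times> V2" "openin X V1" "openin Y V2" using B(2) by blast
    have "(\<lambda>x. (f x, g x)) -` V \<inter> space M = (f -` V1 \<inter> space M) \<inter> (g -` V2 \<inter> space M)" using V by auto
    then show "(\<lambda>x. (f x, g x)) -` V \<inter> space M \<in> sets M"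
      using measurable_borel_of_open[OF f V(2)] measurable_borel_of_open[OF g V(3)] by simp
  qed
  finally show "(\<lambda>x. (f x, g x)) -` U \<inter> space M \<in> sets M" .
qed

lemma limitin_pullback:
  assumes "l \<in> A" "\<forall>\<^sub>F i in F. x i \<in> A" "limitin X (\<lambda>i. f (x i)) (f l) F"
  shows "limitin (pullback_topology A f X) x l F"
  unfolding limitin_def
proof (intro conjI allI impI)
  show "l \<in> topspace (pullback_topology A f X)"
    using assms(1,3) by (auto simp: topspace_pullback_topology limitin_def)
  fix U assume "openin (pullback_topology A f X) U \<and> l \<in> U"
  then obtain V where V: "openin X V" "U = f -` V \<inter> A" "f l \<in> V" by (auto simp: openin_pullback_topology)
  then have "\<forall>\<^sub>F i in F. f (x i) \<in> V" using assms(3) by (auto simp: limitin_def)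
  with assms(2) show "\<forall>\<^sub>F i in F. x i \<in> U" by eventually_elim (use V in auto)
qed

section \<open>Countably many coordinates for the vague topology\<close>

definition tent :: "nat \<Rightarrow> real \<Rightarrow> real" where
  "tent n x = max 0 (min 1 (real n + 1 - \<bar>x\<bar>))"

definition vague_coords :: "real measure \<Rightarrow> nat \<times> nat \<Rightarrow> real" where
  "vague_coords \<nu> = (\<lambda>(k, n). integral\<^sup>L \<nu> (\<lambda>x. x ^ k * tent n x))"

lemma compactly_supportedI:
  assumes "continuous_on UNIV f" "\<And>x. \<bar>x\<bar> > B \<Longrightarrow> f x = 0"
  shows "f \<in> compactly_supported"
  unfolding compactly_supported_def
  by (intro CollectI conjI assms exI[of _ "{- B..B}"]) (use assms(2) in force)+

lemma tent_simps: "0 \<le> tent n x" "tent n x \<le> 1" "\<bar>x\<bar> \<le> real n \<Longrightarrow> tent n x = 1" "\<bar>x\<bar> > real n + 1 \<Longrightarrow> tent n x = 0"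
  by (auto simp: tent_def)

lemma tent_compact: "(\<lambda>x. x ^ k * tent n x) \<in> compactly_supported"
  by (rule compactly_supportedI[of _ "real n + 1"])
    (auto simp: tent_simps tent_def[abs_def] intro!: continuous_intros)

lemma compactly_supported_bound:
  assumes "f \<in> compactly_supported"
  obtains B where "\<And>x. \<bar>x\<bar> > B \<Longrightarrow> f x = 0"
proof -
  obtain S where S: "compact S" "\<And>x. x \<notin> S \<Longrightarrow> f x = 0" using assms by (auto simp: compactly_supported_def)
  obtain B where B: "\<And>x. x \<in> S \<Longrightarrow> \<bar>x\<bar> \<le> B" using compact_imp_bounded[OF S(1)] unfolding bounded_iff by auto
  then show ?thesis using that[of B] S(2) by force
qed

lemma compactly_supported_integrable:
  assumes f: "f \<in> compactly_supported" and \<nu>: "\<nu> \<in> locally_finite_measures"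
  shows "integrable \<nu> f"
proof -
  have sets: "sets \<nu> = sets borel" using \<nu> by (simp add: locally_finite_measures_def)
  obtain S where S: "continuous_on UNIV f" "compact S" "\<And>x. x \<notin> S \<Longrightarrow> f x = 0"
    using f by (auto simp: compactly_supported_def)
  have "bounded (f ` S)" by (intro compact_imp_bounded compact_continuous_image continuous_on_subset[OF S(1)] S(2)) auto
  then obtain B where B: "\<And>x. x \<in> S \<Longrightarrow> norm (f x) \<le> B" unfolding bounded_iff by auto
  show ?thesis
  proof (rule integrableI_bounded_set[of S _ _ B])
    show "S \<in> sets \<nu>" using S(2) sets by (simp add: compact_imp_closed)
    show "f \<in> borel_measurable \<nu>"
      using borel_measurable_continuous_onI[OF S(1)] measurable_cong_sets[OF sets refl] by blast
    show "emeasure \<nu> S < \<infinity>" using \<nu> S(2) by (simp add: locally_finite_measures_def)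
  qed (use B S(3) in auto)
qed

lemma vague_continuous:
  assumes "\<phi> \<in> compactly_supported"
  shows "continuous_map vague_topology euclideanreal (\<lambda>\<nu>. integral\<^sup>L \<nu> \<phi>)"
proof -
  have "continuous_map vague_topology euclideanreal ((\<lambda>\<omega>. \<omega> \<phi>) \<circ> (\<lambda>\<nu>. \<lambda>\<phi>\<in>compactly_supported. integral\<^sup>L \<nu> \<phi>))"
    unfolding vague_topology_def
    by (intro continuous_map_pullback continuous_map_product_projection assms)
  then show ?thesis using assms by (simp add: comp_def)
qed

lemma coords_continuous: "continuous_map (pullback_topology locally_finite_measures vague_coords euclidean) euclideanreal (\<lambda>\<nu>. vague_coords \<nu> i)"
proof -
  have "continuous_map euclidean euclideanreal (\<lambda>\<omega> :: nat \<times> nat \<Rightarrow> real. \<omega> i)"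
    by (simp add: continuous_on_product_coordinates)
  from continuous_map_pullback[OF this, of locally_finite_measures vague_coords]
  show ?thesis by (simp add: comp_def)
qed

text \<open>Replacing \<phi> by a polynomial times a tent costs at most \<delta> times the tent mass
  \<open>m \<nu>\<close>, which is not bounded over all measures. The neighbourhood of \<nu>0
  therefore also keeps this mass below \<open>m \<nu>0 + 1\<close>; as the mass is itself one of the
  coordinates, this is an open condition.\<close>

lemma vague_coords_approx:
  assumes \<phi>: "\<phi> \<in> compactly_supported"
  shows "continuous_map (pullback_topology locally_finite_measures vague_coords euclidean) euclideanreal (\<lambda>\<nu>. integral\<^sup>L \<nu> \<phi>)"
proof -
  define X where "X = pullback_topology locally_finite_measures vague_coords (euclidean :: (nat \<times> nat \<Rightarrow> real) topology)"
  have top: "topspace X = locally_finite_measures" by (simp add: X_def topspace_pullback_topology)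
  obtain B where B: "\<And>x. \<bar>x\<bar> > B \<Longrightarrow> \<phi> x = 0" using compactly_supported_bound[OF \<phi>] by metis
  obtain n where n: "B \<le> real n" using real_arch_simple by blast
  \<comment> \<open>The tent is 1 on the support of \<phi> and vanishes outside [-(n+1),n+1], so a
    polynomial close to \<phi> on that interval is, after multiplication by the tent, close
    everywhere.\<close>
  have supp: "\<phi> x = \<phi> x * tent n x" for x
    using B[of x] n tent_simps(3)[of x n] by (cases "\<bar>x\<bar> \<le> real n") auto
  define m where "m \<nu> = vague_coords \<nu> (0, n)" for \<nu>
  have m: "m \<nu> = integral\<^sup>L \<nu> (tent n)" for \<nu> by (simp add: m_def vague_coords_def)
  have cm: "continuous_map X euclideanreal m" unfolding m_def X_def by (rule coords_continuous)
  have "topcontinuous_at X euclideanreal (\<lambda>\<nu>. integral\<^sup>L \<nu> \<phi>) \<nu>0" if \<nu>0: "\<nu>0 \<in> topspace X" for \<nu>0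
    unfolding topcontinuous_at_def
  proof (intro conjI allI impI)
    fix V assume V: "openin euclideanreal V \<and> integral\<^sup>L \<nu>0 \<phi> \<in> V"
    then obtain e where e: "e > 0" "ball (integral\<^sup>L \<nu>0 \<phi>) e \<subseteq> V" using openE[of V] by auto
    have m0: "0 \<le> m \<nu>0" unfolding m by (rule integral_nonneg_AE) (simp add: tent_simps)
    \<comment> \<open>With this \<delta> the approximation errors at \<nu> and \<nu>0 and the
      difference of the two values of G are each at most e/4, which sums to less than e.\<close>
    define \<delta> where "\<delta> = e / 4 / (m \<nu>0 + 1)"
    have "m \<nu>0 + 1 \<noteq> 0" using m0 by simp
    then have \<delta>: "\<delta> > 0" "\<delta> * (m \<nu>0 + 1) = e / 4"
      using e m0 nonzero_eq_divide_eq[of "m \<nu>0 + 1" \<delta> "e / 4"] \<delta>_def by auto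
    obtain P where P: "real_polynomial_function P" "\<And>x. x \<in> {- (real n + 1)..real n + 1} \<Longrightarrow> \<bar>\<phi> x - P x\<bar> < \<delta>"
      using Stone_Weierstrass_real_polynomial_function[of "{- (real n + 1)..real n + 1}" \<phi> \<delta>] \<phi> \<delta>(1)
      by (auto simp: compactly_supported_def intro: continuous_on_subset)
    obtain a d where Pa: "P = (\<lambda>x. \<Sum>i\<le>d. a i * x ^ i)"
      using P(1) unfolding real_polynomial_function_iff_sum by blast
    define G where "G \<nu> = (\<Sum>i\<le>d. a i * vague_coords \<nu> (i, n))" for \<nu>
    have cG: "continuous_map X euclideanreal G"
      unfolding G_def X_def by (intro continuous_map_sum continuous_map_real_mult continuous_map_canonical_const coords_continuous) auto
    have close: "\<bar>integral\<^sup>L \<nu> \<phi> - G \<nu>\<bar> \<le> \<delta> * m \<nu>" if \<nu>: "\<nu> \<in> locally_finite_measures" for \<nu>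
    proof -
      note int = compactly_supported_integrable[OF _ \<nu>]
      have it: "integrable \<nu> (\<lambda>x. a i * (x ^ i * tent n x))" for i by (intro integrable_mult_right int tent_compact)
      have tt: "integrable \<nu> (tent n)" using int[OF tent_compact[of 0 n]] by simp
      have "G \<nu> = integral\<^sup>L \<nu> (\<lambda>x. \<Sum>i\<le>d. a i * (x ^ i * tent n x))"
        by (subst Bochner_Integration.integral_sum) (use it in \<open>auto simp: G_def vague_coords_def\<close>)
      also have "(\<lambda>x. \<Sum>i\<le>d. a i * (x ^ i * tent n x)) = (\<lambda>x. P x * tent n x)"
        by (simp add: Pa sum_distrib_right mult.assoc)
      finally have G: "G \<nu> = integral\<^sup>L \<nu> (\<lambda>x. P x * tent n x)" .
      have iP: "integrable \<nu> (\<lambda>x. P x * tent n x)"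
      proof -
        have "integrable \<nu> (\<lambda>x. \<Sum>i\<le>d. a i * (x ^ i * tent n x))" using it by (intro Bochner_Integration.integrable_sum) auto
        then show ?thesis by (simp add: Pa sum_distrib_right mult.assoc)
      qed
      have "integral\<^sup>L \<nu> \<phi> - G \<nu> = integral\<^sup>L \<nu> (\<lambda>x. \<phi> x - P x * tent n x)"
        unfolding G by (rule Bochner_Integration.integral_diff[symmetric, OF int[OF \<phi>] iP])
      also have "norm \<dots> \<le> integral\<^sup>L \<nu> (\<lambda>x. \<delta> * tent n x)"
      proof (rule order_trans[OF integral_norm_bound], rule integral_mono)
        show "integrable \<nu> (\<lambda>x. norm (\<phi> x - P x * tent n x))" by (intro integrable_norm Bochner_Integration.integrable_diff int[OF \<phi>] iP)
        show "integrable \<nu> (\<lambda>x. \<delta> * tent n x)" by (intro integrable_mult_right tt)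
        fix x
        have "\<phi> x - P x * tent n x = (\<phi> x - P x) * tent n x" using supp[of x] by (simp add: left_diff_distrib)
        moreover have "\<bar>\<phi> x - P x\<bar> * tent n x \<le> \<delta> * tent n x"
        proof (cases "\<bar>x\<bar> \<le> real n + 1")
          case True
          then have "\<bar>\<phi> x - P x\<bar> \<le> \<delta>" using P(2)[of x] by (auto simp: abs_le_iff)
          then show ?thesis using tent_simps(1) by (rule mult_right_mono)
        qed (use tent_simps(4)[of n x] in auto)
        ultimately show "norm (\<phi> x - P x * tent n x) \<le> \<delta> * tent n x" using tent_simps(1)[of n x] by (simp add: abs_mult)
      qed
      also have "\<dots> = \<delta> * m \<nu>" unfolding m by simp
      finally show ?thesis by simp
    qed
    define U where "U = {\<nu> \<in> topspace X. m \<nu> \<in> {..<m \<nu>0 + 1}} \<inter> {\<nu> \<in> topspace X. G \<nu> \<in> ball (G \<nu>0) (e / 4)}"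
    show "\<exists>U. openin X U \<and> \<nu>0 \<in> U \<and> (\<forall>\<nu>\<in>U. integral\<^sup>L \<nu> \<phi> \<in> V)"
    proof (intro exI conjI ballI)
      show "openin X U" unfolding U_def
        by (intro openin_Int openin_continuous_map_preimage[OF cm] openin_continuous_map_preimage[OF cG]) auto
      show "\<nu>0 \<in> U" using \<nu>0 e by (auto simp: U_def)
      fix \<nu> assume "\<nu> \<in> U"
      then have \<nu>: "\<nu> \<in> locally_finite_measures" "m \<nu> < m \<nu>0 + 1" "\<bar>G \<nu>0 - G \<nu>\<bar> < e / 4" by (auto simp: U_def top dist_real_def)
      have "\<delta> * m \<nu> \<le> e / 4" "\<delta> * m \<nu>0 \<le> e / 4" using \<delta> \<nu>(2) mult_left_mono[of "m \<nu>" "m \<nu>0 + 1" \<delta>] mult_left_mono[of "m \<nu>0" "m \<nu>0 + 1" \<delta>] by auto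
      then have "\<bar>integral\<^sup>L \<nu>0 \<phi> - integral\<^sup>L \<nu> \<phi>\<bar> < e"
        using close[OF \<nu>(1)] close[of \<nu>0] \<nu>0 \<nu>(3) e(1) unfolding top by linarith
      then show "integral\<^sup>L \<nu> \<phi> \<in> V" using e(2) by (auto simp: dist_real_def subset_iff)
    qed
  qed (use \<nu>0 in auto)
  then show ?thesis unfolding X_def[symmetric] continuous_map_eq_topcontinuous_at by blast
qed

text \<open>By the Weierstrass theorem, polynomials times tents approximate every test function uniformly on its
  support, so the vague topology is generated by countably many of its integrals.\<close>

lemma vague_topology_eq: "vague_topology = pullback_topology locally_finite_measures vague_coords euclidean"
proof (rule topology_eq[THEN iffD2], intro allI iffI)
  fix S assume "openin vague_topology S"
  then obtain V where V: "openin (product_topology (\<lambda>_. euclideanreal) compactly_supported) V"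
    "S = (\<lambda>\<nu>. \<lambda>\<phi>\<in>compactly_supported. integral\<^sup>L \<nu> \<phi>) -` V \<inter> locally_finite_measures"
    by (auto simp: vague_topology_def openin_pullback_topology)
  let ?X = "pullback_topology locally_finite_measures vague_coords (euclidean :: (nat \<times> nat \<Rightarrow> real) topology)"
  have "continuous_map ?X (product_topology (\<lambda>_. euclideanreal) compactly_supported) (\<lambda>\<nu>. \<lambda>\<phi>\<in>compactly_supported. integral\<^sup>L \<nu> \<phi>)"
    unfolding continuous_map_componentwise using vague_coords_approx by auto
  from openin_continuous_map_preimage[OF this V(1)]
  have "openin ?X {x \<in> topspace ?X. (\<lambda>\<phi>\<in>compactly_supported. integral\<^sup>L x \<phi>) \<in> V}" .
  moreover have "{x \<in> topspace ?X. (\<lambda>\<phi>\<in>compactly_supported. integral\<^sup>L x \<phi>) \<in> V} = S"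
    unfolding V(2) by (auto simp: topspace_pullback_topology)
  ultimately show "openin ?X S" by simp
next
  fix S assume "openin (pullback_topology locally_finite_measures vague_coords (euclidean :: (nat \<times> nat \<Rightarrow> real) topology)) S"
  then obtain V where V: "open V" "S = vague_coords -` V \<inter> locally_finite_measures" by (auto simp: openin_pullback_topology)
  have top: "topspace vague_topology = locally_finite_measures"
    by (auto simp: vague_topology_def topspace_pullback_topology)
  have "continuous_map vague_topology (product_topology (\<lambda>_. euclideanreal) UNIV) vague_coords"
    unfolding continuous_map_componentwise_UNIV vague_coords_def
    using vague_continuous[OF tent_compact] by auto
  then have "continuous_map vague_topology euclidean vague_coords" by (simp add: euclidean_product_topology)
  from openin_continuous_map_preimage[OF this, of V] V
  have "openin vague_topology {x \<in> topspace vague_topology. vague_coords x \<in> V}" by simp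
  moreover have "{x \<in> topspace vague_topology. vague_coords x \<in> V} = S" using V top by auto
  ultimately show "openin vague_topology S" by simp
qed

lemma topspace_vague: "topspace vague_topology = locally_finite_measures"
  by (simp add: vague_topology_eq topspace_pullback_topology)

lemma second_countable_vague: "second_countable vague_topology"
  unfolding vague_topology_eq by (rule second_countable_pullback)

text \<open>The vague topology is a pullback from a countable product of lines, whose Borel sets are
  generated by the coordinates; so it suffices to observe integrals of test functions.\<close>

lemma measurable_vagueI:
  assumes "\<And>x. x \<in> space M \<Longrightarrow> g x \<in> locally_finite_measures"
    and "\<And>\<phi>. \<phi> \<in> compactly_supported \<Longrightarrow> (\<lambda>x. integral\<^sup>L (g x) \<phi>) \<in> borel_measurable M"
  shows "g \<in> measurable M (borel_of vague_topology)"
  unfolding vague_topology_eq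
proof (rule measurable_pullback)
  show "(\<lambda>x. vague_coords (g x)) \<in> borel_measurable M"
  proof (rule measurable_coordinatewise_then_product)
    fix i :: "nat \<times> nat"
    show "(\<lambda>x. vague_coords (g x) i) \<in> borel_measurable M"
      using assms(2)[OF tent_compact] by (cases i) (simp add: vague_coords_def)
  qed
qed (use assms(1) in auto)

lemma limitin_vagueI:
  assumes "\<nu> \<in> locally_finite_measures" "\<forall>\<^sub>F i in F. \<mu> i \<in> locally_finite_measures"
    and "\<And>\<phi>. \<phi> \<in> compactly_supported \<Longrightarrow> ((\<lambda>i. integral\<^sup>L (\<mu> i) \<phi>) \<longlongrightarrow> integral\<^sup>L \<nu> \<phi>) F"
  shows "limitin vague_topology \<mu> \<nu> F"
  unfolding vague_topology_def
  by (rule limitin_pullback[OF assms(1,2)]) (use assms(3) in \<open>auto simp: limitin_componentwise\<close>)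

text \<open>The mass of an open interval is lower semicontinuous: its indicator is an increasing
  limit of test functions, and the mass is a countable supremum of vaguely continuous
  integrals.\<close>

lemma emeasure_vague_measurable:
  "(\<lambda>\<nu>. emeasure \<nu> {- \<epsilon><..<\<epsilon>}) \<in> borel_measurable (borel_of vague_topology)"
proof -
  define \<phi> where "\<phi> n x = max 0 (min 1 (real n * (\<epsilon> - \<bar>x\<bar>)))" for n x
  have z: "\<phi> n x = 0" if "\<epsilon> \<le> \<bar>x\<bar>" for n x
  proof -
    have "real n * (\<epsilon> - \<bar>x\<bar>) \<le> 0" using that by (intro mult_nonneg_nonpos) auto
    then show ?thesis by (simp add: \<phi>_def)
  qed
  have c: "\<phi> n \<in> compactly_supported" for n
  proof (rule compactly_supportedI[of _ \<epsilon>])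
    show "continuous_on UNIV (\<phi> n)" unfolding \<phi>_def[abs_def] by (intro continuous_intros)
  qed (simp add: z)
  have eq: "emeasure \<nu> {- \<epsilon><..<\<epsilon>} = (SUP n. ennreal (integral\<^sup>L \<nu> (\<phi> n)))" if \<nu>: "\<nu> \<in> locally_finite_measures" for \<nu>
  proof -
    have sets: "sets \<nu> = sets borel" using \<nu> by (simp add: locally_finite_measures_def)
    have m: "\<phi> n \<in> borel_measurable \<nu>" for n using compactly_supported_integrable[OF c \<nu>] by (rule borel_measurable_integrable)
    have "emeasure \<nu> {- \<epsilon><..<\<epsilon>} = (\<integral>\<^sup>+x. indicator {- \<epsilon><..<\<epsilon>} x \<partial>\<nu>)" using sets by simp
    also have "\<dots> = (\<integral>\<^sup>+x. (SUP n. ennreal (\<phi> n x)) \<partial>\<nu>)"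
    proof (rule nn_integral_cong)
      fix x
      show "indicator {- \<epsilon><..<\<epsilon>} x = (SUP n. ennreal (\<phi> n x))"
      proof (cases "x \<in> {- \<epsilon><..<\<epsilon>}")
        case True
        then have "0 < \<epsilon> - \<bar>x\<bar>" by auto
        then obtain n where "1 < real n * (\<epsilon> - \<bar>x\<bar>)" using reals_Archimedean3 by blast
        then have "\<phi> n x = 1" by (simp add: \<phi>_def)
        then have "1 \<le> (SUP n. ennreal (\<phi> n x))" by (intro SUP_upper2[of n]) auto
        moreover have "(SUP n. ennreal (\<phi> n x)) \<le> 1" by (intro SUP_least) (simp add: \<phi>_def)
        ultimately show ?thesis using True by simp
      next
        case False
        then have "\<phi> n x = 0" for n by (intro z) auto
        then show ?thesis using False by simp
      qed
    qed
    also have "\<dots> = (SUP n. \<integral>\<^sup>+x. ennreal (\<phi> n x) \<partial>\<nu>)"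
    proof (rule nn_integral_monotone_convergence_SUP)
      show "incseq (\<lambda>n x. ennreal (\<phi> n x))"
      proof (rule incseq_SucI, rule le_funI, rule ennreal_leI)
        fix n x
        show "\<phi> n x \<le> \<phi> (Suc n) x"
        proof (cases "\<epsilon> \<le> \<bar>x\<bar>")
          case False
          then have "real n * (\<epsilon> - \<bar>x\<bar>) \<le> real (Suc n) * (\<epsilon> - \<bar>x\<bar>)" by (intro mult_right_mono) auto
          then show ?thesis unfolding \<phi>_def by (intro max.mono min.mono) auto
        qed (simp add: z)
      qed
    qed (use m in simp)
    also have "\<dots> = (SUP n. ennreal (integral\<^sup>L \<nu> (\<phi> n)))"
      by (intro SUP_cong refl nn_integral_eq_integral compactly_supported_integrable c \<nu>) (simp add: \<phi>_def)
    finally show ?thesis .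
  qed
  have "(\<lambda>\<nu>. SUP n. ennreal (integral\<^sup>L \<nu> (\<phi> n))) \<in> borel_measurable (borel_of vague_topology)"
    by (intro borel_measurable_SUP measurable_compose[OF _ measurable_ennreal] continuous_map_borel_measurable vague_continuous c) auto
  then show ?thesis
    by (rule measurable_cong[THEN iffD1, rotated]) (simp add: eq topspace_vague)
qed

section \<open>Measurable dependence on the coefficient function\<close>

lemma integral_sum_intervals:
  fixes f :: "real \<Rightarrow> real"
  assumes f: "f integrable_on {s..s + real n * d}" and d: "0 \<le> d"
  shows "integral {s..s + real n * d} f = (\<Sum>i<n. integral {s + real i * d..s + real (Suc i) * d} f)"
  using f
proof (induction n)
  case (Suc n)
  have le: "s \<le> s + real n * d" "s + real n * d \<le> s + real (Suc n) * d" using d by (auto simp: algebra_simps)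
  have "f integrable_on {s..s + real n * d}" by (rule integrable_on_subinterval[OF Suc.prems]) (use le in auto)
  from Suc.IH[OF this] Henstock_Kurzweil_Integration.integral_combine[OF le Suc.prems]
  show ?case by simp
qed simp

text \<open>Sums of Stieltjes type, in which f enters only through its integrals over intervals, the
  measurable data of R. Uniform continuity of h bounds the error by e' times the integral of
  |f|.\<close>

lemma riemann_sums_tendsto:
  fixes f h :: "real \<Rightarrow> real"
  assumes st: "s \<le> t" and f: "f integrable_on {s..t}" and af: "(\<lambda>u. \<bar>f u\<bar>) integrable_on {s..t}"
    and fh: "(\<lambda>u. f u * h u) integrable_on {s..t}" and h: "continuous_on {s..t} h"
  shows "(\<lambda>n. \<Sum>i<Suc n. h (s + real i * ((t - s) / Suc n)) *
      integral {s + real i * ((t - s) / Suc n)..s + real (Suc i) * ((t - s) / Suc n)} f)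
    \<longlonglongrightarrow> integral {s..t} (\<lambda>u. f u * h u)"
proof (rule LIMSEQ_I)
  fix e :: real assume e: "0 < e"
  define A where "A = integral {s..t} (\<lambda>u. \<bar>f u\<bar>)"
  have A: "0 \<le> A" unfolding A_def by (rule integral_nonneg[OF af]) auto
  define e' where "e' = e / 2 / (A + 1)"
  have e': "e' > 0" "e' * A < e"
  proof -
    show "e' > 0" using e A by (simp add: e'_def)
    then have "e' * A \<le> e' * (A + 1)" by simp
    also have "\<dots> = e / 2" using A nonzero_eq_divide_eq[of "A + 1" e' "e / 2"] e'_def by auto
    finally show "e' * A < e" using e by simp
  qed
  have "uniformly_continuous_on {s..t} h" by (rule compact_uniformly_continuous[OF h]) simp
  then obtain \<delta> where \<delta>: "\<delta> > 0" "\<And>u v. u \<in> {s..t} \<Longrightarrow> v \<in> {s..t} \<Longrightarrow> \<bar>v - u\<bar> < \<delta> \<Longrightarrow> \<bar>h v - h u\<bar> < e'"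
    unfolding uniformly_continuous_on_def dist_real_def using e'(1) by blast
  obtain N where N: "(t - s) / \<delta> < real N" using reals_Archimedean2 by blast
  show "\<exists>N. \<forall>n\<ge>N. norm ((\<Sum>i<Suc n. h (s + real i * ((t - s) / Suc n)) *
      integral {s + real i * ((t - s) / Suc n)..s + real (Suc i) * ((t - s) / Suc n)} f) - integral {s..t} (\<lambda>u. f u * h u)) < e"
  proof (intro exI allI impI)
    fix n assume n: "N \<le> n"
    define d where "d = (t - s) / Suc n"
    have d0: "0 \<le> d" using st by (simp add: d_def)
    have dd: "d < \<delta>"
    proof -
      have "(t - s) / \<delta> < real (Suc n)" using N n by linarith
      then show ?thesis using \<delta>(1) by (simp add: d_def field_simps)
    qed
    have top: "s + real (Suc n) * d = t" by (simp add: d_def)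
    let ?K = "\<lambda>i. {s + real i * d..s + real (Suc i) * d}"
    have Ksub: "?K i \<subseteq> {s..t}" if "i < Suc n" for i
    proof -
      have "real (Suc i) * d \<le> real (Suc n) * d" using that d0 by (intro mult_right_mono) auto
      moreover have "0 \<le> real i * d" using d0 by simp
      ultimately have "s \<le> s + real i * d" "s + real (Suc i) * d \<le> t" using top by linarith+
      then show ?thesis by auto
    qed
    have sums: "integral {s..t} g = (\<Sum>i<Suc n. integral (?K i) g)" if "g integrable_on {s..t}" for g :: "real \<Rightarrow> real"
      using integral_sum_intervals[of g s "Suc n" d] that d0 unfolding top by simp
    note sub = integrable_on_subinterval[OF _ Ksub]
    have "\<bar>h (s + real i * d) * integral (?K i) f - integral (?K i) (\<lambda>u. f u * h u)\<bar> \<le> e' * integral (?K i) (\<lambda>u. \<bar>f u\<bar>)"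
      if i: "i < Suc n" for i
    proof -
      have i1: "(\<lambda>u. h (s + real i * d) * f u) integrable_on ?K i" by (intro integrable_on_mult_right sub[OF f i])
      have "h (s + real i * d) * integral (?K i) f - integral (?K i) (\<lambda>u. f u * h u)
         = integral (?K i) (\<lambda>u. h (s + real i * d) * f u - f u * h u)"
        using Henstock_Kurzweil_Integration.integral_diff[OF i1 sub[OF fh i]] by simp
      also have "norm \<dots> \<le> integral (?K i) (\<lambda>u. e' * \<bar>f u\<bar>)"
      proof (rule Henstock_Kurzweil_Integration.integral_norm_bound_integral)
        show "(\<lambda>u. h (s + real i * d) * f u - f u * h u) integrable_on ?K i"
          by (intro integrable_diff i1 sub[OF fh i])
        show "(\<lambda>u. e' * \<bar>f u\<bar>) integrable_on ?K i" by (intro integrable_on_mult_right sub[OF af i])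
        fix u assume u: "u \<in> ?K i"
        have nd: "s + real i * d \<in> ?K i" using d0 by (auto simp: algebra_simps)
        have "s + real i * d \<in> {s..t}" "u \<in> {s..t}" using Ksub[OF i] u nd by blast+
        then have "\<bar>h (s + real i * d) - h u\<bar> < e'"
          using u dd by (intro \<delta>(2)) (auto simp: algebra_simps)
        then have "\<bar>h (s + real i * d) - h u\<bar> * \<bar>f u\<bar> \<le> e' * \<bar>f u\<bar>" by (intro mult_right_mono) auto
        moreover have "h (s + real i * d) * f u - f u * h u = (h (s + real i * d) - h u) * f u" by (simp add: algebra_simps)
        ultimately show "norm (h (s + real i * d) * f u - f u * h u) \<le> e' * \<bar>f u\<bar>" by (simp add: abs_mult)
      qed
      finally show ?thesis by simp
    qed
    then have "\<bar>(\<Sum>i<Suc n. h (s + real i * d) * integral (?K i) f - integral (?K i) (\<lambda>u. f u * h u))\<bar>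
        \<le> (\<Sum>i<Suc n. e' * integral (?K i) (\<lambda>u. \<bar>f u\<bar>))"
      by (intro order_trans[OF sum_abs] sum_mono) simp
    also have "\<dots> = e' * A" unfolding A_def sums[OF af] by (simp only: sum_distrib_left)
    finally show "norm ((\<Sum>i<Suc n. h (s + real i * ((t - s) / Suc n)) *
      integral {s + real i * ((t - s) / Suc n)..s + real (Suc i) * ((t - s) / Suc n)} f) - integral {s..t} (\<lambda>u. f u * h u)) < e"
      using e'(2) unfolding d_def[symmetric] sums[OF fh] by (simp only: sum_subtractf real_norm_def)
  qed
qed

text \<open>N will be the probability space with the sigma-algebra generated by R;
  \<open>obs\<close> is the measurability that a coefficient space provides.\<close>

locale random_coefficient =
  fixes N :: "'w measure" and I :: "real set" and R :: "'w \<Rightarrow> real \<Rightarrow> real ^ 2 ^ 2"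
  assumes coef: "\<And>\<omega>. \<omega> \<in> space N \<Longrightarrow> dirac_coefficient I (R \<omega>)"
    and obs: "\<And>s t. s \<in> I \<Longrightarrow> t \<in> I \<Longrightarrow> (\<lambda>\<omega>. LINT u:{s..t}|lebesgue. R \<omega> u) \<in> borel_measurable N"
begin

text \<open>The condition 0 < s keeps the interval inside I in both cases. R is bounded on it, so
  the entry of the integral is the integral of the entry.\<close>

lemma entry_integral_measurable:
  assumes st: "0 < s" "s \<le> t" "t \<le> 1"
  shows "(\<lambda>\<omega>. integral {s..t} (entry (R \<omega>) i j)) \<in> borel_measurable N"
proof (cases "space N = {}")
  case True
  then show ?thesis by (simp add: measurable_def)
next
  case False
  then obtain \<omega>0 where "\<omega>0 \<in> space N" by blast
  then have "{0<..1} \<subseteq> I" by (rule dirac_coefficient.sub_I(1)[OF coef])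
  then have sub: "{s..t} \<subseteq> I" "{s..t} \<subseteq> {0<..1}" using st by auto
  have stI: "s \<in> I" "t \<in> I" using sub st by auto
  have "(\<lambda>A :: real ^ 2 ^ 2. A $ i $ j) \<in> borel_measurable borel"
    by (intro borel_measurable_continuous_onI continuous_intros)
  with obs[OF stI] have "(\<lambda>\<omega>. (LINT u:{s..t}|lebesgue. R \<omega> u) $ i $ j) \<in> borel_measurable N"
    by (rule measurable_compose)
  moreover have "(LINT u:{s..t}|lebesgue. R \<omega> u) $ i $ j = integral {s..t} (entry (R \<omega>) i j)" if \<omega>: "\<omega> \<in> space N" for \<omega>
  proof -
    interpret dirac_coefficient I "R \<omega>" using \<omega> by (rule coef)
    have "bounded (R \<omega> ` {s..t})" using A1 sub by (intro locally_bounded_on_compact) (auto simp: assumption1_def)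
    then obtain B where "\<forall>y\<in>R \<omega> ` {s..t}. norm y \<le> B" unfolding bounded_iff by blast
    then have B: "norm (R \<omega> u) \<le> B" if "u \<in> {s..t}" for u using that by blast
    have int: "integrable lebesgue (\<lambda>u. indicator {s..t} u *\<^sub>R R \<omega> u)"
    proof (rule integrableI_bounded_set[of "{s..t}" _ _ B])
      have "(\<lambda>u. indicator I u *\<^sub>R R \<omega> u) \<in> borel_measurable lebesgue"
        using A1 by (simp add: assumption1_def set_borel_measurable_def)
      moreover have "{s..t} \<in> sets lebesgue" by simp
      ultimately have "(\<lambda>u. indicator {s..t} u *\<^sub>R (indicator I u *\<^sub>R R \<omega> u)) \<in> borel_measurable lebesgue"
        by (rule borel_measurable_scaleR[OF borel_measurable_indicator, rotated])
      moreover have "(\<lambda>u. indicat_real {s..t} u *\<^sub>R (indicat_real I u *\<^sub>R R \<omega> u)) = (\<lambda>u. indicat_real {s..t} u *\<^sub>R R \<omega> u)"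
        using sub by (auto simp: fun_eq_iff indicator_def)
      ultimately show "(\<lambda>u. indicator {s..t} u *\<^sub>R R \<omega> u) \<in> borel_measurable lebesgue" by simp
    qed (use B st in \<open>auto simp: indicator_def\<close>)
    have bl: "bounded_linear (\<lambda>A :: real ^ 2 ^ 2. A $ i $ j)"
      using bounded_linear_compose[OF bounded_linear_vec_nth bounded_linear_vec_nth] .
    have "(LINT u:{s..t}|lebesgue. R \<omega> u) $ i $ j = (\<integral>u. (indicator {s..t} u *\<^sub>R R \<omega> u) $ i $ j \<partial>lebesgue)"
      unfolding set_lebesgue_integral_def by (rule integral_bounded_linear[OF bl int, symmetric])
    also have "\<dots> = (\<integral>u. indicator {s..t} u *\<^sub>R entry (R \<omega>) i j u \<partial>lebesgue)"
      by (intro Bochner_Integration.integral_cong) (use sub in \<open>auto simp: indicator_def entry_def\<close>)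
    also have "\<dots> = integral {s..t} (entry (R \<omega>) i j)"
    proof -
      have "integrable lebesgue (\<lambda>u. (indicator {s..t} u *\<^sub>R R \<omega> u) $ i $ j)"
        by (rule integrable_bounded_linear[OF bl int])
      moreover have "(\<lambda>u. (indicat_real {s..t} u *\<^sub>R R \<omega> u) $ i $ j) = (\<lambda>u. indicat_real {s..t} u *\<^sub>R entry (R \<omega>) i j u)"
        using sub by (auto simp: fun_eq_iff indicator_def entry_def)
      ultimately have "set_integrable lebesgue {s..t} (entry (R \<omega>) i j)" by (simp add: set_integrable_def)
      from set_lebesgue_integral_eq_integral(2)[OF this] show ?thesis by (simp add: set_lebesgue_integral_def)
    qed
    finally show ?thesis .
  qed
  ultimately show ?thesis by (subst measurable_cong[of N _ "\<lambda>\<omega>. (LINT u:{s..t}|lebesgue. R \<omega> u) $ i $ j"]) auto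
qed

lemma product_integral_measurable:
  assumes t: "t \<in> {0<..1}" and h: "\<And>u. u \<in> {0..1} \<Longrightarrow> (\<lambda>\<omega>. h \<omega> u) \<in> borel_measurable N"
    and hc: "\<And>\<omega>. \<omega> \<in> space N \<Longrightarrow> continuous_on {0..1} (h \<omega>)" and s: "0 < s" "s \<le> t"
  shows "(\<lambda>\<omega>. integral {s..t} (\<lambda>u. entry (R \<omega>) i j u * h \<omega> u)) \<in> borel_measurable N"
    and "\<And>\<omega>. \<omega> \<in> space N \<Longrightarrow> (\<lambda>u. entry (R \<omega>) i j u * h \<omega> u) integrable_on {s..t}"
proof -
  have int: "(\<lambda>u. entry (R \<omega>) i j u * k u) absolutely_integrable_on {s..t}"
    if \<omega>: "\<omega> \<in> space N" and k: "continuous_on {0..1} k" for \<omega> k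
  proof -
    interpret dirac_coefficient I "R \<omega>" using \<omega> by (rule coef)
    have "{s..t} \<subseteq> I" using s t sub_I by auto
    then obtain B where B: "B \<ge> 0" "\<And>u. u \<in> {s..t} \<Longrightarrow> \<bar>entry (R \<omega>) i j u\<bar> \<le> B"
      using R_bounded[of "{s..t}"] by (metis compact_Icc)
    have "bounded (k ` {0..1})" by (intro compact_imp_bounded compact_continuous_image k) auto
    then obtain C where C: "0 \<le> C" "\<And>u. u \<in> {0..1} \<Longrightarrow> \<bar>k u\<bar> \<le> C" by (rule bounded_realE) blast
    have "k \<in> borel_measurable (lebesgue_on {s..t})"
      by (rule continuous_imp_measurable_on_sets_lebesgue[OF continuous_on_subset[OF k]]) (use s t in auto)
    then have "(\<lambda>u. entry (R \<omega>) i j u * k u) \<in> borel_measurable (lebesgue_on {s..t})"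
      by (intro borel_measurable_times measurable_restrict_space1[OF entry_meas])
    then show ?thesis
    proof (rule measurable_bounded_by_integrable_imp_absolutely_integrable)
      show "(\<lambda>_. B * C) integrable_on {s..t}" by (rule integrable_const_ivl)
      fix u assume u: "u \<in> {s..t}"
      then have "u \<in> {0..1}" using s t by auto
      then show "norm (entry (R \<omega>) i j u * k u) \<le> B * C" unfolding real_norm_def abs_mult
        using B C u by (intro mult_mono) auto
    qed simp
  qed
  note int' = int[THEN set_lebesgue_integral_eq_integral(1)]
  show "(\<lambda>u. entry (R \<omega>) i j u * h \<omega> u) integrable_on {s..t}" if "\<omega> \<in> space N" for \<omega>
    by (rule int'[OF that hc[OF that]])
  have one: "entry (R \<omega>) i j absolutely_integrable_on {s..t}" if "\<omega> \<in> space N" for \<omega>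
    using int[OF that, of "\<lambda>_. 1"] by simp
  show "(\<lambda>\<omega>. integral {s..t} (\<lambda>u. entry (R \<omega>) i j u * h \<omega> u)) \<in> borel_measurable N"
  proof (rule borel_measurable_LIMSEQ_real)
    fix \<omega> assume \<omega>: "\<omega> \<in> space N"
    show "(\<lambda>n. \<Sum>k<Suc n. h \<omega> (s + real k * ((t - s) / Suc n)) *
      integral {s + real k * ((t - s) / Suc n)..s + real (Suc k) * ((t - s) / Suc n)} (entry (R \<omega>) i j))
      \<longlonglongrightarrow> integral {s..t} (\<lambda>u. entry (R \<omega>) i j u * h \<omega> u)"
    proof (rule riemann_sums_tendsto[OF s(2)])
      show "entry (R \<omega>) i j integrable_on {s..t}" using one[OF \<omega>] by (rule set_lebesgue_integral_eq_integral(1))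
      show "(\<lambda>u. \<bar>entry (R \<omega>) i j u\<bar>) integrable_on {s..t}" using one[OF \<omega>] by (simp add: absolutely_integrable_on_def)
      show "continuous_on {s..t} (h \<omega>)" by (rule continuous_on_subset[OF hc[OF \<omega>]]) (use s t in auto)
    qed (rule int'[OF \<omega> hc[OF \<omega>]])
  next
    fix n
    show "(\<lambda>\<omega>. \<Sum>k<Suc n. h \<omega> (s + real k * ((t - s) / Suc n)) *
      integral {s + real k * ((t - s) / Suc n)..s + real (Suc k) * ((t - s) / Suc n)} (entry (R \<omega>) i j)) \<in> borel_measurable N"
    proof (intro borel_measurable_sum borel_measurable_times)
      fix k assume k: "k \<in> {..<Suc n}"
      define d where "d = (t - s) / Suc n"
      have d0: "0 \<le> d" using s by (simp add: d_def)
      have "real (Suc k) * d \<le> real (Suc n) * d" using k d0 by (intro mult_right_mono) auto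
      moreover have "real (Suc n) * d = t - s" by (simp add: d_def)
      moreover have "0 \<le> real k * d" "real k * d \<le> real (Suc k) * d" using d0 by (auto simp: algebra_simps)
      ultimately have le: "0 < s + real k * d" "s + real k * d \<le> s + real (Suc k) * d" "s + real (Suc k) * d \<le> 1"
        using s t by auto
      show "(\<lambda>\<omega>. h \<omega> (s + real k * ((t - s) / Suc n))) \<in> borel_measurable N"
        unfolding d_def[symmetric] by (rule h) (use le in auto)
      show "(\<lambda>\<omega>. integral {s + real k * ((t - s) / Suc n)..s + real (Suc k) * ((t - s) / Suc n)} (entry (R \<omega>) i j)) \<in> borel_measurable N"
        unfolding d_def[symmetric] by (rule entry_integral_measurable[OF le])
    qed
  qed
qed

text \<open>Integrability up to 0 is given for the sum of the two products. The sum is split on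
  [s,t] with s > 0, where each product is integrable, and s tends to 0 afterwards.\<close>

lemma row_integral_measurable:
  assumes t: "t \<in> {0..1}" 
    and x: "\<And>u. u \<in> {0..1} \<Longrightarrow> (\<lambda>\<omega>. x \<omega> u) \<in> borel_measurable N" "\<And>\<omega>. \<omega> \<in> space N \<Longrightarrow> continuous_on {0..1} (x \<omega>)"
    and y: "\<And>u. u \<in> {0..1} \<Longrightarrow> (\<lambda>\<omega>. y \<omega> u) \<in> borel_measurable N" "\<And>\<omega>. \<omega> \<in> space N \<Longrightarrow> continuous_on {0..1} (y \<omega>)"
    and int: "\<And>\<omega>. \<omega> \<in> space N \<Longrightarrow> (\<lambda>u. entry (R \<omega>) i j u * x \<omega> u + entry (R \<omega>) i' j' u * y \<omega> u) integrable_on {0..1}"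
  shows "(\<lambda>\<omega>. integral {0..t} (\<lambda>u. entry (R \<omega>) i j u * x \<omega> u + entry (R \<omega>) i' j' u * y \<omega> u)) \<in> borel_measurable N"
proof (cases "t = 0")
  case False
  then have t1: "t \<in> {0<..1}" using t by auto
  let ?f = "\<lambda>\<omega> u. entry (R \<omega>) i j u * x \<omega> u + entry (R \<omega>) i' j' u * y \<omega> u"
  define s where "s n = t * inverse (real (Suc (Suc n)))" for n
  have s: "0 < s n" "s n \<le> t" for n using t1 by (auto simp: s_def field_simps)
  have slim: "s \<longlonglongrightarrow> 0"
  proof -
    have "(\<lambda>n. t * inverse (real (Suc (Suc n)))) \<longlonglongrightarrow> t * 0"
      by (intro tendsto_mult_left LIMSEQ_Suc[OF LIMSEQ_inverse_real_of_nat])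
    then show ?thesis by (simp add: s_def[abs_def])
  qed
  show ?thesis
  proof (rule borel_measurable_LIMSEQ_real)
    fix \<omega> assume \<omega>: "\<omega> \<in> space N"
    have "filterlim s (at_right 0) sequentially"
      using slim s(1) by (auto simp: filterlim_at less_imp_neq[OF s(1), symmetric] intro!: always_eventually)
    from filterlim_compose[OF integral_tendsto_0[OF int[OF \<omega>]] this]
    have "(\<lambda>n. integral {0..t} (?f \<omega>) - integral {0..s n} (?f \<omega>)) \<longlonglongrightarrow> integral {0..t} (?f \<omega>) - 0"
      by (intro tendsto_intros)
    then show "(\<lambda>n. integral {s n..t} (?f \<omega>)) \<longlonglongrightarrow> integral {0..t} (?f \<omega>)"
      using integral_indefinite_diff[OF int[OF \<omega>] less_imp_le[OF s(1)] s(2)] t by simp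
  next
    fix n
    note pm = product_integral_measurable[OF t1 _ _ s(1)[of n] s(2)[of n]]
    have "(\<lambda>\<omega>. integral {s n..t} (\<lambda>u. entry (R \<omega>) i j u * x \<omega> u) + integral {s n..t} (\<lambda>u. entry (R \<omega>) i' j' u * y \<omega> u)) \<in> borel_measurable N"
      by (intro borel_measurable_add pm(1) x y)
    moreover have "integral {s n..t} (?f \<omega>) = integral {s n..t} (\<lambda>u. entry (R \<omega>) i j u * x \<omega> u) + integral {s n..t} (\<lambda>u. entry (R \<omega>) i' j' u * y \<omega> u)"
      if "\<omega> \<in> space N" for \<omega>
      by (rule Henstock_Kurzweil_Integration.integral_add[OF pm(2)[OF x that] pm(2)[OF y that]])
    ultimately show "(\<lambda>\<omega>. integral {s n..t} (?f \<omega>)) \<in> borel_measurable N"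
      by (subst measurable_cong) auto
  qed
qed simp

lemma iter_measurable:
  "\<forall>t\<in>{0..1}. (\<lambda>\<omega>. fst (dirac_iter (entry (R \<omega>) 1 1) (entry (R \<omega>) 1 2) (entry (R \<omega>) 2 2) n) t) \<in> borel_measurable N \<and>
    (\<lambda>\<omega>. snd (dirac_iter (entry (R \<omega>) 1 1) (entry (R \<omega>) 1 2) (entry (R \<omega>) 2 2) n) t) \<in> borel_measurable N"
proof (induction n)
  case (Suc n)
  let ?x = "\<lambda>\<omega>. fst (dirac_iter (entry (R \<omega>) 1 1) (entry (R \<omega>) 1 2) (entry (R \<omega>) 2 2) n)"
  let ?y = "\<lambda>\<omega>. snd (dirac_iter (entry (R \<omega>) 1 1) (entry (R \<omega>) 1 2) (entry (R \<omega>) 2 2) n)"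
  have c: "continuous_on {0..1} (?x \<omega>)" "continuous_on {0..1} (?y \<omega>)"
    "(\<lambda>u. entry (R \<omega>) 1 2 u * ?x \<omega> u + entry (R \<omega>) 2 2 u * ?y \<omega> u) integrable_on {0..1}"
    "(\<lambda>u. entry (R \<omega>) 1 1 u * ?x \<omega> u + entry (R \<omega>) 1 2 u * ?y \<omega> u) integrable_on {0..1}"
    if \<omega>: "\<omega> \<in> space N" for \<omega>
  proof -
    interpret dirac_coefficient I "R \<omega>" using \<omega> by (rule coef)
    show "continuous_on {0..1} (?x \<omega>)" "continuous_on {0..1} (?y \<omega>)" by (rule iter_cont)+
    obtain C where "admissible C (xs n) (ys n)" using iter_admissible by metis
    from admissible_int'[OF this]
    show "(\<lambda>u. entry (R \<omega>) 1 2 u * ?x \<omega> u + entry (R \<omega>) 2 2 u * ?y \<omega> u) integrable_on {0..1}"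
      "(\<lambda>u. entry (R \<omega>) 1 1 u * ?x \<omega> u + entry (R \<omega>) 1 2 u * ?y \<omega> u) integrable_on {0..1}" by auto
  qed
  have m: "(\<lambda>\<omega>. ?x \<omega> u) \<in> borel_measurable N" "(\<lambda>\<omega>. ?y \<omega> u) \<in> borel_measurable N" if "u \<in> {0..1}" for u
    using Suc.IH that by auto
  show ?case unfolding dirac_iter.simps fst_conv snd_conv
    by (intro ballI conjI borel_measurable_uminus row_integral_measurable m c)
qed simp

end

section \<open>The angle coordinate on the circle of boundary conditions\<close>

lemma (in dirac_coefficient) right_spectral_measure_bc_of:
  "\<theta> \<in> {0..<2 * pi} \<Longrightarrow> right_spectral_measure I R None (bc_of \<theta>) = phase.\<mu> \<theta>"
  by (simp add: right_spectral_measure_eq bc_angle_of)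

text \<open>The angle jumps at the point 1 of the circle, but it is a Borel function of the point:
  sin \<alpha> / (1 - cos \<alpha>) = cot(\<alpha>/2) recovers it elsewhere.\<close>

lemma bc_angle_eq_cis: "bc_angle r = (if cis (bc_angle r) = 1 then 0
    else pi - 2 * arctan (Im (cis (bc_angle r)) / (1 - Re (cis (bc_angle r)))))"
proof (cases r)
  case (Some x)
  define a where "a = arctan x"
  have a: "cos a > 0" unfolding a_def by (intro cos_gt_zero_pi arctan_lbound arctan_ubound)
  have ang: "bc_angle r = pi - 2 * a" by (simp add: Some bc_angle_def a_def)
  have "cis (bc_angle r) \<noteq> 1"
  proof
    assume "cis (bc_angle r) = 1"
    then have "cos (pi - 2 * a) = 1" by (simp add: ang complex_eq_iff)
    then have "cos (2 * a) = -1" by (simp add: cos_diff)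
    then show False using a by (simp add: cos_double_cos)
  qed
  moreover have "sin (pi - 2 * a) / (1 - cos (pi - 2 * a)) = x"
  proof -
    have "1 - cos (pi - 2 * a) = 2 * (cos a)\<^sup>2" by (simp add: cos_diff cos_double_cos)
    moreover have "sin (pi - 2 * a) = 2 * sin a * cos a" by (simp add: sin_diff sin_double)
    ultimately have "sin (pi - 2 * a) / (1 - cos (pi - 2 * a)) = tan a" using a by (simp add: tan_def power2_eq_square)
    then show ?thesis by (simp add: a_def tan_arctan)
  qed
  ultimately show ?thesis by (simp add: ang a_def)
qed (simp add: bc_angle_def)

text \<open>Merging the two pullbacks into one from the complex plane makes second countability and
  the measurability criterion for pullbacks applicable.\<close>

lemma extended_line_eq: "extended_line = pullback_topology UNIV (\<lambda>r. cis (bc_angle r)) euclidean"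
proof (rule topology_eq[THEN iffD2], intro allI)
  fix S
  have "openin extended_line S \<longleftrightarrow> (\<exists>V. open V \<and> S = bc_angle -` (cis -` V \<inter> {0..<2 * pi}))"
    by (auto simp: extended_line_def circle_topology_def openin_pullback_topology)
  also have "\<dots> \<longleftrightarrow> (\<exists>V. open V \<and> S = (\<lambda>r. cis (bc_angle r)) -` V)"
    by (intro ex_cong1 conj_cong refl arg_cong[where f="\<lambda>x. S = x"]) (use bc_angle_range in auto)
  also have "\<dots> \<longleftrightarrow> openin (pullback_topology UNIV (\<lambda>r. cis (bc_angle r)) euclidean) S"
    by (auto simp: openin_pullback_topology)
  finally show "openin extended_line S = openin (pullback_topology UNIV (\<lambda>r. cis (bc_angle r)) euclidean) S" .
qed

lemma second_countable_extended_line: "second_countable extended_line"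
  unfolding extended_line_eq by (rule second_countable_pullback)

lemma topspace_extended_line: "topspace extended_line = UNIV"
  by (simp add: extended_line_eq topspace_pullback_topology)

lemma bc_angle_measurable: "bc_angle \<in> borel_measurable (borel_of extended_line)"
proof -
  have "continuous_map extended_line euclidean (\<lambda>r. cis (bc_angle r))"
    unfolding extended_line_eq using continuous_map_pullback[OF continuous_map_id, of UNIV "\<lambda>r. cis (bc_angle r)" euclidean]
    by (simp add: comp_def id_def)
  then have [measurable]: "(\<lambda>r. cis (bc_angle r)) \<in> borel_measurable (borel_of extended_line)"
    by (rule continuous_map_borel_measurable)
  have "(\<lambda>r. if cis (bc_angle r) = 1 then 0
    else pi - 2 * arctan (Im (cis (bc_angle r)) / (1 - Re (cis (bc_angle r))))) \<in> borel_measurable (borel_of extended_line)"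
    by measurable
  then show ?thesis using bc_angle_eq_cis by simp
qed

abbreviation circle_lborel :: "real measure" where
  "circle_lborel \<equiv> restrict_space lborel {0..<2 * pi}"

lemma space_circle_lborel: "space circle_lborel = {0..<2 * pi}"
  by (simp add: space_restrict_space)

lemma bc_of_measurable: "bc_of \<in> measurable circle_lborel (borel_of extended_line)"
  unfolding extended_line_eq
proof (rule measurable_pullback)
  have "cis \<in> borel_measurable borel" by (intro borel_measurable_continuous_onI continuous_intros)
  then have "cis \<in> borel_measurable circle_lborel" by (intro measurable_restrict_space1) simp
  then show "(\<lambda>x. cis (bc_angle (bc_of x))) \<in> borel_measurable circle_lborel"
    by (rule measurable_cong[THEN iffD2, rotated]) (auto simp: space_circle_lborel bc_angle_of)
qed auto

section \<open>The spectral measure as a random function of the angle\<close>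

context random_coefficient
begin

abbreviation "ent \<omega> i j \<equiv> entry (R \<omega>) i j"

text \<open>\<open>endX\<close> and \<open>endY\<close> are the series of \<open>solX\<close> and
  \<open>solY\<close> at 1, written for every \<omega>, so that joint measurability in \<omega> and
  l can be stated before the assumptions on a single coefficient enter.\<close>

definition endX :: "'w \<Rightarrow> real \<Rightarrow> real" where
  "endX \<omega> l = (\<Sum>n. fst (dirac_iter (ent \<omega> 1 1) (ent \<omega> 1 2) (ent \<omega> 2 2) n) 1 * l ^ n)"
definition endY :: "'w \<Rightarrow> real \<Rightarrow> real" where
  "endY \<omega> l = (\<Sum>n. snd (dirac_iter (ent \<omega> 1 1) (ent \<omega> 1 2) (ent \<omega> 2 2) n) 1 * l ^ n)"

definition end_angle :: "'w \<Rightarrow> real \<Rightarrow> real" where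
  "end_angle \<omega> l = bc_angle (if endY \<omega> l = 0 then None else Some (endX \<omega> l / endY \<omega> l))"

definition spec :: "'w \<Rightarrow> real \<Rightarrow> real measure" where
  "spec \<omega> \<theta> = right_spectral_measure I (R \<omega>) None (bc_of \<theta>)"

lemma end_angle_range: "end_angle \<omega> l \<in> {0..<2 * pi}"
  unfolding end_angle_def by (rule bc_angle_range)

text \<open>Each term of the series is a measurable function of \<omega> times a power of l, and the
  angle is a Borel function of the two sums.\<close>

lemma end_angle_measurable: "(\<lambda>(\<omega>, l). end_angle \<omega> l) \<in> borel_measurable (N \<Otimes>\<^sub>M borel)"
proof -
  have [measurable]: "(\<lambda>\<omega>. fst (dirac_iter (ent \<omega> 1 1) (ent \<omega> 1 2) (ent \<omega> 2 2) n) 1) \<in> borel_measurable N"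
    "(\<lambda>\<omega>. snd (dirac_iter (ent \<omega> 1 1) (ent \<omega> 1 2) (ent \<omega> 2 2) n) 1) \<in> borel_measurable N" for n
    using iter_measurable[of n] by auto
  have [measurable]: "(\<lambda>(\<omega>, l). endX \<omega> l) \<in> borel_measurable (N \<Otimes>\<^sub>M borel)" "(\<lambda>(\<omega>, l). endY \<omega> l) \<in> borel_measurable (N \<Otimes>\<^sub>M borel)"
    unfolding endX_def endY_def by measurable
  have "(\<lambda>(\<omega>, l). if endY \<omega> l = 0 then 0 else 2 * (pi / 2 - arctan (endX \<omega> l / endY \<omega> l))) \<in> borel_measurable (N \<Otimes>\<^sub>M borel)"
    by measurable
  also have "(\<lambda>(\<omega>, l). if endY \<omega> l = 0 then 0 else 2 * (pi / 2 - arctan (endX \<omega> l / endY \<omega> l))) = (\<lambda>(\<omega>, l). end_angle \<omega> l)"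
    by (auto simp: fun_eq_iff end_angle_def bc_angle_def)
  finally show ?thesis .
qed

context
  fixes \<omega> assumes \<omega>: "\<omega> \<in> space N"
begin

interpretation dirac_coefficient I "R \<omega>" using \<omega> by (rule coef)

lemma end_angle_eq: "end_angle \<omega> l = circle_residue (- phase_fun l)"
  unfolding circle_residue_phase end_angle_def endX_def endY_def solX_def solY_def ..

lemma spec_eq: "\<theta> \<in> {0..<2 * pi} \<Longrightarrow> spec \<omega> \<theta> = phase.\<mu> \<theta>"
  unfolding spec_def by (rule right_spectral_measure_bc_of)

lemma spec_end_angle: "spec \<omega> (end_angle \<omega> l) = phase.\<mu> (- phase_fun l)"
proof -
  have "spec \<omega> (end_angle \<omega> l) = phase.\<mu> (end_angle \<omega> l)" by (rule spec_eq[OF end_angle_range])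
  then show ?thesis by (simp only: end_angle_eq phase.\<mu>_circle_residue)
qed

lemma spec_locally_finite: "\<theta> \<in> {0..<2 * pi} \<Longrightarrow> spec \<omega> \<theta> \<in> locally_finite_measures"
  by (simp add: spec_eq phase.\<mu>_locally_finite)

lemma spec_circle:
  fixes f G :: "real \<Rightarrow> ennreal"
  assumes "f \<in> borel_measurable borel" "G \<in> borel_measurable borel"
  shows "(\<integral>\<^sup>+\<theta>. indicator {0..<2 * pi} \<theta> * G \<theta> * (\<integral>\<^sup>+l. f l \<partial>spec \<omega> \<theta>) \<partial>lborel)
     = 2 * (\<integral>\<^sup>+l. f l * G (end_angle \<omega> l) \<partial>lborel)"
proof -
  have "(\<integral>\<^sup>+\<theta>. indicator {0..<2 * pi} \<theta> * G \<theta> * (\<integral>\<^sup>+l. f l \<partial>spec \<omega> \<theta>) \<partial>lborel)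
    = (\<integral>\<^sup>+\<theta>. indicator {0..<2 * pi} \<theta> * G \<theta> * (\<integral>\<^sup>+l. f l \<partial>phase.\<mu> \<theta>) \<partial>lborel)"
    by (intro nn_integral_cong) (auto simp: indicator_def spec_eq)
  then show ?thesis using phase.nn_integral_\<mu>_circle[OF assms] by (simp add: end_angle_eq)
qed

text \<open>Arcs to the right of \<theta> are used because short ones stay inside [0, 2 \<pi>) for
  every \<theta>, including \<theta> = 0.\<close>

lemma spec_right_continuous:
  assumes \<phi>: "\<phi> \<in> compactly_supported" and \<theta>: "\<theta> \<in> {0..<2 * pi}" and e: "e > 0"
  obtains d where "d > 0" "\<And>\<theta>'. \<theta>' \<in> {\<theta>..<\<theta> + d} \<Longrightarrow> \<theta>' \<in> {0..<2 * pi} \<and> \<bar>integral\<^sup>L (spec \<omega> \<theta>') \<phi> - integral\<^sup>L (spec \<omega> \<theta>) \<phi>\<bar> < e"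
proof -
  have "(\<lambda>\<theta>. integral\<^sup>L (phase.\<mu> \<theta>) \<phi>) \<midarrow>\<theta>\<rightarrow> integral\<^sup>L (phase.\<mu> \<theta>) \<phi>"
    using phase.integral_\<mu>_cont[OF \<phi>, of \<theta>] by (simp add: isCont_def)
  from LIM_D[OF this e] obtain s where s: "s > 0"
    "\<And>x. x \<noteq> \<theta> \<Longrightarrow> \<bar>x - \<theta>\<bar> < s \<Longrightarrow> \<bar>integral\<^sup>L (phase.\<mu> x) \<phi> - integral\<^sup>L (phase.\<mu> \<theta>) \<phi>\<bar> < e" by auto
  show ?thesis
  proof (rule that[of "min s (2 * pi - \<theta>)"])
    show "min s (2 * pi - \<theta>) > 0" using s \<theta> by simp
    fix \<theta>' assume "\<theta>' \<in> {\<theta>..<\<theta> + min s (2 * pi - \<theta>)}"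
    then have t: "\<theta> \<le> \<theta>'" "\<theta>' < \<theta> + s" "\<theta>' < 2 * pi" by auto
    then have "\<theta>' \<in> {0..<2 * pi}" using \<theta> by auto
    then show "\<theta>' \<in> {0..<2 * pi} \<and> \<bar>integral\<^sup>L (spec \<omega> \<theta>') \<phi> - integral\<^sup>L (spec \<omega> \<theta>) \<phi>\<bar> < e"
      using s(2)[of \<theta>'] t e \<theta> by (cases "\<theta>' = \<theta>") (auto simp: spec_eq)
  qed
qed

lemma end_angle_0: "end_angle \<omega> 0 = 0"
  using circle_residue_unique[of 0 0 0] by (simp add: end_angle_eq phase_fun_0)

text \<open>With \<psi> the phase, the angle is 2 \<pi> - \<psi>(l) for small l > 0 and -\<psi>(l)
  for small l \<le> 0. It jumps at 0 as a number and is continuous as a point of the circle.\<close>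

lemma end_angle_cis_cont: "isCont (\<lambda>l. cis (end_angle \<omega> l)) 0"
proof -
  have "continuous_on UNIV cis" by (intro continuous_intros)
  then have cis: "isCont cis x" for x by (simp add: continuous_on_eq_continuous_at)
  have "isCont (\<lambda>l. - phase_fun l) 0" by (intro continuous_intros phase.cont)
  from isCont_o2[OF this cis] show ?thesis by (simp add: end_angle_eq cis_circle_residue)
qed

text \<open>The spectral measure is 2 \<pi>-periodic in the angle, which hides the jump of the angle
  at l = 0.\<close>

lemma spec_end_angle_cont:
  assumes "\<phi> \<in> compactly_supported"
  shows "isCont (\<lambda>l. integral\<^sup>L (spec \<omega> (end_angle \<omega> l)) \<phi>) 0"
proof -
  have "isCont (\<lambda>l. - phase_fun l) 0" by (intro continuous_intros phase.cont)
  from isCont_o2[OF this phase.integral_\<mu>_cont[OF assms]]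
  show ?thesis by (simp add: spec_end_angle)
qed

end

text \<open>The integral of a test function is the limit of its averages over short arcs, and these are
  explicit integrals by the averaging formula.\<close>

lemma spec_integral_measurable:
  assumes \<phi>: "\<phi> \<in> compactly_supported"
  shows "(\<lambda>(\<omega>, \<theta>). integral\<^sup>L (spec \<omega> \<theta>) \<phi>) \<in> borel_measurable (N \<Otimes>\<^sub>M circle_lborel)"
proof -
  have nonneg_case: "(\<lambda>(\<omega>, \<theta>). integral\<^sup>L (spec \<omega> \<theta>) \<phi>) \<in> borel_measurable (N \<Otimes>\<^sub>M circle_lborel)"
    if \<phi>: "\<phi> \<in> compactly_supported" and nonneg: "\<And>x. 0 \<le> \<phi> x" for \<phi>
  proof -
    have \<phi>m [measurable]: "\<phi> \<in> borel_measurable borel"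
      using \<phi> by (intro borel_measurable_continuous_onI) (simp add: compactly_supported_def)
    define c where "c n = inverse (real (Suc n))" for n
    have c: "c n > 0" for n by (simp add: c_def)
    define Av where "Av n z = (case z of (\<omega>, \<theta>) \<Rightarrow>
      2 * (\<integral>\<^sup>+l. ennreal (\<phi> l) * indicator {\<theta>..<\<theta> + c n} (end_angle \<omega> l) \<partial>lborel))" for n and z :: "'w \<times> real"
    have Av_meas: "Av n \<in> borel_measurable (N \<Otimes>\<^sub>M circle_lborel)" for n
    proof -
      have cm: "(\<lambda>z. snd (fst z)) \<in> borel_measurable ((N \<Otimes>\<^sub>M circle_lborel) \<Otimes>\<^sub>M lborel)"
      proof -
        have "(\<lambda>x. x) \<in> borel_measurable circle_lborel" by (intro measurable_restrict_space1) simp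
        then show ?thesis by (rule measurable_compose[rotated]) measurable
      qed
      have em: "(\<lambda>z. end_angle (fst (fst z)) (snd z)) \<in> borel_measurable ((N \<Otimes>\<^sub>M circle_lborel) \<Otimes>\<^sub>M lborel)"
      proof -
        have "(\<lambda>z. (fst (fst z), snd z)) \<in> measurable ((N \<Otimes>\<^sub>M circle_lborel) \<Otimes>\<^sub>M lborel) (N \<Otimes>\<^sub>M borel)"
          by measurable
        from measurable_compose[OF this end_angle_measurable] show ?thesis by simp
      qed
      have pm: "Measurable.pred ((N \<Otimes>\<^sub>M circle_lborel) \<Otimes>\<^sub>M lborel)
          (\<lambda>z. snd (fst z) \<le> end_angle (fst (fst z)) (snd z) \<and> end_angle (fst (fst z)) (snd z) < snd (fst z) + c n)"
        using cm em by measurable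
      have "(\<lambda>z. ennreal (\<phi> (snd z)) * (if snd (fst z) \<le> end_angle (fst (fst z)) (snd z) \<and> end_angle (fst (fst z)) (snd z) < snd (fst z) + c n then 1 else 0))
        \<in> borel_measurable ((N \<Otimes>\<^sub>M circle_lborel) \<Otimes>\<^sub>M lborel)"
        by (intro borel_measurable_times_ennreal measurable_If[OF _ _ predE[OF pm]]) measurable
      from sigma_finite_measure.borel_measurable_nn_integral_fst[OF lborel.sigma_finite_measure_axioms this]
      have "(\<lambda>x. 2 * (\<integral>\<^sup>+l. ennreal (\<phi> l) * (if snd x \<le> end_angle (fst x) l \<and> end_angle (fst x) l < snd x + c n then 1 else 0) \<partial>lborel))
        \<in> borel_measurable (N \<Otimes>\<^sub>M circle_lborel)" by (intro borel_measurable_times_ennreal) simp_all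
      also have "(\<lambda>x. 2 * (\<integral>\<^sup>+l. ennreal (\<phi> l) * (if snd x \<le> end_angle (fst x) l \<and> end_angle (fst x) l < snd x + c n then 1 else 0) \<partial>lborel)) = Av n"
        by (auto simp: fun_eq_iff Av_def indicator_def intro!: arg_cong[where f="\<lambda>x. 2 * x"] nn_integral_cong)
      finally show ?thesis .
    qed
    show ?thesis
    proof (rule borel_measurable_LIMSEQ_real)
      show "(\<lambda>z. enn2real (Av n z) / c n) \<in> borel_measurable (N \<Otimes>\<^sub>M circle_lborel)" for n
        using Av_meas by measurable
      fix z assume "z \<in> space (N \<Otimes>\<^sub>M circle_lborel)"
      then obtain \<omega> \<theta> where z: "z = (\<omega>, \<theta>)" "\<omega> \<in> space N" "\<theta> \<in> {0..<2 * pi}"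
        by (auto simp: space_pair_measure space_circle_lborel)
      define v where "v \<theta> = integral\<^sup>L (spec \<omega> \<theta>) \<phi>" for \<theta>
      have v0: "0 \<le> v \<theta>" for \<theta> unfolding v_def by (rule integral_nonneg_AE) (simp add: nonneg)
      have Av: "Av n z = (\<integral>\<^sup>+\<theta>'. indicator {0..<2 * pi} \<theta>' * indicator {\<theta>..<\<theta> + c n} \<theta>' * ennreal (v \<theta>') \<partial>lborel)" for n
      proof -
        have "Av n z = (\<integral>\<^sup>+\<theta>'. indicator {0..<2 * pi} \<theta>' * indicator {\<theta>..<\<theta> + c n} \<theta>' * (\<integral>\<^sup>+l. ennreal (\<phi> l) \<partial>spec \<omega> \<theta>') \<partial>lborel)"
          unfolding Av_def z(1) prod.case by (rule spec_circle[OF z(2), symmetric]) measurable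
        also have "\<dots> = (\<integral>\<^sup>+\<theta>'. indicator {0..<2 * pi} \<theta>' * indicator {\<theta>..<\<theta> + c n} \<theta>' * ennreal (v \<theta>') \<partial>lborel)"
        proof (rule nn_integral_cong)
          fix \<theta>'
          have "(\<integral>\<^sup>+l. ennreal (\<phi> l) \<partial>spec \<omega> \<theta>') = ennreal (v \<theta>')" if "\<theta>' \<in> {0..<2 * pi}"
            unfolding v_def using compactly_supported_integrable[OF \<phi> spec_locally_finite[OF z(2) that]]
            by (intro nn_integral_eq_integral) (auto simp: nonneg)
          then show "indicator {0..<2 * pi} \<theta>' * indicator {\<theta>..<\<theta> + c n} \<theta>' * (\<integral>\<^sup>+l. ennreal (\<phi> l) \<partial>spec \<omega> \<theta>')
            = indicator {0..<2 * pi} \<theta>' * indicator {\<theta>..<\<theta> + c n} \<theta>' * ennreal (v \<theta>')"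
            by (cases "\<theta>' \<in> {0..<2 * pi}") auto
        qed
        finally show ?thesis .
      qed
      show "(\<lambda>n. enn2real (Av n z) / c n) \<longlonglongrightarrow> (case z of (\<omega>, \<theta>) \<Rightarrow> integral\<^sup>L (spec \<omega> \<theta>) \<phi>)"
        unfolding z(1) prod.case v_def[symmetric]
      proof (rule LIMSEQ_I)
        fix e :: real assume e: "0 < e"
        then have "e / 2 > 0" by simp
        from spec_right_continuous[OF z(2) \<phi> z(3) this]
        obtain d where d: "d > 0" "\<And>\<theta>'. \<theta>' \<in> {\<theta>..<\<theta> + d} \<Longrightarrow> \<theta>' \<in> {0..<2 * pi} \<and> \<bar>v \<theta>' - v \<theta>\<bar> < e / 2"
          unfolding v_def by metis
        obtain n0 where n0: "c n0 < d" using reals_Archimedean[OF d(1)] unfolding c_def by blast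
        show "\<exists>n0. \<forall>n\<ge>n0. norm (enn2real (Av n (\<omega>, \<theta>)) / c n - v \<theta>) < e"
        proof (intro exI allI impI)
          fix n assume "n0 \<le> n"
          then have "c n \<le> c n0" unfolding c_def by (intro le_imp_inverse_le) auto
          then have cn: "c n < d" using n0 by simp
          have const: "(\<integral>\<^sup>+\<theta>'. ennreal B * indicator {\<theta>..<\<theta> + c n} \<theta>' \<partial>lborel) = ennreal (B * c n)" if "0 \<le> B" for B
            using c[of n] that by (simp add: nn_integral_cmult_indicator ennreal_mult')
          have in_d: "\<theta>' \<in> {0..<2 * pi} \<and> \<bar>v \<theta>' - v \<theta>\<bar> < e / 2" if "\<theta>' \<in> {\<theta>..<\<theta> + c n}" for \<theta>'
            by (rule d(2)) (use that cn in auto)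
          have up: "Av n (\<omega>, \<theta>) \<le> ennreal ((v \<theta> + e / 2) * c n)"
          proof -
            have "Av n (\<omega>, \<theta>) \<le> (\<integral>\<^sup>+\<theta>'. ennreal (v \<theta> + e / 2) * indicator {\<theta>..<\<theta> + c n} \<theta>' \<partial>lborel)"
              unfolding Av[unfolded z(1)]
            proof (rule nn_integral_mono)
              fix \<theta>'
              show "indicator {0..<2 * pi} \<theta>' * indicator {\<theta>..<\<theta> + c n} \<theta>' * ennreal (v \<theta>') \<le> ennreal (v \<theta> + e / 2) * indicator {\<theta>..<\<theta> + c n} \<theta>'"
              proof (cases "\<theta>' \<in> {\<theta>..<\<theta> + c n}")
                case True
                have "v \<theta>' \<le> v \<theta> + e / 2" using in_d[OF True] by linarith
                then show ?thesis using True in_d[OF True] by (simp add: ennreal_leI)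
              qed simp
            qed
            also have "\<dots> = ennreal ((v \<theta> + e / 2) * c n)" by (rule const) (use v0[of \<theta>] e in simp)
            finally show ?thesis .
          qed
          \<comment> \<open>The maximum with 0 keeps the constant nonnegative, so that its
            extended-valued integral is the intended product.\<close>
          have low: "ennreal (max 0 (v \<theta> - e / 2) * c n) \<le> Av n (\<omega>, \<theta>)"
          proof -
            have "ennreal (max 0 (v \<theta> - e / 2) * c n) = (\<integral>\<^sup>+\<theta>'. ennreal (max 0 (v \<theta> - e / 2)) * indicator {\<theta>..<\<theta> + c n} \<theta>' \<partial>lborel)"
              by (rule const[symmetric]) simp
            also have "\<dots> \<le> Av n (\<omega>, \<theta>)" unfolding Av[unfolded z(1)]
            proof (rule nn_integral_mono)
              fix \<theta>'
              show "ennreal (max 0 (v \<theta> - e / 2)) * indicator {\<theta>..<\<theta> + c n} \<theta>' \<le> indicator {0..<2 * pi} \<theta>' * indicator {\<theta>..<\<theta> + c n} \<theta>' * ennreal (v \<theta>')"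
              proof (cases "\<theta>' \<in> {\<theta>..<\<theta> + c n}")
                case True
                have "max 0 (v \<theta> - e / 2) \<le> v \<theta>'" using in_d[OF True] v0[of \<theta>'] by linarith
                then show ?thesis using True in_d[OF True] by (simp add: ennreal_leI)
              qed simp
            qed
            finally show ?thesis .
          qed
          have fin: "Av n (\<omega>, \<theta>) < top" using up by (rule le_less_trans) simp
          have nn: "0 \<le> (v \<theta> + e / 2) * c n" using v0[of \<theta>] e c[of n] by simp
          have 1: "enn2real (Av n (\<omega>, \<theta>)) \<le> (v \<theta> + e / 2) * c n" using enn2real_mono[OF up] nn by simp
          have nn': "0 \<le> max 0 (v \<theta> - e / 2) * c n" using c[of n] by simp
          have 2: "max 0 (v \<theta> - e / 2) * c n \<le> enn2real (Av n (\<omega>, \<theta>))"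
            using enn2real_mono[OF low fin] enn2real_ennreal[OF nn'] by simp
          have "(v \<theta> - e / 2) * c n \<le> max 0 (v \<theta> - e / 2) * c n" using c[of n] by (intro mult_right_mono) auto
          with 2 have 3: "(v \<theta> - e / 2) * c n \<le> enn2real (Av n (\<omega>, \<theta>))" by simp
          from 1 c[of n] have "enn2real (Av n (\<omega>, \<theta>)) / c n \<le> v \<theta> + e / 2" by (simp add: pos_divide_le_eq)
          moreover from 3 c[of n] have "v \<theta> - e / 2 \<le> enn2real (Av n (\<omega>, \<theta>)) / c n" by (simp add: pos_le_divide_eq)
          ultimately show "norm (enn2real (Av n (\<omega>, \<theta>)) / c n - v \<theta>) < e" using e by (simp add: abs_less_iff)
        qed
      qed
    qed
  qed
  obtain S where S: "continuous_on UNIV \<phi>" "compact S" "\<And>x. x \<notin> S \<Longrightarrow> \<phi> x = 0" using \<phi> by (auto simp: compactly_supported_def)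
  \<comment> \<open>The averaging formula concerns nonnegative integrands, so \<phi> is split into
    positive and negative part.\<close>
  have p: "(\<lambda>x. max 0 (\<phi> x)) \<in> compactly_supported" "(\<lambda>x. max 0 (- \<phi> x)) \<in> compactly_supported"
    unfolding compactly_supported_def using S by (auto intro!: continuous_intros exI[of _ S])
  have "(\<lambda>z. (case z of (\<omega>, \<theta>) \<Rightarrow> integral\<^sup>L (spec \<omega> \<theta>) (\<lambda>x. max 0 (\<phi> x))) - (case z of (\<omega>, \<theta>) \<Rightarrow> integral\<^sup>L (spec \<omega> \<theta>) (\<lambda>x. max 0 (- \<phi> x))))
    \<in> borel_measurable (N \<Otimes>\<^sub>M circle_lborel)"
    by (intro borel_measurable_diff nonneg_case p) auto
  moreover have "(case z of (\<omega>, \<theta>) \<Rightarrow> integral\<^sup>L (spec \<omega> \<theta>) \<phi>) =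
      (case z of (\<omega>, \<theta>) \<Rightarrow> integral\<^sup>L (spec \<omega> \<theta>) (\<lambda>x. max 0 (\<phi> x))) - (case z of (\<omega>, \<theta>) \<Rightarrow> integral\<^sup>L (spec \<omega> \<theta>) (\<lambda>x. max 0 (- \<phi> x)))"
    if zs: "z \<in> space (N \<Otimes>\<^sub>M circle_lborel)" for z
  proof -
    obtain \<omega> \<theta> where z: "z = (\<omega>, \<theta>)" "\<omega> \<in> space N" "\<theta> \<in> {0..<2 * pi}"
      using zs by (auto simp: space_pair_measure space_circle_lborel)
    note int = compactly_supported_integrable[OF _ spec_locally_finite[OF z(2,3)]]
    have "integral\<^sup>L (spec \<omega> \<theta>) \<phi> = integral\<^sup>L (spec \<omega> \<theta>) (\<lambda>x. max 0 (\<phi> x) - max 0 (- \<phi> x))"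
      by (rule Bochner_Integration.integral_cong) auto
    then show ?thesis unfolding z(1) prod.case using Bochner_Integration.integral_diff[OF int[OF p(1)] int[OF p(2)]] by simp
  qed
  ultimately show ?thesis by (subst measurable_cong) auto
qed

lemma spec_measurable: "(\<lambda>(\<omega>, \<theta>). spec \<omega> \<theta>) \<in> measurable (N \<Otimes>\<^sub>M circle_lborel) (borel_of vague_topology)"
proof (rule measurable_vagueI)
  show "(case z of (\<omega>, \<theta>) \<Rightarrow> spec \<omega> \<theta>) \<in> locally_finite_measures" if "z \<in> space (N \<Otimes>\<^sub>M circle_lborel)" for z
    using that spec_locally_finite by (auto simp: space_pair_measure space_circle_lborel)
  show "(\<lambda>z. integral\<^sup>L (case z of (\<omega>, \<theta>) \<Rightarrow> spec \<omega> \<theta>) \<phi>) \<in> borel_measurable (N \<Otimes>\<^sub>M circle_lborel)"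
    if "\<phi> \<in> compactly_supported" for \<phi>
    using spec_integral_measurable[OF that] by (simp add: case_prod_beta')
qed

end

section \<open>Averaging over the boundary condition\<close>

locale random_decoration = random_coefficient N I R + prob_space N
  for N :: "'w measure" and I :: "real set" and R :: "'w \<Rightarrow> real \<Rightarrow> real ^ 2 ^ 2" +
  fixes T :: "(real \<Rightarrow> real ^ 2 ^ 2) topology" and \<rho> :: "real \<Rightarrow> real"
  assumes T: "second_countable T" and R_meas: "R \<in> measurable N (borel_of T)"
    and \<rho>_meas: "\<rho> \<in> borel_measurable circle_lborel"
    and \<rho>_nonneg: "\<And>\<theta>. \<theta> \<in> {0..<2 * pi} \<Longrightarrow> 0 \<le> \<rho> \<theta>"
    and \<rho>_bounded: "bounded (\<rho> ` {0..<2 * pi})"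
    and \<rho>_cont: "topcontinuous_at circle_topology euclideanreal \<rho> 0"
begin

abbreviation "V \<equiv> prod_topology vague_topology (prod_topology T extended_line)"
abbreviation "U \<equiv> restrict_space lborel {-1<..<1 :: real}"

definition decor :: "'w \<Rightarrow> real \<Rightarrow> real measure \<times> (real \<Rightarrow> real ^ 2 ^ 2) \<times> real option" where
  "decor \<omega> \<theta> = (spec \<omega> \<theta>, (R \<omega>, bc_of \<theta>))"

lemma decor_measurable: "(\<lambda>(\<omega>, \<theta>). decor \<omega> \<theta>) \<in> measurable (N \<Otimes>\<^sub>M circle_lborel) (borel_of V)"
proof -
  have 1: "(\<lambda>z. case z of (\<omega>, \<theta>) \<Rightarrow> spec \<omega> \<theta>) \<in> measurable (N \<Otimes>\<^sub>M circle_lborel) (borel_of vague_topology)"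
    by (rule spec_measurable)
  have 2: "(\<lambda>z. R (fst z)) \<in> measurable (N \<Otimes>\<^sub>M circle_lborel) (borel_of T)"
    by (rule measurable_compose[OF measurable_fst R_meas])
  have 3: "(\<lambda>z. bc_of (snd z)) \<in> measurable (N \<Otimes>\<^sub>M circle_lborel) (borel_of extended_line)"
    by (rule measurable_compose[OF measurable_snd bc_of_measurable])
  have "(\<lambda>z. (case z of (\<omega>, \<theta>) \<Rightarrow> spec \<omega> \<theta>, (R (fst z), bc_of (snd z)))) \<in> measurable (N \<Otimes>\<^sub>M circle_lborel) (borel_of V)"
    by (intro measurable_prod_borel_of second_countable_prod second_countable_vague second_countable_extended_line T 1 2 3)
  then show ?thesis by (simp add: decor_def case_prod_beta')
qed

lemma decor_0_measurable: "(\<lambda>\<omega>. decor \<omega> 0) \<in> measurable N (borel_of V)"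
proof -
  have "(\<lambda>\<omega>. (\<omega>, 0)) \<in> measurable N (N \<Otimes>\<^sub>M circle_lborel)"
    by (intro measurable_Pair measurable_const) (auto simp: space_circle_lborel)
  from measurable_compose[OF this decor_measurable] show ?thesis by simp
qed

lemma end_measurable:
  "(\<lambda>z. (fst z, end_angle (fst z) (\<epsilon> * snd z))) \<in> measurable (N \<Otimes>\<^sub>M U) (N \<Otimes>\<^sub>M circle_lborel)"
proof -
  have "(\<lambda>x. x) \<in> borel_measurable U" by (intro measurable_restrict_space1) simp
  then have [measurable]: "snd \<in> borel_measurable (N \<Otimes>\<^sub>M U)" by (rule measurable_compose[rotated]) measurable
  have "(\<lambda>z. (fst z, \<epsilon> * snd z)) \<in> measurable (N \<Otimes>\<^sub>M U) (N \<Otimes>\<^sub>M borel)" by measurable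
  from measurable_compose[OF this end_angle_measurable]
  have "(\<lambda>z. end_angle (fst z) (\<epsilon> * snd z)) \<in> measurable (N \<Otimes>\<^sub>M U) lborel" by simp
  then have "(\<lambda>z. end_angle (fst z) (\<epsilon> * snd z)) \<in> measurable (N \<Otimes>\<^sub>M U) circle_lborel"
    by (intro measurable_restrict_space2) (use end_angle_range in auto)
  then show ?thesis by (intro measurable_Pair) auto
qed

lemma \<rho>_bound: obtains B where "0 \<le> B" "\<And>\<theta>. \<theta> \<in> {0..<2 * pi} \<Longrightarrow> \<bar>\<rho> \<theta>\<bar> \<le> B"
  using bounded_realE[OF \<rho>_bounded] by metis

text \<open>Convergence holds in each factor: vaguely for the spectral measure, trivially for R, and
  on the circle for the boundary condition.\<close>

lemma decor_tendsto:
  assumes \<omega>: "\<omega> \<in> space N" and s: "s \<longlonglongrightarrow> 0" and f: "continuous_map V euclideanreal f"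
  shows "(\<lambda>i. f (decor \<omega> (end_angle \<omega> (s i)))) \<longlonglongrightarrow> f (decor \<omega> 0)"
proof -
  note e0 = end_angle_0[OF \<omega>]
  have lf: "spec \<omega> (end_angle \<omega> l) \<in> locally_finite_measures" for l
    by (rule spec_locally_finite[OF \<omega> end_angle_range])
  have 1: "limitin vague_topology (\<lambda>i. spec \<omega> (end_angle \<omega> (s i))) (spec \<omega> 0) sequentially"
  proof (rule limitin_vagueI)
    show "spec \<omega> 0 \<in> locally_finite_measures" using lf[of 0] e0 by simp
    show "(\<lambda>i. integral\<^sup>L (spec \<omega> (end_angle \<omega> (s i))) \<phi>) \<longlonglongrightarrow> integral\<^sup>L (spec \<omega> 0) \<phi>" if "\<phi> \<in> compactly_supported" for \<phi>
      using isCont_tendsto_compose[OF spec_end_angle_cont[OF \<omega> that] s] e0 by simp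
  qed (use lf in simp)
  have "R \<omega> \<in> topspace T" using measurable_space[OF R_meas \<omega>] by simp
  then have 2: "limitin T (\<lambda>i. R \<omega>) (R \<omega>) sequentially" by simp
  have 3: "limitin extended_line (\<lambda>i. bc_of (end_angle \<omega> (s i))) (bc_of 0) sequentially"
    unfolding extended_line_eq
  proof (rule limitin_pullback)
    have "(\<lambda>i. cis (end_angle \<omega> (s i))) \<longlonglongrightarrow> cis 0"
      using isCont_tendsto_compose[OF end_angle_cis_cont[OF \<omega>] s] e0 by simp
    then show "limitin euclidean (\<lambda>i. cis (bc_angle (bc_of (end_angle \<omega> (s i))))) (cis (bc_angle (bc_of 0))) sequentially"
      by (simp add: bc_angle_of[OF end_angle_range] bc_angle_of)
  qed auto
  have "limitin V (\<lambda>i. decor \<omega> (end_angle \<omega> (s i))) (decor \<omega> 0) sequentially"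
    unfolding limitin_pairwise decor_def comp_def using 1 2 3 by simp
  from continuous_map_limit[OF f this] show ?thesis by (simp add: comp_def)
qed

text \<open>The angles approach 0 on the circle, possibly through values just below 2 \<pi>; this is
  where continuity of \<rho> in the circle topology enters.\<close>

lemma \<rho>_tendsto:
  assumes \<omega>: "\<omega> \<in> space N" and s: "s \<longlonglongrightarrow> 0"
  shows "(\<lambda>i. \<rho> (end_angle \<omega> (s i))) \<longlonglongrightarrow> \<rho> 0"
proof (rule topological_tendstoI)
  fix S assume S: "open S" "\<rho> 0 \<in> S"
  then obtain W where W: "openin circle_topology W" "0 \<in> W" "\<And>y. y \<in> W \<Longrightarrow> \<rho> y \<in> S"
    using \<rho>_cont unfolding topcontinuous_at_def by (metis open_openin)
  then obtain A where A: "open A" "W = cis -` A \<inter> {0..<2 * pi}" by (auto simp: circle_topology_def openin_pullback_topology)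
  have "(\<lambda>i. cis (end_angle \<omega> (s i))) \<longlonglongrightarrow> cis 0"
    using isCont_tendsto_compose[OF end_angle_cis_cont[OF \<omega>] s] end_angle_0[OF \<omega>] by simp
  moreover have "cis 0 \<in> A" using W(2) A(2) by simp
  ultimately have "\<forall>\<^sub>F i in sequentially. cis (end_angle \<omega> (s i)) \<in> A" using topological_tendstoD A(1) by blast
  then show "\<forall>\<^sub>F i in sequentially. \<rho> (end_angle \<omega> (s i)) \<in> S"
    by eventually_elim (use W(3) A(2) end_angle_range in auto)
qed

text \<open>The substitution l = \<epsilon> u carries the window (-\<epsilon>,\<epsilon>) to the
  fixed interval (-1,1), so that dominated convergence takes place on one measure space.\<close>

definition kernel :: "(real measure \<times> (real \<Rightarrow> real ^ 2 ^ 2) \<times> real option \<Rightarrow> real) \<Rightarrow> real \<Rightarrow> 'w \<times> real \<Rightarrow> real" where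
  "kernel f \<epsilon> z = \<rho> (end_angle (fst z) (\<epsilon> * snd z)) * f (decor (fst z) (end_angle (fst z) (\<epsilon> * snd z)))"

definition average :: "(real measure \<times> (real \<Rightarrow> real ^ 2 ^ 2) \<times> real option \<Rightarrow> real) \<Rightarrow> real \<Rightarrow> real" where
  "average f \<epsilon> = (\<integral>z. kernel f \<epsilon> z \<partial>(N \<Otimes>\<^sub>M U))"

lemma U_emeasure: "emeasure U (space U) = 2"
  by (simp add: space_restrict_space emeasure_restrict_space)

lemma U_finite: "finite_measure U"
  by (rule finite_measureI) (simp only: U_emeasure, simp)

lemma NU_finite: "finite_measure (N \<Otimes>\<^sub>M U)"
  by (rule finite_measure_pair_measure[OF U_finite finite_measure_axioms])

lemma kernel_measurable:
  assumes f: "f \<in> borel_measurable (borel_of V)"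
  shows "kernel f \<epsilon> \<in> borel_measurable (N \<Otimes>\<^sub>M U)"
proof -
  have "(\<lambda>z. \<rho> (snd z)) \<in> borel_measurable (N \<Otimes>\<^sub>M circle_lborel)"
    by (rule measurable_compose[OF measurable_snd \<rho>_meas])
  moreover have "(\<lambda>z. f (decor (fst z) (snd z))) \<in> borel_measurable (N \<Otimes>\<^sub>M circle_lborel)"
    using measurable_compose[OF decor_measurable f] by (simp add: case_prod_beta')
  ultimately have "(\<lambda>z. \<rho> (snd z) * f (decor (fst z) (snd z))) \<in> borel_measurable (N \<Otimes>\<^sub>M circle_lborel)"
    by (rule borel_measurable_times)
  from measurable_compose[OF end_measurable this] show ?thesis by (simp add: kernel_def[abs_def])
qed

lemma decor_space: "\<omega> \<in> space N \<Longrightarrow> \<theta> \<in> {0..<2 * pi} \<Longrightarrow> decor \<omega> \<theta> \<in> topspace V"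
  using measurable_space[OF decor_measurable, of "(\<omega>, \<theta>)"] by (simp add: space_pair_measure space_circle_lborel)

lemma kernel_bound:
  assumes "\<And>x. x \<in> topspace V \<Longrightarrow> \<bar>f x\<bar> \<le> C"
  shows "\<exists>B. \<forall>\<epsilon>. \<forall>z\<in>space (N \<Otimes>\<^sub>M U). \<bar>kernel f \<epsilon> z\<bar> \<le> B"
proof -
  obtain B where B: "0 \<le> B" "\<And>\<theta>. \<theta> \<in> {0..<2 * pi} \<Longrightarrow> \<bar>\<rho> \<theta>\<bar> \<le> B" using \<rho>_bound by metis
  have "\<bar>kernel f \<epsilon> z\<bar> \<le> B * \<bar>C\<bar>" if "z \<in> space (N \<Otimes>\<^sub>M U)" for \<epsilon> z
  proof -
    have "fst z \<in> space N" using that by (auto simp: space_pair_measure)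
    then have "\<bar>f (decor (fst z) (end_angle (fst z) (\<epsilon> * snd z)))\<bar> \<le> \<bar>C\<bar>"
      using assms[OF decor_space[OF _ end_angle_range]] by (meson abs_ge_self order_trans)
    then show ?thesis unfolding kernel_def abs_mult using B(1) B(2)[OF end_angle_range] by (intro mult_mono) auto
  qed
  then show ?thesis by blast
qed

lemma kernel_integrable:
  assumes f: "f \<in> borel_measurable (borel_of V)" "\<And>x. x \<in> topspace V \<Longrightarrow> \<bar>f x\<bar> \<le> C"
  shows "integrable (N \<Otimes>\<^sub>M U) (kernel f \<epsilon>)"
proof -
  obtain B where B: "\<forall>\<epsilon>. \<forall>z\<in>space (N \<Otimes>\<^sub>M U). \<bar>kernel f \<epsilon> z\<bar> \<le> B" using kernel_bound[OF f(2)] ..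
  show ?thesis
  proof (rule finite_measure.integrable_const_bound[OF NU_finite _ kernel_measurable[OF f(1)]])
    show "AE z in N \<Otimes>\<^sub>M U. norm (kernel f \<epsilon> z) \<le> B" by (rule AE_I2) (simp add: B)
  qed
qed

text \<open>In the limit the integrand no longer depends on u, and the factor 2 is the length of
  (-1,1). Bounds for \<rho> and f provide a constant majorant.\<close>

lemma average_tendsto:
  assumes f: "continuous_map V euclideanreal f" "\<And>x. x \<in> topspace V \<Longrightarrow> \<bar>f x\<bar> \<le> C"
  shows "(average f \<longlongrightarrow> 2 * (\<rho> 0 * (\<integral>\<omega>. f (decor \<omega> 0) \<partial>N))) (at_right 0)"
  unfolding tendsto_at_iff_sequentially
proof (intro allI impI)
  fix s :: "nat \<Rightarrow> real" assume s: "\<forall>i. s i \<in> {0<..} - {0}" "s \<longlonglongrightarrow> 0"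
  have fm: "f \<in> borel_measurable (borel_of V)" by (rule continuous_map_borel_measurable[OF f(1)])
  obtain B where B: "\<forall>\<epsilon>. \<forall>z\<in>space (N \<Otimes>\<^sub>M U). \<bar>kernel f \<epsilon> z\<bar> \<le> B" using kernel_bound[OF f(2)] ..
  interpret NU: finite_measure "N \<Otimes>\<^sub>M U" by (rule NU_finite)
  interpret pair_sigma_finite N U
    using finite_measure.sigma_finite_measure[OF U_finite] sigma_finite_measure_axioms by (intro pair_sigma_finite.intro)
  have m0: "(\<lambda>z. \<rho> 0 * f (decor (fst z) 0)) \<in> borel_measurable (N \<Otimes>\<^sub>M U)"
    by (rule borel_measurable_times[OF borel_measurable_const
        measurable_compose[OF measurable_fst measurable_compose[OF decor_0_measurable fm]]])
  have "(\<lambda>i. \<integral>z. kernel f (s i) z \<partial>(N \<Otimes>\<^sub>M U)) \<longlonglongrightarrow> (\<integral>z. \<rho> 0 * f (decor (fst z) 0) \<partial>(N \<Otimes>\<^sub>M U))"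
  proof (rule integral_dominated_convergence[where w="\<lambda>_. B"])
    show "AE z in N \<Otimes>\<^sub>M U. (\<lambda>i. kernel f (s i) z) \<longlonglongrightarrow> \<rho> 0 * f (decor (fst z) 0)"
    proof (rule AE_I2)
      fix z assume "z \<in> space (N \<Otimes>\<^sub>M U)"
      then have \<omega>: "fst z \<in> space N" by (auto simp: space_pair_measure)
      have "(\<lambda>i. s i * snd z) \<longlonglongrightarrow> 0" using tendsto_mult_left_zero[OF s(2), of "snd z"] by simp
      then show "(\<lambda>i. kernel f (s i) z) \<longlonglongrightarrow> \<rho> 0 * f (decor (fst z) 0)"
        unfolding kernel_def by (intro tendsto_mult \<rho>_tendsto decor_tendsto \<omega> f(1))
    qed
    show "AE z in N \<Otimes>\<^sub>M U. norm (kernel f (s i) z) \<le> B" for i by (rule AE_I2) (simp add: B)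
  qed (simp_all add: kernel_measurable[OF fm] m0)
  also have "(\<integral>z. \<rho> 0 * f (decor (fst z) 0) \<partial>(N \<Otimes>\<^sub>M U)) = (\<integral>z. (\<lambda>(\<omega>, u). \<rho> 0 * f (decor \<omega> 0)) z \<partial>(N \<Otimes>\<^sub>M U))"
    by (simp add: case_prod_beta')
  also have "\<dots> = (\<integral>\<omega>. (\<integral>u. \<rho> 0 * f (decor \<omega> 0) \<partial>U) \<partial>N)"
  proof (rule integral_fst[symmetric])
    have "integrable (N \<Otimes>\<^sub>M U) (\<lambda>z. \<rho> 0 * f (decor (fst z) 0))"
    proof (rule NU.integrable_const_bound[where B="\<bar>\<rho> 0\<bar> * C"])
      show "AE z in N \<Otimes>\<^sub>M U. norm (\<rho> 0 * f (decor (fst z) 0)) \<le> \<bar>\<rho> 0\<bar> * C"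
        using f(2)[OF decor_space] by (intro AE_I2) (auto simp: space_pair_measure abs_mult intro!: mult_left_mono)
    qed (rule m0)
    then show "integrable (N \<Otimes>\<^sub>M U) (\<lambda>(\<omega>, u). \<rho> 0 * f (decor \<omega> 0))" by (simp add: case_prod_beta')
  qed
  also have "\<dots> = 2 * (\<rho> 0 * (\<integral>\<omega>. f (decor \<omega> 0) \<partial>N))"
    using U_emeasure by (simp add: measure_def space_restrict_space)
  finally show "(average f \<circ> s) \<longlonglongrightarrow> 2 * (\<rho> 0 * (\<integral>\<omega>. f (decor \<omega> 0) \<partial>N))"
    by (simp add: comp_def average_def)
qed

text \<open>For each \<omega> the averaging formula turns the integral over the angle into one over
  the window and contributes the factor 2; the substitution l = \<epsilon> u contributes
  \<epsilon>.\<close>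

lemma average_eq:
  assumes f: "f \<in> borel_measurable (borel_of V)" "\<And>x. x \<in> topspace V \<Longrightarrow> \<bar>f x\<bar> \<le> C" "\<And>x. 0 \<le> f x" and \<epsilon>: "\<epsilon> > 0"
  shows "(\<integral>\<^sup>+\<omega>. \<integral>\<^sup>+\<theta>. ennreal (\<rho> \<theta>) * (ennreal (f (decor \<omega> \<theta>)) * emeasure (spec \<omega> \<theta>) {- \<epsilon><..<\<epsilon>}) \<partial>circle_lborel \<partial>N)
    = ennreal (2 * \<epsilon> * average f \<epsilon>)"
proof -
  have k0: "0 \<le> kernel f \<epsilon> z" for \<epsilon> z
    unfolding kernel_def using \<rho>_nonneg[OF end_angle_range] f(3) by simp
  interpret Us: finite_measure U by (rule U_finite)
  have "(\<integral>\<^sup>+\<theta>. ennreal (\<rho> \<theta>) * (ennreal (f (decor \<omega> \<theta>)) * emeasure (spec \<omega> \<theta>) {- \<epsilon><..<\<epsilon>}) \<partial>circle_lborel)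
    = ennreal (2 * \<epsilon>) * (\<integral>\<^sup>+u. ennreal (kernel f \<epsilon> (\<omega>, u)) \<partial>U)" if \<omega>: "\<omega> \<in> space N" for \<omega>
  proof -
    \<comment> \<open>The cutoff makes G Borel on the whole line, as the averaging formula demands,
      while \<rho> is given as a measurable function on [0, 2 \<pi>).\<close>
    define G where "G \<theta> = ennreal (\<rho> \<theta>) * ennreal (f (decor \<omega> \<theta>)) * indicator {0..<2 * pi} \<theta>" for \<theta>
    have G: "G \<in> borel_measurable borel"
    proof -
      have "(\<lambda>\<theta>. f (decor \<omega> \<theta>)) \<in> borel_measurable circle_lborel"
        using measurable_compose[OF measurable_Pair1'[OF \<omega>] measurable_compose[OF decor_measurable f(1)]] by simp
      then have "(\<lambda>\<theta>. ennreal (\<rho> \<theta>) * ennreal (f (decor \<omega> \<theta>))) \<in> borel_measurable circle_lborel"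
        using \<rho>_meas by measurable
      then have "(\<lambda>\<theta>. ennreal (\<rho> \<theta>) * ennreal (f (decor \<omega> \<theta>)) * indicator {0..<2 * pi} \<theta>) \<in> borel_measurable lborel"
        by (subst (asm) borel_measurable_restrict_space_iff_ennreal) auto
      then show ?thesis by (simp add: G_def[abs_def])
    qed
    have em: "emeasure (spec \<omega> \<theta>) {- \<epsilon><..<\<epsilon>} = (\<integral>\<^sup>+l. indicator {- \<epsilon><..<\<epsilon>} l \<partial>spec \<omega> \<theta>)" if "\<theta> \<in> {0..<2 * pi}" for \<theta>
      using spec_locally_finite[OF \<omega> that] by (simp add: locally_finite_measures_def)
    have "(\<integral>\<^sup>+\<theta>. ennreal (\<rho> \<theta>) * (ennreal (f (decor \<omega> \<theta>)) * emeasure (spec \<omega> \<theta>) {- \<epsilon><..<\<epsilon>}) \<partial>circle_lborel)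
      = (\<integral>\<^sup>+\<theta>. indicator {0..<2 * pi} \<theta> * G \<theta> * (\<integral>\<^sup>+l. indicator {- \<epsilon><..<\<epsilon>} l \<partial>spec \<omega> \<theta>) \<partial>lborel)"
    proof (subst nn_integral_restrict_space, simp, intro nn_integral_cong)
      fix \<theta> :: real
      show "ennreal (\<rho> \<theta>) * (ennreal (f (decor \<omega> \<theta>)) * emeasure (spec \<omega> \<theta>) {- \<epsilon><..<\<epsilon>}) * indicator {0..<2 * pi} \<theta>
        = indicator {0..<2 * pi} \<theta> * G \<theta> * (\<integral>\<^sup>+l. indicator {- \<epsilon><..<\<epsilon>} l \<partial>spec \<omega> \<theta>)"
        by (cases "\<theta> \<in> {0..<2 * pi}") (simp_all only: G_def em indicator_simps mult_1_left mult_1_right mult_zero_left mult_zero_right mult.assoc not_False_eq_True)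
    qed
    also have "\<dots> = 2 * (\<integral>\<^sup>+l. indicator {- \<epsilon><..<\<epsilon>} l * G (end_angle \<omega> l) \<partial>lborel)"
      by (rule spec_circle[OF \<omega> _ G]) measurable
    also have "(\<integral>\<^sup>+l. indicator {- \<epsilon><..<\<epsilon>} l * G (end_angle \<omega> l) \<partial>lborel)
      = ennreal \<epsilon> * (\<integral>\<^sup>+u. indicator {- \<epsilon><..<\<epsilon>} (0 + \<epsilon> * u) * G (end_angle \<omega> (0 + \<epsilon> * u)) \<partial>lborel)"
    proof -
      have "end_angle \<omega> \<in> borel_measurable borel"
        using measurable_compose[OF measurable_Pair1'[OF \<omega>] end_angle_measurable] by simp
      then have "(\<lambda>l. indicator {- \<epsilon><..<\<epsilon>} l * G (end_angle \<omega> l)) \<in> borel_measurable borel"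
        using measurable_compose[OF _ G] by (intro borel_measurable_times_ennreal borel_measurable_indicator) auto
      from nn_integral_real_affine[OF this, of \<epsilon> 0] \<epsilon> show ?thesis by simp
    qed
    also have "(\<integral>\<^sup>+u. indicator {- \<epsilon><..<\<epsilon>} (0 + \<epsilon> * u) * G (end_angle \<omega> (0 + \<epsilon> * u)) \<partial>lborel)
      = (\<integral>\<^sup>+u. ennreal (kernel f \<epsilon> (\<omega>, u)) * indicator {-1<..<1} u \<partial>lborel)"
    proof (rule nn_integral_cong)
      fix u
      have "\<epsilon> * u \<in> {- \<epsilon><..<\<epsilon>} \<longleftrightarrow> u \<in> {-1<..<1}"
        using \<epsilon> mult_less_cancel_left_pos[OF \<epsilon>, of u 1] mult_less_cancel_left_pos[OF \<epsilon>, of "-1" u] by auto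
      then have "indicator {- \<epsilon><..<\<epsilon>} (\<epsilon> * u) = (indicator {-1<..<1} u :: ennreal)" by (simp only: indicator_def)
      moreover have "G (end_angle \<omega> (\<epsilon> * u)) = ennreal (kernel f \<epsilon> (\<omega>, u))"
        using end_angle_range[of \<omega> "\<epsilon> * u"] \<rho>_nonneg[OF end_angle_range, of \<omega> "\<epsilon> * u"]
        by (simp add: G_def kernel_def ennreal_mult')
      ultimately show "indicator {- \<epsilon><..<\<epsilon>} (0 + \<epsilon> * u) * G (end_angle \<omega> (0 + \<epsilon> * u))
        = ennreal (kernel f \<epsilon> (\<omega>, u)) * indicator {-1<..<1} u" by (simp add: mult.commute)
    qed
    also have "\<dots> = (\<integral>\<^sup>+u. ennreal (kernel f \<epsilon> (\<omega>, u)) \<partial>U)"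
      by (subst nn_integral_restrict_space) auto
    also have "2 * (ennreal \<epsilon> * (\<integral>\<^sup>+u. ennreal (kernel f \<epsilon> (\<omega>, u)) \<partial>U)) = ennreal (2 * \<epsilon>) * (\<integral>\<^sup>+u. ennreal (kernel f \<epsilon> (\<omega>, u)) \<partial>U)"
      using \<epsilon> by (simp add: ennreal_mult' mult.assoc)
    finally show ?thesis .
  qed
  then have "(\<integral>\<^sup>+\<omega>. \<integral>\<^sup>+\<theta>. ennreal (\<rho> \<theta>) * (ennreal (f (decor \<omega> \<theta>)) * emeasure (spec \<omega> \<theta>) {- \<epsilon><..<\<epsilon>}) \<partial>circle_lborel \<partial>N)
    = (\<integral>\<^sup>+\<omega>. ennreal (2 * \<epsilon>) * (\<integral>\<^sup>+u. ennreal (kernel f \<epsilon> (\<omega>, u)) \<partial>U) \<partial>N)"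
    by (rule nn_integral_cong)
  also have "\<dots> = ennreal (2 * \<epsilon>) * (\<integral>\<^sup>+\<omega>. (\<integral>\<^sup>+u. ennreal (kernel f \<epsilon> (\<omega>, u)) \<partial>U) \<partial>N)"
    using kernel_measurable[OF f(1), of \<epsilon>] by (intro nn_integral_cmult Us.borel_measurable_nn_integral) (simp add: case_prod_beta')
  also have "(\<integral>\<^sup>+\<omega>. (\<integral>\<^sup>+u. ennreal (kernel f \<epsilon> (\<omega>, u)) \<partial>U) \<partial>N) = (\<integral>\<^sup>+z. ennreal (kernel f \<epsilon> z) \<partial>(N \<Otimes>\<^sub>M U))"
    using kernel_measurable[OF f(1), of \<epsilon>] by (intro Us.nn_integral_fst) simp
  also have "\<dots> = ennreal (average f \<epsilon>)"
    unfolding average_def by (rule nn_integral_eq_integral[OF kernel_integrable[OF f(1,2)]]) (use k0 in auto)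
  also have "ennreal (2 * \<epsilon>) * ennreal (average f \<epsilon>) = ennreal (2 * \<epsilon> * average f \<epsilon>)"
    using \<epsilon> by (simp add: ennreal_mult')
  finally show ?thesis .
qed

end

text \<open>The first coordinate is \<omega> itself, seen through the smaller sigma-algebra F.
  Functions of \<omega> that are measurable for F can then be integrated against a product law
  without being factored through another random element.\<close>

lemma (in prob_space) law_of_independent_pair:
  assumes sub: "subalgebra M F"
    and indep: "indep_set (sets F) G" and Y: "Y \<in> measurable M S" "\<And>A. A \<in> sets S \<Longrightarrow> Y -` A \<inter> space M \<in> G"
  shows "distr M (restr_to_subalg M F \<Otimes>\<^sub>M S) (\<lambda>\<omega>. (\<omega>, Y \<omega>)) = restr_to_subalg M F \<Otimes>\<^sub>M distr M S Y"
proof -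
  let ?N = "restr_to_subalg M F"
  have sets_N: "sets ?N = sets F" by (rule sets_restr_to_subalg[OF sub])
  have id: "(\<lambda>\<omega>. \<omega>) \<in> measurable M ?N"
    using sub by (intro measurableI) (auto simp: sets_N space_restr_to_subalg subalgebra_def dest: sets.sets_into_space)
  have spF: "space F = space M" "sets F \<subseteq> sets M" using sub by (auto simp: subalgebra_def)
  have AE: "A \<in> sets F \<Longrightarrow> (\<lambda>\<omega>. \<omega>) -` A \<inter> space M = A" for A using sets.sets_into_space[of A F] spF by auto
  have pair: "(\<lambda>\<omega>. (\<omega>, Y \<omega>)) \<in> measurable M (?N \<Otimes>\<^sub>M S)" by (rule measurable_Pair[OF id Y(1)])
  have "finite_measure ?N"
    by (rule finite_measure_restr_to_subalg) (use sub in \<open>simp_all add: finite_measure_axioms\<close>)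
  then have N: "sigma_finite_measure ?N" by (rule finite_measure.sigma_finite_measure)
  have S: "sigma_finite_measure (distr M S Y)"
    by (rule finite_measure.sigma_finite_measure[OF finite_measure_distr[OF Y(1)]])
  have "?N \<Otimes>\<^sub>M distr M S Y = distr M (?N \<Otimes>\<^sub>M S) (\<lambda>\<omega>. (\<omega>, Y \<omega>))"
  proof (rule pair_measure_eqI[OF N S])
    show "sets (?N \<Otimes>\<^sub>M distr M S Y) = sets (distr M (?N \<Otimes>\<^sub>M S) (\<lambda>\<omega>. (\<omega>, Y \<omega>)))"
      by (simp cong: sets_pair_measure_cong)
    fix A B assume A: "A \<in> sets ?N" and B: "B \<in> sets (distr M S Y)"
    have A': "A \<in> sets F" using A by (simp add: sets_N)
    have B': "B \<in> sets S" "Y -` B \<inter> space M \<in> G" using B Y(2) by simp_all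
    have "emeasure (distr M (?N \<Otimes>\<^sub>M S) (\<lambda>\<omega>. (\<omega>, Y \<omega>))) (A \<times> B) = emeasure M (A \<inter> (Y -` B \<inter> space M))"
      using A B'(1) sets.sets_into_space[OF A'] spF
      by (subst emeasure_distr[OF pair]) (auto intro!: arg_cong[where f="emeasure M"])
    also have "\<dots> = emeasure M A * emeasure M (Y -` B \<inter> space M)"
      using indep_setD[OF indep A' B'(2)] by (simp add: emeasure_eq_measure ennreal_mult)
    also have "\<dots> = emeasure ?N A * emeasure (distr M S Y) B"
      by (simp add: emeasure_restr_to_subalg[OF sub A'] emeasure_distr[OF Y(1) B'(1)])
    finally show "emeasure ?N A * emeasure (distr M S Y) B = emeasure (distr M (?N \<Otimes>\<^sub>M S) (\<lambda>\<omega>. (\<omega>, Y \<omega>))) (A \<times> B)" ..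
  qed
  then show ?thesis ..
qed

theorem proposition28:
  fixes M :: "'w measure"
    and I :: "real set"
    and T :: "(real \<Rightarrow> real ^ 2 ^ 2) topology"
    and R :: "'w \<Rightarrow> real \<Rightarrow> real ^ 2 ^ 2"
    and q :: "'w \<Rightarrow> real option"
    and \<rho> :: "real \<Rightarrow> real"
  assumes "prob_space M"
    and "I = {0..1} \<or> I = {0<..1}"
    and "coefficient_space I T"
    and "\<And>\<omega>. \<omega> \<in> space M \<Longrightarrow> assumption1 I (R \<omega>)"
    and "\<And>\<omega>. \<omega> \<in> space M \<Longrightarrow> assumption2 I (bc_vec None) (R \<omega>)"
    and "R \<in> measurable M (borel_of T)"
    and "q \<in> measurable M (borel_of extended_line)"
    and "prob_space.indep_set M (sets (vimage_algebra (space M) R (borel_of T)))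
           (sets (vimage_algebra (space M) q (borel_of extended_line)))"
    and "distributed M (restrict_space lborel {0..<2 * pi}) (\<lambda>\<omega>. bc_angle (q \<omega>)) (\<lambda>\<theta>. ennreal (\<rho> \<theta>))"
    and "\<And>\<theta>. \<theta> \<in> {0..<2 * pi} \<Longrightarrow> 0 \<le> \<rho> \<theta>"
    and "bounded (\<rho> ` {0..<2 * pi})"
    and "topcontinuous_at circle_topology euclideanreal \<rho> 0"
    and "0 < \<rho> 0"
  shows "(\<lambda>\<omega>. (right_spectral_measure I (R \<omega>) None None, (R \<omega>, None)))
           \<in> measurable M (borel_of (prod_topology vague_topology (prod_topology T extended_line))) \<and>
         biased_by_weight_of_0 M (prod_topology T extended_line)
           (\<lambda>\<omega>. right_spectral_measure I (R \<omega>) None (q \<omega>)) (\<lambda>\<omega>. (R \<omega>, q \<omega>))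
           (decorated_law M (prod_topology T extended_line)
             (\<lambda>\<omega>. right_spectral_measure I (R \<omega>) None None) (\<lambda>\<omega>. (R \<omega>, None)))"
proof -
  interpret M: prob_space M by fact
  \<comment> \<open>With the sigma-algebra generated by R on the first factor, independence gives
    the pair of \<omega> and the angle of q a product law.\<close>
  define F where "F = vimage_algebra (space M) R (borel_of T)"
  define N where "N = restr_to_subalg M F"
  have RX: "R \<in> space M \<rightarrow> space (borel_of T)" using measurable_space[OF assms(6)] by blast
  have RF: "R \<in> measurable F (borel_of T)" unfolding F_def by (rule measurable_vimage_algebra1[OF RX])
  have sub: "subalgebra M F"
    unfolding subalgebra_def F_def
    by (auto simp: sets_vimage_algebra2[OF RX] measurable_sets[OF assms(6)])
  have spN: "space N = space M" by (simp add: N_def space_restr_to_subalg)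
  have sets_N: "sets N = sets F" unfolding N_def by (rule sets_restr_to_subalg[OF sub])
  have RN: "R \<in> measurable N (borel_of T)" unfolding N_def by (rule measurable_in_subalg[OF sub RF])
  have probN: "prob_space N" unfolding N_def by (rule prob_space_restr_to_subalg[OF sub assms(1)])
  have \<rho>e: "(\<lambda>\<theta>. ennreal (\<rho> \<theta>)) \<in> borel_measurable circle_lborel"
    using assms(9) by (simp add: distributed_def)
  have \<rho>m: "\<rho> \<in> borel_measurable circle_lborel"
  proof -
    have "(\<lambda>\<theta>. enn2real (ennreal (\<rho> \<theta>))) \<in> borel_measurable circle_lborel" using \<rho>e by measurable
    then show ?thesis
      by (rule measurable_cong[THEN iffD1, rotated]) (use assms(10) in \<open>auto simp: space_circle_lborel\<close>)
  qed
  interpret random_decoration N I R T \<rho>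
  proof (intro random_decoration.intro random_coefficient.intro random_decoration_axioms.intro)
    show "dirac_coefficient I (R \<omega>)" if "\<omega> \<in> space N" for \<omega>
      using assms(2,4,5) that by (simp add: dirac_coefficient_def spN)
    show "(\<lambda>\<omega>. LINT u:{s..t}|lebesgue. R \<omega> u) \<in> borel_measurable N" if "s \<in> I" "t \<in> I" for s t
      using measurable_compose[OF RN, of "\<lambda>S. LINT u:{s..t}|lebesgue. S u" borel] assms(3) that
      by (auto simp: coefficient_space_def)
    show "second_countable T" using assms(3) by (simp add: coefficient_space_def polish_space_def)
  qed (fact probN RN \<rho>m assms)+
  let ?A = "\<lambda>\<omega>. bc_angle (q \<omega>)"
  have decor_q: "(right_spectral_measure I (R \<omega>) None (q \<omega>), (R \<omega>, q \<omega>)) = decor \<omega> (?A \<omega>)" for \<omega>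
    by (simp add: decor_def spec_def bc_of_angle)
  have decor_None: "(right_spectral_measure I (R \<omega>) None None, (R \<omega>, None)) = decor \<omega> 0" for \<omega>
    by (simp add: decor_def spec_def bc_of_def)
  have Am: "?A \<in> measurable M circle_lborel" using assms(9) by (simp add: distributed_def)
  have idm: "(\<lambda>\<omega>. \<omega>) \<in> measurable M N"
    unfolding N_def using sub by (intro measurableI) (auto simp: sets_restr_to_subalg[OF sub] space_restr_to_subalg subalgebra_def)
  have pm: "(\<lambda>\<omega>. (\<omega>, ?A \<omega>)) \<in> measurable M (N \<Otimes>\<^sub>M circle_lborel)" by (intro measurable_Pair idm Am)
  have decor_qm: "(\<lambda>\<omega>. decor \<omega> (?A \<omega>)) \<in> measurable M (borel_of V)"
    using measurable_compose[OF pm decor_measurable] by simp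
  have decor_0m: "(\<lambda>\<omega>. decor \<omega> 0) \<in> measurable M (borel_of V)"
    using measurable_compose[OF idm decor_0_measurable] by simp
  have law: "distr M (N \<Otimes>\<^sub>M circle_lborel) (\<lambda>\<omega>. (\<omega>, ?A \<omega>)) = N \<Otimes>\<^sub>M density circle_lborel (\<lambda>\<theta>. ennreal (\<rho> \<theta>))"
  proof -
    have "distr M (N \<Otimes>\<^sub>M circle_lborel) (\<lambda>\<omega>. (\<omega>, ?A \<omega>)) = N \<Otimes>\<^sub>M distr M circle_lborel ?A"
      unfolding N_def
    proof (rule M.law_of_independent_pair[OF sub assms(8)[folded F_def] Am])
      fix A assume A: "A \<in> sets circle_lborel"
      have "bc_angle \<in> measurable (borel_of extended_line) lborel" using bc_angle_measurable by simp
      then have "bc_angle \<in> measurable (borel_of extended_line) circle_lborel"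
        by (intro measurable_restrict_space2) (use bc_angle_range in auto)
      from measurable_sets[OF this A] have "bc_angle -` A \<inter> space (borel_of extended_line) \<in> sets (borel_of extended_line)" .
      from in_vimage_algebra[OF this, of q "space M"]
      show "?A -` A \<inter> space M \<in> sets (vimage_algebra (space M) q (borel_of extended_line))"
        by (simp add: topspace_extended_line vimage_def)
    qed
    then show ?thesis using distributed_distr_eq_density[OF assms(9)] by simp
  qed
  have emm: "(\<lambda>z. emeasure (case z of (\<omega>, \<theta>) \<Rightarrow> spec \<omega> \<theta>) {- \<epsilon><..<\<epsilon>}) \<in> borel_measurable (N \<Otimes>\<^sub>M circle_lborel)" for \<epsilon>
    by (rule measurable_compose[OF spec_measurable emeasure_vague_measurable])
  \<comment> \<open>This is the biased expectation of f before normalisation; f = 1 gives the mean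
    weight.\<close>
  have expect: "(\<integral>\<^sup>+\<omega>. ennreal (f (decor \<omega> (?A \<omega>))) * emeasure (spec \<omega> (?A \<omega>)) {- \<epsilon><..<\<epsilon>} \<partial>M) = ennreal (2 * \<epsilon> * average f \<epsilon>)"
    if f: "f \<in> borel_measurable (borel_of V)" "\<And>x. x \<in> topspace V \<Longrightarrow> \<bar>f x\<bar> \<le> C" "\<And>x. 0 \<le> f x" and \<epsilon>: "\<epsilon> > 0" for f C \<epsilon>
  proof -
    define h where "h = (\<lambda>z. ennreal (f (case z of (\<omega>, \<theta>) \<Rightarrow> decor \<omega> \<theta>)) * emeasure (case z of (\<omega>, \<theta>) \<Rightarrow> spec \<omega> \<theta>) {- \<epsilon><..<\<epsilon>})"
    have h: "h \<in> borel_measurable (N \<Otimes>\<^sub>M circle_lborel)"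
      unfolding h_def using measurable_compose[OF decor_measurable f(1)] emm[of \<epsilon>]
      by (intro borel_measurable_times_ennreal measurable_compose[OF _ measurable_ennreal])
    have "prob_space (density circle_lborel (\<lambda>\<theta>. ennreal (\<rho> \<theta>)))"
      using M.prob_space_distr[OF Am] distributed_distr_eq_density[OF assms(9)] by simp
    then interpret D: prob_space "density circle_lborel (\<lambda>\<theta>. ennreal (\<rho> \<theta>))" .
    have "(\<integral>\<^sup>+\<omega>. ennreal (f (decor \<omega> (?A \<omega>))) * emeasure (spec \<omega> (?A \<omega>)) {- \<epsilon><..<\<epsilon>} \<partial>M)
      = (\<integral>\<^sup>+z. h z \<partial>distr M (N \<Otimes>\<^sub>M circle_lborel) (\<lambda>\<omega>. (\<omega>, ?A \<omega>)))"
      by (subst nn_integral_distr[OF pm]) (use h in \<open>simp_all add: h_def\<close>)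
    also have "\<dots> = (\<integral>\<^sup>+\<omega>. \<integral>\<^sup>+\<theta>. h (\<omega>, \<theta>) \<partial>density circle_lborel (\<lambda>\<theta>. ennreal (\<rho> \<theta>)) \<partial>N)"
      unfolding law by (rule D.nn_integral_fst[symmetric]) (use h in simp)
    also have "\<dots> = (\<integral>\<^sup>+\<omega>. \<integral>\<^sup>+\<theta>. ennreal (\<rho> \<theta>) * h (\<omega>, \<theta>) \<partial>circle_lborel \<partial>N)"
    proof (rule nn_integral_cong)
      fix \<omega> assume "\<omega> \<in> space N"
      then have "(\<lambda>\<theta>. h (\<omega>, \<theta>)) \<in> borel_measurable circle_lborel" by (rule measurable_compose[OF measurable_Pair1' h])
      then show "(\<integral>\<^sup>+\<theta>. h (\<omega>, \<theta>) \<partial>density circle_lborel (\<lambda>\<theta>. ennreal (\<rho> \<theta>))) = (\<integral>\<^sup>+\<theta>. ennreal (\<rho> \<theta>) * h (\<omega>, \<theta>) \<partial>circle_lborel)"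
        by (rule nn_integral_density[OF \<rho>e])
    qed
    also have "\<dots> = ennreal (2 * \<epsilon> * average f \<epsilon>)"
      unfolding h_def prod.case by (rule average_eq[OF f \<epsilon>])
    finally show ?thesis .
  qed
  define m where "m = average (\<lambda>_. 1)"
  have const1: "(\<lambda>_. 1) \<in> borel_measurable (borel_of V)" "continuous_map V euclideanreal (\<lambda>_. 1)"
    by simp_all
  have m_lim: "(m \<longlongrightarrow> 2 * \<rho> 0) (at_right 0)"
    using average_tendsto[OF const1(2), of 1] by (simp add: m_def prob_space)
  \<comment> \<open>m tends to 2 \<rho> 0 > 0, so the means are positive for small \<epsilon> and
    the biased laws are defined.\<close>
  have ev: "\<forall>\<^sub>F \<epsilon> in at_right 0. 0 < \<epsilon> \<and> 0 < m \<epsilon>"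
    using order_tendstoD(1)[OF m_lim, of 0] assms(13) eventually_at_right_less[of "0::real"] by (simp add: eventually_conj_iff)
  let ?\<mu> = "\<lambda>\<omega>. right_spectral_measure I (R \<omega>) None (q \<omega>)" and ?\<xi> = "\<lambda>\<omega>. (R \<omega>, q \<omega>)"
  have \<mu>_spec: "?\<mu> \<omega> = spec \<omega> (?A \<omega>)" for \<omega> by (simp add: spec_def bc_of_angle)
  have mean: "mean_weight M ?\<mu> \<epsilon> = ennreal (2 * \<epsilon> * m \<epsilon>)" if "\<epsilon> > 0" for \<epsilon>
    using expect[OF const1(1), of 1 \<epsilon>] that by (simp add: mean_weight_def \<mu>_spec m_def)
  define L where "L = decorated_law M (prod_topology T extended_line) ?\<mu> ?\<xi>"
  have L: "L = distr M (borel_of V) (\<lambda>\<omega>. decor \<omega> (?A \<omega>))"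
    unfolding L_def decorated_law_def decor_q ..
  define Q where "Q = decorated_law M (prod_topology T extended_line) (\<lambda>\<omega>. right_spectral_measure I (R \<omega>) None None) (\<lambda>\<omega>. (R \<omega>, None))"
  have Q: "Q = distr M (borel_of V) (\<lambda>\<omega>. decor \<omega> 0)"
    unfolding Q_def decorated_law_def decor_None ..
  define P where "P \<epsilon> = density L (\<lambda>(\<nu>, x). emeasure \<nu> {- \<epsilon><..<\<epsilon>} / mean_weight M ?\<mu> \<epsilon>)" for \<epsilon>
  have sets_P: "sets (P \<epsilon>) = sets (borel_of V)" for \<epsilon> by (simp add: P_def L)
  have Wm: "(\<lambda>z. emeasure (fst z) {- \<epsilon><..<\<epsilon>}) \<in> borel_measurable (borel_of V)" for \<epsilon>
    by (rule measurable_compose[OF continuous_map_borel_of[OF continuous_map_fst] emeasure_vague_measurable])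
  have nnP: "(\<integral>\<^sup>+z. ennreal (f z) \<partial>P \<epsilon>) = ennreal (average f \<epsilon> / m \<epsilon>)"
    if f: "f \<in> borel_measurable (borel_of V)" "\<And>x. x \<in> topspace V \<Longrightarrow> \<bar>f x\<bar> \<le> C" "\<And>x. 0 \<le> f x" and \<epsilon>: "0 < \<epsilon>" "0 < m \<epsilon>" for f C \<epsilon>
  proof -
    let ?c = "ennreal (2 * \<epsilon> * m \<epsilon>)"
    have "(\<integral>\<^sup>+z. ennreal (f z) \<partial>P \<epsilon>) = (\<integral>\<^sup>+z. emeasure (fst z) {- \<epsilon><..<\<epsilon>} / ?c * ennreal (f z) \<partial>L)"
      unfolding P_def mean[OF \<epsilon>(1)] case_prod_beta'
      by (rule nn_integral_density) (use Wm[of \<epsilon>] f(1) in \<open>simp_all add: L borel_measurable_divide_ennreal\<close>)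
    also have "\<dots> = (\<integral>\<^sup>+\<omega>. emeasure (fst (decor \<omega> (?A \<omega>))) {- \<epsilon><..<\<epsilon>} / ?c * ennreal (f (decor \<omega> (?A \<omega>))) \<partial>M)"
      unfolding L by (rule nn_integral_distr[OF decor_qm]) (use Wm[of \<epsilon>] f(1) in measurable)
    also have "\<dots> = (\<integral>\<^sup>+\<omega>. (ennreal (f (decor \<omega> (?A \<omega>))) * emeasure (spec \<omega> (?A \<omega>)) {- \<epsilon><..<\<epsilon>}) / ?c \<partial>M)"
      by (simp add: decor_def ennreal_times_divide mult.commute)
    also have "\<dots> = (\<integral>\<^sup>+\<omega>. ennreal (f (decor \<omega> (?A \<omega>))) * emeasure (spec \<omega> (?A \<omega>)) {- \<epsilon><..<\<epsilon>} \<partial>M) / ?c"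
    proof (rule nn_integral_divide)
      have "(\<lambda>\<omega>. emeasure (fst (decor \<omega> (?A \<omega>))) {- \<epsilon><..<\<epsilon>}) \<in> borel_measurable M" by (rule measurable_compose[OF decor_qm Wm])
      then show "(\<lambda>\<omega>. ennreal (f (decor \<omega> (?A \<omega>))) * emeasure (spec \<omega> (?A \<omega>)) {- \<epsilon><..<\<epsilon>}) \<in> borel_measurable M"
        using measurable_compose[OF decor_qm f(1)]
        by (intro borel_measurable_times_ennreal measurable_compose[OF _ measurable_ennreal]) (simp_all add: decor_def)
    qed
    also have "\<dots> = ennreal (2 * \<epsilon> * average f \<epsilon>) / ?c" by (rule arg_cong[where f="\<lambda>x. x / ?c", OF expect[OF f \<epsilon>(1)]])
    also have "\<dots> = ennreal (average f \<epsilon> / m \<epsilon>)"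
    proof -
      have "0 \<le> average f \<epsilon>" unfolding average_def
        by (rule integral_nonneg_AE) (simp add: kernel_def f(3) \<rho>_nonneg[OF end_angle_range])
      then show ?thesis using \<epsilon> by (simp add: divide_ennreal)
    qed
    finally show ?thesis .
  qed
  have probP: "prob_space (P \<epsilon>)" if \<epsilon>: "0 < \<epsilon>" "0 < m \<epsilon>" for \<epsilon>
  proof (rule prob_spaceI)
    have "emeasure (P \<epsilon>) (space (P \<epsilon>)) = (\<integral>\<^sup>+z. ennreal 1 \<partial>P \<epsilon>)" by simp
    also have "\<dots> = 1" using nnP[OF const1(1) _ _ \<epsilon>, of 1] \<epsilon> by (simp add: m_def[symmetric])
    finally show "emeasure (P \<epsilon>) (space (P \<epsilon>)) = 1" .
  qed
  have lim: "((\<lambda>\<epsilon>. integral\<^sup>L (P \<epsilon>) f) \<longlongrightarrow> integral\<^sup>L Q f) (at_right 0)"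
    if f: "continuous_map V euclideanreal f" "bounded (f ` topspace V)" for f
  proof -
    have fm: "f \<in> borel_measurable (borel_of V)" by (rule continuous_map_borel_measurable[OF f(1)])
    obtain C where C: "0 \<le> C" "\<And>x. x \<in> topspace V \<Longrightarrow> \<bar>f x\<bar> \<le> C" using bounded_realE[OF f(2)] by metis
    \<comment> \<open>Adding C makes f nonnegative on the space V; the maximum with 0 extends this
      to all arguments, as \<open>average_eq\<close> demands. The shift cancels because the biased
      laws and Q have mass 1.\<close>
    define k where "k x = max 0 (f x + C)" for x
    have k: "continuous_map V euclideanreal k"
      unfolding k_def by (intro continuous_map_real_max continuous_map_add f(1)) simp_all
    have km: "k \<in> borel_measurable (borel_of V)" by (rule continuous_map_borel_measurable[OF k])
    have kb: "\<bar>k x\<bar> \<le> 2 * C" "k x = f x + C" if "x \<in> topspace V" for x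
      using C(2)[OF that] by (auto simp: k_def)
    have k0: "0 \<le> k x" for x by (simp add: k_def)
    have int: "integral\<^sup>L (P \<epsilon>) f = average k \<epsilon> / m \<epsilon> - C" if \<epsilon>: "0 < \<epsilon>" "0 < m \<epsilon>" for \<epsilon>
    proof -
      interpret P: prob_space "P \<epsilon>" by (rule probP[OF \<epsilon>])
      have fP: "f \<in> borel_measurable (P \<epsilon>)" "k \<in> borel_measurable (P \<epsilon>)"
        using fm km measurable_cong_sets[OF sets_P refl] by blast+
      have spP: "space (P \<epsilon>) = topspace V" using sets_eq_imp_space_eq[OF sets_P] by simp
      have fi: "integrable (P \<epsilon>) f" by (rule P.integrable_const_bound[OF _ fP(1), of C]) (use C(2) spP in auto)
      have a0: "0 \<le> average k \<epsilon>" unfolding average_def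
        by (rule integral_nonneg_AE) (simp add: kernel_def k0 \<rho>_nonneg[OF end_angle_range])
      have "integral\<^sup>L (P \<epsilon>) k = enn2real (\<integral>\<^sup>+z. ennreal (k z) \<partial>P \<epsilon>)"
        by (rule integral_eq_nn_integral[OF fP(2)]) (simp add: k0)
      also have "\<dots> = average k \<epsilon> / m \<epsilon>" using nnP[OF km kb(1) k0 \<epsilon>] a0 \<epsilon> by simp
      finally have "average k \<epsilon> / m \<epsilon> = integral\<^sup>L (P \<epsilon>) k" ..
      also have "\<dots> = integral\<^sup>L (P \<epsilon>) (\<lambda>x. f x + C)"
        by (rule Bochner_Integration.integral_cong) (use kb(2) spP in auto)
      also have "\<dots> = integral\<^sup>L (P \<epsilon>) f + C" using fi by (simp add: P.prob_space)
      finally show ?thesis by simp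
    qed
    have fQ: "(\<lambda>\<omega>. f (decor \<omega> 0)) \<in> borel_measurable M" by (rule measurable_compose[OF decor_0m fm])
    have dsp: "decor \<omega> 0 \<in> topspace V" if "\<omega> \<in> space M" for \<omega> using measurable_space[OF decor_0m that] by simp
    have fi: "integrable M (\<lambda>\<omega>. f (decor \<omega> 0))"
      by (rule M.integrable_const_bound[OF _ fQ, of C]) (use C(2) dsp in auto)
    \<comment> \<open>Q is a law under M while the averages live on N; the integrals agree because
      the integrand is measurable for F.\<close>
    have kN: "(\<integral>\<omega>. k (decor \<omega> 0) \<partial>N) = integral\<^sup>L Q f + C"
    proof -
      have "(\<lambda>\<omega>. k (decor \<omega> 0)) \<in> borel_measurable N" by (rule measurable_compose[OF decor_0_measurable km])
      then have "(\<lambda>\<omega>. k (decor \<omega> 0)) \<in> borel_measurable F" using measurable_cong_sets[OF sets_N refl] by blast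
      from integral_subalgebra2[OF sub this]
      have "(\<integral>\<omega>. k (decor \<omega> 0) \<partial>N) = (\<integral>\<omega>. k (decor \<omega> 0) \<partial>M)" by (simp add: N_def)
      also have "\<dots> = (\<integral>\<omega>. f (decor \<omega> 0) + C \<partial>M)"
        by (rule Bochner_Integration.integral_cong) (use kb(2) dsp in auto)
      also have "\<dots> = (\<integral>\<omega>. f (decor \<omega> 0) \<partial>M) + C" using fi by (simp add: M.prob_space)
      also have "(\<integral>\<omega>. f (decor \<omega> 0) \<partial>M) = integral\<^sup>L Q f" unfolding Q by (rule integral_distr[OF decor_0m fm, symmetric])
      finally show ?thesis .
    qed
    have "((\<lambda>\<epsilon>. average k \<epsilon> / m \<epsilon> - C) \<longlongrightarrow> 2 * (\<rho> 0 * (\<integral>\<omega>. k (decor \<omega> 0) \<partial>N)) / (2 * \<rho> 0) - C) (at_right 0)"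
      by (intro tendsto_intros average_tendsto[OF k kb(1)] m_lim) (use assms(13) in auto)
    moreover have "2 * (\<rho> 0 * (\<integral>\<omega>. k (decor \<omega> 0) \<partial>N)) / (2 * \<rho> 0) - C = integral\<^sup>L Q f"
      using assms(13) by (simp add: kN)
    moreover have "\<forall>\<^sub>F \<epsilon> in at_right 0. average k \<epsilon> / m \<epsilon> - C = integral\<^sup>L (P \<epsilon>) f"
      using ev by eventually_elim (simp add: int)
    ultimately show ?thesis by (auto intro: Lim_transform_eventually)
  qed
  have "converges_weakly V P Q (at_right 0)"
    unfolding converges_weakly_def
  proof (intro conjI allI impI)
    show "\<forall>\<^sub>F \<epsilon> in at_right 0. prob_space (P \<epsilon>) \<and> sets (P \<epsilon>) = sets (borel_of V)"
      using ev by eventually_elim (simp add: probP sets_P)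
    show "prob_space Q" unfolding Q by (rule M.prob_space_distr[OF decor_0m])
    show "sets Q = sets (borel_of V)" by (simp add: Q)
  qed (use lim in blast)
  moreover have "\<forall>\<^sub>F \<epsilon> in at_right 0. 0 < mean_weight M ?\<mu> \<epsilon> \<and> mean_weight M ?\<mu> \<epsilon> < \<infinity>"
    using ev by eventually_elim (simp add: mean)
  ultimately show ?thesis
    unfolding biased_by_weight_of_0_def decor_q decor_None L_def[symmetric] Q_def[symmetric] P_def[symmetric]
    using decor_0m decor_qm by (simp add: P_def[abs_def])
qed

end
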